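(* Let $k$ be a field with $\operatorname{char}(k)\ne2,3$. If $(A,-)$ is an $(m_1,m_2)$-product algebra over $k$ with $m_1\ge m_2$, then $\mathbf{Aut}(A,-)=\mathbf{Aut}(A)$ if and only if $(m_1,m_2)=(1,1)$, $(2,1)$, $(4,1)$, $(8,1)$, $(8,4)$ or $(8,8)$.
   Context: Throughout, $m_1,m_2\in\{1,2,4,8\}$ and $(m_1,m_2)\ne(2,2)$. An $(m_1,m_2)$-product algebra is a $k$-algebra with involution $(A,-)$ such that over a separable closure $k^s$ it becomes isomorphic, as an algebra with involution, to $C(m_1)\otimes_{k^s}C(m_2)$, where $C(m)$ is the split composition algebra of dimension $m$ over $k^s$ and the involution is the tensor product of the standard involutions. $\mathbf{Aut}(A)$ is the group scheme of $k$-algebra automorphisms of $A$ and $\mathbf{Aut}(A,-)$ its subgroup scheme of automorphisms commuting with the involution. *)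

theory Defs
  imports "HOL-Algebra.Algebra"
begin

section \<open>Algebras with involution\<close>

text \<open>
  An algebra is a unital, not necessarily associative algebra over a commutative ring. It is
  stored in the record type \<^typ>\<open>('k, 'a) module\<close>, whose ring fields hold the
  bilinear product and the unit. The library locale \<^locale>\<open>algebra\<close> is the
  commutative associative case.
\<close>

locale unital_algebra = module K A for K (structure) and A (structure) +
  assumes mult_closed: "\<lbrakk>x \<in> carrier A; y \<in> carrier A\<rbrakk> \<Longrightarrow> x \<otimes>\<^bsub>A\<^esub> y \<in> carrier A"
    and unit_closed: "\<one>\<^bsub>A\<^esub> \<in> carrier A"
    and unit_left: "x \<in> carrier A \<Longrightarrow> \<one>\<^bsub>A\<^esub> \<otimes>\<^bsub>A\<^esub> x = x"
    and unit_right: "x \<in> carrier A \<Longrightarrow> x \<otimes>\<^bsub>A\<^esub> \<one>\<^bsub>A\<^esub> = x"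
    and distrib_left: "\<lbrakk>x \<in> carrier A; y \<in> carrier A; z \<in> carrier A\<rbrakk> \<Longrightarrow>
      x \<otimes>\<^bsub>A\<^esub> (y \<oplus>\<^bsub>A\<^esub> z) = (x \<otimes>\<^bsub>A\<^esub> y) \<oplus>\<^bsub>A\<^esub> (x \<otimes>\<^bsub>A\<^esub> z)"
    and distrib_right: "\<lbrakk>x \<in> carrier A; y \<in> carrier A; z \<in> carrier A\<rbrakk> \<Longrightarrow>
      (x \<oplus>\<^bsub>A\<^esub> y) \<otimes>\<^bsub>A\<^esub> z = (x \<otimes>\<^bsub>A\<^esub> z) \<oplus>\<^bsub>A\<^esub> (y \<otimes>\<^bsub>A\<^esub> z)"
    and smult_left: "\<lbrakk>c \<in> carrier K; x \<in> carrier A; y \<in> carrier A\<rbrakk> \<Longrightarrow>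
      (c \<odot>\<^bsub>A\<^esub> x) \<otimes>\<^bsub>A\<^esub> y = c \<odot>\<^bsub>A\<^esub> (x \<otimes>\<^bsub>A\<^esub> y)"
    and smult_right: "\<lbrakk>c \<in> carrier K; x \<in> carrier A; y \<in> carrier A\<rbrakk> \<Longrightarrow>
      x \<otimes>\<^bsub>A\<^esub> (c \<odot>\<^bsub>A\<^esub> y) = c \<odot>\<^bsub>A\<^esub> (x \<otimes>\<^bsub>A\<^esub> y)"

definition linear_maps ::
  "('k, 'x) ring_scheme \<Rightarrow> ('k, 'a, 'y) module_scheme \<Rightarrow> ('k, 'b, 'z) module_scheme \<Rightarrow> ('a \<Rightarrow> 'b) set"
  where "linear_maps K A B = {f \<in> carrier A \<rightarrow> carrier B.
     (\<forall>x\<in>carrier A. \<forall>y\<in>carrier A. f (x \<oplus>\<^bsub>A\<^esub> y) = f x \<oplus>\<^bsub>B\<^esub> f y) \<and>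
     (\<forall>c\<in>carrier K. \<forall>x\<in>carrier A. f (c \<odot>\<^bsub>A\<^esub> x) = c \<odot>\<^bsub>B\<^esub> f x)}"

definition algebra_homs ::
  "('k, 'x) ring_scheme \<Rightarrow> ('k, 'a, 'y) module_scheme \<Rightarrow> ('k, 'b, 'z) module_scheme \<Rightarrow> ('a \<Rightarrow> 'b) set"
  where "algebra_homs K A B = {f \<in> linear_maps K A B.
     (\<forall>x\<in>carrier A. \<forall>y\<in>carrier A. f (x \<otimes>\<^bsub>A\<^esub> y) = f x \<otimes>\<^bsub>B\<^esub> f y) \<and> f \<one>\<^bsub>A\<^esub> = \<one>\<^bsub>B\<^esub>}"

locale algebra_with_involution = unital_algebra K A
  for K (structure) and A (structure) and j +
  assumes involution_linear: "j \<in> linear_maps K A A"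
    and involution_involutive: "x \<in> carrier A \<Longrightarrow> j (j x) = x"
    and involution_antimult: "\<lbrakk>x \<in> carrier A; y \<in> carrier A\<rbrakk> \<Longrightarrow> j (x \<otimes>\<^bsub>A\<^esub> y) = j y \<otimes>\<^bsub>A\<^esub> j x"

definition isomorphic_with_involution ::
  "('k, 'x) ring_scheme \<Rightarrow> ('k, 'a, 'y) module_scheme \<Rightarrow> ('a \<Rightarrow> 'a) \<Rightarrow>
   ('k, 'b, 'z) module_scheme \<Rightarrow> ('b \<Rightarrow> 'b) \<Rightarrow> bool"
  where "isomorphic_with_involution K A i B j \<longleftrightarrow>
    (\<exists>f \<in> algebra_homs K A B. bij_betw f (carrier A) (carrier B) \<and>
       (\<forall>x\<in>carrier A. f (i x) = j (f x)))"


section \<open>Tensor products and base change\<close>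

text \<open>
  The tensor product of two algebras over \<open>K\<close> is the free abelian group on pairs modulo
  the subgroup generated by the usual relations, so its elements are cosets. An operation on the
  tensor product is given by an operation on representatives: the union of the cosets of all
  results is a single coset whenever the operation is well defined, as it is below for algebras.
\<close>

abbreviation tensor_free ::
  "('k, 'a, 'y) module_scheme \<Rightarrow> ('k, 'b, 'z) module_scheme \<Rightarrow> ('a \<times> 'b \<Rightarrow>\<^sub>0 int) monoid"
  where "tensor_free A B \<equiv> free_Abelian_group (carrier A \<times> carrier B)"

definition tensor_relations ::
  "('k, 'x) ring_scheme \<Rightarrow> ('k, 'a, 'y) module_scheme \<Rightarrow> ('k, 'b, 'z) module_scheme \<Rightarrow>
   ('a \<times> 'b \<Rightarrow>\<^sub>0 int) set"
  where "tensor_relations K A B =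
     {frag_of (a \<oplus>\<^bsub>A\<^esub> a', b) - frag_of (a, b) - frag_of (a', b) | a a' b.
        a \<in> carrier A \<and> a' \<in> carrier A \<and> b \<in> carrier B} \<union>
     {frag_of (a, b \<oplus>\<^bsub>B\<^esub> b') - frag_of (a, b) - frag_of (a, b') | a b b'.
        a \<in> carrier A \<and> b \<in> carrier B \<and> b' \<in> carrier B} \<union>
     {frag_of (c \<odot>\<^bsub>A\<^esub> a, b) - frag_of (a, c \<odot>\<^bsub>B\<^esub> b) | c a b.
        c \<in> carrier K \<and> a \<in> carrier A \<and> b \<in> carrier B}"

definition tensor_kernel ::
  "('k, 'x) ring_scheme \<Rightarrow> ('k, 'a, 'y) module_scheme \<Rightarrow> ('k, 'b, 'z) module_scheme \<Rightarrow>
   ('a \<times> 'b \<Rightarrow>\<^sub>0 int) set"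
  where "tensor_kernel K A B = generate (tensor_free A B) (tensor_relations K A B)"

definition tensor_class ::
  "('k, 'x) ring_scheme \<Rightarrow> ('k, 'a, 'y) module_scheme \<Rightarrow> ('k, 'b, 'z) module_scheme \<Rightarrow>
   ('a \<times> 'b \<Rightarrow>\<^sub>0 int) \<Rightarrow> ('a \<times> 'b \<Rightarrow>\<^sub>0 int) set"
  where "tensor_class K A B x = tensor_kernel K A B #>\<^bsub>tensor_free A B\<^esub> x"

definition tensor_product ::
  "('k, 'x) ring_scheme \<Rightarrow> ('k, 'a, 'y) module_scheme \<Rightarrow> ('k, 'b, 'z) module_scheme \<Rightarrow>
   ('k, ('a \<times> 'b \<Rightarrow>\<^sub>0 int) set) module"
  where "tensor_product K A B =
   \<lparr>carrier = carrier (tensor_free A B Mod tensor_kernel K A B),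
    monoid.mult = (\<lambda>S T. \<Union>x\<in>S. \<Union>y\<in>T. tensor_class K A B
      (frag_extend (\<lambda>(a, b). frag_extend (\<lambda>(a', b'). frag_of (a \<otimes>\<^bsub>A\<^esub> a', b \<otimes>\<^bsub>B\<^esub> b')) y) x)),
    one = tensor_class K A B (frag_of (\<one>\<^bsub>A\<^esub>, \<one>\<^bsub>B\<^esub>)),
    ring.zero = \<one>\<^bsub>tensor_free A B Mod tensor_kernel K A B\<^esub>,
    ring.add = monoid.mult (tensor_free A B Mod tensor_kernel K A B),
    smult = (\<lambda>c S. \<Union>x\<in>S. tensor_class K A B
      (frag_extend (\<lambda>(a, b). frag_of (c \<odot>\<^bsub>A\<^esub> a, b)) x))\<rparr>"

definition tensor_map ::
  "('k, 'x) ring_scheme \<Rightarrow> ('k, 'a, 'y) module_scheme \<Rightarrow> ('k, 'b, 'z) module_scheme \<Rightarrow>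
   ('a \<Rightarrow> 'a) \<Rightarrow> ('b \<Rightarrow> 'b) \<Rightarrow> ('a \<times> 'b \<Rightarrow>\<^sub>0 int) set \<Rightarrow> ('a \<times> 'b \<Rightarrow>\<^sub>0 int) set"
  where "tensor_map K A B f g S =
    (\<Union>x\<in>S. tensor_class K A B (frag_extend (\<lambda>(a, b). frag_of (f a, g b)) x))"

text \<open>
  For a commutative \<open>K\<close>-algebra \<open>R\<close>, the base change of \<open>A\<close> has the ring
  structure of \<open>A \<otimes> R\<close>, with scalars from \<open>R\<close> acting on the second factor.
\<close>

definition base_change ::
  "('k, 'x) ring_scheme \<Rightarrow> ('k, 'a, 'y) module_scheme \<Rightarrow> ('k, 'r, 'z) module_scheme \<Rightarrow>
   ('r, ('a \<times> 'r \<Rightarrow>\<^sub>0 int) set) module"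
  where "base_change K A R =
   \<lparr>carrier = carrier (tensor_product K A R),
    monoid.mult = monoid.mult (tensor_product K A R),
    one = one (tensor_product K A R),
    ring.zero = ring.zero (tensor_product K A R),
    ring.add = ring.add (tensor_product K A R),
    smult = (\<lambda>r S. \<Union>x\<in>S. tensor_class K A R
      (frag_extend (\<lambda>(a, s). frag_of (a, r \<otimes>\<^bsub>R\<^esub> s)) x))\<rparr>"

abbreviation base_change_map ::
  "('k, 'x) ring_scheme \<Rightarrow> ('k, 'a, 'y) module_scheme \<Rightarrow> ('k, 'r, 'z) module_scheme \<Rightarrow>
   ('a \<Rightarrow> 'a) \<Rightarrow> ('a \<times> 'r \<Rightarrow>\<^sub>0 int) set \<Rightarrow> ('a \<times> 'r \<Rightarrow>\<^sub>0 int) set"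
  where "base_change_map K A R f \<equiv> tensor_map K A R f (\<lambda>r. r)"


section \<open>Automorphism group schemes\<close>

text \<open>
  A group scheme is given by its functor of points: to a commutative \<open>K\<close>-algebra \<open>R\<close>
  (locale \<^locale>\<open>algebra\<close>) the functors below assign the group of \<open>R\<close>-algebra
  automorphisms of the base change, respectively those commuting with the involution.
\<close>

definition algebra_autos :: "('k, 'x) ring_scheme \<Rightarrow> ('k, 'a, 'y) module_scheme \<Rightarrow> ('a \<Rightarrow> 'a) set"
  where "algebra_autos K A = Bij (carrier A) \<inter> algebra_homs K A A"

definition Aut_scheme ::
  "('k, 'x) ring_scheme \<Rightarrow> ('k, 'a, 'y) module_scheme \<Rightarrow> ('k, 'r, 'z) module_scheme \<Rightarrow>
   (('a \<times> 'r \<Rightarrow>\<^sub>0 int) set \<Rightarrow> ('a \<times> 'r \<Rightarrow>\<^sub>0 int) set) monoid"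
  where "Aut_scheme K A R = (BijGroup (carrier (base_change K A R)))
     \<lparr>carrier := algebra_autos R (base_change K A R)\<rparr>"

definition Aut_involution_scheme ::
  "('k, 'x) ring_scheme \<Rightarrow> ('k, 'a, 'y) module_scheme \<Rightarrow> ('a \<Rightarrow> 'a) \<Rightarrow> ('k, 'r, 'z) module_scheme \<Rightarrow>
   (('a \<times> 'r \<Rightarrow>\<^sub>0 int) set \<Rightarrow> ('a \<times> 'r \<Rightarrow>\<^sub>0 int) set) monoid"
  where "Aut_involution_scheme K A j R = (BijGroup (carrier (base_change K A R)))
     \<lparr>carrier := {f \<in> algebra_autos R (base_change K A R).
        \<forall>x\<in>carrier (base_change K A R).
          f (base_change_map K A R j x) = base_change_map K A R j (f x)}\<rparr>"


section \<open>Separable closures\<close>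

text \<open>Polynomials are lists of coefficients, the leading coefficient first.\<close>

definition poly_derivative :: "('a, 'x) ring_scheme \<Rightarrow> 'a list \<Rightarrow> 'a list"
  where "poly_derivative F p =
    ring.normalize F (map (\<lambda>i. add_pow F i (ring.coeff F p i)) (rev [1..<length p]))"

definition separable_poly :: "('a, 'x) ring_scheme \<Rightarrow> 'a list \<Rightarrow> bool"
  where "separable_poly F p \<longleftrightarrow> p \<in> carrier (poly_ring F) \<and>
    (\<exists>u\<in>carrier (poly_ring F). \<exists>v\<in>carrier (poly_ring F).
       (u \<otimes>\<^bsub>poly_ring F\<^esub> p) \<oplus>\<^bsub>poly_ring F\<^esub> (v \<otimes>\<^bsub>poly_ring F\<^esub> poly_derivative F p)
         = \<one>\<^bsub>poly_ring F\<^esub>)"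

text \<open>The field \<open>k\<close> is embedded in \<open>E\<close> by sending \<open>c\<close> to \<open>c \<odot> \<one>\<close>.\<close>

definition separable_closure :: "('k, 'x) ring_scheme \<Rightarrow> ('k, 'e, 'y) module_scheme \<Rightarrow> bool"
  where "separable_closure k E \<longleftrightarrow> field k \<and> field E \<and> algebra k E \<and>
    (\<forall>x\<in>carrier E. \<exists>p. separable_poly k p \<and>
       ring.eval E (map (\<lambda>c. c \<odot>\<^bsub>E\<^esub> \<one>\<^bsub>E\<^esub>) p) x = \<zero>\<^bsub>E\<^esub>) \<and>
    (\<forall>p. separable_poly E p \<and> degree p > 0 \<longrightarrow>
       (\<exists>x\<in>carrier E. ring.eval E p x = \<zero>\<^bsub>E\<^esub>))"


section \<open>Split composition algebras\<close>

text \<open>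
  The split composition algebra of dimension 8 is Zorn's algebra of vector matrices with rows
  \<open>(a, u)\<close> and \<open>(v, b)\<close>, where \<open>a, b\<close> are scalars and \<open>u, v\<close> are vectors
  with three coordinates. Its norm is \<open>a b - u \<bullet> v\<close>. Keeping only the first coordinate
  of \<open>u\<close> and \<open>v\<close> gives the two by two matrices, since then the cross products
  vanish. The diagonal ones form \<open>F \<times> F\<close>, and the scalar ones form \<open>F\<close>. The standard
  involution restricts to the adjugate, the exchange and the identity on these three.
\<close>

datatype 'a zorn = Zorn 'a "'a \<times> 'a \<times> 'a" "'a \<times> 'a \<times> 'a" 'a

fun vec_add :: "('a, 'x) ring_scheme \<Rightarrow> 'a \<times> 'a \<times> 'a \<Rightarrow> 'a \<times> 'a \<times> 'a \<Rightarrow> 'a \<times> 'a \<times> 'a"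
  where "vec_add F (u1, u2, u3) (v1, v2, v3) = (u1 \<oplus>\<^bsub>F\<^esub> v1, u2 \<oplus>\<^bsub>F\<^esub> v2, u3 \<oplus>\<^bsub>F\<^esub> v3)"

fun vec_scale :: "('a, 'x) ring_scheme \<Rightarrow> 'a \<Rightarrow> 'a \<times> 'a \<times> 'a \<Rightarrow> 'a \<times> 'a \<times> 'a"
  where "vec_scale F c (u1, u2, u3) = (c \<otimes>\<^bsub>F\<^esub> u1, c \<otimes>\<^bsub>F\<^esub> u2, c \<otimes>\<^bsub>F\<^esub> u3)"

fun vec_neg :: "('a, 'x) ring_scheme \<Rightarrow> 'a \<times> 'a \<times> 'a \<Rightarrow> 'a \<times> 'a \<times> 'a"
  where "vec_neg F (u1, u2, u3) = (\<ominus>\<^bsub>F\<^esub> u1, \<ominus>\<^bsub>F\<^esub> u2, \<ominus>\<^bsub>F\<^esub> u3)"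

fun vec_dot :: "('a, 'x) ring_scheme \<Rightarrow> 'a \<times> 'a \<times> 'a \<Rightarrow> 'a \<times> 'a \<times> 'a \<Rightarrow> 'a"
  where "vec_dot F (u1, u2, u3) (v1, v2, v3) =
    (u1 \<otimes>\<^bsub>F\<^esub> v1) \<oplus>\<^bsub>F\<^esub> (u2 \<otimes>\<^bsub>F\<^esub> v2) \<oplus>\<^bsub>F\<^esub> (u3 \<otimes>\<^bsub>F\<^esub> v3)"

fun vec_cross :: "('a, 'x) ring_scheme \<Rightarrow> 'a \<times> 'a \<times> 'a \<Rightarrow> 'a \<times> 'a \<times> 'a \<Rightarrow> 'a \<times> 'a \<times> 'a"
  where "vec_cross F (u1, u2, u3) (v1, v2, v3) =
    ((u2 \<otimes>\<^bsub>F\<^esub> v3) \<ominus>\<^bsub>F\<^esub> (u3 \<otimes>\<^bsub>F\<^esub> v2),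
     (u3 \<otimes>\<^bsub>F\<^esub> v1) \<ominus>\<^bsub>F\<^esub> (u1 \<otimes>\<^bsub>F\<^esub> v3),
     (u1 \<otimes>\<^bsub>F\<^esub> v2) \<ominus>\<^bsub>F\<^esub> (u2 \<otimes>\<^bsub>F\<^esub> v1))"

fun zorn_mult :: "('a, 'x) ring_scheme \<Rightarrow> 'a zorn \<Rightarrow> 'a zorn \<Rightarrow> 'a zorn"
  where "zorn_mult F (Zorn a u v b) (Zorn a' u' v' b') =
    Zorn ((a \<otimes>\<^bsub>F\<^esub> a') \<oplus>\<^bsub>F\<^esub> vec_dot F u v')
      (vec_add F (vec_add F (vec_scale F a u') (vec_scale F b' u)) (vec_cross F v v'))
      (vec_add F (vec_add F (vec_scale F a' v) (vec_scale F b v')) (vec_neg F (vec_cross F u u')))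
      ((b \<otimes>\<^bsub>F\<^esub> b') \<oplus>\<^bsub>F\<^esub> vec_dot F v u')"

fun zorn_add :: "('a, 'x) ring_scheme \<Rightarrow> 'a zorn \<Rightarrow> 'a zorn \<Rightarrow> 'a zorn"
  where "zorn_add F (Zorn a u v b) (Zorn a' u' v' b') =
    Zorn (a \<oplus>\<^bsub>F\<^esub> a') (vec_add F u u') (vec_add F v v') (b \<oplus>\<^bsub>F\<^esub> b')"

fun zorn_scale :: "('a, 'x) ring_scheme \<Rightarrow> 'a \<Rightarrow> 'a zorn \<Rightarrow> 'a zorn"
  where "zorn_scale F c (Zorn a u v b) =
    Zorn (c \<otimes>\<^bsub>F\<^esub> a) (vec_scale F c u) (vec_scale F c v) (c \<otimes>\<^bsub>F\<^esub> b)"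

fun zorn_conj :: "('a, 'x) ring_scheme \<Rightarrow> 'a zorn \<Rightarrow> 'a zorn"
  where "zorn_conj F (Zorn a u v b) = Zorn b (vec_neg F u) (vec_neg F v) a"

definition zorn_carrier :: "('a, 'x) ring_scheme \<Rightarrow> nat \<Rightarrow> 'a zorn set"
  where "zorn_carrier F m = {Zorn a (u1, u2, u3) (v1, v2, v3) b | a u1 u2 u3 v1 v2 v3 b.
     {a, u1, u2, u3, v1, v2, v3, b} \<subseteq> carrier F \<and>
     (m \<le> 4 \<longrightarrow> u2 = \<zero>\<^bsub>F\<^esub> \<and> u3 = \<zero>\<^bsub>F\<^esub> \<and> v2 = \<zero>\<^bsub>F\<^esub> \<and> v3 = \<zero>\<^bsub>F\<^esub>) \<and>
     (m \<le> 2 \<longrightarrow> u1 = \<zero>\<^bsub>F\<^esub> \<and> v1 = \<zero>\<^bsub>F\<^esub>) \<and>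
     (m \<le> 1 \<longrightarrow> a = b)}"

text \<open>The parameter \<open>m\<close> is meant to be 1, 2, 4 or 8, and is then the dimension.\<close>

definition split_composition :: "('a, 'x) ring_scheme \<Rightarrow> nat \<Rightarrow> ('a, 'a zorn) module"
  where "split_composition F m =
   \<lparr>carrier = zorn_carrier F m,
    monoid.mult = zorn_mult F,
    one = Zorn \<one>\<^bsub>F\<^esub> (\<zero>\<^bsub>F\<^esub>, \<zero>\<^bsub>F\<^esub>, \<zero>\<^bsub>F\<^esub>) (\<zero>\<^bsub>F\<^esub>, \<zero>\<^bsub>F\<^esub>, \<zero>\<^bsub>F\<^esub>) \<one>\<^bsub>F\<^esub>,
    ring.zero = Zorn \<zero>\<^bsub>F\<^esub> (\<zero>\<^bsub>F\<^esub>, \<zero>\<^bsub>F\<^esub>, \<zero>\<^bsub>F\<^esub>) (\<zero>\<^bsub>F\<^esub>, \<zero>\<^bsub>F\<^esub>, \<zero>\<^bsub>F\<^esub>) \<zero>\<^bsub>F\<^esub>,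
    ring.add = zorn_add F,
    smult = zorn_scale F\<rparr>"


section \<open>Product algebras\<close>

definition product_algebra ::
  "('k, 'x) ring_scheme \<Rightarrow> ('k, 'e, 'y) module_scheme \<Rightarrow> nat \<Rightarrow> nat \<Rightarrow>
   ('k, 'a) module \<Rightarrow> ('a \<Rightarrow> 'a) \<Rightarrow> bool"
  where "product_algebra k ks m1 m2 A j \<longleftrightarrow>
    algebra_with_involution k A j \<and>
    isomorphic_with_involution ks
      (base_change k A ks) (base_change_map k A ks j)
      (tensor_product ks (split_composition ks m1) (split_composition ks m2))
      (tensor_map ks (split_composition ks m1) (split_composition ks m2)
        (zorn_conj ks) (zorn_conj ks))"

end

theory Submission
  imports Defs
begin

text \<open>
  Write \<open>(x, y, z)\<close> for the associator and \<open>[x, y]\<close> for the commutator, and \<open>A\<^sub>R\<close>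
  for the base change of \<open>A\<close> to \<open>R\<close>. The two group schemes agree if and only if, for every \<open>R\<close>, each
  automorphism of \<open>A\<^sub>R\<close> commutes with the involution. The proof either recovers the involution
  from the multiplication or exhibits an infinitesimal automorphism that moves it.

  \<^emph>\<open>The involution is determined.\<close> Let \<open>N(A)\<close>, the alternative nucleus, consist of the \<open>s\<close>
  with \<open>(s, x, y) = - (x, s, y)\<close> for all \<open>x, y\<close>. Automorphisms preserve it, and since it is cut
  out by linear maps and the ground ring is a field, \<open>N(A\<^sub>R)\<close> is spanned by the image of
  \<open>N(A)\<close> (\<open>base_kernel\<close>, \<open>base_nucleus\<close>). Call \<open>(A, j)\<close> skew generated if \<open>j\<close> negates every
  commutator of two elements of \<open>N(A)\<close> and these commutators generate \<open>A\<close> as an algebra. An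
  automorphism \<open>\<phi>\<close> of \<open>A\<^sub>R\<close> carries commutators of \<open>N(A)\<close> to commutators of
  \<open>N(A\<^sub>R)\<close>, which the extended involution also negates; hence \<open>\<phi>\<close> commutes with the
  involution on generators, and so everywhere (\<open>automorphism_commutes\<close>). Being skew generated
  descends from the separable closure (\<open>skew_generated_descent\<close>), and it holds for
  \<open>C(m) \<otimes> C(n)\<close> with \<open>(m, n)\<close> equal to \<open>(4, 1)\<close>, \<open>(8, 1)\<close>, \<open>(8, 4)\<close> or \<open>(8, 8)\<close>: there the
  nucleus is \<open>C(m) \<otimes> 1 + 1 \<otimes> C(n)\<close>, and commutators in a composition algebra have trace zero,
  which means that conjugation negates them (\<open>split_skew_generated\<close>). The case \<open>(2, 1)\<close>, where
  all commutators vanish, is a computation with \<open>A = k 1 + k s\<close> and \<open>s\<^sup>2\<close> a unit, and for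
  \<open>(1, 1)\<close> the involution is trivial.

  \<^emph>\<open>The involution is moved.\<close> For \<open>(4, 2)\<close>, \<open>(8, 2)\<close> and \<open>(4, 4)\<close> the product is alternative, so
  every pair \<open>a, b\<close> gives the derivation \<open>D(x) = [[a, b], x] - 3 (a, b, x)\<close>
  (\<open>inner_derivation_product\<close>). If all of these commuted with the involution of \<open>A\<close>, the same
  would hold over the separable closure, because the condition is trilinear. It fails there:
  for \<open>a = u \<otimes> e\<close> and \<open>b = v \<otimes> e\<close>, with \<open>e\<close> an idempotent that its conjugate annihilates,
  \<open>D\<close> kills the conjugate of \<open>a\<close> but doubles \<open>a\<close> (\<open>split_derivation_noncommuting\<close>). So some \<open>D\<close> on
  \<open>A\<close> does not commute with the involution, and neither does the automorphism \<open>1 + \<epsilon> D\<close> over the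
  dual numbers (\<open>noncommuting_automorphism\<close>).
\<close>

section \<open>Nonassociative algebras\<close>

context unital_algebra begin
lemma null_left: assumes "x \<in> carrier A" shows "\<zero>\<^bsub>A\<^esub> \<otimes>\<^bsub>A\<^esub> x = \<zero>\<^bsub>A\<^esub>"
proof -
  have "\<zero>\<^bsub>A\<^esub> \<otimes>\<^bsub>A\<^esub> x \<oplus>\<^bsub>A\<^esub> \<zero>\<^bsub>A\<^esub> \<otimes>\<^bsub>A\<^esub> x = \<zero>\<^bsub>A\<^esub> \<otimes>\<^bsub>A\<^esub> x"
    using distrib_right[of "\<zero>\<^bsub>A\<^esub>" "\<zero>\<^bsub>A\<^esub>" x] assms by simp
  then show ?thesis using mult_closed[of "\<zero>\<^bsub>A\<^esub>" x] assms by simp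
qed
lemma null_right: assumes "x \<in> carrier A" shows "x \<otimes>\<^bsub>A\<^esub> \<zero>\<^bsub>A\<^esub> = \<zero>\<^bsub>A\<^esub>"
proof -
  have "x \<otimes>\<^bsub>A\<^esub> \<zero>\<^bsub>A\<^esub> \<oplus>\<^bsub>A\<^esub> x \<otimes>\<^bsub>A\<^esub> \<zero>\<^bsub>A\<^esub> = x \<otimes>\<^bsub>A\<^esub> \<zero>\<^bsub>A\<^esub>"
    using distrib_left[of x "\<zero>\<^bsub>A\<^esub>" "\<zero>\<^bsub>A\<^esub>"] assms by simp
  then show ?thesis using mult_closed[of x "\<zero>\<^bsub>A\<^esub>"] assms by simp
qed
lemma uminus_left: assumes "x \<in> carrier A" "y \<in> carrier A" shows "(\<ominus>\<^bsub>A\<^esub> x) \<otimes>\<^bsub>A\<^esub> y = \<ominus>\<^bsub>A\<^esub> (x \<otimes>\<^bsub>A\<^esub> y)"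
proof (rule M.minus_equality[symmetric])
  show "(\<ominus>\<^bsub>A\<^esub> x) \<otimes>\<^bsub>A\<^esub> y \<oplus>\<^bsub>A\<^esub> x \<otimes>\<^bsub>A\<^esub> y = \<zero>\<^bsub>A\<^esub>"
    using distrib_right[of "\<ominus>\<^bsub>A\<^esub> x" x y] assms by (simp add: M.l_neg null_left)
qed (use assms mult_closed in auto)
lemma uminus_right: assumes "x \<in> carrier A" "y \<in> carrier A" shows "x \<otimes>\<^bsub>A\<^esub> (\<ominus>\<^bsub>A\<^esub> y) = \<ominus>\<^bsub>A\<^esub> (x \<otimes>\<^bsub>A\<^esub> y)"
proof (rule M.minus_equality[symmetric])
  show "x \<otimes>\<^bsub>A\<^esub> (\<ominus>\<^bsub>A\<^esub> y) \<oplus>\<^bsub>A\<^esub> x \<otimes>\<^bsub>A\<^esub> y = \<zero>\<^bsub>A\<^esub>"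
    using distrib_left[of x "\<ominus>\<^bsub>A\<^esub> y" y] assms by (simp add: M.l_neg null_right)
qed (use assms mult_closed in auto)

text \<open>
  The rules let the algebra method decide identities of nonassociative rings: products are
  expanded over sums but never reassociated.
\<close>

lemmas na_ring_simprules
  [algebra unital_algebra "ring.zero A" "ring.add A" "a_inv A" "a_minus A" "monoid.mult A"] =
  M.a_closed M.zero_closed M.a_inv_closed M.minus_closed mult_closed
  M.a_assoc M.l_zero M.l_neg M.a_comm M.minus_eq
  M.r_zero M.r_neg M.r_neg2 M.r_neg1 M.minus_add M.minus_minus M.add.inv_one
  M.a_lcomm distrib_left distrib_right uminus_left uminus_right null_left null_right

end

section \<open>Tensor products of modules\<close>

definition pure_tensor ::
  "('k, 'x) ring_scheme \<Rightarrow> ('k, 'a, 'y) module_scheme \<Rightarrow> ('k, 'b, 'z) module_scheme \<Rightarrow>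
   'a \<Rightarrow> 'b \<Rightarrow> ('a \<times> 'b \<Rightarrow>\<^sub>0 int) set"
  where "pure_tensor K A B a b = tensor_class K A B (frag_of (a, b))"

locale tensor_pair = fst: module K A + snd: module K B
  for K (structure) and A (structure) and B (structure)
begin

text \<open>
  Besides the tensor product \<open>T\<close> and its pure tensors \<open>t a b\<close> there are names for the
  construction: the free group \<open>Fr\<close> on pairs, the subgroup \<open>Ke\<close> of relations, and the class map
  \<open>cl\<close> from the one to the cosets of the other.
\<close>

abbreviation Fr where "Fr \<equiv> tensor_free A B"
abbreviation Ke where "Ke \<equiv> tensor_kernel K A B"
abbreviation cl where "cl \<equiv> tensor_class K A B"
abbreviation T where "T \<equiv> tensor_product K A B"
abbreviation t where "t \<equiv> pure_tensor K A B"

declare carrier_free_Abelian_group_iff [simp del]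

lemma free_zero [simp]: "0 \<in> carrier Fr"
  by (simp add: carrier_free_Abelian_group_iff)

lemma free_minus: "x \<in> carrier Fr \<Longrightarrow> - x \<in> carrier Fr"
  by (simp add: carrier_free_Abelian_group_iff)

lemma free_inv [simp]: "x \<in> carrier Fr \<Longrightarrow> inv\<^bsub>Fr\<^esub> x = - x"
  by (simp add: carrier_free_Abelian_group_iff)

lemma free_diff: "x \<in> carrier Fr \<Longrightarrow> y \<in> carrier Fr \<Longrightarrow> x - y \<in> carrier Fr"
  using keys_diff[of x y] by (auto simp: carrier_free_Abelian_group_iff)

lemma free_add: "x \<in> carrier Fr \<Longrightarrow> y \<in> carrier Fr \<Longrightarrow> x + y \<in> carrier Fr"
  using keys_add[of x y] by (auto simp: carrier_free_Abelian_group_iff)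

lemma relations_closed: "tensor_relations K A B \<subseteq> carrier Fr"
  unfolding tensor_relations_def
  by (auto intro!: free_diff)

lemma kernel_subgroup: "subgroup Ke Fr"
  unfolding tensor_kernel_def
  by (rule group.generate_is_subgroup) (use relations_closed in auto)

lemma kernel_normal: "Ke \<lhd> Fr"
  using comm_group.normal_iff_subgroup[OF abelian_free_Abelian_group] kernel_subgroup by blast

lemma kernel_zero: "0 \<in> Ke"
  using subgroup.one_closed[OF kernel_subgroup] by simp

lemma kernel_add: "x \<in> Ke \<Longrightarrow> y \<in> Ke \<Longrightarrow> x + y \<in> Ke"
  using subgroup.m_closed[OF kernel_subgroup] by simp

lemma kernel_carrier: "x \<in> Ke \<Longrightarrow> x \<in> carrier Fr"
  using subgroup.subset[OF kernel_subgroup] by blast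

lemma kernel_minus: "x \<in> Ke \<Longrightarrow> - x \<in> Ke"
  using subgroup.m_inv_closed[OF kernel_subgroup] kernel_carrier by (metis free_inv)

lemma kernel_diff: "x \<in> Ke \<Longrightarrow> y \<in> Ke \<Longrightarrow> x - y \<in> Ke"
  using kernel_add[of x "- y"] kernel_minus by simp

lemma kernel_induct [consumes 1, case_names zero rel add minus]:
  assumes "x \<in> Ke" and "P 0" and "\<And>x. x \<in> tensor_relations K A B \<Longrightarrow> P x"
    and "\<And>x y. x \<in> Ke \<Longrightarrow> y \<in> Ke \<Longrightarrow> P x \<Longrightarrow> P y \<Longrightarrow> P (x + y)" and "\<And>x. x \<in> Ke \<Longrightarrow> P x \<Longrightarrow> P (- x)"
  shows "P x"
  using assms(1) unfolding tensor_kernel_def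
proof (induction rule: generate.induct)
  case one then show ?case using assms(2) by simp
next
  case (incl h) then show ?case using assms(3) by simp
next
  case (inv h)
  then have "h \<in> carrier Fr" "h \<in> Ke"
    using relations_closed generate.incl[of h] by (auto simp: tensor_kernel_def subset_iff)
  then show ?case using assms(3,5) inv by simp
next
  case (eng h1 h2) then show ?case using assms(4) by (simp add: tensor_kernel_def)
qed

lemma relation_in_kernel: "x \<in> tensor_relations K A B \<Longrightarrow> x \<in> Ke"
  unfolding tensor_kernel_def by (rule generate.incl)

lemma class_eq_iff:
  assumes "x \<in> carrier Fr" "y \<in> carrier Fr"
  shows "cl x = cl y \<longleftrightarrow> x - y \<in> Ke"
proof -
  interpret Fr: group Fr by simp
  have "cl x = cl y \<longleftrightarrow> x \<otimes>\<^bsub>Fr\<^esub> inv\<^bsub>Fr\<^esub> y \<in> Ke"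
    unfolding tensor_class_def
    by (metis Fr.rcos_self Fr.repr_independence assms kernel_subgroup subgroup.rcos_module
        Fr.group_axioms)
  then show ?thesis using assms by simp
qed

lemma class_self: "x \<in> carrier Fr \<Longrightarrow> x \<in> cl x"
  unfolding tensor_class_def using group.rcos_self[OF _ _ kernel_subgroup] by simp

lemma class_cases:
  assumes "S \<in> carrier T"
  obtains x where "x \<in> carrier Fr" "S = cl x"
  using assms by (auto simp: tensor_product_def FactGroup_def RCOSETS_def tensor_class_def)

lemma class_closed: "x \<in> carrier Fr \<Longrightarrow> cl x \<in> carrier T"
  by (auto simp: tensor_product_def FactGroup_def RCOSETS_def tensor_class_def)

lemma class_member:
  assumes "x \<in> carrier Fr" "y \<in> cl x"
  shows "y \<in> carrier Fr" "cl y = cl x"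
proof -
  show y: "y \<in> carrier Fr"
    using assms kernel_carrier by (auto simp: tensor_class_def r_coset_def intro: free_add)
  show "cl y = cl x"
    using assms group.repr_independence[of Fr y Ke x] kernel_subgroup
    unfolding tensor_class_def by simp
qed

text \<open>
  Operations on the tensor product are defined as unions over all representatives. For a map
  that preserves the relations every representative contributes the same class, so one suffices.
\<close>

lemma class_map:
  assumes "x \<in> carrier Fr" and "\<And>y. y \<in> carrier Fr \<Longrightarrow> h y \<in> carrier Fr"
    and "\<And>y z. h (y - z) = h y - h z" and "\<And>y. y \<in> Ke \<Longrightarrow> h y \<in> Ke"
  shows "(\<Union>y\<in>cl x. cl (h y)) = cl (h x)"
proof -
  have "cl (h y) = cl (h x)" if "y \<in> cl x" for y
  proof -
    have "y - x \<in> Ke" using class_member[OF assms(1) that] class_eq_iff assms(1) by blast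
    then have "h y - h x \<in> Ke" using assms(3,4) by metis
    then show ?thesis using class_eq_iff assms(1,2) class_member(1)[OF assms(1) that] by blast
  qed
  then show ?thesis using class_self[OF assms(1)] by blast
qed

lemma class_zero: "\<zero>\<^bsub>T\<^esub> = cl 0"
  unfolding tensor_product_def FactGroup_def tensor_class_def
  using group.coset_mult_one[of Fr Ke] subgroup.subset[OF kernel_subgroup] by simp

lemma class_add:
  assumes "x \<in> carrier Fr" "y \<in> carrier Fr"
  shows "cl x \<oplus>\<^bsub>T\<^esub> cl y = cl (x + y)"
  unfolding tensor_product_def FactGroup_def tensor_class_def
  using normal.rcos_sum[OF kernel_normal] assms by simp

lemma tensor_abelian_group: "abelian_group T"
proof (rule abelian_groupI)
  fix x y z assume "x \<in> carrier T" "y \<in> carrier T" "z \<in> carrier T"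
  then obtain a b c where abc: "x = cl a" "y = cl b" "z = cl c"
    "a \<in> carrier Fr" "b \<in> carrier Fr" "c \<in> carrier Fr"
    by (metis class_cases)
  have [simp]: "a + b \<in> carrier Fr" "b + c \<in> carrier Fr" "b + a \<in> carrier Fr" "- a \<in> carrier Fr"
    using abc free_add free_minus by auto
  show "x \<oplus>\<^bsub>T\<^esub> y \<in> carrier T" using abc class_add class_closed by simp
  show "x \<oplus>\<^bsub>T\<^esub> y \<oplus>\<^bsub>T\<^esub> z = x \<oplus>\<^bsub>T\<^esub> (y \<oplus>\<^bsub>T\<^esub> z)" using abc class_add by (simp add: add.assoc)
  show "x \<oplus>\<^bsub>T\<^esub> y = y \<oplus>\<^bsub>T\<^esub> x" using abc class_add by (simp add: add.commute)
  show "\<zero>\<^bsub>T\<^esub> \<oplus>\<^bsub>T\<^esub> x = x" using abc class_add[of 0 a] class_zero by simp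
  show "\<exists>y\<in>carrier T. y \<oplus>\<^bsub>T\<^esub> x = \<zero>\<^bsub>T\<^esub>"
    using abc class_add[of "- a" a] class_zero class_closed[of "- a"] by fastforce
next
  show "\<zero>\<^bsub>T\<^esub> \<in> carrier T" using class_zero class_closed[of 0] by simp
qed

lemma pure_closed: "a \<in> carrier A \<Longrightarrow> b \<in> carrier B \<Longrightarrow> t a b \<in> carrier T"
  unfolding pure_tensor_def by (rule class_closed) simp

lemma pure_relation:
  assumes "frag_of (a, b) - frag_of (a', b') - frag_of (a'', b'') \<in> tensor_relations K A B"
    "{a, a', a''} \<subseteq> carrier A" "{b, b', b''} \<subseteq> carrier B"
  shows "t a b = t a' b' \<oplus>\<^bsub>T\<^esub> t a'' b''"
proof -
  have "frag_of (a, b) - (frag_of (a', b') + frag_of (a'', b'')) \<in> Ke"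
    using relation_in_kernel[OF assms(1)] by (simp add: diff_diff_eq)
  then have "cl (frag_of (a, b)) = cl (frag_of (a', b') + frag_of (a'', b''))"
    by (intro class_eq_iff[THEN iffD2] free_add) (use assms(2,3) in auto)
  then show ?thesis
    using class_add[of "frag_of (a', b')" "frag_of (a'', b'')"] assms(2,3)
    unfolding pure_tensor_def by simp
qed

lemma pure_add_left:
  "a \<in> carrier A \<Longrightarrow> a' \<in> carrier A \<Longrightarrow> b \<in> carrier B \<Longrightarrow> t (a \<oplus>\<^bsub>A\<^esub> a') b = t a b \<oplus>\<^bsub>T\<^esub> t a' b"
  by (rule pure_relation) (auto simp: tensor_relations_def)

lemma pure_add_right:
  "a \<in> carrier A \<Longrightarrow> b \<in> carrier B \<Longrightarrow> b' \<in> carrier B \<Longrightarrow> t a (b \<oplus>\<^bsub>B\<^esub> b') = t a b \<oplus>\<^bsub>T\<^esub> t a b'"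
  by (rule pure_relation) (auto simp: tensor_relations_def)

lemma pure_balanced:
  assumes "c \<in> carrier K" "a \<in> carrier A" "b \<in> carrier B"
  shows "t (c \<odot>\<^bsub>A\<^esub> a) b = t a (c \<odot>\<^bsub>B\<^esub> b)"
proof -
  have "frag_of (c \<odot>\<^bsub>A\<^esub> a, b) - frag_of (a, c \<odot>\<^bsub>B\<^esub> b) \<in> Ke"
    by (rule relation_in_kernel) (use assms in \<open>auto simp: tensor_relations_def\<close>)
  then show ?thesis using class_eq_iff assms unfolding pure_tensor_def by simp
qed

lemma tensor_induct [consumes 1, case_names pure add]:
  assumes "z \<in> carrier T" and "\<And>a b. a \<in> carrier A \<Longrightarrow> b \<in> carrier B \<Longrightarrow> P (t a b)"
    and "\<And>x y. x \<in> carrier T \<Longrightarrow> y \<in> carrier T \<Longrightarrow> P x \<Longrightarrow> P y \<Longrightarrow> P (x \<oplus>\<^bsub>T\<^esub> y)"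
  shows "P z"
proof -
  interpret T: abelian_group T by (rule tensor_abelian_group)
  obtain x where x: "x \<in> carrier Fr" "z = cl x" by (rule class_cases[OF assms(1)])
  have minus: "cl (- y) = \<ominus>\<^bsub>T\<^esub> cl y" if "y \<in> carrier Fr" for y
    by (rule T.minus_equality[symmetric])
      (use that class_add[of "- y" y] class_zero class_closed free_minus in auto)
  have neg: "\<ominus>\<^bsub>T\<^esub> t a b = t (\<ominus>\<^bsub>A\<^esub> a) b" if "a \<in> carrier A" "b \<in> carrier B" for a b
  proof (rule T.minus_equality)
    have "t (\<zero>\<^bsub>A\<^esub> \<oplus>\<^bsub>A\<^esub> \<zero>\<^bsub>A\<^esub>) b = t \<zero>\<^bsub>A\<^esub> b \<oplus>\<^bsub>T\<^esub> t \<zero>\<^bsub>A\<^esub> b" using that by (intro pure_add_left) auto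
    then have "t \<zero>\<^bsub>A\<^esub> b = \<zero>\<^bsub>T\<^esub>"
      using that pure_closed[of "\<zero>\<^bsub>A\<^esub>" b] by simp
    then show "t (\<ominus>\<^bsub>A\<^esub> a) b \<oplus>\<^bsub>T\<^esub> t a b = \<zero>\<^bsub>T\<^esub>"
      using that pure_add_left[of "\<ominus>\<^bsub>A\<^esub> a" a b] by (simp add: fst.M.l_neg)
  qed (use that pure_closed in auto)
  have zero: "P \<zero>\<^bsub>T\<^esub>"
  proof -
    have "P (t \<zero>\<^bsub>A\<^esub> \<zero>\<^bsub>B\<^esub> \<oplus>\<^bsub>T\<^esub> t (\<ominus>\<^bsub>A\<^esub> \<zero>\<^bsub>A\<^esub>) \<zero>\<^bsub>B\<^esub>)" by (intro assms pure_closed) auto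
    then show ?thesis using neg[of "\<zero>\<^bsub>A\<^esub>" "\<zero>\<^bsub>B\<^esub>"] pure_closed[of "\<zero>\<^bsub>A\<^esub>" "\<zero>\<^bsub>B\<^esub>"] by (metis T.r_neg fst.M.zero_closed snd.M.zero_closed)
  qed
  have keys: "Poly_Mapping.keys x \<subseteq> carrier A \<times> carrier B"
    using x by (simp add: carrier_free_Abelian_group_iff)
  \<comment> \<open>The induction runs over differences, so both signs are carried along.\<close>
  have "P (cl x) \<and> P (\<ominus>\<^bsub>T\<^esub> cl x)"
  proof (rule free_Abelian_group_induct[OF keys])
    show "P (cl 0) \<and> P (\<ominus>\<^bsub>T\<^esub> cl 0)"
      unfolding class_zero[symmetric] T.minus_equality[OF T.l_zero[OF T.zero_closed] T.zero_closed T.zero_closed]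
      using zero by simp
  next
    fix x y assume xy: "Poly_Mapping.keys x \<subseteq> carrier A \<times> carrier B"
      "Poly_Mapping.keys y \<subseteq> carrier A \<times> carrier B"
      "P (cl x) \<and> P (\<ominus>\<^bsub>T\<^esub> cl x)" "P (cl y) \<and> P (\<ominus>\<^bsub>T\<^esub> cl y)"
    then have c: "x \<in> carrier Fr" "y \<in> carrier Fr" "- y \<in> carrier Fr"
      by (simp_all add: carrier_free_Abelian_group_iff)
    have d: "cl (x - y) = cl x \<oplus>\<^bsub>T\<^esub> \<ominus>\<^bsub>T\<^esub> cl y"
      using class_add[of x "- y"] c minus by simp
    have e: "\<ominus>\<^bsub>T\<^esub> cl (x - y) = \<ominus>\<^bsub>T\<^esub> cl x \<oplus>\<^bsub>T\<^esub> cl y"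
      unfolding d using c class_closed by (simp add: T.minus_add)
    have "P (cl (x - y))" unfolding d by (intro assms(3)) (use xy c class_closed in auto)
    moreover have "P (\<ominus>\<^bsub>T\<^esub> cl (x - y))"
      unfolding e by (intro assms(3)) (use xy c class_closed in auto)
    ultimately show "P (cl (x - y)) \<and> P (\<ominus>\<^bsub>T\<^esub> cl (x - y))" by simp
  next
    fix p assume "p \<in> carrier A \<times> carrier B"
    then show "P (cl (frag_of p)) \<and> P (\<ominus>\<^bsub>T\<^esub> cl (frag_of p))"
      using assms(2) neg unfolding pure_tensor_def by (cases p) force
  qed
  then show ?thesis using x by simp
qed

text \<open>
  The universal property: a balanced biadditive map kills the relations, so its additive
  extension to the free group factors through the classes.
\<close>

lemma tensor_lift:
  assumes H: "abelian_group H"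
    and cl: "\<And>a b. a \<in> carrier A \<Longrightarrow> b \<in> carrier B \<Longrightarrow> f a b \<in> carrier H"
    and l: "\<And>a a' b. a \<in> carrier A \<Longrightarrow> a' \<in> carrier A \<Longrightarrow> b \<in> carrier B \<Longrightarrow> f (a \<oplus>\<^bsub>A\<^esub> a') b = f a b \<oplus>\<^bsub>H\<^esub> f a' b"
    and r: "\<And>a b b'. a \<in> carrier A \<Longrightarrow> b \<in> carrier B \<Longrightarrow> b' \<in> carrier B \<Longrightarrow> f a (b \<oplus>\<^bsub>B\<^esub> b') = f a b \<oplus>\<^bsub>H\<^esub> f a b'"
    and bal: "\<And>c a b. c \<in> carrier K \<Longrightarrow> a \<in> carrier A \<Longrightarrow> b \<in> carrier B \<Longrightarrow> f (c \<odot>\<^bsub>A\<^esub> a) b = f a (c \<odot>\<^bsub>B\<^esub> b)"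
  obtains h where "h \<in> carrier T \<rightarrow> carrier H"
    "\<And>x y. x \<in> carrier T \<Longrightarrow> y \<in> carrier T \<Longrightarrow> h (x \<oplus>\<^bsub>T\<^esub> y) = h x \<oplus>\<^bsub>H\<^esub> h y"
    "\<And>a b. a \<in> carrier A \<Longrightarrow> b \<in> carrier B \<Longrightarrow> h (t a b) = f a b"
proof -
  interpret H: abelian_group H by fact
  have "(\<lambda>p. f (fst p) (snd p)) ` (carrier A \<times> carrier B) \<subseteq> carrier (add_monoid H)"
    using cl by auto
  from comm_group.free_Abelian_group_universal[OF H.a_comm_group this] obtain g where
    g: "g \<in> hom Fr (add_monoid H)" "\<And>x. x \<in> carrier A \<times> carrier B \<Longrightarrow> g (frag_of x) = f (fst x) (snd x)"
    by blast
  have gc: "g x \<in> carrier H" if "x \<in> carrier Fr" for x using g(1) that by (auto simp: hom_def)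
  have gadd: "g (x + y) = g x \<oplus>\<^bsub>H\<^esub> g y" if "x \<in> carrier Fr" "y \<in> carrier Fr" for x y
    using g(1) that unfolding hom_def by auto
  have gmin: "g (x - y) = g x \<ominus>\<^bsub>H\<^esub> g y" if "x \<in> carrier Fr" "y \<in> carrier Fr" for x y
  proof -
    have d: "x - y \<in> carrier Fr" using that by (rule free_diff)
    have "g x = g (x - y) \<oplus>\<^bsub>H\<^esub> g y" using gadd[OF d that(2)] by simp
    then show ?thesis using gc that d by (simp add: H.minus_eq H.a_assoc H.r_neg)
  qed
  have ker: "g x = \<zero>\<^bsub>H\<^esub>" if "x \<in> Ke" for x
    using that
  proof (induction rule: kernel_induct)
    case zero
    show ?case using gmin[of 0 0] gc[of 0] by (simp add: H.r_neg H.minus_eq)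
  next
    case (rel x)
    have diff: "frag_of p - frag_of q \<in> carrier Fr" if "p \<in> carrier A \<times> carrier B" "q \<in> carrier A \<times> carrier B" for p q
      using that free_diff by auto
    have e3: "(y \<oplus>\<^bsub>H\<^esub> z) \<ominus>\<^bsub>H\<^esub> y \<ominus>\<^bsub>H\<^esub> z = \<zero>\<^bsub>H\<^esub>" if "y \<in> carrier H" "z \<in> carrier H" for y z
    proof -
      have "(y \<oplus>\<^bsub>H\<^esub> z) \<oplus>\<^bsub>H\<^esub> (\<ominus>\<^bsub>H\<^esub> y \<oplus>\<^bsub>H\<^esub> \<ominus>\<^bsub>H\<^esub> z) = \<zero>\<^bsub>H\<^esub>"
        using H.r_neg[of "y \<oplus>\<^bsub>H\<^esub> z"] that by (simp add: H.minus_add)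
      then show ?thesis using that by (simp add: H.minus_eq H.a_assoc)
    qed
    from rel show ?case unfolding tensor_relations_def
    proof (elim UnE CollectE exE conjE)
      fix a a' b assume a: "x = frag_of (a \<oplus>\<^bsub>A\<^esub> a', b) - frag_of (a, b) - frag_of (a', b)"
        "a \<in> carrier A" "a' \<in> carrier A" "b \<in> carrier B"
      then have "g x = (f a b \<oplus>\<^bsub>H\<^esub> f a' b) \<ominus>\<^bsub>H\<^esub> f a b \<ominus>\<^bsub>H\<^esub> f a' b"
        using diff by (simp add: gmin g l)
      then show ?thesis using e3 cl a by simp
    next
      fix a b b' assume b: "x = frag_of (a, b \<oplus>\<^bsub>B\<^esub> b') - frag_of (a, b) - frag_of (a, b')"
        "a \<in> carrier A" "b \<in> carrier B" "b' \<in> carrier B"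
      then have "g x = (f a b \<oplus>\<^bsub>H\<^esub> f a b') \<ominus>\<^bsub>H\<^esub> f a b \<ominus>\<^bsub>H\<^esub> f a b'"
        using diff by (simp add: gmin g r)
      then show ?thesis using e3 cl b by simp
    next
      fix c a b assume "x = frag_of (c \<odot>\<^bsub>A\<^esub> a, b) - frag_of (a, c \<odot>\<^bsub>B\<^esub> b)"
        "c \<in> carrier K" "a \<in> carrier A" "b \<in> carrier B"
      then show ?thesis using cl by (simp add: gmin g bal H.minus_eq H.r_neg)
    qed
  next
    case (add x y)
    then show ?case using gadd kernel_carrier by simp
  next
    case (minus x)
    have "g (- x) = g (0 - x)" by simp
    also have "\<dots> = \<zero>\<^bsub>H\<^esub>" using gmin[of 0 x] gmin[of 0 0] gc[of 0] minus kernel_carrier[of x]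
      by (simp add: H.r_neg H.minus_eq)
    finally show ?case .
  qed
  \<comment> \<open>The value on a class is that of any representative; two representatives differ by a
    relation, where \<open>g\<close> vanishes.\<close>
  define h where "h S = (THE y. \<exists>x\<in>carrier Fr. S = cl x \<and> y = g x)" for S
  have h: "h (cl x) = g x" if x: "x \<in> carrier Fr" for x
    unfolding h_def
  proof (rule the_equality)
    fix y assume "\<exists>x'\<in>carrier Fr. cl x = cl x' \<and> y = g x'"
    then obtain x' where x': "x' \<in> carrier Fr" "cl x = cl x'" "y = g x'" by blast
    then have k: "x - x' \<in> Ke" using class_eq_iff[OF x x'(1)] by simp
    have "g x = g (x - x') \<oplus>\<^bsub>H\<^esub> g x'" using gadd[OF kernel_carrier[OF k] x'(1)] by simp
    then show "y = g x" using ker[OF k] gc x' by simp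
  qed (use x in blast)
  show thesis
  proof
    show "h \<in> carrier T \<rightarrow> carrier H"
    proof
      fix S assume "S \<in> carrier T"
      then obtain x where "x \<in> carrier Fr" "S = cl x" by (rule class_cases)
      then show "h S \<in> carrier H" using h gc by simp
    qed
    show "h (S \<oplus>\<^bsub>T\<^esub> S') = h S \<oplus>\<^bsub>H\<^esub> h S'" if S: "S \<in> carrier T" "S' \<in> carrier T" for S S'
    proof -
      obtain x where x: "x \<in> carrier Fr" "S = cl x" by (rule class_cases[OF S(1)])
      obtain y where y: "y \<in> carrier Fr" "S' = cl y" by (rule class_cases[OF S(2)])
      have "x + y \<in> carrier Fr" using x y free_add by auto
      then show ?thesis using h gadd x y class_add by simp
    qed
    show "h (t a b) = f a b" if "a \<in> carrier A" "b \<in> carrier B" for a b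
      using that h[of "frag_of (a, b)"] g(2)[of "(a, b)"] by (simp add: pure_tensor_def)
  qed
qed

end

section \<open>Tensor maps and tensor products of algebras\<close>

context tensor_pair begin

lemma class_eqD: "x \<in> carrier Fr \<Longrightarrow> y \<in> carrier Fr \<Longrightarrow> cl x = cl y \<Longrightarrow> x - y \<in> Ke"
  using class_eq_iff by blast

lemma kernel_left: "a \<in> carrier A \<Longrightarrow> a' \<in> carrier A \<Longrightarrow> b \<in> carrier B \<Longrightarrow>
    frag_of (a \<oplus>\<^bsub>A\<^esub> a', b) - frag_of (a, b) - frag_of (a', b) \<in> Ke"
  by (rule relation_in_kernel) (unfold tensor_relations_def, blast)

lemma kernel_right: "a \<in> carrier A \<Longrightarrow> b \<in> carrier B \<Longrightarrow> b' \<in> carrier B \<Longrightarrow>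
    frag_of (a, b \<oplus>\<^bsub>B\<^esub> b') - frag_of (a, b) - frag_of (a, b') \<in> Ke"
  by (rule relation_in_kernel) (unfold tensor_relations_def, blast)

lemma kernel_balanced: "c \<in> carrier K \<Longrightarrow> a \<in> carrier A \<Longrightarrow> b \<in> carrier B \<Longrightarrow>
    frag_of (c \<odot>\<^bsub>A\<^esub> a, b) - frag_of (a, c \<odot>\<^bsub>B\<^esub> b) \<in> Ke"
  by (rule relation_in_kernel) (unfold tensor_relations_def, blast)

lemma free_induct [consumes 1, case_names zero of diff]:
  assumes "x \<in> carrier Fr" "P 0" "\<And>a b. a \<in> carrier A \<Longrightarrow> b \<in> carrier B \<Longrightarrow> P (frag_of (a, b))"
    "\<And>x y. x \<in> carrier Fr \<Longrightarrow> y \<in> carrier Fr \<Longrightarrow> P x \<Longrightarrow> P y \<Longrightarrow> P (x - y)"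
  shows "P x"
  by (rule free_Abelian_group_induct[of x "carrier A \<times> carrier B"])
    (use assms in \<open>auto simp: carrier_free_Abelian_group_iff\<close>)

lemma
  assumes f: "f \<in> carrier A \<rightarrow> carrier A"
      "\<And>x y. x \<in> carrier A \<Longrightarrow> y \<in> carrier A \<Longrightarrow> f (x \<oplus>\<^bsub>A\<^esub> y) = f x \<oplus>\<^bsub>A\<^esub> f y"
    and g: "g \<in> carrier B \<rightarrow> carrier B"
      "\<And>x y. x \<in> carrier B \<Longrightarrow> y \<in> carrier B \<Longrightarrow> g (x \<oplus>\<^bsub>B\<^esub> y) = g x \<oplus>\<^bsub>B\<^esub> g y"
    and bal: "\<And>c a b. c \<in> carrier K \<Longrightarrow> a \<in> carrier A \<Longrightarrow> b \<in> carrier B \<Longrightarrow>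
      t (f (c \<odot>\<^bsub>A\<^esub> a)) (g b) = t (f a) (g (c \<odot>\<^bsub>B\<^esub> b))"
  shows tensor_map_closed: "S \<in> carrier T \<Longrightarrow> tensor_map K A B f g S \<in> carrier T"
    and tensor_map_add: "S \<in> carrier T \<Longrightarrow> S' \<in> carrier T \<Longrightarrow>
      tensor_map K A B f g (S \<oplus>\<^bsub>T\<^esub> S') = tensor_map K A B f g S \<oplus>\<^bsub>T\<^esub> tensor_map K A B f g S'"
    and tensor_map_pure: "a \<in> carrier A \<Longrightarrow> b \<in> carrier B \<Longrightarrow> tensor_map K A B f g (t a b) = t (f a) (g b)"
proof -
  define h where "h = frag_extend (\<lambda>(a, b). frag_of (f a, g b))"
  have h_of [simp]: "h (frag_of (a, b)) = frag_of (f a, g b)" for a b by (simp add: h_def)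
  have h_diff: "h (x - y) = h x - h y" for x y by (simp add: h_def frag_extend_diff)
  have h_add: "h (x + y) = h x + h y" for x y by (simp add: h_def frag_extend_add)
  have h_minus: "h (- x) = - h x" for x by (simp add: h_def frag_extend_minus)
  have h_closed: "h x \<in> carrier Fr" if "x \<in> carrier Fr" for x
    using that
  proof (induction x rule: free_induct)
    case zero then show ?case by (simp add: h_def)
  next
    case (of a b) then show ?case using f g by auto
  next
    case (diff x y) then show ?case by (simp add: h_diff free_diff)
  qed
  have h_ker: "h x \<in> Ke" if "x \<in> Ke" for x
    using that
  proof (induction x rule: kernel_induct)
    case zero then show ?case by (simp add: h_def kernel_zero)
  next
    case (rel x)
    from rel show ?case unfolding tensor_relations_def
    proof (elim UnE CollectE exE conjE)
      fix a a' b assume "x = frag_of (a \<oplus>\<^bsub>A\<^esub> a', b) - frag_of (a, b) - frag_of (a', b)"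
        "a \<in> carrier A" "a' \<in> carrier A" "b \<in> carrier B"
      then show ?thesis using f g
        by (simp add: h_diff kernel_left kernel_right Pi_iff)
    next
      fix a b b' assume "x = frag_of (a, b \<oplus>\<^bsub>B\<^esub> b') - frag_of (a, b) - frag_of (a, b')"
        "a \<in> carrier A" "b \<in> carrier B" "b' \<in> carrier B"
      then show ?thesis using f g
        by (simp add: h_diff kernel_left kernel_right Pi_iff)
    next
      fix c a b assume x: "x = frag_of (c \<odot>\<^bsub>A\<^esub> a, b) - frag_of (a, c \<odot>\<^bsub>B\<^esub> b)"
        "c \<in> carrier K" "a \<in> carrier A" "b \<in> carrier B"
      show ?thesis unfolding x(1) h_diff h_of
        by (rule class_eqD) (use x f g bal[OF x(2-4)] in \<open>auto simp: pure_tensor_def\<close>)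
    qed
  next
    case (add x y) then show ?case by (simp add: h_add kernel_add)
  next
    case (minus x) then show ?case by (simp add: h_minus kernel_minus)
  qed
  have eq: "tensor_map K A B f g (cl x) = cl (h x)" if "x \<in> carrier Fr" for x
    unfolding tensor_map_def h_def[symmetric]
    by (rule class_map) (use that h_closed h_diff h_ker in auto)
  show "tensor_map K A B f g S \<in> carrier T" if S: "S \<in> carrier T"
  proof -
    obtain x where "x \<in> carrier Fr" "S = cl x" by (rule class_cases[OF S])
    then show ?thesis using eq h_closed class_closed by simp
  qed
  show "tensor_map K A B f g (S \<oplus>\<^bsub>T\<^esub> S') = tensor_map K A B f g S \<oplus>\<^bsub>T\<^esub> tensor_map K A B f g S'"
    if S: "S \<in> carrier T" "S' \<in> carrier T"
  proof -
    obtain x where x: "x \<in> carrier Fr" "S = cl x" by (rule class_cases[OF S(1)])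
    obtain y where y: "y \<in> carrier Fr" "S' = cl y" by (rule class_cases[OF S(2)])
    show ?thesis using x y eq h_closed class_add free_add h_add by simp
  qed
  show "tensor_map K A B f g (t a b) = t (f a) (g b)" if "a \<in> carrier A" "b \<in> carrier B"
    using eq that by (simp add: pure_tensor_def)
qed

end

lemma frag_extend_diff_function:
  "frag_extend (\<lambda>p. u p - v p) x = frag_extend u x - frag_extend v x"
  by (rule frag_induction[of x UNIV]) (auto simp: frag_extend_diff)

lemma frag_extend_zero_function: "frag_extend (\<lambda>p. 0) x = 0"
  by (simp add: frag_extend_eq_0)

locale tensor_algebras = fst: unital_algebra K A + snd: unital_algebra K B
  for K (structure) and A (structure) and B (structure)

sublocale tensor_algebras \<subseteq> tensor_pair ..

context tensor_algebras begin

text \<open>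
  The bilinear multiplication of the free group on pairs. The relations form an ideal for it,
  which makes the multiplication of classes well defined.
\<close>

definition free_mult where
  "free_mult x y = frag_extend (\<lambda>(a, b). frag_extend (\<lambda>(a', b'). frag_of (a \<otimes>\<^bsub>A\<^esub> a', b \<otimes>\<^bsub>B\<^esub> b')) y) x"

lemma free_mult_of [simp]:
  "free_mult (frag_of (a, b)) (frag_of (a', b')) = frag_of (a \<otimes>\<^bsub>A\<^esub> a', b \<otimes>\<^bsub>B\<^esub> b')"
  by (simp add: free_mult_def)

lemma free_mult_diff_left: "free_mult (x - y) z = free_mult x z - free_mult y z"
  by (simp add: free_mult_def frag_extend_diff)

lemma free_mult_diff_right: "free_mult x (y - z) = free_mult x y - free_mult x z"
  by (simp add: free_mult_def frag_extend_diff case_prod_unfold frag_extend_diff_function)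

lemma free_mult_zero [simp]: "free_mult 0 y = 0" "free_mult x 0 = 0"
  by (simp_all add: free_mult_def case_prod_unfold frag_extend_zero_function)

lemma free_mult_minus_left: "free_mult (- x) z = - free_mult x z"
  using free_mult_diff_left[of 0 x z] by simp

lemma free_mult_minus_right: "free_mult x (- z) = - free_mult x z"
  using free_mult_diff_right[of x 0 z] by simp

lemma free_mult_add_left: "free_mult (x + y) z = free_mult x z + free_mult y z"
  using free_mult_diff_left[of x "- y" z] by (simp add: free_mult_minus_left)

lemma free_mult_add_right: "free_mult x (y + z) = free_mult x y + free_mult x z"
  using free_mult_diff_right[of x y "- z"] by (simp add: free_mult_minus_right)

lemma free_mult_closed:
  assumes "x \<in> carrier Fr" "y \<in> carrier Fr"
  shows "free_mult x y \<in> carrier Fr"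
  using assms(1)
proof (induction x rule: free_induct)
  case (of a b)
  show ?case using assms(2)
    by (induction y rule: free_induct)
      (use of in \<open>auto simp: free_mult_diff_right free_diff fst.mult_closed snd.mult_closed\<close>)
qed (auto simp: free_mult_diff_left free_diff)

lemma free_mult_kernel_left:
  assumes "x \<in> Ke" "y \<in> carrier Fr"
  shows "free_mult x y \<in> Ke"
  using assms(1)
proof (induction x rule: kernel_induct)
  case (rel x)
  show ?case using assms(2)
  proof (induction y rule: free_induct)
    case (of a0 b0)
    from rel show ?case unfolding tensor_relations_def
    proof (elim UnE CollectE exE conjE)
      fix a a' b assume "x = frag_of (a \<oplus>\<^bsub>A\<^esub> a', b) - frag_of (a, b) - frag_of (a', b)"
        "a \<in> carrier A" "a' \<in> carrier A" "b \<in> carrier B"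
      then show ?thesis using of
        by (simp add: free_mult_diff_left fst.distrib_right kernel_left kernel_right kernel_balanced fst.mult_closed snd.mult_closed)
    next
      fix a b b' assume "x = frag_of (a, b \<oplus>\<^bsub>B\<^esub> b') - frag_of (a, b) - frag_of (a, b')"
        "a \<in> carrier A" "b \<in> carrier B" "b' \<in> carrier B"
      then show ?thesis using of
        by (simp add: free_mult_diff_left snd.distrib_right kernel_left kernel_right kernel_balanced fst.mult_closed snd.mult_closed)
    next
      fix c a b assume "x = frag_of (c \<odot>\<^bsub>A\<^esub> a, b) - frag_of (a, c \<odot>\<^bsub>B\<^esub> b)"
        "c \<in> carrier K" "a \<in> carrier A" "b \<in> carrier B"
      then show ?thesis using of
        by (simp add: free_mult_diff_left fst.smult_left snd.smult_left kernel_left kernel_right kernel_balanced fst.mult_closed snd.mult_closed)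
    qed
  qed (auto simp: free_mult_diff_right kernel_diff kernel_zero)
qed (auto simp: free_mult_add_left free_mult_minus_left kernel_add kernel_minus kernel_zero)

lemma free_mult_kernel_right:
  assumes "x \<in> Ke" "y \<in> carrier Fr"
  shows "free_mult y x \<in> Ke"
  using assms(1)
proof (induction x rule: kernel_induct)
  case (rel x)
  show ?case using assms(2)
  proof (induction y rule: free_induct)
    case (of a0 b0)
    from rel show ?case unfolding tensor_relations_def
    proof (elim UnE CollectE exE conjE)
      fix a a' b assume "x = frag_of (a \<oplus>\<^bsub>A\<^esub> a', b) - frag_of (a, b) - frag_of (a', b)"
        "a \<in> carrier A" "a' \<in> carrier A" "b \<in> carrier B"
      then show ?thesis using of
        by (simp add: free_mult_diff_right fst.distrib_left kernel_left kernel_right kernel_balanced fst.mult_closed snd.mult_closed)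
    next
      fix a b b' assume "x = frag_of (a, b \<oplus>\<^bsub>B\<^esub> b') - frag_of (a, b) - frag_of (a, b')"
        "a \<in> carrier A" "b \<in> carrier B" "b' \<in> carrier B"
      then show ?thesis using of
        by (simp add: free_mult_diff_right snd.distrib_left kernel_left kernel_right kernel_balanced fst.mult_closed snd.mult_closed)
    next
      fix c a b assume "x = frag_of (c \<odot>\<^bsub>A\<^esub> a, b) - frag_of (a, c \<odot>\<^bsub>B\<^esub> b)"
        "c \<in> carrier K" "a \<in> carrier A" "b \<in> carrier B"
      then show ?thesis using of
        by (simp add: free_mult_diff_right fst.smult_right snd.smult_right kernel_left kernel_right kernel_balanced fst.mult_closed snd.mult_closed)
    qed
  qed (auto simp: free_mult_diff_left kernel_diff kernel_zero)
qed (auto simp: free_mult_add_right free_mult_minus_right kernel_add kernel_minus kernel_zero)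

lemma class_mult:
  assumes "x \<in> carrier Fr" "y \<in> carrier Fr"
  shows "cl x \<otimes>\<^bsub>T\<^esub> cl y = cl (free_mult x y)"
proof -
  have "cl x \<otimes>\<^bsub>T\<^esub> cl y = (\<Union>u\<in>cl x. \<Union>v\<in>cl y. cl (free_mult u v))"
    by (simp add: tensor_product_def free_mult_def)
  also have "\<dots> = (\<Union>u\<in>cl x. cl (free_mult u y))"
  proof (rule SUP_cong)
    fix u assume "u \<in> cl x"
    then have "u \<in> carrier Fr" using class_member assms by blast
    then show "(\<Union>v\<in>cl y. cl (free_mult u v)) = cl (free_mult u y)"
      by (intro class_map) (use assms free_mult_closed free_mult_diff_right free_mult_kernel_right in auto)
  qed simp
  also have "\<dots> = cl (free_mult x y)"
    by (intro class_map) (use assms free_mult_closed free_mult_diff_left free_mult_kernel_left in auto)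
  finally show ?thesis .
qed

lemma pure_mult:
  assumes "a \<in> carrier A" "a' \<in> carrier A" "b \<in> carrier B" "b' \<in> carrier B"
  shows "t a b \<otimes>\<^bsub>T\<^esub> t a' b' = t (a \<otimes>\<^bsub>A\<^esub> a') (b \<otimes>\<^bsub>B\<^esub> b')"
  using class_mult[of "frag_of (a, b)" "frag_of (a', b')"] assms by (simp add: pure_tensor_def)

lemma tensor_mult_closed: "x \<in> carrier T \<Longrightarrow> y \<in> carrier T \<Longrightarrow> x \<otimes>\<^bsub>T\<^esub> y \<in> carrier T"
  by (metis class_cases class_mult class_closed free_mult_closed)

lemma tensor_distrib_left:
  assumes "x \<in> carrier T" "y \<in> carrier T" "z \<in> carrier T"
  shows "x \<otimes>\<^bsub>T\<^esub> (y \<oplus>\<^bsub>T\<^esub> z) = x \<otimes>\<^bsub>T\<^esub> y \<oplus>\<^bsub>T\<^esub> x \<otimes>\<^bsub>T\<^esub> z"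
proof -
  obtain a where a: "a \<in> carrier Fr" "x = cl a" by (rule class_cases[OF assms(1)])
  obtain b where b: "b \<in> carrier Fr" "y = cl b" by (rule class_cases[OF assms(2)])
  obtain c where c: "c \<in> carrier Fr" "z = cl c" by (rule class_cases[OF assms(3)])
  show ?thesis using a b c
    by (simp add: class_mult class_add free_add free_mult_add_right free_mult_closed)
qed

lemma tensor_distrib_right:
  assumes "x \<in> carrier T" "y \<in> carrier T" "z \<in> carrier T"
  shows "(x \<oplus>\<^bsub>T\<^esub> y) \<otimes>\<^bsub>T\<^esub> z = x \<otimes>\<^bsub>T\<^esub> z \<oplus>\<^bsub>T\<^esub> y \<otimes>\<^bsub>T\<^esub> z"
proof -
  obtain a where a: "a \<in> carrier Fr" "x = cl a" by (rule class_cases[OF assms(1)])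
  obtain b where b: "b \<in> carrier Fr" "y = cl b" by (rule class_cases[OF assms(2)])
  obtain c where c: "c \<in> carrier Fr" "z = cl c" by (rule class_cases[OF assms(3)])
  show ?thesis using a b c
    by (simp add: class_mult class_add free_add free_mult_add_left free_mult_closed)
qed

lemma tensor_one: "\<one>\<^bsub>T\<^esub> = t \<one>\<^bsub>A\<^esub> \<one>\<^bsub>B\<^esub>"
  by (simp add: tensor_product_def pure_tensor_def)

lemma tensor_smult: "c \<odot>\<^bsub>T\<^esub> x = tensor_map K A B (\<lambda>a. c \<odot>\<^bsub>A\<^esub> a) (\<lambda>b. b) x"
  by (simp add: tensor_product_def tensor_map_def)

lemma
  assumes c: "c \<in> carrier K"
  shows tensor_smult_closed: "x \<in> carrier T \<Longrightarrow> c \<odot>\<^bsub>T\<^esub> x \<in> carrier T"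
    and tensor_smult_add: "x \<in> carrier T \<Longrightarrow> y \<in> carrier T \<Longrightarrow>
      c \<odot>\<^bsub>T\<^esub> (x \<oplus>\<^bsub>T\<^esub> y) = c \<odot>\<^bsub>T\<^esub> x \<oplus>\<^bsub>T\<^esub> c \<odot>\<^bsub>T\<^esub> y"
    and tensor_smult_pure: "a \<in> carrier A \<Longrightarrow> b \<in> carrier B \<Longrightarrow> c \<odot>\<^bsub>T\<^esub> t a b = t (c \<odot>\<^bsub>A\<^esub> a) b"
proof -
  have bal: "t (c \<odot>\<^bsub>A\<^esub> (d \<odot>\<^bsub>A\<^esub> a)) b = t (c \<odot>\<^bsub>A\<^esub> a) (d \<odot>\<^bsub>B\<^esub> b)"
    if "d \<in> carrier K" "a \<in> carrier A" "b \<in> carrier B" for d a b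
    using that c fst.smult_assoc1[of c d a] fst.smult_assoc1[of d c a] pure_balanced[of d "c \<odot>\<^bsub>A\<^esub> a" b]
    by (simp add: fst.R.m_comm)
  show "x \<in> carrier T \<Longrightarrow> c \<odot>\<^bsub>T\<^esub> x \<in> carrier T"
    unfolding tensor_smult by (rule tensor_map_closed) (use c bal fst.smult_r_distr in auto)
  show "x \<in> carrier T \<Longrightarrow> y \<in> carrier T \<Longrightarrow>
      c \<odot>\<^bsub>T\<^esub> (x \<oplus>\<^bsub>T\<^esub> y) = c \<odot>\<^bsub>T\<^esub> x \<oplus>\<^bsub>T\<^esub> c \<odot>\<^bsub>T\<^esub> y"
    unfolding tensor_smult by (rule tensor_map_add) (use c bal fst.smult_r_distr in auto)
  show "a \<in> carrier A \<Longrightarrow> b \<in> carrier B \<Longrightarrow> c \<odot>\<^bsub>T\<^esub> t a b = t (c \<odot>\<^bsub>A\<^esub> a) b"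
    unfolding tensor_smult by (rule tensor_map_pure) (use c bal fst.smult_r_distr in auto)
qed

sublocale T: abelian_group T by (rule tensor_abelian_group)

lemma add_swap: "a \<in> carrier T \<Longrightarrow> b \<in> carrier T \<Longrightarrow> c \<in> carrier T \<Longrightarrow> d \<in> carrier T \<Longrightarrow>
   (a \<oplus>\<^bsub>T\<^esub> b) \<oplus>\<^bsub>T\<^esub> (c \<oplus>\<^bsub>T\<^esub> d) = (a \<oplus>\<^bsub>T\<^esub> c) \<oplus>\<^bsub>T\<^esub> (b \<oplus>\<^bsub>T\<^esub> d)"
  by (simp add: T.a_ac)

theorem tensor_unital_algebra: "unital_algebra K T"
proof (unfold_locales, goal_cases)
  case (1 a x) then show ?case by (rule tensor_smult_closed)
next
  case (2 a b x)
  from 2(3) show ?case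
    by (induction x rule: tensor_induct)
      (use 2(1,2) in \<open>simp_all add: tensor_smult_pure tensor_smult_add tensor_smult_closed
        fst.smult_l_distr pure_add_left pure_closed add_swap\<close>)
next
  case (3 a x y) then show ?case by (rule tensor_smult_add)
next
  case (4 a b x)
  from 4(3) show ?case
    by (induction x rule: tensor_induct)
      (use 4(1,2) in \<open>simp_all add: tensor_smult_pure tensor_smult_add tensor_smult_closed
        fst.smult_assoc1 pure_closed\<close>)
next
  case (5 x)
  then show ?case
    by (induction x rule: tensor_induct) (simp_all add: tensor_smult_pure tensor_smult_add)
next
  case (6 x y) then show ?case by (rule tensor_mult_closed)
next
  case 7 show ?case unfolding tensor_one by (intro pure_closed fst.unit_closed snd.unit_closed)
next
  case (8 x)
  then show ?case
    by (induction x rule: tensor_induct)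
      (simp_all add: tensor_one pure_mult pure_closed tensor_distrib_left fst.unit_closed snd.unit_closed
        fst.unit_left snd.unit_left)
next
  case (9 x)
  then show ?case
    by (induction x rule: tensor_induct)
      (simp_all add: tensor_one pure_mult pure_closed tensor_distrib_right fst.unit_closed snd.unit_closed
        fst.unit_right snd.unit_right)
next
  case (10 x y z) then show ?case by (rule tensor_distrib_left)
next
  case (11 x y z) then show ?case by (rule tensor_distrib_right)
next
  case (12 c x y)
  from 12(2,3) show ?case
  proof (induction x rule: tensor_induct)
    case (pure a b)
    from pure(3) show ?case
      by (induction y rule: tensor_induct)
        (use pure(1,2) 12(1) in \<open>simp_all add: tensor_smult_pure pure_mult pure_closed fst.mult_closed
          snd.mult_closed fst.smult_left tensor_distrib_left tensor_smult_add tensor_mult_closed\<close>)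
  qed (use 12(1) in \<open>simp_all add: tensor_distrib_right tensor_smult_add tensor_smult_closed tensor_mult_closed\<close>)
next
  case (13 c x y)
  from 13(2,3) show ?case
  proof (induction x rule: tensor_induct)
    case (pure a b)
    from pure(3) show ?case
      by (induction y rule: tensor_induct)
        (use pure(1,2) 13(1) in \<open>simp_all add: tensor_smult_pure pure_mult pure_closed fst.mult_closed
          snd.mult_closed fst.smult_right tensor_distrib_left tensor_smult_add tensor_smult_closed tensor_mult_closed\<close>)
  qed (use 13(1) in \<open>simp_all add: tensor_distrib_right tensor_smult_add tensor_smult_closed tensor_mult_closed\<close>)
qed

end

section \<open>Separating linear functionals\<close>

definition linear_functionals :: "('k, 'x) ring_scheme \<Rightarrow> ('k, 'a, 'y) module_scheme \<Rightarrow> ('a \<Rightarrow> 'k) set"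
  where "linear_functionals K A = {l \<in> carrier A \<rightarrow> carrier K.
     (\<forall>x\<in>carrier A. \<forall>y\<in>carrier A. l (x \<oplus>\<^bsub>A\<^esub> y) = l x \<oplus>\<^bsub>K\<^esub> l y) \<and>
     (\<forall>c\<in>carrier K. \<forall>x\<in>carrier A. l (c \<odot>\<^bsub>A\<^esub> x) = c \<otimes>\<^bsub>K\<^esub> l x)}"

lemma (in module) subspaceI:
  assumes "U \<subseteq> carrier M" "\<zero>\<^bsub>M\<^esub> \<in> U" "\<And>x y. x \<in> U \<Longrightarrow> y \<in> U \<Longrightarrow> x \<oplus>\<^bsub>M\<^esub> y \<in> U"
    "\<And>c x. c \<in> carrier R \<Longrightarrow> x \<in> U \<Longrightarrow> c \<odot>\<^bsub>M\<^esub> x \<in> U"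
  shows "submodule U R M"
proof (rule submoduleI)
  fix x assume x: "x \<in> U"
  then have "x \<in> carrier M" using assms(1) by blast
  then have "(\<ominus> \<one>) \<odot>\<^bsub>M\<^esub> x = \<ominus>\<^bsub>M\<^esub> x" by (simp add: smult_l_minus)
  then show "\<ominus>\<^bsub>M\<^esub> x \<in> U" using assms(4)[of "\<ominus> \<one>" x] x by simp
qed (use assms in auto)

lemma (in module) submodule_zero:
  assumes "submodule U R M" shows "\<zero>\<^bsub>M\<^esub> \<in> U"
proof -
  note E = submoduleE[OF assms]
  obtain w where "w \<in> U" using E(2) by blast
  then have "\<zero> \<odot>\<^bsub>M\<^esub> w \<in> U" "w \<in> carrier M" using E(1,4) by blast+
  then show ?thesis by simp
qed

text \<open>
  Zorn's lemma, applied to the submodules that contain \<open>U\<close> and miss \<open>a\<close>.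
\<close>

lemma (in module) maximal_submodule_avoiding:
  assumes U: "submodule U R M" and a: "a \<notin> U"
  obtains W where "submodule W R M" "U \<subseteq> W" "a \<notin> W"
    "\<And>V. submodule V R M \<Longrightarrow> W \<subseteq> V \<Longrightarrow> a \<notin> V \<Longrightarrow> V = W"
proof -
  let ?F = "{W. submodule W R M \<and> U \<subseteq> W \<and> a \<notin> W}"
  have "\<exists>W\<in>?F. \<forall>V\<in>?F. W \<subseteq> V \<longrightarrow> V = W"
  proof (rule subset_Zorn_nonempty)
    show "?F \<noteq> {}" using U a by auto
  next
    fix C assume C: "C \<noteq> {}" "subset.chain ?F C"
    then have sub: "\<And>W. W \<in> C \<Longrightarrow> submodule W R M \<and> U \<subseteq> W \<and> a \<notin> W"
      unfolding subset.chain_def by blast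
    note E = submoduleE[OF conjunct1[OF sub]]
    have "submodule (\<Union>C) R M"
    proof (rule subspaceI)
      show "\<Union>C \<subseteq> carrier M" using E(1) by blast
      show "\<zero>\<^bsub>M\<^esub> \<in> \<Union>C" using C(1) sub submodule_zero by blast
      show "c \<odot>\<^bsub>M\<^esub> x \<in> \<Union>C" if "c \<in> carrier R" "x \<in> \<Union>C" for c x using that E(4) by blast
      show "x \<oplus>\<^bsub>M\<^esub> y \<in> \<Union>C" if xy: "x \<in> \<Union>C" "y \<in> \<Union>C" for x y
      proof -
        obtain V W where VW: "V \<in> C" "x \<in> V" "W \<in> C" "y \<in> W" using xy by blast
        then have "V \<subseteq> W \<or> W \<subseteq> V" using C(2) unfolding subset.chain_def by blast
        then show ?thesis using VW E(5)[of V x y] E(5)[of W x y] by blast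
      qed
    qed
    then show "\<Union>C \<in> ?F" using C sub by blast
  qed
  then obtain W where "W \<in> ?F" "\<forall>V\<in>?F. W \<subseteq> V \<longrightarrow> V = W" by (rule bexE)
  then show thesis by (intro that[of W]) auto
qed

lemma (in module) smult_minus_distrib:
  "c \<in> carrier R \<Longrightarrow> d \<in> carrier R \<Longrightarrow> x \<in> carrier M \<Longrightarrow> (c \<ominus> d) \<odot>\<^bsub>M\<^esub> x = c \<odot>\<^bsub>M\<^esub> x \<ominus>\<^bsub>M\<^esub> d \<odot>\<^bsub>M\<^esub> x"
  by (simp add: a_minus_def smult_l_distr smult_l_minus)

text \<open>
  A submodule \<open>W\<close> that is maximal among those that contain \<open>U\<close> and miss \<open>a\<close> is a complement of
  the line through \<open>a\<close>. The functional is the coordinate along that line, which is defined by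
  \<open>x - l(x) a \<in> W\<close>.
\<close>

theorem (in module) functional_separating:
  assumes field: "field R" and U: "submodule U R M" and a: "a \<in> carrier M" "a \<notin> U"
  obtains l where "l \<in> linear_functionals R M" "\<And>u. u \<in> U \<Longrightarrow> l u = \<zero>" "l a = \<one>"
proof -
  obtain W where W: "submodule W R M" "U \<subseteq> W" "a \<notin> W"
    "\<And>V. submodule V R M \<Longrightarrow> W \<subseteq> V \<Longrightarrow> a \<notin> V \<Longrightarrow> V = W"
    by (rule maximal_submodule_avoiding[OF U a(2)]) blast
  note E = submoduleE[OF W(1)]
  have zW: "\<zero>\<^bsub>M\<^esub> \<in> W" by (rule submodule_zero[OF W(1)])
  \<comment> \<open>Otherwise a nonzero multiple of \<open>a\<close> would lie in \<open>W\<close>.\<close>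
  have unique: "c = d" if cd: "c \<in> carrier R" "d \<in> carrier R" and x: "x \<in> carrier M"
    "x \<ominus>\<^bsub>M\<^esub> c \<odot>\<^bsub>M\<^esub> a \<in> W" "x \<ominus>\<^bsub>M\<^esub> d \<odot>\<^bsub>M\<^esub> a \<in> W" for c d x
  proof (rule ccontr)
    assume ne: "c \<noteq> d"
    have dc: "d \<ominus> c \<in> Units R"
      using ne cd field by (metis R.minus_closed R.r_right_minus_eq field.field_Units Diff_iff singletonD)
    have "(x \<ominus>\<^bsub>M\<^esub> c \<odot>\<^bsub>M\<^esub> a) \<oplus>\<^bsub>M\<^esub> \<ominus>\<^bsub>M\<^esub> (x \<ominus>\<^bsub>M\<^esub> d \<odot>\<^bsub>M\<^esub> a) \<in> W" using x E by blast
    also have "(x \<ominus>\<^bsub>M\<^esub> c \<odot>\<^bsub>M\<^esub> a) \<oplus>\<^bsub>M\<^esub> \<ominus>\<^bsub>M\<^esub> (x \<ominus>\<^bsub>M\<^esub> d \<odot>\<^bsub>M\<^esub> a) = (d \<ominus> c) \<odot>\<^bsub>M\<^esub> a"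
      using cd x(1) a(1) by (simp add: smult_minus_distrib M.minus_eq M.minus_add M.a_ac M.r_neg1 M.r_neg2)
    finally have "inv (d \<ominus> c) \<odot>\<^bsub>M\<^esub> ((d \<ominus> c) \<odot>\<^bsub>M\<^esub> a) \<in> W" using dc E(4) by blast
    then show False
      using dc W(3) a(1) cd smult_assoc1[of "inv (d \<ominus> c)" "d \<ominus> c" a] by simp
  qed
  have exists: "\<exists>c\<in>carrier R. x \<ominus>\<^bsub>M\<^esub> c \<odot>\<^bsub>M\<^esub> a \<in> W" if x: "x \<in> carrier M" for x
  proof (cases "x \<in> W")
    case True
    then have "x \<ominus>\<^bsub>M\<^esub> \<zero> \<odot>\<^bsub>M\<^esub> a \<in> W" using a(1) x E(5)[OF True E(3)[OF zW]] by (simp add: M.minus_eq)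
    then show ?thesis by blast
  next
    case False
    \<comment> \<open>By maximality \<open>W + R x\<close> contains \<open>a\<close>, and the relation can be solved for \<open>x\<close>.\<close>
    define V where "V = {w \<oplus>\<^bsub>M\<^esub> c \<odot>\<^bsub>M\<^esub> x | w c. w \<in> W \<and> c \<in> carrier R}"
    have "submodule V R M"
    proof (rule subspaceI)
      show "V \<subseteq> carrier M" using E(1) x by (auto simp: V_def)
      have "\<zero>\<^bsub>M\<^esub> \<oplus>\<^bsub>M\<^esub> \<zero> \<odot>\<^bsub>M\<^esub> x \<in> V" unfolding V_def using zW by blast
      then show "\<zero>\<^bsub>M\<^esub> \<in> V" using x by simp
      show "u \<oplus>\<^bsub>M\<^esub> v \<in> V" if "u \<in> V" "v \<in> V" for u v
      proof -
        from that obtain w c w' c' where wc: "u = w \<oplus>\<^bsub>M\<^esub> c \<odot>\<^bsub>M\<^esub> x" "w \<in> W" "c \<in> carrier R"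
          "v = w' \<oplus>\<^bsub>M\<^esub> c' \<odot>\<^bsub>M\<^esub> x" "w' \<in> W" "c' \<in> carrier R" by (auto simp: V_def)
        then have "w \<in> carrier M" "w' \<in> carrier M" using E(1) by blast+
        then have "u \<oplus>\<^bsub>M\<^esub> v = (w \<oplus>\<^bsub>M\<^esub> w') \<oplus>\<^bsub>M\<^esub> (c \<oplus> c') \<odot>\<^bsub>M\<^esub> x" using wc x
          by (simp add: smult_l_distr M.a_ac)
        moreover have "w \<oplus>\<^bsub>M\<^esub> w' \<in> W" "c \<oplus> c' \<in> carrier R" using wc E(5) by auto
        ultimately show ?thesis unfolding V_def by blast
      qed
      show "c \<odot>\<^bsub>M\<^esub> v \<in> V" if "c \<in> carrier R" "v \<in> V" for c v
      proof -
        from that obtain w d where wc: "v = w \<oplus>\<^bsub>M\<^esub> d \<odot>\<^bsub>M\<^esub> x" "w \<in> W" "d \<in> carrier R" by (auto simp: V_def)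
        then have "w \<in> carrier M" using E(1) by blast
        then have "c \<odot>\<^bsub>M\<^esub> v = c \<odot>\<^bsub>M\<^esub> w \<oplus>\<^bsub>M\<^esub> (c \<otimes> d) \<odot>\<^bsub>M\<^esub> x" using wc x that
          by (simp add: smult_r_distr smult_assoc1)
        moreover have "c \<odot>\<^bsub>M\<^esub> w \<in> W" "c \<otimes> d \<in> carrier R" using wc E(4) that by auto
        ultimately show ?thesis unfolding V_def by blast
      qed
    qed
    moreover have "W \<subseteq> V"
    proof
      fix w assume w: "w \<in> W"
      then have "w \<oplus>\<^bsub>M\<^esub> \<zero> \<odot>\<^bsub>M\<^esub> x \<in> V" unfolding V_def by blast
      then show "w \<in> V" using x w E(1) by auto
    qed
    moreover have "x \<in> V"
    proof -
      have "\<zero>\<^bsub>M\<^esub> \<oplus>\<^bsub>M\<^esub> \<one> \<odot>\<^bsub>M\<^esub> x \<in> V" unfolding V_def using zW by blast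
      then show ?thesis using x by simp
    qed
    ultimately have "a \<in> V" using W(4)[of V] False by blast
    then obtain w c where wc: "a = w \<oplus>\<^bsub>M\<^esub> c \<odot>\<^bsub>M\<^esub> x" "w \<in> W" "c \<in> carrier R" by (auto simp: V_def)
    have w: "w \<in> carrier M" using wc E(1) by blast
    have "c \<noteq> \<zero>" using wc w x W(3) by auto
    then have c: "c \<in> Units R" using field.field_Units[OF field] wc by blast
    have "inv c \<odot>\<^bsub>M\<^esub> a = inv c \<odot>\<^bsub>M\<^esub> w \<oplus>\<^bsub>M\<^esub> x"
      using wc w x c smult_assoc1[of "inv c" c x, symmetric] by (simp add: smult_r_distr)
    then have "x \<ominus>\<^bsub>M\<^esub> inv c \<odot>\<^bsub>M\<^esub> a = \<ominus>\<^bsub>M\<^esub> (inv c \<odot>\<^bsub>M\<^esub> w)"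
      using w x c by (simp add: M.minus_eq M.minus_add M.a_ac M.r_neg1 M.r_neg2 M.r_neg)
    moreover have "\<ominus>\<^bsub>M\<^esub> (inv c \<odot>\<^bsub>M\<^esub> w) \<in> W" using E(3,4) c wc by auto
    ultimately show ?thesis using c by (metis R.Units_inv_closed)
  qed
  define l where "l x = (THE c. c \<in> carrier R \<and> x \<ominus>\<^bsub>M\<^esub> c \<odot>\<^bsub>M\<^esub> a \<in> W)" for x
  have l: "l x = c" if "x \<in> carrier M" "c \<in> carrier R" "x \<ominus>\<^bsub>M\<^esub> c \<odot>\<^bsub>M\<^esub> a \<in> W" for x c
    unfolding l_def by (rule the_equality) (use that unique in blast)+
  have l': "l x \<in> carrier R" "x \<ominus>\<^bsub>M\<^esub> l x \<odot>\<^bsub>M\<^esub> a \<in> W" if "x \<in> carrier M" for x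
    using exists[OF that] l[OF that] by auto
  show thesis
  proof
    show "l \<in> linear_functionals R M"
      unfolding linear_functionals_def
    proof (intro CollectI conjI ballI Pi_I)
      fix x assume x: "x \<in> carrier M"
      show "l x \<in> carrier R" using l' x by blast
      fix y assume y: "y \<in> carrier M"
      have "(x \<ominus>\<^bsub>M\<^esub> l x \<odot>\<^bsub>M\<^esub> a) \<oplus>\<^bsub>M\<^esub> (y \<ominus>\<^bsub>M\<^esub> l y \<odot>\<^bsub>M\<^esub> a) \<in> W" using l' x y E(5) by blast
      also have "(x \<ominus>\<^bsub>M\<^esub> l x \<odot>\<^bsub>M\<^esub> a) \<oplus>\<^bsub>M\<^esub> (y \<ominus>\<^bsub>M\<^esub> l y \<odot>\<^bsub>M\<^esub> a) = (x \<oplus>\<^bsub>M\<^esub> y) \<ominus>\<^bsub>M\<^esub> (l x \<oplus> l y) \<odot>\<^bsub>M\<^esub> a"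
        using x y a(1) l' by (simp add: smult_l_distr M.minus_eq M.minus_add M.a_ac)
      finally show "l (x \<oplus>\<^bsub>M\<^esub> y) = l x \<oplus> l y" using x y l' by (intro l) auto
    next
      fix c x assume x: "c \<in> carrier R" "x \<in> carrier M"
      have "c \<odot>\<^bsub>M\<^esub> (x \<ominus>\<^bsub>M\<^esub> l x \<odot>\<^bsub>M\<^esub> a) \<in> W" using l' x E(4) by blast
      also have "c \<odot>\<^bsub>M\<^esub> (x \<ominus>\<^bsub>M\<^esub> l x \<odot>\<^bsub>M\<^esub> a) = c \<odot>\<^bsub>M\<^esub> x \<ominus>\<^bsub>M\<^esub> (c \<otimes> l x) \<odot>\<^bsub>M\<^esub> a"
        using x a(1) l' by (simp add: smult_r_distr M.minus_eq smult_r_minus smult_assoc1)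
      finally show "l (c \<odot>\<^bsub>M\<^esub> x) = c \<otimes> l x" using x l' by (intro l) auto
    qed
    have "a \<ominus>\<^bsub>M\<^esub> \<one> \<odot>\<^bsub>M\<^esub> a \<in> W" using a(1) zW by (simp add: M.minus_eq M.r_neg)
    then show "l a = \<one>" using l a(1) by blast
    fix u assume u: "u \<in> U"
    then have "u \<in> W" "u \<in> carrier M" using W(2) E(1) by blast+
    then have "u \<ominus>\<^bsub>M\<^esub> \<zero> \<odot>\<^bsub>M\<^esub> a \<in> W" using a(1) E(5)[of u "\<ominus>\<^bsub>M\<^esub> \<zero>\<^bsub>M\<^esub>"] E(3)[OF zW] by (simp add: M.minus_eq)
    then show "l u = \<zero>" using l \<open>u \<in> carrier M\<close> by blast
  qed
qed

lemma linear_functionalsD: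
  assumes "l \<in> linear_functionals K M"
  shows "x \<in> carrier M \<Longrightarrow> l x \<in> carrier K"
    "x \<in> carrier M \<Longrightarrow> y \<in> carrier M \<Longrightarrow> l (x \<oplus>\<^bsub>M\<^esub> y) = l x \<oplus>\<^bsub>K\<^esub> l y"
    "c \<in> carrier K \<Longrightarrow> x \<in> carrier M \<Longrightarrow> l (c \<odot>\<^bsub>M\<^esub> x) = c \<otimes>\<^bsub>K\<^esub> l x"
  using assms by (auto simp: linear_functionals_def)

context tensor_algebras begin

text \<open>
  Contracting the first factor with a functional gives an additive map to the second factor.
  Such slices detect elements of a tensor product without a choice of bases.
\<close>

lemma functional_slice:
  assumes l: "l \<in> linear_functionals K A"
  obtains h where "h \<in> carrier T \<rightarrow> carrier B"
    "\<And>x y. x \<in> carrier T \<Longrightarrow> y \<in> carrier T \<Longrightarrow> h (x \<oplus>\<^bsub>T\<^esub> y) = h x \<oplus>\<^bsub>B\<^esub> h y"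
    "\<And>a b. a \<in> carrier A \<Longrightarrow> b \<in> carrier B \<Longrightarrow> h (t a b) = l a \<odot>\<^bsub>B\<^esub> b"
proof (rule tensor_lift[of B "\<lambda>a s. l a \<odot>\<^bsub>B\<^esub> s"])
  note L = linear_functionalsD[OF l]
  show "abelian_group B" by (rule snd.M.abelian_group_axioms)
  show "l a \<odot>\<^bsub>B\<^esub> s \<in> carrier B" if "a \<in> carrier A" "s \<in> carrier B" for a s using that L by simp
  show "l (a \<oplus>\<^bsub>A\<^esub> a') \<odot>\<^bsub>B\<^esub> s = l a \<odot>\<^bsub>B\<^esub> s \<oplus>\<^bsub>B\<^esub> l a' \<odot>\<^bsub>B\<^esub> s"
    if "a \<in> carrier A" "a' \<in> carrier A" "s \<in> carrier B" for a a' s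
    using that by (simp add: L snd.smult_l_distr)
  show "l a \<odot>\<^bsub>B\<^esub> (s \<oplus>\<^bsub>B\<^esub> s') = l a \<odot>\<^bsub>B\<^esub> s \<oplus>\<^bsub>B\<^esub> l a \<odot>\<^bsub>B\<^esub> s'"
    if "a \<in> carrier A" "s \<in> carrier B" "s' \<in> carrier B" for a s s'
    using that by (simp add: L snd.smult_r_distr)
  show "l (c \<odot>\<^bsub>A\<^esub> a) \<odot>\<^bsub>B\<^esub> s = l a \<odot>\<^bsub>B\<^esub> (c \<odot>\<^bsub>B\<^esub> s)"
    if "c \<in> carrier K" "a \<in> carrier A" "s \<in> carrier B" for c a s
  proof -
    have "l a \<in> carrier K" using that L by simp
    then have "(c \<otimes> l a) \<odot>\<^bsub>B\<^esub> s = (l a \<otimes> c) \<odot>\<^bsub>B\<^esub> s" using that by (simp add: fst.R.m_comm)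
    then show ?thesis using that \<open>l a \<in> carrier K\<close> by (simp add: L snd.smult_assoc1)
  qed
qed (use that in simp_all)

end

section \<open>Base change\<close>

text \<open>
  Finite sums are encoded as folds over lists, so that induction over them needs no hypothesis
  on the structure \<open>G\<close>.
\<close>

definition add_span :: "('a, 'x) ring_scheme \<Rightarrow> 'a set \<Rightarrow> 'a set"
  where "add_span G Y = {foldr (ring.add G) xs \<zero>\<^bsub>G\<^esub> | xs. set xs \<subseteq> Y}"

lemma add_span_zero: "\<zero>\<^bsub>G\<^esub> \<in> add_span G Y"
  unfolding add_span_def by (rule CollectI, rule exI[of _ "[]"]) simp

lemma add_span_add:
  assumes "x \<in> Y" "z \<in> add_span G Y"
  shows "x \<oplus>\<^bsub>G\<^esub> z \<in> add_span G Y"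
proof -
  obtain xs where "z = foldr (ring.add G) xs \<zero>\<^bsub>G\<^esub>" "set xs \<subseteq> Y"
    using assms(2) by (auto simp: add_span_def)
  then show ?thesis using assms(1) unfolding add_span_def by (intro CollectI exI[of _ "x # xs"]) simp
qed

lemma add_span_induct [consumes 1, case_names zero add]:
  assumes "z \<in> add_span G Y" "P \<zero>\<^bsub>G\<^esub>"
    and "\<And>x z. x \<in> Y \<Longrightarrow> z \<in> add_span G Y \<Longrightarrow> P z \<Longrightarrow> P (x \<oplus>\<^bsub>G\<^esub> z)"
  shows "P z"
proof -
  obtain xs where xs: "z = foldr (ring.add G) xs \<zero>\<^bsub>G\<^esub>" "set xs \<subseteq> Y"
    using assms(1) by (auto simp: add_span_def)
  have "foldr (ring.add G) ys \<zero>\<^bsub>G\<^esub> \<in> add_span G Y \<and> P (foldr (ring.add G) ys \<zero>\<^bsub>G\<^esub>)"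
    if "set ys \<subseteq> Y" for ys
    using that by (induction ys) (auto simp: assms(2) add_span_zero intro: add_span_add assms(3))
  then show ?thesis using xs by simp
qed

lemma algebra_imp_unital_algebra:
  assumes "algebra K S"
  shows "unital_algebra K S"
proof -
  interpret S: algebra K S by fact
  show ?thesis
  proof (unfold_locales, goal_cases)
    case (8 c x y)
    then have "c \<odot>\<^bsub>S\<^esub> (y \<otimes>\<^bsub>S\<^esub> x) = x \<otimes>\<^bsub>S\<^esub> (c \<odot>\<^bsub>S\<^esub> y)"
      using S.smult_assoc2[of c y x] S.m_comm[of x "c \<odot>\<^bsub>S\<^esub> y"] by simp
    then show ?case using 8 by (simp add: S.m_comm)
  qed (auto simp: S.l_distr S.r_distr S.smult_assoc2)
qed

locale scalar_extension = alg: unital_algebra K A + ext: algebra K S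
  for K (structure) and A (structure) and S (structure)

sublocale scalar_extension \<subseteq> tensor_algebras K A S
  by (intro tensor_algebras.intro alg.unital_algebra_axioms algebra_imp_unital_algebra ext.algebra_axioms)

context scalar_extension begin

abbreviation B where "B \<equiv> base_change K A S"

lemma base_change_simps [simp]:
  "carrier B = carrier T" "monoid.mult B = monoid.mult T" "one B = one T"
  "ring.zero B = ring.zero T" "ring.add B = ring.add T"
  by (simp_all add: base_change_def)

text \<open>
  The action of \<open>S\<close> on the second factor is a tensor map, so it inherits well-definedness,
  additivity and its value on pure tensors from the general case.
\<close>

lemma base_smult: "r \<odot>\<^bsub>B\<^esub> x = tensor_map K A S (\<lambda>a. a) (\<lambda>s. r \<otimes>\<^bsub>S\<^esub> s) x"
  by (simp add: base_change_def tensor_map_def)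

lemma
  assumes r: "r \<in> carrier S"
  shows base_smult_closed: "x \<in> carrier T \<Longrightarrow> r \<odot>\<^bsub>B\<^esub> x \<in> carrier T"
    and base_smult_add: "x \<in> carrier T \<Longrightarrow> y \<in> carrier T \<Longrightarrow>
      r \<odot>\<^bsub>B\<^esub> (x \<oplus>\<^bsub>T\<^esub> y) = r \<odot>\<^bsub>B\<^esub> x \<oplus>\<^bsub>T\<^esub> r \<odot>\<^bsub>B\<^esub> y"
    and base_smult_pure: "a \<in> carrier A \<Longrightarrow> s \<in> carrier S \<Longrightarrow> r \<odot>\<^bsub>B\<^esub> t a s = t a (r \<otimes>\<^bsub>S\<^esub> s)"
proof -
  have bal: "t (c \<odot>\<^bsub>A\<^esub> a) (r \<otimes>\<^bsub>S\<^esub> s) = t a (r \<otimes>\<^bsub>S\<^esub> (c \<odot>\<^bsub>S\<^esub> s))"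
    if "c \<in> carrier K" "a \<in> carrier A" "s \<in> carrier S" for c a s
    using that r by (simp add: pure_balanced snd.smult_right)
  show "x \<in> carrier T \<Longrightarrow> r \<odot>\<^bsub>B\<^esub> x \<in> carrier T"
    unfolding base_smult by (rule tensor_map_closed) (use r bal ext.r_distr in auto)
  show "x \<in> carrier T \<Longrightarrow> y \<in> carrier T \<Longrightarrow>
      r \<odot>\<^bsub>B\<^esub> (x \<oplus>\<^bsub>T\<^esub> y) = r \<odot>\<^bsub>B\<^esub> x \<oplus>\<^bsub>T\<^esub> r \<odot>\<^bsub>B\<^esub> y"
    unfolding base_smult by (rule tensor_map_add) (use r bal ext.r_distr in auto)
  show "a \<in> carrier A \<Longrightarrow> s \<in> carrier S \<Longrightarrow> r \<odot>\<^bsub>B\<^esub> t a s = t a (r \<otimes>\<^bsub>S\<^esub> s)"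
    unfolding base_smult by (rule tensor_map_pure) (use r bal ext.r_distr in auto)
qed

theorem base_unital_algebra: "unital_algebra S B"
proof -
  have "abelian_group B"
  proof (rule abelian_groupI)
    fix x assume "x \<in> carrier B"
    then show "\<exists>y\<in>carrier B. y \<oplus>\<^bsub>B\<^esub> x = \<zero>\<^bsub>B\<^esub>"
      using T.l_neg[of x] by (intro bexI[of _ "\<ominus>\<^bsub>T\<^esub> x"]) auto
  qed (auto simp: T.a_ac)
  moreover have "cring S" ..
  ultimately have mod: "module S B"
  proof (intro moduleI, goal_cases)
    case (3 r x) then show ?case by (simp add: base_smult_closed)
  next
    case (4 r s x)
    from 4(5) have "x \<in> carrier T" by simp
    then show ?case
      by (induction x rule: tensor_induct)
        (use 4 in \<open>simp_all add: base_smult_pure base_smult_add base_smult_closed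
          ext.l_distr pure_add_right pure_closed add_swap\<close>)
  next
    case (5 r x y) then show ?case by (simp add: base_smult_add)
  next
    case (6 r s x)
    from 6(5) have "x \<in> carrier T" by simp
    then show ?case
      by (induction x rule: tensor_induct)
        (use 6 in \<open>simp_all add: base_smult_pure base_smult_add base_smult_closed
          ext.m_assoc pure_closed\<close>)
  next
    case (7 x)
    then have "x \<in> carrier T" by simp
    then show ?case
      by (induction x rule: tensor_induct) (simp_all add: base_smult_pure base_smult_add)
  qed auto
  interpret TT: unital_algebra K T by (rule tensor_unital_algebra)
  show ?thesis
  proof (rule unital_algebra.intro[OF mod], unfold_locales, goal_cases)
    case (7 c x y)
    then have "x \<in> carrier T" "y \<in> carrier T" "c \<in> carrier S" by simp_all
    then have "(c \<odot>\<^bsub>B\<^esub> x) \<otimes>\<^bsub>T\<^esub> y = c \<odot>\<^bsub>B\<^esub> (x \<otimes>\<^bsub>T\<^esub> y)"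
    proof (induction x rule: tensor_induct)
      case (pure a s)
      from pure(3) show ?case
        by (induction y rule: tensor_induct)
          (use pure(1,2,4) in \<open>simp_all add: base_smult_pure pure_mult pure_closed alg.mult_closed
            ext.m_assoc tensor_distrib_left base_smult_add tensor_mult_closed\<close>)
    qed (simp_all add: tensor_distrib_right base_smult_add base_smult_closed tensor_mult_closed)
    then show ?case by simp
  next
    case (8 c x y)
    then have "x \<in> carrier T" "y \<in> carrier T" "c \<in> carrier S" by simp_all
    then have "x \<otimes>\<^bsub>T\<^esub> (c \<odot>\<^bsub>B\<^esub> y) = c \<odot>\<^bsub>B\<^esub> (x \<otimes>\<^bsub>T\<^esub> y)"
    proof (induction x rule: tensor_induct)
      case (pure a s)
      from pure(3) show ?case
        by (induction y rule: tensor_induct)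
          (use pure(1,2,4) in \<open>simp_all add: base_smult_pure pure_mult pure_closed alg.mult_closed
            ext.m_lcomm tensor_distrib_left base_smult_add base_smult_closed tensor_mult_closed\<close>)
    qed (simp_all add: tensor_distrib_right base_smult_add base_smult_closed tensor_mult_closed)
    then show ?case by simp
  qed (simp_all add: TT.mult_closed TT.unit_closed TT.unit_left TT.unit_right TT.distrib_left TT.distrib_right)
qed

sublocale B: unital_algebra S B by (rule base_unital_algebra)

lemma base_induct [consumes 1, case_names pure add]:
  assumes "z \<in> carrier B" and "\<And>a s. a \<in> carrier A \<Longrightarrow> s \<in> carrier S \<Longrightarrow> P (t a s)"
    and "\<And>x y. x \<in> carrier B \<Longrightarrow> y \<in> carrier B \<Longrightarrow> P x \<Longrightarrow> P y \<Longrightarrow> P (x \<oplus>\<^bsub>B\<^esub> y)"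
  shows "P z"
  using assms tensor_induct[of z P] by simp

lemma base_pure [simp]: "a \<in> carrier A \<Longrightarrow> s \<in> carrier S \<Longrightarrow> t a s \<in> carrier B"
  by (simp add: pure_closed)

lemma base_pure_add_left:
  "a \<in> carrier A \<Longrightarrow> a' \<in> carrier A \<Longrightarrow> s \<in> carrier S \<Longrightarrow> t (a \<oplus>\<^bsub>A\<^esub> a') s = t a s \<oplus>\<^bsub>B\<^esub> t a' s"
  by (simp add: pure_add_left)

lemma base_pure_add_right:
  "a \<in> carrier A \<Longrightarrow> s \<in> carrier S \<Longrightarrow> s' \<in> carrier S \<Longrightarrow> t a (s \<oplus>\<^bsub>S\<^esub> s') = t a s \<oplus>\<^bsub>B\<^esub> t a s'"
  by (simp add: pure_add_right)

lemma base_pure_mult: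
  "a \<in> carrier A \<Longrightarrow> a' \<in> carrier A \<Longrightarrow> s \<in> carrier S \<Longrightarrow> s' \<in> carrier S \<Longrightarrow>
    t a s \<otimes>\<^bsub>B\<^esub> t a' s' = t (a \<otimes>\<^bsub>A\<^esub> a') (s \<otimes>\<^bsub>S\<^esub> s')"
  by (simp add: pure_mult)

lemma base_one: "\<one>\<^bsub>B\<^esub> = t \<one>\<^bsub>A\<^esub> \<one>\<^bsub>S\<^esub>"
  by (simp add: tensor_one)

lemma pure_zero_left: "s \<in> carrier S \<Longrightarrow> t \<zero>\<^bsub>A\<^esub> s = \<zero>\<^bsub>B\<^esub>"
  using base_pure_add_left[of "\<zero>\<^bsub>A\<^esub>" "\<zero>\<^bsub>A\<^esub>" s] B.M.add.l_cancel_one'[of "t \<zero>\<^bsub>A\<^esub> s" "t \<zero>\<^bsub>A\<^esub> s"] base_pure[of "\<zero>\<^bsub>A\<^esub>" s]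
  by (simp del: base_pure base_change_simps)

lemma pure_zero_right: "a \<in> carrier A \<Longrightarrow> t a \<zero>\<^bsub>S\<^esub> = \<zero>\<^bsub>B\<^esub>"
  using base_pure_add_right[of a "\<zero>\<^bsub>S\<^esub>" "\<zero>\<^bsub>S\<^esub>"] B.M.add.l_cancel_one'[of "t a \<zero>\<^bsub>S\<^esub>" "t a \<zero>\<^bsub>S\<^esub>"] base_pure[of a "\<zero>\<^bsub>S\<^esub>"]
  by (simp del: base_pure base_change_simps)

lemma pure_minus_left: "a \<in> carrier A \<Longrightarrow> s \<in> carrier S \<Longrightarrow> t (\<ominus>\<^bsub>A\<^esub> a) s = \<ominus>\<^bsub>B\<^esub> t a s"
  using base_pure_add_left[of "\<ominus>\<^bsub>A\<^esub> a" a s] pure_zero_left[of s] base_pure[of a s] base_pure[of "\<ominus>\<^bsub>A\<^esub> a" s]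
  by (intro B.M.minus_equality[symmetric]) (simp_all add: alg.M.l_neg del: base_pure base_change_simps)

lemma pure_diff_left: "a \<in> carrier A \<Longrightarrow> a' \<in> carrier A \<Longrightarrow> s \<in> carrier S \<Longrightarrow>
    t (a \<ominus>\<^bsub>A\<^esub> a') s = t a s \<ominus>\<^bsub>B\<^esub> t a' s"
  by (simp add: a_minus_def base_pure_add_left pure_minus_left del: base_change_simps)

text \<open>
  From here on the base change is treated as an algebra over \<open>S\<close> in its own right, and its
  operations are no longer unfolded to those of the tensor product over \<open>K\<close>.
\<close>

declare base_change_simps [simp del]

lemma linear_mapsD:
  assumes "f \<in> linear_maps K A A"
  shows "x \<in> carrier A \<Longrightarrow> f x \<in> carrier A"
    "x \<in> carrier A \<Longrightarrow> y \<in> carrier A \<Longrightarrow> f (x \<oplus>\<^bsub>A\<^esub> y) = f x \<oplus>\<^bsub>A\<^esub> f y"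
    "c \<in> carrier K \<Longrightarrow> x \<in> carrier A \<Longrightarrow> f (c \<odot>\<^bsub>A\<^esub> x) = c \<odot>\<^bsub>A\<^esub> f x"
  using assms by (auto simp: linear_maps_def)

lemma
  assumes f: "f \<in> linear_maps K A A"
  shows base_map_closed: "x \<in> carrier B \<Longrightarrow> base_change_map K A S f x \<in> carrier B"
    and base_map_add: "x \<in> carrier B \<Longrightarrow> y \<in> carrier B \<Longrightarrow>
      base_change_map K A S f (x \<oplus>\<^bsub>B\<^esub> y) = base_change_map K A S f x \<oplus>\<^bsub>B\<^esub> base_change_map K A S f y"
    and base_map_pure: "a \<in> carrier A \<Longrightarrow> s \<in> carrier S \<Longrightarrow> base_change_map K A S f (t a s) = t (f a) s"
proof -
  note D = linear_mapsD[OF f]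
  have bal: "t (f (c \<odot>\<^bsub>A\<^esub> a)) s = t (f a) (c \<odot>\<^bsub>S\<^esub> s)"
    if "c \<in> carrier K" "a \<in> carrier A" "s \<in> carrier S" for c a s
    using that D by (simp add: pure_balanced)
  show "x \<in> carrier B \<Longrightarrow> base_change_map K A S f x \<in> carrier B"
    unfolding base_change_simps by (rule tensor_map_closed) (use D bal in auto)
  show "x \<in> carrier B \<Longrightarrow> y \<in> carrier B \<Longrightarrow>
      base_change_map K A S f (x \<oplus>\<^bsub>B\<^esub> y) = base_change_map K A S f x \<oplus>\<^bsub>B\<^esub> base_change_map K A S f y"
    unfolding base_change_simps by (rule tensor_map_add) (use D bal in auto)
  show "a \<in> carrier A \<Longrightarrow> s \<in> carrier S \<Longrightarrow> base_change_map K A S f (t a s) = t (f a) s"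
    by (rule tensor_map_pure) (use D bal in auto)
qed

lemma base_map_smult:
  assumes f: "f \<in> linear_maps K A A" and r: "r \<in> carrier S" and x: "x \<in> carrier B"
  shows "base_change_map K A S f (r \<odot>\<^bsub>B\<^esub> x) = r \<odot>\<^bsub>B\<^esub> base_change_map K A S f x"
  using x
  by (induction x rule: base_induct)
    (use r linear_mapsD[OF f] in \<open>simp_all add: base_map_pure[OF f] base_map_add[OF f] base_map_closed[OF f]
      base_smult_pure B.smult_r_distr\<close>)

lemma slice_left:
  assumes l: "l \<in> linear_functionals K A"
  obtains h where "h \<in> carrier B \<rightarrow> carrier S"
    "\<And>x y. x \<in> carrier B \<Longrightarrow> y \<in> carrier B \<Longrightarrow> h (x \<oplus>\<^bsub>B\<^esub> y) = h x \<oplus>\<^bsub>S\<^esub> h y"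
    "\<And>a s. a \<in> carrier A \<Longrightarrow> s \<in> carrier S \<Longrightarrow> h (t a s) = l a \<odot>\<^bsub>S\<^esub> s"
  by (rule functional_slice[OF l]) (rule that, simp_all add: base_change_simps)

lemma slice_right:
  assumes l: "l \<in> linear_functionals K S"
  obtains h where "h \<in> carrier B \<rightarrow> carrier A"
    "\<And>x y. x \<in> carrier B \<Longrightarrow> y \<in> carrier B \<Longrightarrow> h (x \<oplus>\<^bsub>B\<^esub> y) = h x \<oplus>\<^bsub>A\<^esub> h y"
    "\<And>a s. a \<in> carrier A \<Longrightarrow> s \<in> carrier S \<Longrightarrow> h (t a s) = l s \<odot>\<^bsub>A\<^esub> a"
proof (rule tensor_lift[of A "\<lambda>a s. l s \<odot>\<^bsub>A\<^esub> a"])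
  note L = linear_functionalsD[OF l]
  show "abelian_group A" by (rule alg.M.abelian_group_axioms)
  show "l s \<odot>\<^bsub>A\<^esub> a \<in> carrier A" if "a \<in> carrier A" "s \<in> carrier S" for a s using that L by simp
  show "l s \<odot>\<^bsub>A\<^esub> (a \<oplus>\<^bsub>A\<^esub> a') = l s \<odot>\<^bsub>A\<^esub> a \<oplus>\<^bsub>A\<^esub> l s \<odot>\<^bsub>A\<^esub> a'"
    if "a \<in> carrier A" "a' \<in> carrier A" "s \<in> carrier S" for a a' s
    using that by (simp add: L alg.smult_r_distr)
  show "l (s \<oplus>\<^bsub>S\<^esub> s') \<odot>\<^bsub>A\<^esub> a = l s \<odot>\<^bsub>A\<^esub> a \<oplus>\<^bsub>A\<^esub> l s' \<odot>\<^bsub>A\<^esub> a"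
    if "a \<in> carrier A" "s \<in> carrier S" "s' \<in> carrier S" for a s s'
    using that by (simp add: L alg.smult_l_distr)
  show "l s \<odot>\<^bsub>A\<^esub> (c \<odot>\<^bsub>A\<^esub> a) = l (c \<odot>\<^bsub>S\<^esub> s) \<odot>\<^bsub>A\<^esub> a"
    if "c \<in> carrier K" "a \<in> carrier A" "s \<in> carrier S" for c a s
  proof -
    have "l s \<in> carrier K" using that L by simp
    then have "(c \<otimes> l s) \<odot>\<^bsub>A\<^esub> a = (l s \<otimes> c) \<odot>\<^bsub>A\<^esub> a" using that by (simp add: alg.R.m_comm)
    then show ?thesis using that L \<open>l s \<in> carrier K\<close> by (simp add: alg.smult_assoc1)
  qed
qed (use that in \<open>simp_all add: base_change_simps\<close>)

end

section \<open>Associators, commutators and the alternative nucleus\<close>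

definition commutator :: "('k, 'a, 'y) module_scheme \<Rightarrow> 'a \<Rightarrow> 'a \<Rightarrow> 'a"
  where "commutator A x y = x \<otimes>\<^bsub>A\<^esub> y \<ominus>\<^bsub>A\<^esub> y \<otimes>\<^bsub>A\<^esub> x"

definition associator :: "('k, 'a, 'y) module_scheme \<Rightarrow> 'a \<Rightarrow> 'a \<Rightarrow> 'a \<Rightarrow> 'a"
  where "associator A x y z = (x \<otimes>\<^bsub>A\<^esub> y) \<otimes>\<^bsub>A\<^esub> z \<ominus>\<^bsub>A\<^esub> x \<otimes>\<^bsub>A\<^esub> (y \<otimes>\<^bsub>A\<^esub> z)"

definition left_alternator :: "('k, 'a, 'y) module_scheme \<Rightarrow> 'a \<Rightarrow> 'a \<Rightarrow> 'a \<Rightarrow> 'a"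
  where "left_alternator A x y z = associator A x y z \<oplus>\<^bsub>A\<^esub> associator A y x z"

definition right_alternator :: "('k, 'a, 'y) module_scheme \<Rightarrow> 'a \<Rightarrow> 'a \<Rightarrow> 'a \<Rightarrow> 'a"
  where "right_alternator A x y z = associator A x y z \<oplus>\<^bsub>A\<^esub> associator A x z y"

text \<open>
  The condition is linear in \<open>s\<close>, so the nucleus is an intersection of kernels of linear maps
  and behaves well under base change.
\<close>

definition alternative_nucleus :: "('k, 'a, 'y) module_scheme \<Rightarrow> 'a set"
  where "alternative_nucleus A = {s \<in> carrier A. \<forall>x\<in>carrier A. \<forall>y\<in>carrier A. left_alternator A s x y = \<zero>\<^bsub>A\<^esub>}"

definition subalgebra :: "('k, 'x) ring_scheme \<Rightarrow> ('k, 'a, 'y) module_scheme \<Rightarrow> 'a set \<Rightarrow> bool"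
  where "subalgebra K A U \<longleftrightarrow> submodule U K A \<and> \<one>\<^bsub>A\<^esub> \<in> U \<and> (\<forall>x\<in>U. \<forall>y\<in>U. x \<otimes>\<^bsub>A\<^esub> y \<in> U)"

definition nucleus_commutators :: "('k, 'a, 'y) module_scheme \<Rightarrow> 'a set"
  where "nucleus_commutators A = {commutator A n n' | n n'. n \<in> alternative_nucleus A \<and> n' \<in> alternative_nucleus A}"

text \<open>
  Under this condition the multiplication determines the involution: it acts as \<open>-1\<close> on a set
  of generators that every automorphism respects.
\<close>

definition skew_generated :: "('k, 'x) ring_scheme \<Rightarrow> ('k, 'a, 'y) module_scheme \<Rightarrow> ('a \<Rightarrow> 'a) \<Rightarrow> bool"
  where "skew_generated K A j \<longleftrightarrow> (\<forall>x\<in>nucleus_commutators A. j x = \<ominus>\<^bsub>A\<^esub> x) \<and>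
     (\<forall>U. subalgebra K A U \<longrightarrow> nucleus_commutators A \<subseteq> U \<longrightarrow> U = carrier A)"

context unital_algebra begin

lemma smult_minus: "c \<in> carrier K \<Longrightarrow> x \<in> carrier A \<Longrightarrow> y \<in> carrier A \<Longrightarrow>
    c \<odot>\<^bsub>A\<^esub> (x \<ominus>\<^bsub>A\<^esub> y) = c \<odot>\<^bsub>A\<^esub> x \<ominus>\<^bsub>A\<^esub> c \<odot>\<^bsub>A\<^esub> y"
  by (simp add: M.minus_eq smult_r_distr smult_r_minus)

lemma commutator_closed [simp]:
  "x \<in> carrier A \<Longrightarrow> y \<in> carrier A \<Longrightarrow> commutator A x y \<in> carrier A"
  by (simp add: commutator_def mult_closed)

lemma associator_closed [simp]:
  "x \<in> carrier A \<Longrightarrow> y \<in> carrier A \<Longrightarrow> z \<in> carrier A \<Longrightarrow> associator A x y z \<in> carrier A"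
  by (simp add: associator_def mult_closed)

lemma left_alternator_closed [simp]:
  "x \<in> carrier A \<Longrightarrow> y \<in> carrier A \<Longrightarrow> z \<in> carrier A \<Longrightarrow> left_alternator A x y z \<in> carrier A"
  by (simp add: left_alternator_def)

lemma right_alternator_closed [simp]:
  "x \<in> carrier A \<Longrightarrow> y \<in> carrier A \<Longrightarrow> z \<in> carrier A \<Longrightarrow> right_alternator A x y z \<in> carrier A"
  by (simp add: right_alternator_def)

lemma commutator_add_left:
  assumes "x \<in> carrier A" "x' \<in> carrier A" "y \<in> carrier A"
  shows "commutator A (x \<oplus>\<^bsub>A\<^esub> x') y = commutator A x y \<oplus>\<^bsub>A\<^esub> commutator A x' y"
  using assms unfolding commutator_def by algebra

lemma commutator_add_right:
  assumes "x \<in> carrier A" "y \<in> carrier A" "y' \<in> carrier A"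
  shows "commutator A x (y \<oplus>\<^bsub>A\<^esub> y') = commutator A x y \<oplus>\<^bsub>A\<^esub> commutator A x y'"
  using assms unfolding commutator_def by algebra

lemma commutator_zero [simp]:
  "x \<in> carrier A \<Longrightarrow> commutator A x \<zero>\<^bsub>A\<^esub> = \<zero>\<^bsub>A\<^esub>" "x \<in> carrier A \<Longrightarrow> commutator A \<zero>\<^bsub>A\<^esub> x = \<zero>\<^bsub>A\<^esub>"
  by (simp_all add: commutator_def null_left null_right M.minus_eq M.r_neg)

lemma associator_add:
  assumes "x \<in> carrier A" "x' \<in> carrier A" "y \<in> carrier A" "z \<in> carrier A"
  shows "associator A (x \<oplus>\<^bsub>A\<^esub> x') y z = associator A x y z \<oplus>\<^bsub>A\<^esub> associator A x' y z"
    "associator A y (x \<oplus>\<^bsub>A\<^esub> x') z = associator A y x z \<oplus>\<^bsub>A\<^esub> associator A y x' z"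
    "associator A y z (x \<oplus>\<^bsub>A\<^esub> x') = associator A y z x \<oplus>\<^bsub>A\<^esub> associator A y z x'"
  using assms unfolding associator_def by algebra+

lemma associator_smult:
  assumes "c \<in> carrier K" "x \<in> carrier A" "y \<in> carrier A" "z \<in> carrier A"
  shows "associator A (c \<odot>\<^bsub>A\<^esub> x) y z = c \<odot>\<^bsub>A\<^esub> associator A x y z"
    "associator A y (c \<odot>\<^bsub>A\<^esub> x) z = c \<odot>\<^bsub>A\<^esub> associator A y x z"
    "associator A y z (c \<odot>\<^bsub>A\<^esub> x) = c \<odot>\<^bsub>A\<^esub> associator A y z x"
  using assms unfolding associator_def by (simp_all add: smult_left smult_right mult_closed smult_minus)

lemma left_alternator_add:
  assumes "x \<in> carrier A" "x' \<in> carrier A" "y \<in> carrier A" "z \<in> carrier A"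
  shows "left_alternator A (x \<oplus>\<^bsub>A\<^esub> x') y z = left_alternator A x y z \<oplus>\<^bsub>A\<^esub> left_alternator A x' y z"
    "left_alternator A y (x \<oplus>\<^bsub>A\<^esub> x') z = left_alternator A y x z \<oplus>\<^bsub>A\<^esub> left_alternator A y x' z"
    "left_alternator A y z (x \<oplus>\<^bsub>A\<^esub> x') = left_alternator A y z x \<oplus>\<^bsub>A\<^esub> left_alternator A y z x'"
  using assms unfolding left_alternator_def by (simp_all add: associator_add M.a_ac)

lemma right_alternator_add:
  assumes "x \<in> carrier A" "x' \<in> carrier A" "y \<in> carrier A" "z \<in> carrier A"
  shows "right_alternator A (x \<oplus>\<^bsub>A\<^esub> x') y z = right_alternator A x y z \<oplus>\<^bsub>A\<^esub> right_alternator A x' y z"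
    "right_alternator A y (x \<oplus>\<^bsub>A\<^esub> x') z = right_alternator A y x z \<oplus>\<^bsub>A\<^esub> right_alternator A y x' z"
    "right_alternator A y z (x \<oplus>\<^bsub>A\<^esub> x') = right_alternator A y z x \<oplus>\<^bsub>A\<^esub> right_alternator A y z x'"
  using assms unfolding right_alternator_def by (simp_all add: associator_add M.a_ac)

lemma left_alternator_smult:
  assumes "c \<in> carrier K" "x \<in> carrier A" "y \<in> carrier A" "z \<in> carrier A"
  shows "left_alternator A (c \<odot>\<^bsub>A\<^esub> x) y z = c \<odot>\<^bsub>A\<^esub> left_alternator A x y z"
    "left_alternator A y (c \<odot>\<^bsub>A\<^esub> x) z = c \<odot>\<^bsub>A\<^esub> left_alternator A y x z"
    "left_alternator A y z (c \<odot>\<^bsub>A\<^esub> x) = c \<odot>\<^bsub>A\<^esub> left_alternator A y z x"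
  using assms unfolding left_alternator_def by (simp_all add: associator_smult smult_r_distr)

lemma right_alternator_smult:
  assumes "c \<in> carrier K" "x \<in> carrier A" "y \<in> carrier A" "z \<in> carrier A"
  shows "right_alternator A (c \<odot>\<^bsub>A\<^esub> x) y z = c \<odot>\<^bsub>A\<^esub> right_alternator A x y z"
    "right_alternator A y (c \<odot>\<^bsub>A\<^esub> x) z = c \<odot>\<^bsub>A\<^esub> right_alternator A y x z"
    "right_alternator A y z (c \<odot>\<^bsub>A\<^esub> x) = c \<odot>\<^bsub>A\<^esub> right_alternator A y z x"
  using assms unfolding right_alternator_def by (simp_all add: associator_smult smult_r_distr)

lemma alternative_nucleusD:
  assumes "n \<in> alternative_nucleus A"
  shows "n \<in> carrier A" "x \<in> carrier A \<Longrightarrow> y \<in> carrier A \<Longrightarrow> left_alternator A n x y = \<zero>\<^bsub>A\<^esub>"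
  using assms by (auto simp: alternative_nucleus_def)

end

locale algebra_hom = dom: unital_algebra K A + cod: unital_algebra K B
  for K (structure) and A (structure) and B (structure) + fixes f
  assumes hom: "f \<in> algebra_homs K A B"
begin

lemma
  shows hom_closed [simp]: "x \<in> carrier A \<Longrightarrow> f x \<in> carrier B"
    and hom_add: "x \<in> carrier A \<Longrightarrow> y \<in> carrier A \<Longrightarrow> f (x \<oplus>\<^bsub>A\<^esub> y) = f x \<oplus>\<^bsub>B\<^esub> f y"
    and hom_mult: "x \<in> carrier A \<Longrightarrow> y \<in> carrier A \<Longrightarrow> f (x \<otimes>\<^bsub>A\<^esub> y) = f x \<otimes>\<^bsub>B\<^esub> f y"
    and hom_smult: "c \<in> carrier K \<Longrightarrow> x \<in> carrier A \<Longrightarrow> f (c \<odot>\<^bsub>A\<^esub> x) = c \<odot>\<^bsub>B\<^esub> f x"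
    and hom_one: "f \<one>\<^bsub>A\<^esub> = \<one>\<^bsub>B\<^esub>"
  using hom by (auto simp: algebra_homs_def linear_maps_def)

lemma hom_zero: "f \<zero>\<^bsub>A\<^esub> = \<zero>\<^bsub>B\<^esub>"
  using hom_smult[of \<zero> "\<zero>\<^bsub>A\<^esub>"] by simp

lemma hom_minus: "x \<in> carrier A \<Longrightarrow> f (\<ominus>\<^bsub>A\<^esub> x) = \<ominus>\<^bsub>B\<^esub> f x"
  using hom_add[of "\<ominus>\<^bsub>A\<^esub> x" x] by (intro cod.M.minus_equality[symmetric]) (simp_all add: dom.M.l_neg hom_zero)

lemma hom_diff: "x \<in> carrier A \<Longrightarrow> y \<in> carrier A \<Longrightarrow> f (x \<ominus>\<^bsub>A\<^esub> y) = f x \<ominus>\<^bsub>B\<^esub> f y"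
  by (simp add: a_minus_def hom_add hom_minus)

lemma hom_commutator: "x \<in> carrier A \<Longrightarrow> y \<in> carrier A \<Longrightarrow> f (commutator A x y) = commutator B (f x) (f y)"
  by (simp add: commutator_def hom_diff hom_mult dom.mult_closed)

lemma hom_associator: "x \<in> carrier A \<Longrightarrow> y \<in> carrier A \<Longrightarrow> z \<in> carrier A \<Longrightarrow>
    f (associator A x y z) = associator B (f x) (f y) (f z)"
  by (simp add: associator_def hom_diff hom_mult dom.mult_closed)

lemma hom_left_alternator: "x \<in> carrier A \<Longrightarrow> y \<in> carrier A \<Longrightarrow> z \<in> carrier A \<Longrightarrow>
    f (left_alternator A x y z) = left_alternator B (f x) (f y) (f z)"
  by (simp add: left_alternator_def hom_add hom_associator)

lemma hom_right_alternator: "x \<in> carrier A \<Longrightarrow> y \<in> carrier A \<Longrightarrow> z \<in> carrier A \<Longrightarrow>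
    f (right_alternator A x y z) = right_alternator B (f x) (f y) (f z)"
  by (simp add: right_alternator_def hom_add hom_associator)

lemma image_subalgebra:
  assumes "subalgebra K A U"
  shows "subalgebra K B (f ` U)"
proof -
  have U: "submodule U K A" "\<one>\<^bsub>A\<^esub> \<in> U" "\<And>x y. x \<in> U \<Longrightarrow> y \<in> U \<Longrightarrow> x \<otimes>\<^bsub>A\<^esub> y \<in> U"
    using assms by (auto simp: subalgebra_def)
  note E = dom.submoduleE[OF U(1)]
  have c: "\<And>x. x \<in> U \<Longrightarrow> x \<in> carrier A" using E(1) by blast
  have "submodule (f ` U) K B"
  proof (rule cod.subspaceI)
    show "f ` U \<subseteq> carrier B" using c by auto
    show "\<zero>\<^bsub>B\<^esub> \<in> f ` U" using dom.submodule_zero[OF U(1)] hom_zero by (metis imageI)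
    show "x \<oplus>\<^bsub>B\<^esub> y \<in> f ` U" if "x \<in> f ` U" "y \<in> f ` U" for x y
      using that E(5) c by (auto simp: hom_add[symmetric])
    show "d \<odot>\<^bsub>B\<^esub> x \<in> f ` U" if "d \<in> carrier K" "x \<in> f ` U" for d x
      using that E(4) c by (auto simp: hom_smult[symmetric])
  qed
  moreover have "\<one>\<^bsub>B\<^esub> \<in> f ` U" using U(2) hom_one by (metis imageI)
  moreover have "x \<otimes>\<^bsub>B\<^esub> y \<in> f ` U" if "x \<in> f ` U" "y \<in> f ` U" for x y
    using that U(3) c by (auto simp: hom_mult[symmetric])
  ultimately show ?thesis by (auto simp: subalgebra_def)
qed

end

locale algebra_iso = algebra_hom +
  assumes bij: "bij_betw f (carrier A) (carrier B)"
begin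

lemma inj: "x \<in> carrier A \<Longrightarrow> y \<in> carrier A \<Longrightarrow> f x = f y \<Longrightarrow> x = y"
  using bij by (auto simp: bij_betw_def inj_on_def)

lemma surj: assumes "y \<in> carrier B" obtains x where "x \<in> carrier A" "f x = y"
  using bij assms by (metis bij_betw_imp_surj_on imageE)

lemma nucleus_iff: "x \<in> carrier A \<Longrightarrow> f x \<in> alternative_nucleus B \<longleftrightarrow> x \<in> alternative_nucleus A"
proof
  assume x: "x \<in> carrier A" "f x \<in> alternative_nucleus B"
  show "x \<in> alternative_nucleus A" unfolding alternative_nucleus_def
  proof (intro CollectI conjI ballI x)
    fix y z assume yz: "y \<in> carrier A" "z \<in> carrier A"
    then show "left_alternator A x y z = \<zero>\<^bsub>A\<^esub>"
      using x cod.alternative_nucleusD(2)[OF x(2), of "f y" "f z"]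
      by (intro inj) (simp_all add: hom_left_alternator hom_zero)
  qed
next
  assume x: "x \<in> carrier A" "x \<in> alternative_nucleus A"
  show "f x \<in> alternative_nucleus B" unfolding alternative_nucleus_def
  proof (intro CollectI conjI ballI)
    fix y' z' assume "y' \<in> carrier B" "z' \<in> carrier B"
    then obtain y z where "y \<in> carrier A" "z \<in> carrier A" "f y = y'" "f z = z'" by (metis surj)
    then show "left_alternator B (f x) y' z' = \<zero>\<^bsub>B\<^esub>"
      using dom.alternative_nucleusD(2)[OF x(2), of y z] x hom_left_alternator[of x y z] hom_zero by auto
  qed (use x in simp)
qed

lemma nucleus_commutators_image: "nucleus_commutators B = f ` nucleus_commutators A"
proof (intro subset_antisym subsetI)
  fix x assume "x \<in> nucleus_commutators B"
  then obtain m m' where m: "x = commutator B m m'" "m \<in> alternative_nucleus B" "m' \<in> alternative_nucleus B"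
    by (auto simp: nucleus_commutators_def)
  obtain n where n: "n \<in> carrier A" "f n = m" using surj cod.alternative_nucleusD(1)[OF m(2)] by metis
  obtain n' where n': "n' \<in> carrier A" "f n' = m'" using surj cod.alternative_nucleusD(1)[OF m(3)] by metis
  have "commutator A n n' \<in> nucleus_commutators A"
    using n n' m nucleus_iff by (auto simp: nucleus_commutators_def)
  moreover have "f (commutator A n n') = x" using n n' m by (simp add: hom_commutator)
  ultimately show "x \<in> f ` nucleus_commutators A" by blast
next
  fix x assume "x \<in> f ` nucleus_commutators A"
  then obtain n n' where n: "x = f (commutator A n n')" "n \<in> alternative_nucleus A" "n' \<in> alternative_nucleus A"
    by (auto simp: nucleus_commutators_def)
  then have "n \<in> carrier A" "n' \<in> carrier A" using dom.alternative_nucleusD by auto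
  then show "x \<in> nucleus_commutators B"
    using n nucleus_iff hom_commutator by (auto simp: nucleus_commutators_def)
qed

lemma skew_generated_pullback:
  assumes j: "\<And>x. x \<in> carrier A \<Longrightarrow> i x \<in> carrier A" "\<And>x. x \<in> carrier A \<Longrightarrow> f (i x) = j (f x)"
    and B: "skew_generated K B j"
  shows "skew_generated K A i"
  unfolding skew_generated_def
proof (intro conjI ballI allI impI)
  fix x assume x: "x \<in> nucleus_commutators A"
  then have c: "x \<in> carrier A"
    by (auto simp: nucleus_commutators_def intro!: dom.commutator_closed dest: dom.alternative_nucleusD(1))
  have "f x \<in> nucleus_commutators B" using x nucleus_commutators_image by blast
  then have "f (i x) = f (\<ominus>\<^bsub>A\<^esub> x)" using B c j by (simp add: skew_generated_def hom_minus)
  then show "i x = \<ominus>\<^bsub>A\<^esub> x" using c j by (intro inj) auto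
next
  fix U assume U: "subalgebra K A U" "nucleus_commutators A \<subseteq> U"
  have "f ` U = carrier B"
    using B image_subalgebra[OF U(1)] U(2) nucleus_commutators_image unfolding skew_generated_def by blast
  moreover have sub: "U \<subseteq> carrier A" using U(1) dom.submoduleE(1) by (simp add: subalgebra_def)
  ultimately have "x \<in> U" if x: "x \<in> carrier A" for x
  proof -
    have "f x \<in> f ` U" using x \<open>f ` U = carrier B\<close> by simp
    then obtain u where "u \<in> U" "f x = f u" by blast
    then show ?thesis using inj[OF x] sub by blast
  qed
  then show "U = carrier A" using sub by blast
qed

end

section \<open>Kernels and subspaces under base change\<close>

context scalar_extension begin

text \<open>
  An element of the base change is a sum of tensors \<open>a\<^sub>1 \<otimes> r\<^sub>1 + ... + a\<^sub>n \<otimes> r\<^sub>n\<close>, and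
  \<open>combos\<close> collects those with a prescribed list of second components. Recursion on the list
  replaces the choice of a basis of \<open>S\<close>: a component in the linear span of the later ones can be
  absorbed by them.
\<close>

primrec combos where
  "combos [] = {\<zero>\<^bsub>B\<^esub>}"
| "combos (r # rs) = {t a r \<oplus>\<^bsub>B\<^esub> z | a z. a \<in> carrier A \<and> z \<in> combos rs}"

primrec lin_span where
  "lin_span [] = {\<zero>\<^bsub>S\<^esub>}"
| "lin_span (r # rs) = {c \<odot>\<^bsub>S\<^esub> r \<oplus>\<^bsub>S\<^esub> s | c s. c \<in> carrier K \<and> s \<in> lin_span rs}"

lemma combos_Cons: "a \<in> carrier A \<Longrightarrow> z \<in> combos rs \<Longrightarrow> t a r \<oplus>\<^bsub>B\<^esub> z \<in> combos (r # rs)"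
  by auto

lemma lin_span_Cons: "c \<in> carrier K \<Longrightarrow> s \<in> lin_span rs \<Longrightarrow> c \<odot>\<^bsub>S\<^esub> r \<oplus>\<^bsub>S\<^esub> s \<in> lin_span (r # rs)"
  by auto

lemma combos_closed: "set rs \<subseteq> carrier S \<Longrightarrow> z \<in> combos rs \<Longrightarrow> z \<in> carrier B"
  by (induction rs arbitrary: z) auto

lemma combos_append:
  "set rs \<subseteq> carrier S \<Longrightarrow> set rs' \<subseteq> carrier S \<Longrightarrow> z \<in> combos rs \<Longrightarrow> z' \<in> combos rs' \<Longrightarrow>
    z \<oplus>\<^bsub>B\<^esub> z' \<in> combos (rs @ rs')"
proof (induction rs arbitrary: z)
  case Nil then show ?case using combos_closed by simp
next
  case (Cons r rs)
  then obtain a y where y: "z = t a r \<oplus>\<^bsub>B\<^esub> y" "a \<in> carrier A" "y \<in> combos rs" by auto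
  then have "z \<oplus>\<^bsub>B\<^esub> z' = t a r \<oplus>\<^bsub>B\<^esub> (y \<oplus>\<^bsub>B\<^esub> z')" "y \<oplus>\<^bsub>B\<^esub> z' \<in> combos (rs @ rs')"
    using Cons combos_closed[of rs y] combos_closed[of rs' z'] by (auto simp: B.M.a_assoc)
  then show ?case using y(2) by auto
qed

lemma combos_exhaust:
  assumes "z \<in> carrier B"
  obtains rs where "set rs \<subseteq> carrier S" "z \<in> combos rs"
proof -
  have "\<exists>rs. set rs \<subseteq> carrier S \<and> z \<in> combos rs"
    using assms
  proof (induction z rule: base_induct)
    case (pure a s)
    then show ?case using combos_Cons[of a "\<zero>\<^bsub>B\<^esub>" "[]" s] by (intro exI[of _ "[s]"]) (simp del: combos.simps(2))
  next
    case (add x y)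
    then show ?case using combos_append by (metis le_sup_iff set_append)
  qed
  then show thesis using that by blast
qed

lemma lin_span_closed: "set rs \<subseteq> carrier S \<Longrightarrow> s \<in> lin_span rs \<Longrightarrow> s \<in> carrier S"
  by (induction rs arbitrary: s) auto

lemma lin_span_zero: "set rs \<subseteq> carrier S \<Longrightarrow> \<zero>\<^bsub>S\<^esub> \<in> lin_span rs"
proof (induction rs)
  case (Cons r rs)
  then show ?case using lin_span_Cons[of \<zero> "\<zero>\<^bsub>S\<^esub>" rs r] by (simp del: lin_span.simps(2))
qed simp

lemma lin_span_contains: "set rs \<subseteq> carrier S \<Longrightarrow> r \<in> set rs \<Longrightarrow> r \<in> lin_span rs"
proof (induction rs)
  case (Cons q rs)
  show ?case
  proof (cases "r = q")
    case True
    then show ?thesis using lin_span_Cons[of \<one> "\<zero>\<^bsub>S\<^esub>" rs q] lin_span_zero[of rs] Cons.prems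
      by (simp del: lin_span.simps(2))
  next
    case False
    then have "r \<in> lin_span rs" using Cons by simp
    moreover have "r \<in> carrier S" "q \<in> carrier S" using Cons.prems by auto
    ultimately show ?thesis using lin_span_Cons[of \<zero> r rs q] by (simp del: lin_span.simps(2))
  qed
qed simp

lemma lin_span_submodule:
  assumes "set rs \<subseteq> carrier S"
  shows "submodule (lin_span rs) K S"
proof (rule ext.subspaceI)
  show "lin_span rs \<subseteq> carrier S" using lin_span_closed[OF assms] by blast
  show "\<zero>\<^bsub>S\<^esub> \<in> lin_span rs" using lin_span_zero[OF assms] .
  show "x \<oplus>\<^bsub>S\<^esub> y \<in> lin_span rs" if "x \<in> lin_span rs" "y \<in> lin_span rs" for x y
    using assms that
  proof (induction rs arbitrary: x y)
    case (Cons r rs)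
    then obtain c s d u where *: "x = c \<odot>\<^bsub>S\<^esub> r \<oplus>\<^bsub>S\<^esub> s" "y = d \<odot>\<^bsub>S\<^esub> r \<oplus>\<^bsub>S\<^esub> u"
      "c \<in> carrier K" "d \<in> carrier K" "s \<in> lin_span rs" "u \<in> lin_span rs" by auto
    then have "s \<in> carrier S" "u \<in> carrier S" "r \<in> carrier S"
      using lin_span_closed[of rs] Cons by auto
    then have "x \<oplus>\<^bsub>S\<^esub> y = (c \<oplus> d) \<odot>\<^bsub>S\<^esub> r \<oplus>\<^bsub>S\<^esub> (s \<oplus>\<^bsub>S\<^esub> u)"
      using * by (simp add: ext.smult_l_distr ext.a_ac)
    moreover have "s \<oplus>\<^bsub>S\<^esub> u \<in> lin_span rs" using Cons * by simp
    ultimately show ?case using * by auto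
  qed simp
  show "c \<odot>\<^bsub>S\<^esub> x \<in> lin_span rs" if "c \<in> carrier K" "x \<in> lin_span rs" for c x
    using assms that
  proof (induction rs arbitrary: x)
    case (Cons r rs)
    then obtain d s where *: "x = d \<odot>\<^bsub>S\<^esub> r \<oplus>\<^bsub>S\<^esub> s" "d \<in> carrier K" "s \<in> lin_span rs" by auto
    then have "s \<in> carrier S" "r \<in> carrier S"
      using lin_span_closed[of rs] Cons by auto
    then have "c \<odot>\<^bsub>S\<^esub> x = (c \<otimes> d) \<odot>\<^bsub>S\<^esub> r \<oplus>\<^bsub>S\<^esub> c \<odot>\<^bsub>S\<^esub> s"
      using * Cons by (simp add: ext.smult_r_distr ext.smult_assoc1)
    moreover have "c \<odot>\<^bsub>S\<^esub> s \<in> lin_span rs" using Cons * by simp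
    ultimately show ?case using * Cons.prems by auto
  qed simp
qed

lemma combos_absorb:
  "set rs \<subseteq> carrier S \<Longrightarrow> r \<in> lin_span rs \<Longrightarrow> a \<in> carrier A \<Longrightarrow> z \<in> combos rs \<Longrightarrow>
    t a r \<oplus>\<^bsub>B\<^esub> z \<in> combos rs"
proof (induction rs arbitrary: r z)
  case Nil then show ?case by (simp add: pure_zero_right)
next
  case (Cons q rs)
  then obtain c s where s: "r = c \<odot>\<^bsub>S\<^esub> q \<oplus>\<^bsub>S\<^esub> s" "c \<in> carrier K" "s \<in> lin_span rs" by auto
  obtain b y where y: "z = t b q \<oplus>\<^bsub>B\<^esub> y" "b \<in> carrier A" "y \<in> combos rs" using Cons.prems by auto
  have c: "q \<in> carrier S" "s \<in> carrier S" "y \<in> carrier B"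
    using Cons.prems lin_span_closed[of rs s] combos_closed[of rs y] s y by auto
  have "t a r \<oplus>\<^bsub>B\<^esub> z = (t (c \<odot>\<^bsub>A\<^esub> a) q \<oplus>\<^bsub>B\<^esub> t b q) \<oplus>\<^bsub>B\<^esub> (t a s \<oplus>\<^bsub>B\<^esub> y)"
    using s y c Cons.prems(3) by (simp add: base_pure_add_right pure_balanced B.M.a_ac)
  also have "\<dots> = t (c \<odot>\<^bsub>A\<^esub> a \<oplus>\<^bsub>A\<^esub> b) q \<oplus>\<^bsub>B\<^esub> (t a s \<oplus>\<^bsub>B\<^esub> y)"
    using s y c Cons.prems(3) by (simp add: base_pure_add_left)
  finally have eq: "t a r \<oplus>\<^bsub>B\<^esub> z = t (c \<odot>\<^bsub>A\<^esub> a \<oplus>\<^bsub>A\<^esub> b) q \<oplus>\<^bsub>B\<^esub> (t a s \<oplus>\<^bsub>B\<^esub> y)" .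
  show ?case unfolding eq by (rule combos_Cons) (use Cons s y in auto)
qed

end

locale scalar_extension_over_field = scalar_extension + assumes field: "field K"
begin

text \<open>
  Over a field, kernels commute with base change. In \<open>z = a\<^sub>1 \<otimes> r\<^sub>1 + ... + a\<^sub>n \<otimes> r\<^sub>n\<close> one
  may assume that \<open>r\<^sub>1\<close> is not in the span of the others. The slice by a functional that is one
  at \<open>r\<^sub>1\<close> and zero at the others commutes with every \<open>f\<close> and sends \<open>z\<close> to \<open>a\<^sub>1\<close>, so \<open>a\<^sub>1\<close>
  lies in all the kernels; the remaining sum is treated by induction.
\<close>

theorem base_kernel:
  assumes F: "F \<subseteq> linear_maps K A A" and z: "z \<in> carrier B"
    and ker: "\<And>f. f \<in> F \<Longrightarrow> base_change_map K A S f z = \<zero>\<^bsub>B\<^esub>"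
  shows "z \<in> add_span B {t n r | n r. n \<in> carrier A \<and> r \<in> carrier S \<and> (\<forall>f\<in>F. f n = \<zero>\<^bsub>A\<^esub>)}"
proof -
  let ?Y = "{t n r | n r. n \<in> carrier A \<and> r \<in> carrier S \<and> (\<forall>f\<in>F. f n = \<zero>\<^bsub>A\<^esub>)}"
  have main: "z \<in> add_span B ?Y"
    if "set rs \<subseteq> carrier S" "z \<in> combos rs" "\<And>f. f \<in> F \<Longrightarrow> base_change_map K A S f z = \<zero>\<^bsub>B\<^esub>" for rs z
    using that
  proof (induction rs arbitrary: z)
    case Nil
    then show ?case using add_span_zero[of B ?Y] by simp
  next
    case (Cons q rs)
    then have c: "q \<in> carrier S" "set rs \<subseteq> carrier S" by auto
    obtain a y where y: "z = t a q \<oplus>\<^bsub>B\<^esub> y" "a \<in> carrier A" "y \<in> combos rs" using Cons.prems by auto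
    then have yc: "y \<in> carrier B" using combos_closed c by blast
    show ?case
    proof (cases "q \<in> lin_span rs")
      case True
      then have "z \<in> combos rs" using combos_absorb[OF c(2)] y by blast
      then show ?thesis using Cons c by blast
    next
      case False
      \<comment> \<open>A functional that sees only \<open>q\<close> recovers the coefficient \<open>a\<close> as a slice of \<open>z\<close>.\<close>
      obtain l where l: "l \<in> linear_functionals K S" "\<And>u. u \<in> lin_span rs \<Longrightarrow> l u = \<zero>" "l q = \<one>"
        by (rule ext.functional_separating[OF field lin_span_submodule[OF c(2)] c(1) False]) blast
      obtain h where h: "h \<in> carrier B \<rightarrow> carrier A"
        "\<And>x y. x \<in> carrier B \<Longrightarrow> y \<in> carrier B \<Longrightarrow> h (x \<oplus>\<^bsub>B\<^esub> y) = h x \<oplus>\<^bsub>A\<^esub> h y"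
        "\<And>a s. a \<in> carrier A \<Longrightarrow> s \<in> carrier S \<Longrightarrow> h (t a s) = l s \<odot>\<^bsub>A\<^esub> a"
        by (rule slice_right[OF l(1)]) blast
      have h0: "h \<zero>\<^bsub>B\<^esub> = \<zero>\<^bsub>A\<^esub>"
        using h(3)[of "\<zero>\<^bsub>A\<^esub>" q] c pure_zero_left[of q] linear_functionalsD(1)[OF l(1)] by simp
      have hc: "h w = \<zero>\<^bsub>A\<^esub>" if "w \<in> combos ps" "set ps \<subseteq> set rs" for w ps
        using that
      proof (induction ps arbitrary: w)
        case Nil then show ?case using h0 by simp
      next
        case (Cons p ps)
        then obtain b v where v: "w = t b p \<oplus>\<^bsub>B\<^esub> v" "b \<in> carrier A" "v \<in> combos ps" by auto
        have p: "p \<in> carrier S" "p \<in> set rs" "set ps \<subseteq> carrier S" using Cons.prems c by auto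
        then have "l p = \<zero>" using l(2) lin_span_contains c by blast
        then show ?case using v p Cons h(2,3) combos_closed[OF p(3) v(3)] by simp
      qed
      have ha: "h z = a"
        using y yc c h(2,3) hc[OF y(3)] l(3) by simp
      have slice: "h (base_change_map K A S f w) = f (h w)" if f: "f \<in> F" and w: "w \<in> carrier B" for f w
      proof -
        have f': "f \<in> linear_maps K A A" using f F by blast
        show ?thesis using w
        proof (induction w rule: base_induct)
          case (pure b s)
          then show ?case using linear_mapsD[OF f'] linear_functionalsD(1)[OF l(1)]
            by (simp add: base_map_pure[OF f'] h)
        next
          case (add x y)
          moreover have "h x \<in> carrier A" "h y \<in> carrier A" using h(1) add(1,2) by auto
          ultimately show ?case using linear_mapsD[OF f']
            by (simp add: base_map_add[OF f'] base_map_closed[OF f'] h(2))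
        qed
      qed
      have fa: "f a = \<zero>\<^bsub>A\<^esub>" if "f \<in> F" for f
        using slice[OF that, of z] Cons.prems(3)[OF that] h0 ha combos_closed[OF Cons.prems(1,2)] by simp
      have "base_change_map K A S f y = \<zero>\<^bsub>B\<^esub>" if f: "f \<in> F" for f
      proof -
        have f': "f \<in> linear_maps K A A" using f F by blast
        have "\<zero>\<^bsub>B\<^esub> = t (f a) q \<oplus>\<^bsub>B\<^esub> base_change_map K A S f y"
          using Cons.prems(3)[OF f] y yc c by (simp add: base_map_add[OF f'] base_map_pure[OF f'])
        then show ?thesis using fa[OF f] c base_map_closed[OF f' yc] by (simp add: pure_zero_left)
      qed
      then have "y \<in> add_span B ?Y" by (rule Cons.IH[OF c(2) y(3)])
      then show ?thesis unfolding y(1) using y(2) c fa by (intro add_span_add) auto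
    qed
  qed
  obtain rs where "set rs \<subseteq> carrier S" "z \<in> combos rs" by (rule combos_exhaust[OF z])
  then show ?thesis using ker by (rule main)
qed

lemma pure_inj:
  assumes "\<one>\<^bsub>S\<^esub> \<noteq> \<zero>\<^bsub>S\<^esub>" "a \<in> carrier A" "t a \<one>\<^bsub>S\<^esub> = \<zero>\<^bsub>B\<^esub>"
  shows "a = \<zero>\<^bsub>A\<^esub>"
proof -
  obtain l where l: "l \<in> linear_functionals K S" "l \<one>\<^bsub>S\<^esub> = \<one>"
    by (rule ext.functional_separating[OF field lin_span_submodule[of "[]"], of "\<one>\<^bsub>S\<^esub>"]) (use assms in auto)
  obtain h where h: "h \<in> carrier B \<rightarrow> carrier A"
    "\<And>a s. a \<in> carrier A \<Longrightarrow> s \<in> carrier S \<Longrightarrow> h (t a s) = l s \<odot>\<^bsub>A\<^esub> a"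
    by (rule slice_right[OF l(1)]) blast
  have "h \<zero>\<^bsub>B\<^esub> = \<zero>\<^bsub>A\<^esub>"
    using h(2)[of "\<zero>\<^bsub>A\<^esub>" "\<one>\<^bsub>S\<^esub>"] pure_zero_left[of "\<one>\<^bsub>S\<^esub>"] l(2) by simp
  then show ?thesis using h(2)[of a "\<one>\<^bsub>S\<^esub>"] assms l(2) by simp
qed

lemma pure_inj':
  assumes "\<one>\<^bsub>S\<^esub> \<noteq> \<zero>\<^bsub>S\<^esub>" "a \<in> carrier A" "b \<in> carrier A" "t a \<one>\<^bsub>S\<^esub> = t b \<one>\<^bsub>S\<^esub>"
  shows "a = b"
proof -
  have "t (a \<ominus>\<^bsub>A\<^esub> b) \<one>\<^bsub>S\<^esub> = \<zero>\<^bsub>B\<^esub>" using assms by (simp add: pure_diff_left B.M.minus_eq B.M.r_neg)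
  then have "a \<ominus>\<^bsub>A\<^esub> b = \<zero>\<^bsub>A\<^esub>" using assms by (intro pure_inj) auto
  then have "(a \<ominus>\<^bsub>A\<^esub> b) \<oplus>\<^bsub>A\<^esub> b = b" using assms by simp
  then show ?thesis using assms by (simp add: alg.M.minus_eq alg.M.a_assoc alg.M.l_neg)
qed

text \<open>
  A functional that is zero on \<open>U\<close> and one at \<open>a\<close> gives a slice that is zero on the span of \<open>U\<close>
  but not at \<open>a\<close>.
\<close>

lemma base_subspace_descent:
  assumes one: "\<one>\<^bsub>S\<^esub> \<noteq> \<zero>\<^bsub>S\<^esub>" and U: "submodule U K A" and a: "a \<in> carrier A"
    and span: "t a \<one>\<^bsub>S\<^esub> \<in> add_span B {t u r | u r. u \<in> U \<and> r \<in> carrier S}"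
  shows "a \<in> U"
proof (rule ccontr)
  assume "a \<notin> U"
  then obtain l where l: "l \<in> linear_functionals K A" "\<And>u. u \<in> U \<Longrightarrow> l u = \<zero>" "l a = \<one>"
    using alg.functional_separating[OF field U a] by blast
  obtain h where h: "h \<in> carrier B \<rightarrow> carrier S"
    "\<And>x y. x \<in> carrier B \<Longrightarrow> y \<in> carrier B \<Longrightarrow> h (x \<oplus>\<^bsub>B\<^esub> y) = h x \<oplus>\<^bsub>S\<^esub> h y"
    "\<And>a s. a \<in> carrier A \<Longrightarrow> s \<in> carrier S \<Longrightarrow> h (t a s) = l a \<odot>\<^bsub>S\<^esub> s"
    by (rule slice_left[OF l(1)]) blast
  have UA: "\<And>u. u \<in> U \<Longrightarrow> u \<in> carrier A" using alg.submoduleE(1)[OF U] by blast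
  have "z \<in> carrier B \<and> h z = \<zero>\<^bsub>S\<^esub>" if "z \<in> add_span B {t u r | u r. u \<in> U \<and> r \<in> carrier S}" for z
    using that
  proof (induction z rule: add_span_induct)
    case zero
    have "h (t \<zero>\<^bsub>A\<^esub> \<one>\<^bsub>S\<^esub>) = \<zero>\<^bsub>S\<^esub>" using l(2) alg.submodule_zero[OF U] by (simp add: h(3))
    then show ?case by (simp add: pure_zero_left)
  next
    case (add x z)
    then show ?case using UA l(2) h(2,3) by auto
  qed
  then have "h (t a \<one>\<^bsub>S\<^esub>) = \<zero>\<^bsub>S\<^esub>" using span by blast
  then show False using h(3)[of a "\<one>\<^bsub>S\<^esub>"] a l(3) one by simp
qed

end

section \<open>Involutions that are forced by the multiplication\<close>

context unital_algebra begin

lemma left_alternator_linear: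
  assumes "x \<in> carrier A" "y \<in> carrier A"
  shows "(\<lambda>s. left_alternator A s x y) \<in> linear_maps K A A"
  using assms by (auto simp: linear_maps_def left_alternator_add left_alternator_smult)

end

context algebra_with_involution begin

lemma involution_closed [simp]: "x \<in> carrier A \<Longrightarrow> j x \<in> carrier A"
  and involution_add: "x \<in> carrier A \<Longrightarrow> y \<in> carrier A \<Longrightarrow> j (x \<oplus>\<^bsub>A\<^esub> y) = j x \<oplus>\<^bsub>A\<^esub> j y"
  and involution_smult: "c \<in> carrier K \<Longrightarrow> x \<in> carrier A \<Longrightarrow> j (c \<odot>\<^bsub>A\<^esub> x) = c \<odot>\<^bsub>A\<^esub> j x"
  using involution_linear by (auto simp: linear_maps_def)

lemma involution_one: "j \<one>\<^bsub>A\<^esub> = \<one>\<^bsub>A\<^esub>"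
  using involution_antimult[of "\<one>\<^bsub>A\<^esub>" "j \<one>\<^bsub>A\<^esub>"] involution_involutive[OF unit_closed]
  by (simp add: unit_closed unit_left unit_right)

lemma involution_zero: "j \<zero>\<^bsub>A\<^esub> = \<zero>\<^bsub>A\<^esub>"
  using involution_smult[of \<zero> "\<zero>\<^bsub>A\<^esub>"] by simp

lemma involution_minus: "x \<in> carrier A \<Longrightarrow> j (\<ominus>\<^bsub>A\<^esub> x) = \<ominus>\<^bsub>A\<^esub> j x"
  using involution_add[of "\<ominus>\<^bsub>A\<^esub> x" x]
  by (intro M.minus_equality[symmetric]) (simp_all add: M.l_neg involution_zero)

end

context scalar_extension begin

lemma base_commutator:
  "a \<in> carrier A \<Longrightarrow> b \<in> carrier A \<Longrightarrow> r \<in> carrier S \<Longrightarrow> s \<in> carrier S \<Longrightarrow>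
    commutator B (t a r) (t b s) = t (commutator A a b) (r \<otimes>\<^bsub>S\<^esub> s)"
  by (simp add: commutator_def base_pure_mult pure_diff_left alg.mult_closed ext.m_comm)

lemma base_associator:
  "a \<in> carrier A \<Longrightarrow> b \<in> carrier A \<Longrightarrow> c \<in> carrier A \<Longrightarrow>
   r \<in> carrier S \<Longrightarrow> s \<in> carrier S \<Longrightarrow> q \<in> carrier S \<Longrightarrow>
    associator B (t a r) (t b s) (t c q) = t (associator A a b c) (r \<otimes>\<^bsub>S\<^esub> s \<otimes>\<^bsub>S\<^esub> q)"
  by (simp add: associator_def base_pure_mult pure_diff_left alg.mult_closed ext.m_assoc)

lemma base_left_alternator:
  "a \<in> carrier A \<Longrightarrow> b \<in> carrier A \<Longrightarrow> c \<in> carrier A \<Longrightarrow>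
   r \<in> carrier S \<Longrightarrow> s \<in> carrier S \<Longrightarrow> q \<in> carrier S \<Longrightarrow>
    left_alternator B (t a r) (t b s) (t c q) = t (left_alternator A a b c) (r \<otimes>\<^bsub>S\<^esub> s \<otimes>\<^bsub>S\<^esub> q)"
  by (simp add: left_alternator_def base_associator base_pure_add_left ext.m_comm[of s r])

lemma base_right_alternator:
  "a \<in> carrier A \<Longrightarrow> b \<in> carrier A \<Longrightarrow> c \<in> carrier A \<Longrightarrow>
   r \<in> carrier S \<Longrightarrow> s \<in> carrier S \<Longrightarrow> q \<in> carrier S \<Longrightarrow>
    right_alternator B (t a r) (t b s) (t c q) = t (right_alternator A a b c) (r \<otimes>\<^bsub>S\<^esub> s \<otimes>\<^bsub>S\<^esub> q)"
  by (simp add: right_alternator_def base_associator base_pure_add_left ext.m_assoc ext.m_comm[of q s])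

lemma base_trilinear_zero:
  assumes f: "\<And>x x' y z. x \<in> carrier B \<Longrightarrow> x' \<in> carrier B \<Longrightarrow> y \<in> carrier B \<Longrightarrow> z \<in> carrier B \<Longrightarrow>
      f (x \<oplus>\<^bsub>B\<^esub> x') y z = f x y z \<oplus>\<^bsub>B\<^esub> f x' y z"
    "\<And>x x' y z. x \<in> carrier B \<Longrightarrow> x' \<in> carrier B \<Longrightarrow> y \<in> carrier B \<Longrightarrow> z \<in> carrier B \<Longrightarrow>
      f y (x \<oplus>\<^bsub>B\<^esub> x') z = f y x z \<oplus>\<^bsub>B\<^esub> f y x' z"
    "\<And>x x' y z. x \<in> carrier B \<Longrightarrow> x' \<in> carrier B \<Longrightarrow> y \<in> carrier B \<Longrightarrow> z \<in> carrier B \<Longrightarrow>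
      f y z (x \<oplus>\<^bsub>B\<^esub> x') = f y z x \<oplus>\<^bsub>B\<^esub> f y z x'"
    and pure: "\<And>a b c r s q. a \<in> carrier A \<Longrightarrow> b \<in> carrier A \<Longrightarrow> c \<in> carrier A \<Longrightarrow>
      r \<in> carrier S \<Longrightarrow> s \<in> carrier S \<Longrightarrow> q \<in> carrier S \<Longrightarrow> f (t a r) (t b s) (t c q) = \<zero>\<^bsub>B\<^esub>"
    and xyz: "x \<in> carrier B" "y \<in> carrier B" "z \<in> carrier B"
  shows "f x y z = \<zero>\<^bsub>B\<^esub>"
  using xyz
proof (induction x arbitrary: y z rule: base_induct)
  case (pure a r)
  note a = pure
  from a(3,4) show ?case
  proof (induction y arbitrary: z rule: base_induct)
    case (pure b s)
    note b = pure
    from b(3) show ?case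
    proof (induction z rule: base_induct)
      case (pure c q)
      then show ?case using a b assms(4) by simp
    qed (use a b f in simp)
  qed (use a f in simp)
qed (use f in simp)

lemma pure_in_base_nucleus:
  assumes n: "n \<in> alternative_nucleus A" and r: "r \<in> carrier S"
  shows "t n r \<in> alternative_nucleus B"
proof -
  note N = alg.alternative_nucleusD[OF n]
  have "left_alternator B (t n r) y z = \<zero>\<^bsub>B\<^esub>" if "y \<in> carrier B" "z \<in> carrier B" for y z
    using that
  proof (induction y arbitrary: z rule: base_induct)
    case (pure b s)
    note b = pure
    from b(3) show ?case
      by (induction z rule: base_induct)
        (use b N r in \<open>simp_all add: base_left_alternator pure_zero_left B.left_alternator_add\<close>)
  qed (use N r in \<open>simp add: B.left_alternator_add\<close>)
  then show ?thesis using N r by (simp add: alternative_nucleus_def)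
qed

text \<open>
  Testing membership in the nucleus of the base change on elements of \<open>A\<close> only involves maps
  that are extended from \<open>A\<close>, to which the theorem on kernels applies.
\<close>

lemma base_map_left_alternator:
  assumes z: "z \<in> carrier B" and xy: "x \<in> carrier A" "y \<in> carrier A"
  shows "left_alternator B z (t x \<one>\<^bsub>S\<^esub>) (t y \<one>\<^bsub>S\<^esub>) = base_change_map K A S (\<lambda>s. left_alternator A s x y) z"
  using z
  by (induction z rule: base_induct)
    (use xy in \<open>simp_all add: base_left_alternator base_map_pure[OF alg.left_alternator_linear]
      base_map_add[OF alg.left_alternator_linear] B.left_alternator_add\<close>)

end

theorem (in scalar_extension_over_field) base_nucleus:
  assumes z: "z \<in> alternative_nucleus B"
  shows "z \<in> add_span B {t n r | n r. n \<in> alternative_nucleus A \<and> r \<in> carrier S}"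
proof -
  note N = B.alternative_nucleusD[OF z]
  let ?F = "{\<lambda>s. left_alternator A s x y | x y. x \<in> carrier A \<and> y \<in> carrier A}"
  have "z \<in> add_span B {t n r | n r. n \<in> carrier A \<and> r \<in> carrier S \<and> (\<forall>f\<in>?F. f n = \<zero>\<^bsub>A\<^esub>)}"
  proof (rule base_kernel)
    show "?F \<subseteq> linear_maps K A A" using alg.left_alternator_linear by blast
    show "base_change_map K A S f z = \<zero>\<^bsub>B\<^esub>" if "f \<in> ?F" for f
      using that base_map_left_alternator[OF N(1)] N(2) by auto
  qed (rule N(1))
  moreover have "(n \<in> carrier A \<and> r \<in> carrier S \<and> (\<forall>f\<in>?F. f n = \<zero>\<^bsub>A\<^esub>)) \<longleftrightarrow>
      n \<in> alternative_nucleus A \<and> r \<in> carrier S" for n r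
    unfolding alternative_nucleus_def by auto
  ultimately show ?thesis by simp
qed

locale involution_extension = scalar_extension_over_field K A S + inv: algebra_with_involution K A j
  for K (structure) and A (structure) and S (structure) and j
begin

abbreviation J where "J \<equiv> base_change_map K A S j"

lemmas J_closed [simp] = base_map_closed[OF inv.involution_linear]
lemmas J_add = base_map_add[OF inv.involution_linear]
lemmas J_pure = base_map_pure[OF inv.involution_linear]
lemmas J_smult = base_map_smult[OF inv.involution_linear]

lemma J_zero: "J \<zero>\<^bsub>B\<^esub> = \<zero>\<^bsub>B\<^esub>"
  using J_pure[of "\<zero>\<^bsub>A\<^esub>" "\<one>\<^bsub>S\<^esub>"] by (simp add: pure_zero_left inv.involution_zero)

lemma J_one: "J \<one>\<^bsub>B\<^esub> = \<one>\<^bsub>B\<^esub>"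
  using J_pure[of "\<one>\<^bsub>A\<^esub>" "\<one>\<^bsub>S\<^esub>"] by (simp add: base_one inv.involution_one alg.unit_closed)

lemma J_antimult:
  assumes "x \<in> carrier B" "y \<in> carrier B"
  shows "J (x \<otimes>\<^bsub>B\<^esub> y) = J y \<otimes>\<^bsub>B\<^esub> J x"
  using assms
proof (induction x arbitrary: y rule: base_induct)
  case (pure a r)
  note a = pure
  from a(3) show ?case
    by (induction y rule: base_induct)
      (use a in \<open>simp_all add: base_pure_mult J_pure J_add B.distrib_left B.distrib_right
        alg.mult_closed B.mult_closed inv.involution_antimult ext.m_comm\<close>)
qed (simp add: J_add B.distrib_left B.distrib_right B.mult_closed)

lemma base_commutator_skew:
  assumes skew: "\<forall>x\<in>nucleus_commutators A. j x = \<ominus>\<^bsub>A\<^esub> x"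
    and "x \<in> alternative_nucleus B" "y \<in> alternative_nucleus B"
  shows "J (commutator B x y) = \<ominus>\<^bsub>B\<^esub> commutator B x y"
proof -
  let ?Y = "{t n r | n r. n \<in> alternative_nucleus A \<and> r \<in> carrier S}"
  have nc: "n \<in> carrier A" if "n \<in> alternative_nucleus A" for n
    using alg.alternative_nucleusD(1)[OF that] .
  have zero: "J \<zero>\<^bsub>B\<^esub> = \<ominus>\<^bsub>B\<^esub> \<zero>\<^bsub>B\<^esub>"
    unfolding J_zero by (rule B.M.minus_equality[symmetric]) auto
  have "x \<in> add_span B ?Y" "y \<in> add_span B ?Y" using base_nucleus assms by auto
  then have "x \<in> carrier B \<and> y \<in> carrier B \<and> J (commutator B x y) = \<ominus>\<^bsub>B\<^esub> commutator B x y"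
  proof (induction x arbitrary: y rule: add_span_induct)
    case zero
    from zero show ?case
      by (induction y rule: add_span_induct) (use zero \<open>J \<zero>\<^bsub>B\<^esub> = \<ominus>\<^bsub>B\<^esub> \<zero>\<^bsub>B\<^esub>\<close> nc in auto)
  next
    case (add x z)
    then obtain n r where n: "x = t n r" "n \<in> alternative_nucleus A" "r \<in> carrier S" by blast
    have "x \<in> carrier B" using n nc by simp
    moreover have "y \<in> carrier B" "z \<in> carrier B" "J (commutator B z y) = \<ominus>\<^bsub>B\<^esub> commutator B z y"
      using add by blast+
    moreover have "J (commutator B x y) = \<ominus>\<^bsub>B\<^esub> commutator B x y"
      using add.prems
    proof (induction y rule: add_span_induct)
      case zero then show ?case using \<open>J \<zero>\<^bsub>B\<^esub> = \<ominus>\<^bsub>B\<^esub> \<zero>\<^bsub>B\<^esub>\<close> \<open>x \<in> carrier B\<close> by simp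
    next
      case (add y w)
      then obtain m s where m: "y = t m s" "m \<in> alternative_nucleus A" "s \<in> carrier S" by blast
      have "w \<in> carrier B"
        using add(2) by (induction w rule: add_span_induct) (use nc in auto)
      moreover have "commutator A n m \<in> nucleus_commutators A"
        using n m by (auto simp: nucleus_commutators_def)
      ultimately show ?case using add m n nc skew
        by (simp add: base_commutator B.commutator_add_right J_add J_pure pure_minus_left B.M.minus_add)
    qed
    ultimately show ?case
      by (simp add: B.commutator_add_left J_add B.M.minus_add)
  qed
  then show ?thesis by blast
qed

text \<open>
  For a subalgebra \<open>U\<close> of \<open>A\<close> that contains the commutators of the nucleus, the \<open>S\<close>-span of \<open>U\<close>
  is a subalgebra of the base change that contains the commutators there, because the nucleus of
  the base change is spanned by that of \<open>A\<close>. Hence the span is everything, and \<open>U\<close> itself is \<open>A\<close>.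
\<close>

theorem skew_generated_descent:
  assumes one: "\<one>\<^bsub>S\<^esub> \<noteq> \<zero>\<^bsub>S\<^esub>" and B: "skew_generated S B J"
  shows "skew_generated K A j"
  unfolding skew_generated_def
proof (intro conjI ballI allI impI)
  fix x assume "x \<in> nucleus_commutators A"
  then obtain n n' where n: "x = commutator A n n'" "n \<in> alternative_nucleus A" "n' \<in> alternative_nucleus A"
    by (auto simp: nucleus_commutators_def)
  then have c: "n \<in> carrier A" "n' \<in> carrier A" using alg.alternative_nucleusD(1) by auto
  have "commutator B (t n \<one>\<^bsub>S\<^esub>) (t n' \<one>\<^bsub>S\<^esub>) \<in> nucleus_commutators B"
    using n pure_in_base_nucleus ext.one_closed unfolding nucleus_commutators_def by blast
  then have "J (t x \<one>\<^bsub>S\<^esub>) = \<ominus>\<^bsub>B\<^esub> t x \<one>\<^bsub>S\<^esub>"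
    using B n c by (simp add: skew_generated_def base_commutator)
  then have "t (j x) \<one>\<^bsub>S\<^esub> = t (\<ominus>\<^bsub>A\<^esub> x) \<one>\<^bsub>S\<^esub>" using n c by (simp add: J_pure pure_minus_left)
  then show "j x = \<ominus>\<^bsub>A\<^esub> x" using n c by (intro pure_inj'[OF one]) auto
next
  fix U assume U: "subalgebra K A U" "nucleus_commutators A \<subseteq> U"
  let ?Y = "{t u r | u r. u \<in> U \<and> r \<in> carrier S}"
  have sub: "submodule U K A" "\<one>\<^bsub>A\<^esub> \<in> U" "\<And>x y. x \<in> U \<Longrightarrow> y \<in> U \<Longrightarrow> x \<otimes>\<^bsub>A\<^esub> y \<in> U"
    using U by (auto simp: subalgebra_def)
  have UA: "\<And>u. u \<in> U \<Longrightarrow> u \<in> carrier A" using alg.submoduleE(1)[OF sub(1)] by blast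
  have YB: "z \<in> carrier B" if "z \<in> add_span B ?Y" for z
    using that by (induction z rule: add_span_induct) (use UA in auto)
  have inY: "z \<in> add_span B ?Y" if "z \<in> ?Y" for z
    using add_span_add[OF that add_span_zero[of B]] that UA by auto
  have Yadd: "x \<oplus>\<^bsub>B\<^esub> y \<in> add_span B ?Y" if "x \<in> add_span B ?Y" "y \<in> add_span B ?Y" for x y
    using that(1)
  proof (induction x rule: add_span_induct)
    case zero then show ?case using that(2) YB by simp
  next
    case (add x z)
    then have "x \<in> carrier B" "z \<in> carrier B" "y \<in> carrier B" using UA YB that(2) by auto
    then have "x \<oplus>\<^bsub>B\<^esub> z \<oplus>\<^bsub>B\<^esub> y = x \<oplus>\<^bsub>B\<^esub> (z \<oplus>\<^bsub>B\<^esub> y)" by (simp add: B.M.a_assoc)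
    then show ?case using add add_span_add[of x ?Y "z \<oplus>\<^bsub>B\<^esub> y" B] by simp
  qed
  have Ysmult: "s \<odot>\<^bsub>B\<^esub> x \<in> add_span B ?Y" if "s \<in> carrier S" "x \<in> add_span B ?Y" for s x
    using that(2)
  proof (induction x rule: add_span_induct)
    case zero then show ?case using that(1) add_span_zero by simp
  next
    case (add x z)
    then obtain u r where u: "x = t u r" "u \<in> U" "r \<in> carrier S" by blast
    have eq: "s \<odot>\<^bsub>B\<^esub> (x \<oplus>\<^bsub>B\<^esub> z) = t u (s \<otimes>\<^bsub>S\<^esub> r) \<oplus>\<^bsub>B\<^esub> s \<odot>\<^bsub>B\<^esub> z"
      using u UA YB[OF add(2)] that(1) by (simp add: B.smult_r_distr base_smult_pure)
    show ?case unfolding eq by (rule add_span_add) (use u that(1) add in auto)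
  qed
  have Ymult: "x \<otimes>\<^bsub>B\<^esub> y \<in> add_span B ?Y" if "x \<in> add_span B ?Y" "y \<in> add_span B ?Y" for x y
    using that(1)
  proof (induction x rule: add_span_induct)
    case zero then show ?case using that(2) YB add_span_zero by (simp add: B.null_left)
  next
    case (add x z)
    then obtain u r where u: "x = t u r" "u \<in> U" "r \<in> carrier S" by blast
    have "x \<otimes>\<^bsub>B\<^esub> y \<in> add_span B ?Y"
      using that(2)
    proof (induction y rule: add_span_induct)
      case zero then show ?case using u UA add_span_zero by (simp add: B.null_right)
    next
      case (add y w)
      then obtain v s where v: "y = t v s" "v \<in> U" "s \<in> carrier S" by blast
      have eq: "x \<otimes>\<^bsub>B\<^esub> (y \<oplus>\<^bsub>B\<^esub> w) = t (u \<otimes>\<^bsub>A\<^esub> v) (r \<otimes>\<^bsub>S\<^esub> s) \<oplus>\<^bsub>B\<^esub> x \<otimes>\<^bsub>B\<^esub> w"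
        using u v UA YB[OF add(2)] by (simp add: B.distrib_left base_pure_mult)
      show ?case unfolding eq by (rule add_span_add) (use u v sub(3) add in auto)
    qed
    moreover have "(x \<oplus>\<^bsub>B\<^esub> z) \<otimes>\<^bsub>B\<^esub> y = x \<otimes>\<^bsub>B\<^esub> y \<oplus>\<^bsub>B\<^esub> z \<otimes>\<^bsub>B\<^esub> y"
      using u UA YB add(2) that(2) by (simp add: B.distrib_right)
    ultimately show ?case using add Yadd by simp
  qed
  have "subalgebra S B (add_span B ?Y)"
    unfolding subalgebra_def
  proof (intro conjI ballI)
    show "submodule (add_span B ?Y) S B"
      by (rule B.subspaceI) (use YB Yadd Ysmult add_span_zero in auto)
    show "\<one>\<^bsub>B\<^esub> \<in> add_span B ?Y" unfolding base_one using sub(2) by (intro inY) auto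
  qed (rule Ymult)
  moreover have "nucleus_commutators B \<subseteq> add_span B ?Y"
  proof
    fix x assume "x \<in> nucleus_commutators B"
    then obtain m m' where m: "x = commutator B m m'" "m \<in> alternative_nucleus B" "m' \<in> alternative_nucleus B"
      by (auto simp: nucleus_commutators_def)
    let ?N = "{t n r | n r. n \<in> alternative_nucleus A \<and> r \<in> carrier S}"
    have nc: "n \<in> carrier A" if "n \<in> alternative_nucleus A" for n
      using alg.alternative_nucleusD(1)[OF that] .
    have NB: "z \<in> carrier B" if "z \<in> add_span B ?N" for z
      using that by (induction z rule: add_span_induct) (use nc in auto)
    have "commutator B m m' \<in> add_span B ?Y" if "m \<in> add_span B ?N" "m' \<in> add_span B ?N" for m m'
      using that(1)
    proof (induction m rule: add_span_induct)
      case zero then show ?case using NB that(2) add_span_zero by simp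
    next
      case (add x z)
      then obtain n r where n: "x = t n r" "n \<in> alternative_nucleus A" "r \<in> carrier S" by blast
      have "commutator B x m' \<in> add_span B ?Y"
        using that(2)
      proof (induction m' rule: add_span_induct)
        case zero then show ?case using n nc add_span_zero by simp
      next
        case (add y w)
        then obtain n' s where n': "y = t n' s" "n' \<in> alternative_nucleus A" "s \<in> carrier S" by blast
        have "commutator A n n' \<in> U" using n n' U(2) by (auto simp: nucleus_commutators_def)
        moreover have "commutator B x (y \<oplus>\<^bsub>B\<^esub> w) = t (commutator A n n') (r \<otimes>\<^bsub>S\<^esub> s) \<oplus>\<^bsub>B\<^esub> commutator B x w"
          using n n' nc NB[OF add(2)] by (simp add: B.commutator_add_right base_commutator)
        ultimately show ?case using n n' add add_span_add[of "t (commutator A n n') (r \<otimes>\<^bsub>S\<^esub> s)" ?Y "commutator B x w" B] by auto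
      qed
      moreover have "commutator B (x \<oplus>\<^bsub>B\<^esub> z) m' = commutator B x m' \<oplus>\<^bsub>B\<^esub> commutator B z m'"
        using n nc NB that add(2) by (simp add: B.commutator_add_left)
      ultimately show ?case using add Yadd by simp
    qed
    then show "x \<in> add_span B ?Y" using m base_nucleus by blast
  qed
  ultimately have eq: "add_span B ?Y = carrier B" using B unfolding skew_generated_def by blast
  have "a \<in> U" if "a \<in> carrier A" for a
    by (rule base_subspace_descent[OF one sub(1) that]) (use eq that in simp)
  then show "U = carrier A" using UA by blast
qed

text \<open>
  The elements of \<open>A\<close> at which \<open>\<phi>\<close> and \<open>J\<close> commute form a subalgebra, since both sides reverse
  products in the same way. It contains the commutators of the nucleus: \<open>\<phi>\<close> maps them to
  commutators of the nucleus of the base change, and \<open>J\<close> negates both.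
\<close>

theorem automorphism_commutes:
  assumes A: "skew_generated K A j" and \<phi>: "\<phi> \<in> algebra_autos S B" and x: "x \<in> carrier B"
  shows "\<phi> (J x) = J (\<phi> x)"
proof -
  interpret \<phi>: algebra_iso S B B \<phi>
    using \<phi> by unfold_locales (auto simp: algebra_autos_def Bij_def)
  define U where "U = {w \<in> carrier A. \<phi> (J (t w \<one>\<^bsub>S\<^esub>)) = J (\<phi> (t w \<one>\<^bsub>S\<^esub>))}"
  have "subalgebra K A U"
    unfolding subalgebra_def
  proof (intro conjI ballI)
    show "submodule U K A"
    proof (rule alg.subspaceI)
      show "\<zero>\<^bsub>A\<^esub> \<in> U" by (simp add: U_def pure_zero_left J_zero \<phi>.hom_zero)
      show "x \<oplus>\<^bsub>A\<^esub> y \<in> U" if "x \<in> U" "y \<in> U" for x y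
        using that by (simp add: U_def base_pure_add_left J_add \<phi>.hom_add)
      show "c \<odot>\<^bsub>A\<^esub> x \<in> U" if "c \<in> carrier K" "x \<in> U" for c x
      proof -
        have "t (c \<odot>\<^bsub>A\<^esub> x) \<one>\<^bsub>S\<^esub> = (c \<odot>\<^bsub>S\<^esub> \<one>\<^bsub>S\<^esub>) \<odot>\<^bsub>B\<^esub> t x \<one>\<^bsub>S\<^esub>"
          using that by (simp add: pure_balanced base_smult_pure U_def)
        then show ?thesis using that by (simp add: U_def J_smult \<phi>.hom_smult)
      qed
    qed (auto simp: U_def)
    show "\<one>\<^bsub>A\<^esub> \<in> U"
      using \<phi>.hom_one J_one by (simp add: U_def base_one alg.unit_closed)
    show "x \<otimes>\<^bsub>A\<^esub> y \<in> U" if "x \<in> U" "y \<in> U" for x y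
    proof -
      have "t (x \<otimes>\<^bsub>A\<^esub> y) \<one>\<^bsub>S\<^esub> = t x \<one>\<^bsub>S\<^esub> \<otimes>\<^bsub>B\<^esub> t y \<one>\<^bsub>S\<^esub>"
        using that by (simp add: base_pure_mult U_def)
      then show ?thesis using that by (simp add: U_def J_antimult \<phi>.hom_mult alg.mult_closed)
    qed
  qed
  moreover have "nucleus_commutators A \<subseteq> U"
  proof
    fix w assume w: "w \<in> nucleus_commutators A"
    then obtain n n' where n: "w = commutator A n n'" "n \<in> alternative_nucleus A" "n' \<in> alternative_nucleus A"
      by (auto simp: nucleus_commutators_def)
    have skew: "\<forall>x\<in>nucleus_commutators A. j x = \<ominus>\<^bsub>A\<^esub> x" using A by (simp add: skew_generated_def)
    have c: "n \<in> carrier A" "n' \<in> carrier A" using n alg.alternative_nucleusD(1) by auto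
    have N: "t n \<one>\<^bsub>S\<^esub> \<in> alternative_nucleus B" "t n' \<one>\<^bsub>S\<^esub> \<in> alternative_nucleus B"
      using n pure_in_base_nucleus by auto
    then have "\<phi> (t n \<one>\<^bsub>S\<^esub>) \<in> alternative_nucleus B" "\<phi> (t n' \<one>\<^bsub>S\<^esub>) \<in> alternative_nucleus B"
      using \<phi>.nucleus_iff B.alternative_nucleusD(1) by blast+
    moreover have "\<phi> (t w \<one>\<^bsub>S\<^esub>) = commutator B (\<phi> (t n \<one>\<^bsub>S\<^esub>)) (\<phi> (t n' \<one>\<^bsub>S\<^esub>))"
      using n c by (simp add: \<phi>.hom_commutator[symmetric] base_commutator)
    ultimately have "J (\<phi> (t w \<one>\<^bsub>S\<^esub>)) = \<ominus>\<^bsub>B\<^esub> \<phi> (t w \<one>\<^bsub>S\<^esub>)"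
      using base_commutator_skew[OF skew] by simp
    moreover have "J (t w \<one>\<^bsub>S\<^esub>) = \<ominus>\<^bsub>B\<^esub> t w \<one>\<^bsub>S\<^esub>"
      using skew w n c by (simp add: J_pure pure_minus_left)
    ultimately show "w \<in> U" using n c by (simp add: U_def \<phi>.hom_minus)
  qed
  ultimately have U: "U = carrier A" using A by (simp add: skew_generated_def)
  show ?thesis using x
  proof (induction x rule: base_induct)
    case (pure a s)
    have eq: "t a s = s \<odot>\<^bsub>B\<^esub> t a \<one>\<^bsub>S\<^esub>" using pure by (simp add: base_smult_pure)
    have "a \<in> U" using U pure by simp
    then show ?case unfolding eq using pure by (simp add: U_def J_smult \<phi>.hom_smult)
  qed (simp add: J_add \<phi>.hom_add)
qed

end

section \<open>The algebra laws for Zorn vector matrices\<close>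

lemma zorn_mem_iff:
  "Zorn a (u1, u2, u3) (v1, v2, v3) b \<in> zorn_carrier F m \<longleftrightarrow>
    {a, u1, u2, u3, v1, v2, v3, b} \<subseteq> carrier F \<and>
     (m \<le> 4 \<longrightarrow> u2 = \<zero>\<^bsub>F\<^esub> \<and> u3 = \<zero>\<^bsub>F\<^esub> \<and> v2 = \<zero>\<^bsub>F\<^esub> \<and> v3 = \<zero>\<^bsub>F\<^esub>) \<and>
     (m \<le> 2 \<longrightarrow> u1 = \<zero>\<^bsub>F\<^esub> \<and> v1 = \<zero>\<^bsub>F\<^esub>) \<and> (m \<le> 1 \<longrightarrow> a = b)"
  unfolding zorn_carrier_def by auto

lemma zorn_cases:
  assumes "x \<in> zorn_carrier F m"
  obtains a u1 u2 u3 v1 v2 v3 b where "x = Zorn a (u1, u2, u3) (v1, v2, v3) b"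
    "a \<in> carrier F" "u1 \<in> carrier F" "u2 \<in> carrier F" "u3 \<in> carrier F"
    "v1 \<in> carrier F" "v2 \<in> carrier F" "v3 \<in> carrier F" "b \<in> carrier F"
    "m \<le> 4 \<Longrightarrow> u2 = \<zero>\<^bsub>F\<^esub>" "m \<le> 4 \<Longrightarrow> u3 = \<zero>\<^bsub>F\<^esub>" "m \<le> 4 \<Longrightarrow> v2 = \<zero>\<^bsub>F\<^esub>" "m \<le> 4 \<Longrightarrow> v3 = \<zero>\<^bsub>F\<^esub>"
    "m \<le> 2 \<Longrightarrow> u1 = \<zero>\<^bsub>F\<^esub>" "m \<le> 2 \<Longrightarrow> v1 = \<zero>\<^bsub>F\<^esub>" "m \<le> 1 \<Longrightarrow> a = b"
  using assms unfolding zorn_carrier_def by (elim CollectE exE conjE) (rule that, assumption, simp_all)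

lemma zorn_components:
  assumes "x \<in> zorn_carrier F m"
  obtains a u1 u2 u3 v1 v2 v3 b where "x = Zorn a (u1, u2, u3) (v1, v2, v3) b"
    "a \<in> carrier F" "u1 \<in> carrier F" "u2 \<in> carrier F" "u3 \<in> carrier F"
    "v1 \<in> carrier F" "v2 \<in> carrier F" "v3 \<in> carrier F" "b \<in> carrier F"
  using assms by (rule zorn_cases) (rule that)

lemma split_composition_simps [simp]:
  "carrier (split_composition F m) = zorn_carrier F m"
  "monoid.mult (split_composition F m) = zorn_mult F"
  "one (split_composition F m) = Zorn \<one>\<^bsub>F\<^esub> (\<zero>\<^bsub>F\<^esub>, \<zero>\<^bsub>F\<^esub>, \<zero>\<^bsub>F\<^esub>) (\<zero>\<^bsub>F\<^esub>, \<zero>\<^bsub>F\<^esub>, \<zero>\<^bsub>F\<^esub>) \<one>\<^bsub>F\<^esub>"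
  "ring.zero (split_composition F m) = Zorn \<zero>\<^bsub>F\<^esub> (\<zero>\<^bsub>F\<^esub>, \<zero>\<^bsub>F\<^esub>, \<zero>\<^bsub>F\<^esub>) (\<zero>\<^bsub>F\<^esub>, \<zero>\<^bsub>F\<^esub>, \<zero>\<^bsub>F\<^esub>) \<zero>\<^bsub>F\<^esub>"
  "ring.add (split_composition F m) = zorn_add F"
  "smult (split_composition F m) = zorn_scale F"
  by (simp_all add: split_composition_def)

context cring begin

lemma zorn_add_closed: "x \<in> zorn_carrier R m \<Longrightarrow> y \<in> zorn_carrier R m \<Longrightarrow> zorn_add R x y \<in> zorn_carrier R m"
  by (elim zorn_cases) (simp add: zorn_mem_iff)

lemma zorn_scale_closed: "c \<in> carrier R \<Longrightarrow> x \<in> zorn_carrier R m \<Longrightarrow> zorn_scale R c x \<in> zorn_carrier R m"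
  by (elim zorn_cases) (simp add: zorn_mem_iff)

lemma zorn_conj_closed: "x \<in> zorn_carrier R m \<Longrightarrow> zorn_conj R x \<in> zorn_carrier R m"
  by (elim zorn_cases) (simp add: zorn_mem_iff)

lemma zorn_mult_closed:
  assumes "x \<in> zorn_carrier R m" "y \<in> zorn_carrier R m"
  shows "zorn_mult R x y \<in> zorn_carrier R m"
proof -
  obtain a u1 u2 u3 v1 v2 v3 b where x: "x = Zorn a (u1, u2, u3) (v1, v2, v3) b"
    "a \<in> carrier R" "u1 \<in> carrier R" "u2 \<in> carrier R" "u3 \<in> carrier R"
    "v1 \<in> carrier R" "v2 \<in> carrier R" "v3 \<in> carrier R" "b \<in> carrier R"
    and x0: "m \<le> 4 \<Longrightarrow> u2 = \<zero>" "m \<le> 4 \<Longrightarrow> u3 = \<zero>" "m \<le> 4 \<Longrightarrow> v2 = \<zero>" "m \<le> 4 \<Longrightarrow> v3 = \<zero>"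
    "m \<le> 2 \<Longrightarrow> u1 = \<zero>" "m \<le> 2 \<Longrightarrow> v1 = \<zero>" "m \<le> 1 \<Longrightarrow> a = b"
    using assms(1) by (rule zorn_cases) (rule that)
  obtain a' u1' u2' u3' v1' v2' v3' b' where y: "y = Zorn a' (u1', u2', u3') (v1', v2', v3') b'"
    "a' \<in> carrier R" "u1' \<in> carrier R" "u2' \<in> carrier R" "u3' \<in> carrier R"
    "v1' \<in> carrier R" "v2' \<in> carrier R" "v3' \<in> carrier R" "b' \<in> carrier R"
    and y0: "m \<le> 4 \<Longrightarrow> u2' = \<zero>" "m \<le> 4 \<Longrightarrow> u3' = \<zero>" "m \<le> 4 \<Longrightarrow> v2' = \<zero>" "m \<le> 4 \<Longrightarrow> v3' = \<zero>"
    "m \<le> 2 \<Longrightarrow> u1' = \<zero>" "m \<le> 2 \<Longrightarrow> v1' = \<zero>" "m \<le> 1 \<Longrightarrow> a' = b'"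
    using assms(2) by (rule zorn_cases) (rule that)
  consider "m \<le> 1" | "1 < m" "m \<le> 2" | "2 < m" "m \<le> 4" | "4 < m" by linarith
  then show ?thesis
  proof cases
    case 1 then show ?thesis using x0 y0 x(2-) y(2-) unfolding x(1) y(1) by (simp add: zorn_mem_iff minus_eq)
  next
    case 2 then show ?thesis using x0(1-6) y0(1-6) x(2-) y(2-) unfolding x(1) y(1) by (simp add: zorn_mem_iff minus_eq)
  next
    case 3 then show ?thesis using x0(1-4) y0(1-4) x(2-) y(2-) unfolding x(1) y(1) by (simp add: zorn_mem_iff minus_eq)
  next
    case 4 then show ?thesis using x(2-) y(2-) unfolding x(1) y(1) by (simp add: zorn_mem_iff)
  qed
qed

lemma zorn_abelian_group: "abelian_group (split_composition R m)"
proof (rule abelian_groupI)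
  fix x assume "x \<in> carrier (split_composition R m)"
  then have x: "x \<in> zorn_carrier R m" by simp
  then have "zorn_add R (zorn_scale R (\<ominus> \<one>) x) x = \<zero>\<^bsub>split_composition R m\<^esub>"
    by (elim zorn_components) (simp add: l_minus l_neg)
  then show "\<exists>y\<in>carrier (split_composition R m). y \<oplus>\<^bsub>split_composition R m\<^esub> x = \<zero>\<^bsub>split_composition R m\<^esub>"
    using zorn_scale_closed[OF _ x, of "\<ominus> \<one>"] by (intro bexI[of _ "zorn_scale R (\<ominus> \<one>) x"]) simp_all
  show "\<zero>\<^bsub>split_composition R m\<^esub> \<oplus>\<^bsub>split_composition R m\<^esub> x = x"
    using x by (elim zorn_components) simp
next
  fix x y z assume "x \<in> carrier (split_composition R m)" "y \<in> carrier (split_composition R m)"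
    "z \<in> carrier (split_composition R m)"
  then show "x \<oplus>\<^bsub>split_composition R m\<^esub> y \<oplus>\<^bsub>split_composition R m\<^esub> z =
      x \<oplus>\<^bsub>split_composition R m\<^esub> (y \<oplus>\<^bsub>split_composition R m\<^esub> z)"
    unfolding split_composition_simps by (elim zorn_components) (simp add: a_assoc)
next
  fix x y assume "x \<in> carrier (split_composition R m)" "y \<in> carrier (split_composition R m)"
  then show "x \<oplus>\<^bsub>split_composition R m\<^esub> y = y \<oplus>\<^bsub>split_composition R m\<^esub> x"
    unfolding split_composition_simps by (elim zorn_components) (simp add: a_comm)
qed (simp_all add: zorn_add_closed zorn_mem_iff)

lemma zorn_distrib:
  assumes "x \<in> zorn_carrier R m" "y \<in> zorn_carrier R m" "z \<in> zorn_carrier R m"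
  shows "zorn_mult R x (zorn_add R y z) = zorn_add R (zorn_mult R x y) (zorn_mult R x z)"
    and "zorn_mult R (zorn_add R y z) x = zorn_add R (zorn_mult R y x) (zorn_mult R z x)"
  using assms by (elim zorn_components, simp only: zorn_mult.simps zorn_add.simps vec_dot.simps vec_add.simps
      vec_scale.simps vec_cross.simps vec_neg.simps zorn.inject prod.inject, intro conjI; algebra)+

lemma zorn_mult_scale:
  assumes "c \<in> carrier R" "x \<in> zorn_carrier R m" "y \<in> zorn_carrier R m"
  shows "zorn_mult R (zorn_scale R c x) y = zorn_scale R c (zorn_mult R x y)"
    and "zorn_mult R x (zorn_scale R c y) = zorn_scale R c (zorn_mult R x y)"
  using assms by (elim zorn_components, simp only: zorn_mult.simps zorn_scale.simps vec_dot.simps vec_add.simps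
      vec_scale.simps vec_cross.simps vec_neg.simps zorn.inject prod.inject, intro conjI; algebra)+

end

section \<open>Alternativity of the octonions\<close>

lemma (in unital_algebra) cancel_swapped:
  assumes "p \<in> carrier A" "q \<in> carrier A"
  shows "(p \<oplus>\<^bsub>A\<^esub> \<ominus>\<^bsub>A\<^esub> q) \<oplus>\<^bsub>A\<^esub> (\<ominus>\<^bsub>A\<^esub> p \<oplus>\<^bsub>A\<^esub> q) = \<zero>\<^bsub>A\<^esub>"
    "(p \<oplus>\<^bsub>A\<^esub> \<ominus>\<^bsub>A\<^esub> q) \<oplus>\<^bsub>A\<^esub> (q \<oplus>\<^bsub>A\<^esub> \<ominus>\<^bsub>A\<^esub> p) = \<zero>\<^bsub>A\<^esub>"
    "(\<ominus>\<^bsub>A\<^esub> p \<oplus>\<^bsub>A\<^esub> q) \<oplus>\<^bsub>A\<^esub> (p \<oplus>\<^bsub>A\<^esub> \<ominus>\<^bsub>A\<^esub> q) = \<zero>\<^bsub>A\<^esub>"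
    "(\<ominus>\<^bsub>A\<^esub> p \<oplus>\<^bsub>A\<^esub> q) \<oplus>\<^bsub>A\<^esub> (\<ominus>\<^bsub>A\<^esub> q \<oplus>\<^bsub>A\<^esub> p) = \<zero>\<^bsub>A\<^esub>"
  using assms by algebra+

context cring begin

lemma zorn_unital_algebra: "unital_algebra R (split_composition R m)"
proof -
  have "module R (split_composition R m)"
  proof (rule moduleI, unfold split_composition_simps, goal_cases)
    case 1 show ?case ..
  next
    case 2 show ?case by (rule zorn_abelian_group)
  next
    case (3 a x) then show ?case by (rule zorn_scale_closed)
  next
    case (4 a b x) then show ?case by (elim zorn_components) (simp add: l_distr)
  next
    case (5 a x y) then show ?case by (elim zorn_components) (simp add: r_distr)
  next
    case (6 a b x) then show ?case by (elim zorn_components) (simp add: m_assoc)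
  next
    case (7 x) then show ?case by (elim zorn_components) simp
  qed
  moreover have "unital_algebra_axioms R (split_composition R m)"
  proof (unfold_locales, unfold split_composition_simps, goal_cases)
    case (1 x y) then show ?case by (rule zorn_mult_closed)
  next
    case 2 show ?case by (simp add: zorn_mem_iff)
  next
    case (3 x) then show ?case by (elim zorn_components) (simp add: minus_eq)
  next
    case (4 x) then show ?case by (elim zorn_components) (simp add: minus_eq)
  next
    case (5 x y z) then show ?case by (rule zorn_distrib)
  next
    case (6 x y z) then show ?case by (intro zorn_distrib)
  next
    case (7 c x y) then show ?case by (rule zorn_mult_scale)
  next
    case (8 c x y) then show ?case by (rule zorn_mult_scale)
  qed
  ultimately show ?thesis by (rule unital_algebra.intro)
qed

lemma zorn_uminus:
  assumes "x \<in> zorn_carrier R m"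
  shows "\<ominus>\<^bsub>split_composition R m\<^esub> x = zorn_scale R (\<ominus> \<one>) x"
proof -
  interpret C: unital_algebra R "split_composition R m" by (rule zorn_unital_algebra)
  show ?thesis using C.smult_l_minus[of \<one> x] assms C.smult_one[of x] by simp
qed

lemma zorn_assoc:
  assumes "m \<le> 4" "x \<in> zorn_carrier R m" "y \<in> zorn_carrier R m" "z \<in> zorn_carrier R m"
  shows "zorn_mult R (zorn_mult R x y) z = zorn_mult R x (zorn_mult R y z)"
proof -
  have "\<exists>a u v b. x = Zorn a (u, \<zero>, \<zero>) (v, \<zero>, \<zero>) b \<and> {a, u, v, b} \<subseteq> carrier R"
    if "x \<in> zorn_carrier R m" for x
    using that assms(1) unfolding zorn_carrier_def by auto
  then obtain a u v b a' u' v' b' a'' u'' v'' b'' where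
    "x = Zorn a (u, \<zero>, \<zero>) (v, \<zero>, \<zero>) b" "{a, u, v, b} \<subseteq> carrier R"
    "y = Zorn a' (u', \<zero>, \<zero>) (v', \<zero>, \<zero>) b'" "{a', u', v', b'} \<subseteq> carrier R"
    "z = Zorn a'' (u'', \<zero>, \<zero>) (v'', \<zero>, \<zero>) b''" "{a'', u'', v'', b''} \<subseteq> carrier R"
    using assms by metis
  then show ?thesis
    by (simp add: minus_eq l_distr r_distr a_ac m_ac)
qed

lemma zorn_commute:
  assumes "m \<le> 2" "x \<in> zorn_carrier R m" "y \<in> zorn_carrier R m"
  shows "zorn_mult R x y = zorn_mult R y x"
proof -
  have "\<exists>a b. x = Zorn a (\<zero>, \<zero>, \<zero>) (\<zero>, \<zero>, \<zero>) b \<and> {a, b} \<subseteq> carrier R"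
    if "x \<in> zorn_carrier R m" for x
    using that assms(1) unfolding zorn_carrier_def by auto
  then obtain a b a' b' where
    "x = Zorn a (\<zero>, \<zero>, \<zero>) (\<zero>, \<zero>, \<zero>) b" "{a, b} \<subseteq> carrier R"
    "y = Zorn a' (\<zero>, \<zero>, \<zero>) (\<zero>, \<zero>, \<zero>) b'" "{a', b'} \<subseteq> carrier R"
    using assms by metis
  then show ?thesis
    by (simp add: minus_eq m_comm)
qed

abbreviation octonions where "octonions \<equiv> split_composition R 8"

definition ze1 where "ze1 = Zorn \<one> (\<zero>, \<zero>, \<zero>) (\<zero>, \<zero>, \<zero>) \<zero>"
definition zu1 where "zu1 = Zorn \<zero> (\<one>, \<zero>, \<zero>) (\<zero>, \<zero>, \<zero>) \<zero>"
definition zu2 where "zu2 = Zorn \<zero> (\<zero>, \<one>, \<zero>) (\<zero>, \<zero>, \<zero>) \<zero>"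
definition zu3 where "zu3 = Zorn \<zero> (\<zero>, \<zero>, \<one>) (\<zero>, \<zero>, \<zero>) \<zero>"
definition zv1 where "zv1 = Zorn \<zero> (\<zero>, \<zero>, \<zero>) (\<one>, \<zero>, \<zero>) \<zero>"
definition zv2 where "zv2 = Zorn \<zero> (\<zero>, \<zero>, \<zero>) (\<zero>, \<one>, \<zero>) \<zero>"
definition zv3 where "zv3 = Zorn \<zero> (\<zero>, \<zero>, \<zero>) (\<zero>, \<zero>, \<one>) \<zero>"
definition ze2 where "ze2 = Zorn \<zero> (\<zero>, \<zero>, \<zero>) (\<zero>, \<zero>, \<zero>) \<one>"

lemmas zorn_basis_defs = ze1_def zu1_def zu2_def zu3_def zv1_def zv2_def zv3_def ze2_def

definition zorn_basis where
  "zorn_basis = [ze1, zu1, zu2, zu3, zv1, zv2, zv3, ze2]"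

lemma zorn_basis_closed: "e \<in> set zorn_basis \<Longrightarrow> e \<in> zorn_carrier R 8"
  unfolding zorn_basis_def zorn_basis_defs by (auto simp: zorn_mem_iff)

text \<open>
  The products of basis elements, in the form needed to evaluate associators on the basis by
  rewriting alone.
\<close>

lemma zorn_table:
  "ze1 \<otimes>\<^bsub>octonions\<^esub> ze1 = ze1"
  "ze1 \<otimes>\<^bsub>octonions\<^esub> zu1 = zu1"
  "ze1 \<otimes>\<^bsub>octonions\<^esub> zu2 = zu2"
  "ze1 \<otimes>\<^bsub>octonions\<^esub> zu3 = zu3"
  "ze1 \<otimes>\<^bsub>octonions\<^esub> zv1 = \<zero>\<^bsub>octonions\<^esub>"
  "ze1 \<otimes>\<^bsub>octonions\<^esub> zv2 = \<zero>\<^bsub>octonions\<^esub>"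
  "ze1 \<otimes>\<^bsub>octonions\<^esub> zv3 = \<zero>\<^bsub>octonions\<^esub>"
  "ze1 \<otimes>\<^bsub>octonions\<^esub> ze2 = \<zero>\<^bsub>octonions\<^esub>"
  "zu1 \<otimes>\<^bsub>octonions\<^esub> ze1 = \<zero>\<^bsub>octonions\<^esub>"
  "zu1 \<otimes>\<^bsub>octonions\<^esub> zu1 = \<zero>\<^bsub>octonions\<^esub>"
  "zu1 \<otimes>\<^bsub>octonions\<^esub> zu2 = \<ominus>\<^bsub>octonions\<^esub> zv3"
  "zu1 \<otimes>\<^bsub>octonions\<^esub> zu3 = zv2"
  "zu1 \<otimes>\<^bsub>octonions\<^esub> zv1 = ze1"
  "zu1 \<otimes>\<^bsub>octonions\<^esub> zv2 = \<zero>\<^bsub>octonions\<^esub>"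
  "zu1 \<otimes>\<^bsub>octonions\<^esub> zv3 = \<zero>\<^bsub>octonions\<^esub>"
  "zu1 \<otimes>\<^bsub>octonions\<^esub> ze2 = zu1"
  "zu2 \<otimes>\<^bsub>octonions\<^esub> ze1 = \<zero>\<^bsub>octonions\<^esub>"
  "zu2 \<otimes>\<^bsub>octonions\<^esub> zu1 = zv3"
  "zu2 \<otimes>\<^bsub>octonions\<^esub> zu2 = \<zero>\<^bsub>octonions\<^esub>"
  "zu2 \<otimes>\<^bsub>octonions\<^esub> zu3 = \<ominus>\<^bsub>octonions\<^esub> zv1"
  "zu2 \<otimes>\<^bsub>octonions\<^esub> zv1 = \<zero>\<^bsub>octonions\<^esub>"
  "zu2 \<otimes>\<^bsub>octonions\<^esub> zv2 = ze1"
  "zu2 \<otimes>\<^bsub>octonions\<^esub> zv3 = \<zero>\<^bsub>octonions\<^esub>"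
  "zu2 \<otimes>\<^bsub>octonions\<^esub> ze2 = zu2"
  "zu3 \<otimes>\<^bsub>octonions\<^esub> ze1 = \<zero>\<^bsub>octonions\<^esub>"
  "zu3 \<otimes>\<^bsub>octonions\<^esub> zu1 = \<ominus>\<^bsub>octonions\<^esub> zv2"
  "zu3 \<otimes>\<^bsub>octonions\<^esub> zu2 = zv1"
  "zu3 \<otimes>\<^bsub>octonions\<^esub> zu3 = \<zero>\<^bsub>octonions\<^esub>"
  "zu3 \<otimes>\<^bsub>octonions\<^esub> zv1 = \<zero>\<^bsub>octonions\<^esub>"
  "zu3 \<otimes>\<^bsub>octonions\<^esub> zv2 = \<zero>\<^bsub>octonions\<^esub>"
  "zu3 \<otimes>\<^bsub>octonions\<^esub> zv3 = ze1"
  "zu3 \<otimes>\<^bsub>octonions\<^esub> ze2 = zu3"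
  "zv1 \<otimes>\<^bsub>octonions\<^esub> ze1 = zv1"
  "zv1 \<otimes>\<^bsub>octonions\<^esub> zu1 = ze2"
  "zv1 \<otimes>\<^bsub>octonions\<^esub> zu2 = \<zero>\<^bsub>octonions\<^esub>"
  "zv1 \<otimes>\<^bsub>octonions\<^esub> zu3 = \<zero>\<^bsub>octonions\<^esub>"
  "zv1 \<otimes>\<^bsub>octonions\<^esub> zv1 = \<zero>\<^bsub>octonions\<^esub>"
  "zv1 \<otimes>\<^bsub>octonions\<^esub> zv2 = zu3"
  "zv1 \<otimes>\<^bsub>octonions\<^esub> zv3 = \<ominus>\<^bsub>octonions\<^esub> zu2"
  "zv1 \<otimes>\<^bsub>octonions\<^esub> ze2 = \<zero>\<^bsub>octonions\<^esub>"
  "zv2 \<otimes>\<^bsub>octonions\<^esub> ze1 = zv2"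
  "zv2 \<otimes>\<^bsub>octonions\<^esub> zu1 = \<zero>\<^bsub>octonions\<^esub>"
  "zv2 \<otimes>\<^bsub>octonions\<^esub> zu2 = ze2"
  "zv2 \<otimes>\<^bsub>octonions\<^esub> zu3 = \<zero>\<^bsub>octonions\<^esub>"
  "zv2 \<otimes>\<^bsub>octonions\<^esub> zv1 = \<ominus>\<^bsub>octonions\<^esub> zu3"
  "zv2 \<otimes>\<^bsub>octonions\<^esub> zv2 = \<zero>\<^bsub>octonions\<^esub>"
  "zv2 \<otimes>\<^bsub>octonions\<^esub> zv3 = zu1"
  "zv2 \<otimes>\<^bsub>octonions\<^esub> ze2 = \<zero>\<^bsub>octonions\<^esub>"
  "zv3 \<otimes>\<^bsub>octonions\<^esub> ze1 = zv3"
  "zv3 \<otimes>\<^bsub>octonions\<^esub> zu1 = \<zero>\<^bsub>octonions\<^esub>"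
  "zv3 \<otimes>\<^bsub>octonions\<^esub> zu2 = \<zero>\<^bsub>octonions\<^esub>"
  "zv3 \<otimes>\<^bsub>octonions\<^esub> zu3 = ze2"
  "zv3 \<otimes>\<^bsub>octonions\<^esub> zv1 = zu2"
  "zv3 \<otimes>\<^bsub>octonions\<^esub> zv2 = \<ominus>\<^bsub>octonions\<^esub> zu1"
  "zv3 \<otimes>\<^bsub>octonions\<^esub> zv3 = \<zero>\<^bsub>octonions\<^esub>"
  "zv3 \<otimes>\<^bsub>octonions\<^esub> ze2 = \<zero>\<^bsub>octonions\<^esub>"
  "ze2 \<otimes>\<^bsub>octonions\<^esub> ze1 = \<zero>\<^bsub>octonions\<^esub>"
  "ze2 \<otimes>\<^bsub>octonions\<^esub> zu1 = \<zero>\<^bsub>octonions\<^esub>"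
  "ze2 \<otimes>\<^bsub>octonions\<^esub> zu2 = \<zero>\<^bsub>octonions\<^esub>"
  "ze2 \<otimes>\<^bsub>octonions\<^esub> zu3 = \<zero>\<^bsub>octonions\<^esub>"
  "ze2 \<otimes>\<^bsub>octonions\<^esub> zv1 = zv1"
  "ze2 \<otimes>\<^bsub>octonions\<^esub> zv2 = zv2"
  "ze2 \<otimes>\<^bsub>octonions\<^esub> zv3 = zv3"
  "ze2 \<otimes>\<^bsub>octonions\<^esub> ze2 = ze2"
  by (simp_all add: zorn_basis_defs minus_eq l_minus r_minus zorn_uminus zorn_mem_iff)

lemma zorn_expand:
  assumes "{a, u1, u2, u3, v1, v2, v3, b} \<subseteq> carrier R"
  shows "Zorn a (u1, u2, u3) (v1, v2, v3) b =
    zorn_add R (zorn_scale R a ze1) (zorn_add R (zorn_scale R u1 zu1) (zorn_add R (zorn_scale R u2 zu2) (zorn_add R (zorn_scale R u3 zu3) (zorn_add R (zorn_scale R v1 zv1) (zorn_add R (zorn_scale R v2 zv2) (zorn_add R (zorn_scale R v3 zv3) (zorn_scale R b ze2)))))))"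
  using assms by (simp add: zorn_basis_defs)

lemma zorn_basis_induct [consumes 1, case_names basis scale add]:
  assumes x: "x \<in> zorn_carrier R 8"
    and basis: "\<And>e. e \<in> set zorn_basis \<Longrightarrow> P e"
    and scale: "\<And>c e. c \<in> carrier R \<Longrightarrow> e \<in> zorn_carrier R 8 \<Longrightarrow> P e \<Longrightarrow> P (zorn_scale R c e)"
    and add: "\<And>x y. x \<in> zorn_carrier R 8 \<Longrightarrow> y \<in> zorn_carrier R 8 \<Longrightarrow> P x \<Longrightarrow> P y \<Longrightarrow> P (zorn_add R x y)"
  shows "P x"
  using x
proof (rule zorn_components)
  fix a u1 u2 u3 v1 v2 v3 b assume c: "x = Zorn a (u1, u2, u3) (v1, v2, v3) b"
    "a \<in> carrier R" "u1 \<in> carrier R" "u2 \<in> carrier R" "u3 \<in> carrier R"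
    "v1 \<in> carrier R" "v2 \<in> carrier R" "v3 \<in> carrier R" "b \<in> carrier R"
  have e: "z \<in> zorn_carrier R 8 \<and> P z" if "z \<in> set zorn_basis" for z
    using basis zorn_basis_closed that by blast
  note e' = e[unfolded zorn_basis_def, simplified]
  have "P (zorn_add R (zorn_scale R a ze1) (zorn_add R (zorn_scale R u1 zu1) (zorn_add R (zorn_scale R u2 zu2) (zorn_add R (zorn_scale R u3 zu3) (zorn_add R (zorn_scale R v1 zv1) (zorn_add R (zorn_scale R v2 zv2) (zorn_add R (zorn_scale R v3 zv3) (zorn_scale R b ze2))))))))"
    using c(2-) e' by (intro add scale zorn_add_closed zorn_scale_closed) blast+
  then show "P x" using zorn_expand c by simp
qed

text \<open>
  The alternators are trilinear, so alternativity can be checked on the basis. A direct expansion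
  in coordinates would instead involve polynomials in 24 variables.
\<close>

lemma zorn_basis_alternators:
  "list_all (\<lambda>x. list_all (\<lambda>y. list_all (\<lambda>z.
     left_alternator octonions x y z = \<zero>\<^bsub>octonions\<^esub> \<and>
     right_alternator octonions x y z = \<zero>\<^bsub>octonions\<^esub>)
     zorn_basis) zorn_basis) zorn_basis"
proof -
  interpret C: unital_algebra R "octonions" by (rule zorn_unital_algebra)
  have c: "ze1 \<in> carrier octonions" "ze2 \<in> carrier octonions"
    "zu1 \<in> carrier octonions" "zu2 \<in> carrier octonions" "zu3 \<in> carrier octonions"
    "zv1 \<in> carrier octonions" "zv2 \<in> carrier octonions" "zv3 \<in> carrier octonions"
    using zorn_basis_closed by (simp_all add: zorn_basis_def)
  have z: "\<ominus>\<^bsub>octonions\<^esub> \<zero>\<^bsub>octonions\<^esub> = \<zero>\<^bsub>octonions\<^esub>"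
    by (rule C.M.minus_equality) (simp_all del: split_composition_simps)
  show ?thesis
    unfolding zorn_basis_def left_alternator_def right_alternator_def associator_def
    by (simp only: list.pred_inject HOL.simp_thms zorn_table C.null_left C.null_right C.uminus_left C.uminus_right c
      C.M.minus_eq z C.M.l_zero C.M.r_zero C.M.zero_closed C.M.l_neg C.M.r_neg C.M.minus_minus C.M.a_inv_closed
      C.cancel_swapped)
qed

text \<open>
  After the extension from the basis to the octonions by trilinearity, the smaller algebras follow
  because they are subalgebras with the same operations.
\<close>

lemma zorn_alternators:
  assumes "x \<in> zorn_carrier R m" "y \<in> zorn_carrier R m" "z \<in> zorn_carrier R m"
  shows "left_alternator (split_composition R m) x y z = \<zero>\<^bsub>split_composition R m\<^esub>"
    and "right_alternator (split_composition R m) x y z = \<zero>\<^bsub>split_composition R m\<^esub>"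
proof -
  let ?C = octonions
  interpret C: unital_algebra R ?C by (rule zorn_unital_algebra)
  have sub: "w \<in> zorn_carrier R 8" if "w \<in> zorn_carrier R m" for w
    using that by (elim zorn_components) (simp add: zorn_mem_iff)
  have b: "left_alternator ?C x y z = \<zero>\<^bsub>?C\<^esub> \<and> right_alternator ?C x y z = \<zero>\<^bsub>?C\<^esub>"
    if "x \<in> set zorn_basis" "y \<in> set zorn_basis" "z \<in> set zorn_basis" for x y z
    using zorn_basis_alternators that unfolding list_all_iff by blast
  note simps = C.left_alternator_add C.right_alternator_add C.left_alternator_smult C.right_alternator_smult
  have car: "carrier ?C = zorn_carrier R 8" by simp
  note cl = zorn_basis_closed
  have 1: "left_alternator ?C x y z = \<zero>\<^bsub>?C\<^esub> \<and> right_alternator ?C x y z = \<zero>\<^bsub>?C\<^esub>"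
    if "x \<in> zorn_carrier R 8" "y \<in> set zorn_basis" "z \<in> set zorn_basis" for x y z
    using that(1)
  proof (induction x rule: zorn_basis_induct)
    case (basis e) then show ?case using b that by blast
  next
    case (scale c e)
    then show ?case using C.left_alternator_smult(1)[of c e y z] C.right_alternator_smult(1)[of c e y z]
       cl[OF that(2)] cl[OF that(3)] C.smult_r_null[of c] by simp
  next
    case (add u v)
    then show ?case using C.left_alternator_add(1)[of u v y z] C.right_alternator_add(1)[of u v y z]
       cl[OF that(2)] cl[OF that(3)] C.M.l_zero[OF C.M.zero_closed] by simp
  qed
  have 2: "left_alternator ?C x y z = \<zero>\<^bsub>?C\<^esub> \<and> right_alternator ?C x y z = \<zero>\<^bsub>?C\<^esub>"
    if "x \<in> zorn_carrier R 8" "y \<in> zorn_carrier R 8" "z \<in> set zorn_basis" for x y z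
    using that(2)
  proof (induction y rule: zorn_basis_induct)
    case (basis e) then show ?case using 1 that by blast
  next
    case (scale c e)
    then show ?case using C.left_alternator_smult(2)[of c e x z] C.right_alternator_smult(2)[of c e x z]
       that(1) cl[OF that(3)] C.smult_r_null[of c] by simp
  next
    case (add u v)
    then show ?case using C.left_alternator_add(2)[of u v x z] C.right_alternator_add(2)[of u v x z]
       that(1) cl[OF that(3)] C.M.l_zero[OF C.M.zero_closed] by simp
  qed
  have 3: "left_alternator ?C x y z = \<zero>\<^bsub>?C\<^esub> \<and> right_alternator ?C x y z = \<zero>\<^bsub>?C\<^esub>"
    if "x \<in> zorn_carrier R 8" "y \<in> zorn_carrier R 8" "z \<in> zorn_carrier R 8" for x y z
    using that(3)
  proof (induction z rule: zorn_basis_induct)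
    case (basis e) then show ?case using 2 that by blast
  next
    case (scale c e)
    then show ?case using C.left_alternator_smult(3)[of c e x y] C.right_alternator_smult(3)[of c e x y]
       that(1,2) C.smult_r_null[of c] by simp
  next
    case (add u v)
    then show ?case using C.left_alternator_add(3)[of u v x y] C.right_alternator_add(3)[of u v x y]
       that(1,2) C.M.l_zero[OF C.M.zero_closed] by simp
  qed
  have minus: "x \<ominus>\<^bsub>split_composition R m\<^esub> y = x \<ominus>\<^bsub>?C\<^esub> y"
    if "y \<in> zorn_carrier R m" for x y
    using zorn_uminus[OF that] zorn_uminus[OF sub[OF that]] by (simp add: a_minus_def)
  have eq: "left_alternator (split_composition R m) x y z = left_alternator ?C x y z"
    "right_alternator (split_composition R m) x y z = right_alternator ?C x y z"
    using assms minus by (simp_all add: left_alternator_def right_alternator_def associator_def zorn_mult_closed)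
  show "left_alternator (split_composition R m) x y z = \<zero>\<^bsub>split_composition R m\<^esub>"
    "right_alternator (split_composition R m) x y z = \<zero>\<^bsub>split_composition R m\<^esub>"
    using 3 assms sub eq by simp_all
qed

end

section \<open>The nucleus of a tensor product\<close>

context tensor_algebras begin

sublocale TA: unital_algebra K T by (rule tensor_unital_algebra)

lemma pure_null_left: "b \<in> carrier B \<Longrightarrow> t \<zero>\<^bsub>A\<^esub> b = \<zero>\<^bsub>T\<^esub>"
  using pure_balanced[of \<zero> "\<one>\<^bsub>A\<^esub>" b] tensor_smult_pure[of \<zero> "\<zero>\<^bsub>A\<^esub>" b] pure_closed[of "\<zero>\<^bsub>A\<^esub>" b]
  by simp

lemma pure_null_right: "a \<in> carrier A \<Longrightarrow> t a \<zero>\<^bsub>B\<^esub> = \<zero>\<^bsub>T\<^esub>"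
  using pure_balanced[of \<zero> a "\<zero>\<^bsub>B\<^esub>"] pure_null_left[of "\<zero>\<^bsub>B\<^esub>"] by simp

lemma pure_uminus_left: "a \<in> carrier A \<Longrightarrow> b \<in> carrier B \<Longrightarrow> t (\<ominus>\<^bsub>A\<^esub> a) b = \<ominus>\<^bsub>T\<^esub> t a b"
  using pure_add_left[of "\<ominus>\<^bsub>A\<^esub> a" a b] pure_null_left[of b]
  by (intro T.minus_equality[symmetric]) (simp_all add: fst.M.l_neg pure_closed)

lemma pure_uminus_right: "a \<in> carrier A \<Longrightarrow> b \<in> carrier B \<Longrightarrow> t a (\<ominus>\<^bsub>B\<^esub> b) = \<ominus>\<^bsub>T\<^esub> t a b"
  using pure_add_right[of a "\<ominus>\<^bsub>B\<^esub> b" b] pure_null_right[of a]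
  by (intro T.minus_equality[symmetric]) (simp_all add: snd.M.l_neg pure_closed)

lemma pure_minus_left': "a \<in> carrier A \<Longrightarrow> a' \<in> carrier A \<Longrightarrow> b \<in> carrier B \<Longrightarrow>
    t (a \<ominus>\<^bsub>A\<^esub> a') b = t a b \<ominus>\<^bsub>T\<^esub> t a' b"
  by (simp add: a_minus_def pure_add_left pure_uminus_left)

lemma pure_minus_right': "a \<in> carrier A \<Longrightarrow> b \<in> carrier B \<Longrightarrow> b' \<in> carrier B \<Longrightarrow>
    t a (b \<ominus>\<^bsub>B\<^esub> b') = t a b \<ominus>\<^bsub>T\<^esub> t a b'"
  by (simp add: a_minus_def pure_add_right pure_uminus_right)

lemma pure_associator:
  assumes "a \<in> carrier A" "b \<in> carrier A" "c \<in> carrier A" "a' \<in> carrier B" "b' \<in> carrier B" "c' \<in> carrier B"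
  shows "associator T (t a a') (t b b') (t c c') =
    t ((a \<otimes>\<^bsub>A\<^esub> b) \<otimes>\<^bsub>A\<^esub> c) ((a' \<otimes>\<^bsub>B\<^esub> b') \<otimes>\<^bsub>B\<^esub> c') \<ominus>\<^bsub>T\<^esub>
    t (a \<otimes>\<^bsub>A\<^esub> (b \<otimes>\<^bsub>A\<^esub> c)) (a' \<otimes>\<^bsub>B\<^esub> (b' \<otimes>\<^bsub>B\<^esub> c'))"
  using assms by (simp add: associator_def pure_mult fst.mult_closed snd.mult_closed)

lemma pure_associator_snd:
  assumes "a \<in> carrier A" "b \<in> carrier A" "c \<in> carrier A" "a' \<in> carrier B" "b' \<in> carrier B" "c' \<in> carrier B"
    and "a' \<otimes>\<^bsub>B\<^esub> (b' \<otimes>\<^bsub>B\<^esub> c') = (a' \<otimes>\<^bsub>B\<^esub> b') \<otimes>\<^bsub>B\<^esub> c'"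
  shows "associator T (t a a') (t b b') (t c c') = t (associator A a b c) ((a' \<otimes>\<^bsub>B\<^esub> b') \<otimes>\<^bsub>B\<^esub> c')"
  using assms pure_associator by (simp add: associator_def pure_minus_left' fst.mult_closed snd.mult_closed)

lemma pure_associator_fst:
  assumes "a \<in> carrier A" "b \<in> carrier A" "c \<in> carrier A" "a' \<in> carrier B" "b' \<in> carrier B" "c' \<in> carrier B"
    and "a \<otimes>\<^bsub>A\<^esub> (b \<otimes>\<^bsub>A\<^esub> c) = (a \<otimes>\<^bsub>A\<^esub> b) \<otimes>\<^bsub>A\<^esub> c"
  shows "associator T (t a a') (t b b') (t c c') = t ((a \<otimes>\<^bsub>A\<^esub> b) \<otimes>\<^bsub>A\<^esub> c) (associator B a' b' c')"
  using assms pure_associator by (simp add: associator_def pure_minus_right' fst.mult_closed snd.mult_closed)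

lemma tensor_bilinear_zero:
  assumes "\<And>x x' y. x \<in> carrier T \<Longrightarrow> x' \<in> carrier T \<Longrightarrow> y \<in> carrier T \<Longrightarrow> f (x \<oplus>\<^bsub>T\<^esub> x') y = f x y \<oplus>\<^bsub>T\<^esub> f x' y"
    and "\<And>x x' y. x \<in> carrier T \<Longrightarrow> x' \<in> carrier T \<Longrightarrow> y \<in> carrier T \<Longrightarrow> f y (x \<oplus>\<^bsub>T\<^esub> x') = f y x \<oplus>\<^bsub>T\<^esub> f y x'"
    and "\<And>a a' b b'. a \<in> carrier A \<Longrightarrow> a' \<in> carrier B \<Longrightarrow> b \<in> carrier A \<Longrightarrow> b' \<in> carrier B \<Longrightarrow>
      f (t a a') (t b b') = \<zero>\<^bsub>T\<^esub>"
    and "x \<in> carrier T" "y \<in> carrier T"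
  shows "f x y = \<zero>\<^bsub>T\<^esub>"
  using assms(4,5)
proof (induction x arbitrary: y rule: tensor_induct)
  case (pure a a')
  note a = pure
  from a(3) show ?case
    by (induction y rule: tensor_induct) (use a assms(2,3) pure_closed in auto)
qed (use assms(1) in auto)

lemma pure_one_in_nucleus:
  assumes n: "n \<in> alternative_nucleus A"
  shows "t n \<one>\<^bsub>B\<^esub> \<in> alternative_nucleus T"
proof -
  note N = fst.alternative_nucleusD[OF n]
  have "left_alternator T (t n \<one>\<^bsub>B\<^esub>) x y = \<zero>\<^bsub>T\<^esub>" if "x \<in> carrier T" "y \<in> carrier T" for x y
    using _ _ _ that
  proof (rule tensor_bilinear_zero)
    fix a a' b b' assume ab: "a \<in> carrier A" "a' \<in> carrier B" "b \<in> carrier A" "b' \<in> carrier B"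
    have "left_alternator T (t n \<one>\<^bsub>B\<^esub>) (t a a') (t b b') = t (left_alternator A n a b) (a' \<otimes>\<^bsub>B\<^esub> b')"
      using ab N(1) unfolding left_alternator_def
      by (simp add: pure_associator_snd snd.unit_closed snd.unit_left snd.unit_right snd.mult_closed pure_add_left)
    then show "left_alternator T (t n \<one>\<^bsub>B\<^esub>) (t a a') (t b b') = \<zero>\<^bsub>T\<^esub>"
      using ab N pure_null_left snd.mult_closed by simp
  qed (use N(1) pure_closed snd.unit_closed in \<open>simp_all add: TA.left_alternator_add\<close>)
  then show ?thesis using N(1) pure_closed snd.unit_closed by (simp add: alternative_nucleus_def)
qed

lemma one_pure_in_nucleus:
  assumes n: "n \<in> alternative_nucleus B"
  shows "t \<one>\<^bsub>A\<^esub> n \<in> alternative_nucleus T"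
proof -
  note N = snd.alternative_nucleusD[OF n]
  have "left_alternator T (t \<one>\<^bsub>A\<^esub> n) x y = \<zero>\<^bsub>T\<^esub>" if "x \<in> carrier T" "y \<in> carrier T" for x y
    using _ _ _ that
  proof (rule tensor_bilinear_zero)
    fix a a' b b' assume ab: "a \<in> carrier A" "a' \<in> carrier B" "b \<in> carrier A" "b' \<in> carrier B"
    have "left_alternator T (t \<one>\<^bsub>A\<^esub> n) (t a a') (t b b') = t (a \<otimes>\<^bsub>A\<^esub> b) (left_alternator B n a' b')"
      using ab N(1) unfolding left_alternator_def
      by (simp add: pure_associator_fst fst.unit_closed fst.unit_left fst.unit_right fst.mult_closed pure_add_right)
    then show "left_alternator T (t \<one>\<^bsub>A\<^esub> n) (t a a') (t b b') = \<zero>\<^bsub>T\<^esub>"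
      using ab N pure_null_right fst.mult_closed by simp
  qed (use N(1) pure_closed fst.unit_closed in \<open>simp_all add: TA.left_alternator_add\<close>)
  then show ?thesis using N(1) pure_closed fst.unit_closed by (simp add: alternative_nucleus_def)
qed

lemma pure_commutator_fst: "a \<in> carrier A \<Longrightarrow> b \<in> carrier A \<Longrightarrow>
    commutator T (t a \<one>\<^bsub>B\<^esub>) (t b \<one>\<^bsub>B\<^esub>) = t (commutator A a b) \<one>\<^bsub>B\<^esub>"
  by (simp add: commutator_def pure_mult pure_minus_left' fst.mult_closed snd.unit_closed snd.unit_left)

lemma pure_commutator_snd: "a \<in> carrier B \<Longrightarrow> b \<in> carrier B \<Longrightarrow>
    commutator T (t \<one>\<^bsub>A\<^esub> a) (t \<one>\<^bsub>A\<^esub> b) = t \<one>\<^bsub>A\<^esub> (commutator B a b)"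
  by (simp add: commutator_def pure_mult pure_minus_right' snd.mult_closed fst.unit_closed fst.unit_left)

lemma pure_commutator_mixed: "a \<in> carrier A \<Longrightarrow> b \<in> carrier B \<Longrightarrow>
    commutator T (t a \<one>\<^bsub>B\<^esub>) (t \<one>\<^bsub>A\<^esub> b) = \<zero>\<^bsub>T\<^esub>"
  "a \<in> carrier A \<Longrightarrow> b \<in> carrier B \<Longrightarrow>
    commutator T (t \<one>\<^bsub>A\<^esub> b) (t a \<one>\<^bsub>B\<^esub>) = \<zero>\<^bsub>T\<^esub>"
  by (simp_all add: commutator_def pure_mult fst.unit_closed fst.unit_left fst.unit_right
      snd.unit_closed snd.unit_left snd.unit_right T.minus_eq T.r_neg pure_closed)

lemma factors_commutator:
  assumes "a \<in> carrier A" "a' \<in> carrier A" "b \<in> carrier B" "b' \<in> carrier B"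
  shows "commutator T (t a \<one>\<^bsub>B\<^esub> \<oplus>\<^bsub>T\<^esub> t \<one>\<^bsub>A\<^esub> b) (t a' \<one>\<^bsub>B\<^esub> \<oplus>\<^bsub>T\<^esub> t \<one>\<^bsub>A\<^esub> b') =
    t (commutator A a a') \<one>\<^bsub>B\<^esub> \<oplus>\<^bsub>T\<^esub> t \<one>\<^bsub>A\<^esub> (commutator B b b')"
  using assms
  by (simp add: TA.commutator_add_left TA.commutator_add_right pure_commutator_fst pure_commutator_snd
      pure_commutator_mixed pure_closed fst.unit_closed snd.unit_closed)

text \<open>
  Let \<open>w = c \<otimes> c'\<close> be a pure tensor. As \<open>(a, c, b) = - (c, a, b)\<close> in the first factor, the
  left alternator of \<open>w\<close>, \<open>a \<otimes> d\<close> and \<open>b \<otimes> 1\<close> is \<open>(c, a, b) \<otimes> [c', d]\<close>. Contracting with \<open>q\<close>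
  turns it into the commutator of \<open>d\<close> with the slice of \<open>w\<close> by the functional
  \<open>c \<mapsto> q (c, a, b)\<close>. Both sides are additive in \<open>w\<close>, and for \<open>w = s\<close> in the nucleus the
  alternator is zero.
\<close>

lemma nucleus_slice_central:
  assumes alt: "\<And>x y z. x \<in> carrier A \<Longrightarrow> y \<in> carrier A \<Longrightarrow> z \<in> carrier A \<Longrightarrow> left_alternator A x y z = \<zero>\<^bsub>A\<^esub>"
    and q: "q \<in> linear_functionals K A" and ab: "a \<in> carrier A" "b \<in> carrier A"
    and h: "h \<in> carrier T \<rightarrow> carrier B"
      "\<And>x y. x \<in> carrier T \<Longrightarrow> y \<in> carrier T \<Longrightarrow> h (x \<oplus>\<^bsub>T\<^esub> y) = h x \<oplus>\<^bsub>B\<^esub> h y"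
      "\<And>c d. c \<in> carrier A \<Longrightarrow> d \<in> carrier B \<Longrightarrow> h (t c d) = q (associator A c a b) \<odot>\<^bsub>B\<^esub> d"
    and s: "s \<in> alternative_nucleus T" and d: "d \<in> carrier B"
  shows "commutator B (h s) d = \<zero>\<^bsub>B\<^esub>"
proof -
  obtain g where g: "g \<in> carrier T \<rightarrow> carrier B"
    "\<And>x y. x \<in> carrier T \<Longrightarrow> y \<in> carrier T \<Longrightarrow> g (x \<oplus>\<^bsub>T\<^esub> y) = g x \<oplus>\<^bsub>B\<^esub> g y"
    "\<And>a b. a \<in> carrier A \<Longrightarrow> b \<in> carrier B \<Longrightarrow> g (t a b) = q a \<odot>\<^bsub>B\<^esub> b"
    by (rule functional_slice[OF q]) blast
  have q0: "q x \<in> carrier K" if "x \<in> carrier A" for x using q that by (auto simp: linear_functionals_def)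
  have qmin: "q (\<ominus>\<^bsub>A\<^esub> x) = \<ominus> q x" if "x \<in> carrier A" for x
  proof -
    have "q ((\<ominus> \<one>) \<odot>\<^bsub>A\<^esub> x) = (\<ominus> \<one>) \<otimes> q x" using q that by (auto simp: linear_functionals_def)
    then show ?thesis using that q0 by (simp add: fst.smult_l_minus fst.R.l_minus)
  qed
  have step: "g (left_alternator T w (t a d) (t b \<one>\<^bsub>B\<^esub>)) = commutator B (h w) d" if "w \<in> carrier T" for w
    using that
  proof (induction w rule: tensor_induct)
    case (pure c c')
    have "associator A c a b \<oplus>\<^bsub>A\<^esub> associator A a c b = \<zero>\<^bsub>A\<^esub>"
      using alt[of c a b] pure ab by (simp add: left_alternator_def)
    then have sw: "associator A a c b = \<ominus>\<^bsub>A\<^esub> associator A c a b"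
      using pure ab fst.M.minus_equality[of "associator A a c b" "associator A c a b"] fst.M.a_comm
      by simp
    have "left_alternator T (t c c') (t a d) (t b \<one>\<^bsub>B\<^esub>) =
        t (associator A c a b) (c' \<otimes>\<^bsub>B\<^esub> d) \<oplus>\<^bsub>T\<^esub> t (associator A a c b) (d \<otimes>\<^bsub>B\<^esub> c')"
      using pure ab d unfolding left_alternator_def
      by (simp add: pure_associator_snd snd.unit_closed snd.unit_right snd.mult_closed)
    then have "g (left_alternator T (t c c') (t a d) (t b \<one>\<^bsub>B\<^esub>)) =
        q (associator A c a b) \<odot>\<^bsub>B\<^esub> (c' \<otimes>\<^bsub>B\<^esub> d) \<oplus>\<^bsub>B\<^esub> (\<ominus> q (associator A c a b)) \<odot>\<^bsub>B\<^esub> (d \<otimes>\<^bsub>B\<^esub> c')"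
      using pure ab d by (simp add: g pure_closed snd.mult_closed sw qmin)
    also have "\<dots> = commutator B (h (t c c')) d"
      using pure ab d q0
      by (simp add: h commutator_def snd.smult_left snd.smult_right snd.mult_closed snd.smult_l_minus a_minus_def)
    finally show ?case .
  next
    case (add x y)
    have "h x \<in> carrier B" "h y \<in> carrier B" using h(1) add by auto
    then show ?case using add ab d pure_closed snd.unit_closed
      by (simp add: TA.left_alternator_add g(2) h(2) snd.commutator_add_left)
  qed
  note N = TA.alternative_nucleusD[OF s]
  have "g \<zero>\<^bsub>T\<^esub> = \<zero>\<^bsub>B\<^esub>"
    using g(3)[of "\<zero>\<^bsub>A\<^esub>" "\<zero>\<^bsub>B\<^esub>"] pure_null_left[of "\<zero>\<^bsub>B\<^esub>"] q0[of "\<zero>\<^bsub>A\<^esub>"] by simp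
  then show ?thesis
    using step[OF N(1)] N(2)[of "t a d" "t b \<one>\<^bsub>B\<^esub>"] ab d pure_closed snd.unit_closed by simp
qed

end

section \<open>Coordinates, centre and commutators of split composition algebras\<close>

fun zorn_coord :: "nat \<Rightarrow> 'a zorn \<Rightarrow> 'a"
  where "zorn_coord i (Zorn a (u1, u2, u3) (v1, v2, v3) b) = [a, u1, u2, u3, v1, v2, v3, b] ! i"

context cring begin

lemma zorn_coord_functional:
  assumes "i < 8"
  shows "zorn_coord i \<in> linear_functionals R (split_composition R m)"
proof -
  have i: "i \<in> {0, 1, 2, 3, 4, 5, 6, 7}" using assms by auto
  have 1: "zorn_coord i x \<in> carrier R" if "x \<in> zorn_carrier R m" for x
    using that i by (elim zorn_components) auto
  have 2: "zorn_coord i (zorn_add R x y) = zorn_coord i x \<oplus> zorn_coord i y"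
    if "x \<in> zorn_carrier R m" "y \<in> zorn_carrier R m" for x y
    using that i by (elim zorn_components) auto
  have 3: "zorn_coord i (zorn_scale R c x) = c \<otimes> zorn_coord i x"
    if "x \<in> zorn_carrier R m" for c x
    using that i by (elim zorn_components) auto
  show ?thesis using 1 2 3 by (auto simp: linear_functionals_def)
qed

lemma zorn_basis_members [simp]:
  "ze1 \<in> zorn_carrier R 8" "ze2 \<in> zorn_carrier R 8"
  "zu1 \<in> zorn_carrier R 8" "zu2 \<in> zorn_carrier R 8" "zu3 \<in> zorn_carrier R 8"
  "zv1 \<in> zorn_carrier R 8" "zv2 \<in> zorn_carrier R 8" "zv3 \<in> zorn_carrier R 8"
  using zorn_basis_closed by (simp_all add: zorn_basis_def)

text \<open>
  The difference of the diagonal entries of \<open>x\<close> and each of its off-diagonal coordinates occur as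
  a coordinate of an associator of \<open>x\<close> with two basis elements. These are all the coordinates of
  \<open>x\<close> modulo scalars.
\<close>

lemma zorn_associator_coords:
  assumes c: "{a, u1, u2, u3, v1, v2, v3, b} \<subseteq> carrier R"
  defines "x \<equiv> Zorn a (u1, u2, u3) (v1, v2, v3) b"
  shows "zorn_coord 5 (associator octonions x zu1 zu3) = a \<ominus> b"
    "zorn_coord 6 (associator octonions x ze1 zu2) = u1"
    "zorn_coord 4 (associator octonions x ze1 zu3) = u2"
    "zorn_coord 5 (associator octonions x ze1 zu1) = u3"
    "zorn_coord 3 (associator octonions x ze1 zv2) = v1"
    "zorn_coord 1 (associator octonions x ze1 zv3) = v2"
    "zorn_coord 2 (associator octonions x ze1 zv1) = v3"
proof -
  have minus: "y \<ominus>\<^bsub>octonions\<^esub> z = zorn_add R y (zorn_scale R (\<ominus> \<one>) z)"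
    if "z \<in> zorn_carrier R 8" for y z
    using that by (simp add: a_minus_def zorn_uminus)
  have x: "x \<in> zorn_carrier R 8" using c unfolding x_def by (simp add: zorn_mem_iff)
  have as: "associator octonions x y z =
      zorn_add R (zorn_mult R (zorn_mult R x y) z) (zorn_scale R (\<ominus> \<one>) (zorn_mult R x (zorn_mult R y z)))"
    if "y \<in> zorn_carrier R 8" "z \<in> zorn_carrier R 8" for y z
    using x that by (simp add: associator_def minus zorn_mult_closed)
  show "zorn_coord 5 (associator octonions x zu1 zu3) = a \<ominus> b"
    "zorn_coord 6 (associator octonions x ze1 zu2) = u1"
    "zorn_coord 4 (associator octonions x ze1 zu3) = u2"
    "zorn_coord 5 (associator octonions x ze1 zu1) = u3"
    "zorn_coord 3 (associator octonions x ze1 zv2) = v1"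
    "zorn_coord 1 (associator octonions x ze1 zv3) = v2"
    "zorn_coord 2 (associator octonions x ze1 zv1) = v3"
    using c by (simp_all add: as) (simp_all add: x_def zorn_basis_defs minus_eq l_minus a_comm)
qed

text \<open>
  Commuting with \<open>ze1\<close> forces the off-diagonal coordinates to vanish, and commuting with \<open>zu1\<close>
  makes the diagonal entries equal.
\<close>

lemma zorn_center:
  assumes m: "2 < m" and d: "d \<in> zorn_carrier R m"
    and comm: "\<And>x. x \<in> zorn_carrier R m \<Longrightarrow> commutator (split_composition R m) d x = \<zero>\<^bsub>split_composition R m\<^esub>"
  obtains c where "c \<in> carrier R" "d = zorn_scale R c \<one>\<^bsub>split_composition R m\<^esub>"
proof -
  interpret C: unital_algebra R "split_composition R m" by (rule zorn_unital_algebra)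
  have e: "ze1 \<in> zorn_carrier R m" "zu1 \<in> zorn_carrier R m"
    using m by (simp_all add: zorn_basis_defs zorn_mem_iff)
  have eq: "zorn_mult R d x = zorn_mult R x d" if x: "x \<in> zorn_carrier R m" for x
  proof -
    have "zorn_mult R d x \<ominus>\<^bsub>split_composition R m\<^esub> zorn_mult R x d = \<zero>\<^bsub>split_composition R m\<^esub>"
      using comm[OF x] by (simp add: commutator_def)
    then have "(zorn_mult R d x \<ominus>\<^bsub>split_composition R m\<^esub> zorn_mult R x d) \<oplus>\<^bsub>split_composition R m\<^esub> zorn_mult R x d
        = zorn_mult R x d"
      using C.M.l_zero[of "zorn_mult R x d"] x d zorn_mult_closed[of x m d] by simp
    then show ?thesis
      using C.mult_closed[of d x] C.mult_closed[of x d] x d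
        C.M.a_assoc[of "zorn_mult R d x" "\<ominus>\<^bsub>split_composition R m\<^esub> zorn_mult R x d" "zorn_mult R x d"]
        C.M.l_neg[of "zorn_mult R x d"] C.M.r_zero[of "zorn_mult R d x"] C.M.a_inv_closed[of "zorn_mult R x d"]
      by (simp add: C.M.minus_eq del: zorn_add.simps)
  qed
  show thesis
    using d
  proof (rule zorn_components)
    fix a u1 u2 u3 v1 v2 v3 b assume c: "d = Zorn a (u1, u2, u3) (v1, v2, v3) b"
      "a \<in> carrier R" "u1 \<in> carrier R" "u2 \<in> carrier R" "u3 \<in> carrier R"
      "v1 \<in> carrier R" "v2 \<in> carrier R" "v3 \<in> carrier R" "b \<in> carrier R"
    have z: "u1 = \<zero> \<and> u2 = \<zero> \<and> u3 = \<zero> \<and> v1 = \<zero> \<and> v2 = \<zero> \<and> v3 = \<zero>"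
      using eq[OF e(1)] c by (auto simp: zorn_basis_defs minus_eq)
    have "a = b" using eq[OF e(2)] c z by (simp add: zorn_basis_defs minus_eq)
    then show thesis using c z that[of a] by simp
  qed
qed

text \<open>
  The off-diagonal basis elements are commutators with an idempotent, and \<open>[zu1, zv1]\<close> is
  \<open>ze1 - ze2\<close>, from which half the sum with the unit recovers \<open>ze1\<close>. Dimension two is excluded:
  there all commutators vanish.
\<close>

lemma zorn_commutator_generate:
  assumes m: "m \<in> {1, 4, 8}" and two: "\<one> \<oplus> \<one> \<in> Units R"
    and V: "submodule V R (split_composition R m)" "\<one>\<^bsub>split_composition R m\<^esub> \<in> V"
      "\<And>x y. x \<in> zorn_carrier R m \<Longrightarrow> y \<in> zorn_carrier R m \<Longrightarrow> commutator (split_composition R m) x y \<in> V"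
  shows "V = zorn_carrier R m"
proof -
  let ?C = "split_composition R m"
  interpret C: unital_algebra R ?C by (rule zorn_unital_algebra)
  note E = C.submoduleE[OF V(1)]
  have add: "x \<in> V \<Longrightarrow> y \<in> V \<Longrightarrow> zorn_add R x y \<in> V" for x y using E(5)[of x y] by simp
  have scale: "c \<in> carrier R \<Longrightarrow> x \<in> V \<Longrightarrow> zorn_scale R c x \<in> V" for c x using E(4)[of c x] by simp
  have zero: "Zorn \<zero> (\<zero>, \<zero>, \<zero>) (\<zero>, \<zero>, \<zero>) \<zero> \<in> V" using C.submodule_zero[OF V(1)] by simp
  have com: "commutator ?C x y = zorn_add R (zorn_mult R x y) (zorn_scale R (\<ominus> \<one>) (zorn_mult R y x))"
    if "x \<in> zorn_carrier R m" "y \<in> zorn_carrier R m" for x y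
    using that by (simp add: commutator_def a_minus_def zorn_uminus zorn_mult_closed)
  have one: "Zorn \<one> (\<zero>, \<zero>, \<zero>) (\<zero>, \<zero>, \<zero>) \<one> \<in> V" using V(2) by simp
  have half_closed: "inv (\<one> \<oplus> \<one>) \<in> carrier R" using two by simp
  have half_add: "inv (\<one> \<oplus> \<one>) \<oplus> inv (\<one> \<oplus> \<one>) = \<one>"
    using r_distr[OF one_closed one_closed half_closed] Units_l_inv[OF two] half_closed
    by (simp del: Units_l_inv)
  have "x \<in> V" if x: "x \<in> zorn_carrier R m" for x
    using x
  proof (rule zorn_cases)
    fix a u1 u2 u3 v1 v2 v3 b assume c: "x = Zorn a (u1, u2, u3) (v1, v2, v3) b"
      "a \<in> carrier R" "u1 \<in> carrier R" "u2 \<in> carrier R" "u3 \<in> carrier R"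
      "v1 \<in> carrier R" "v2 \<in> carrier R" "v3 \<in> carrier R" "b \<in> carrier R"
      and c0: "m \<le> 4 \<Longrightarrow> u2 = \<zero>" "m \<le> 4 \<Longrightarrow> u3 = \<zero>" "m \<le> 4 \<Longrightarrow> v2 = \<zero>" "m \<le> 4 \<Longrightarrow> v3 = \<zero>"
      "m \<le> 2 \<Longrightarrow> u1 = \<zero>" "m \<le> 2 \<Longrightarrow> v1 = \<zero>" "m \<le> 1 \<Longrightarrow> a = b"
    consider "m = 1" | "m = 4" | "m = 8" using m by auto
    then show ?thesis
    proof cases
      case 1
      then have "x = zorn_scale R a (Zorn \<one> (\<zero>, \<zero>, \<zero>) (\<zero>, \<zero>, \<zero>) \<one>)" using c c0 by simp
      with scale[OF c(2) one] show ?thesis by (simp only:)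
    next
      case 2
      have mem: "ze1 \<in> zorn_carrier R m" "ze2 \<in> zorn_carrier R m" "zu1 \<in> zorn_carrier R m" "zv1 \<in> zorn_carrier R m"
        using 2 by (simp_all add: zorn_basis_defs zorn_mem_iff)
      have "zu1 = commutator ?C ze1 zu1" "zv1 = commutator ?C ze2 zv1"
        using mem by (simp_all add: com) (simp_all add: zorn_basis_defs minus_eq)
      then have uv: "zu1 \<in> V" "zv1 \<in> V" using V(3) mem by metis+
      define h where "h = inv (\<one> \<oplus> \<one>)"
      have h: "h \<in> carrier R" "h \<oplus> h = \<one>"
        using half_closed half_add by (simp_all add: h_def)
      have "ze1 = zorn_scale R h (zorn_add R (Zorn \<one> (\<zero>, \<zero>, \<zero>) (\<zero>, \<zero>, \<zero>) \<one>) (commutator ?C zu1 zv1))"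
        using mem h by (simp add: com) (simp add: zorn_basis_defs minus_eq r_distr r_neg)
      then have e1: "ze1 \<in> V" using scale add one V(3) mem h by metis
      have "ze2 = zorn_add R (Zorn \<one> (\<zero>, \<zero>, \<zero>) (\<zero>, \<zero>, \<zero>) \<one>) (zorn_scale R (\<ominus> \<one>) ze1)"
        by (simp add: zorn_basis_defs r_neg)
      then have e2: "ze2 \<in> V" using scale add one e1 by (metis a_inv_closed one_closed)
      have "x = zorn_add R (zorn_scale R a ze1) (zorn_add R (zorn_scale R u1 zu1)
          (zorn_add R (zorn_scale R v1 zv1) (zorn_scale R b ze2)))"
        using c c0 2 by (simp add: zorn_basis_defs)
      then show ?thesis using add scale uv e1 e2 c by simp
    next
      case 3
      have mem: "ze1 \<in> zorn_carrier R m" "ze2 \<in> zorn_carrier R m"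
        "zu1 \<in> zorn_carrier R m" "zu2 \<in> zorn_carrier R m" "zu3 \<in> zorn_carrier R m"
        "zv1 \<in> zorn_carrier R m" "zv2 \<in> zorn_carrier R m" "zv3 \<in> zorn_carrier R m"
        using 3 by simp_all
      have "zu1 = commutator ?C ze1 zu1" "zv1 = commutator ?C ze2 zv1"
        "zu2 = commutator ?C ze1 zu2" "zv2 = commutator ?C ze2 zv2"
        "zu3 = commutator ?C ze1 zu3" "zv3 = commutator ?C ze2 zv3"
        using mem by (simp_all add: com) (simp_all add: zorn_basis_defs minus_eq)
      then have uv: "zu1 \<in> V" "zv1 \<in> V" "zu2 \<in> V" "zv2 \<in> V" "zu3 \<in> V" "zv3 \<in> V" using V(3) mem by metis+
      define h where "h = inv (\<one> \<oplus> \<one>)"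
      have h: "h \<in> carrier R" "h \<oplus> h = \<one>"
        using half_closed half_add by (simp_all add: h_def)
      have "ze1 = zorn_scale R h (zorn_add R (Zorn \<one> (\<zero>, \<zero>, \<zero>) (\<zero>, \<zero>, \<zero>) \<one>) (commutator ?C zu1 zv1))"
        using mem h by (simp add: com) (simp add: zorn_basis_defs minus_eq r_distr r_neg)
      then have e1: "ze1 \<in> V" using scale add one V(3) mem h by metis
      have "ze2 = zorn_add R (Zorn \<one> (\<zero>, \<zero>, \<zero>) (\<zero>, \<zero>, \<zero>) \<one>) (zorn_scale R (\<ominus> \<one>) ze1)"
        by (simp add: zorn_basis_defs r_neg)
      then have e2: "ze2 \<in> V" using scale add one e1 by (metis a_inv_closed one_closed)
      show ?thesis
        unfolding c(1) using zorn_expand[of a u1 u2 u3 v1 v2 v3 b] c(2-) add scale uv e1 e2 by simp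
    qed
  qed
  moreover have "V \<subseteq> zorn_carrier R m" using E(1) by simp
  ultimately show ?thesis by blast
qed

text \<open>
  The trace, which is the sum of the diagonal entries, agrees on \<open>x y\<close> and \<open>y x\<close>. A commutator
  therefore has trace zero, and conjugation negates the elements of trace zero.
\<close>

lemma zorn_commutator_skew:
  assumes "x \<in> zorn_carrier R m" "y \<in> zorn_carrier R m"
  shows "zorn_conj R (commutator (split_composition R m) x y) =
    \<ominus>\<^bsub>split_composition R m\<^esub> commutator (split_composition R m) x y"
proof -
  have m: "zorn_mult R x y \<in> zorn_carrier R m" "zorn_mult R y x \<in> zorn_carrier R m"
    using assms zorn_mult_closed by auto
  have tr: "zorn_coord 0 (zorn_mult R x y) \<oplus> zorn_coord 7 (zorn_mult R x y) =
      zorn_coord 0 (zorn_mult R y x) \<oplus> zorn_coord 7 (zorn_mult R y x)"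
    using assms by (elim zorn_components) (simp add: a_ac m_ac)
  have com: "commutator (split_composition R m) x y =
      zorn_add R (zorn_mult R x y) (zorn_scale R (\<ominus> \<one>) (zorn_mult R y x))"
    using m by (simp add: commutator_def a_minus_def zorn_uminus)
  have cm: "commutator (split_composition R m) x y \<in> zorn_carrier R m"
    unfolding com using m by (simp add: zorn_add_closed zorn_scale_closed)
  show ?thesis
    unfolding zorn_uminus[OF cm] unfolding com using m tr
  proof (elim zorn_components)
    fix a u1 u2 u3 v1 v2 v3 b a' u1' u2' u3' v1' v2' v3' b'
    assume "zorn_mult R x y = Zorn a (u1, u2, u3) (v1, v2, v3) b"
      "zorn_mult R y x = Zorn a' (u1', u2', u3') (v1', v2', v3') b'"
      "a \<in> carrier R" "u1 \<in> carrier R" "u2 \<in> carrier R" "u3 \<in> carrier R"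
      "v1 \<in> carrier R" "v2 \<in> carrier R" "v3 \<in> carrier R" "b \<in> carrier R"
      "a' \<in> carrier R" "u1' \<in> carrier R" "u2' \<in> carrier R" "u3' \<in> carrier R"
      "v1' \<in> carrier R" "v2' \<in> carrier R" "v3' \<in> carrier R" "b' \<in> carrier R"
      and tr: "zorn_coord 0 (zorn_mult R x y) \<oplus> zorn_coord 7 (zorn_mult R x y) =
        zorn_coord 0 (zorn_mult R y x) \<oplus> zorn_coord 7 (zorn_mult R y x)"
    note * = this
    have tr': "a \<oplus> b = a' \<oplus> b'" using tr * by simp
    have "b \<oplus> \<ominus> b' = \<ominus> (a \<oplus> \<ominus> a')"
    proof -
      have "b = \<ominus> a \<oplus> (a' \<oplus> b')" using tr'[symmetric] * by (simp add: r_neg1)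
      then have "b \<oplus> \<ominus> b' = \<ominus> a \<oplus> (a' \<oplus> b') \<oplus> \<ominus> b'" by simp
      then show ?thesis using * by (simp add: a_assoc minus_add r_neg)
    qed
    moreover from this have "a \<oplus> \<ominus> a' = \<ominus> (b \<oplus> \<ominus> b')" using * by simp
    ultimately show "zorn_conj R (zorn_add R (zorn_mult R x y) (zorn_scale R (\<ominus> \<one>) (zorn_mult R y x))) =
      zorn_scale R (\<ominus> \<one>) (zorn_add R (zorn_mult R x y) (zorn_scale R (\<ominus> \<one>) (zorn_mult R y x)))"
      using * by (simp add: l_minus)
  qed
qed

end

section \<open>The nucleus of an octonion tensor product\<close>

lemma (in tensor_algebras) additive_eqI:
  assumes g: "\<And>x y. x \<in> carrier T \<Longrightarrow> y \<in> carrier T \<Longrightarrow> g (x \<oplus>\<^bsub>T\<^esub> y) = g x \<oplus>\<^bsub>T\<^esub> g y"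
    and pure: "\<And>a b. a \<in> carrier A \<Longrightarrow> b \<in> carrier B \<Longrightarrow> g (t a b) = t a b"
    and z: "z \<in> carrier T"
  shows "g z = z"
  using z by (induction z rule: tensor_induct) (auto simp: g pure)

context cring begin

text \<open>
  By \<open>nucleus_slice_central\<close> and \<open>zorn_associator_coords\<close> the coordinates of \<open>s\<close> in the second
  factor, taken along \<open>ze1\<close> and the six off-diagonal basis elements, are central and hence scalars.
  These terms combine to \<open>c \<otimes> 1\<close>, and only the coordinate along the unit remains free.
\<close>

lemma octonion_nucleus:
  assumes n: "2 < n" and s: "s \<in> alternative_nucleus (tensor_product R octonions (split_composition R n))"
  obtains c d where "c \<in> zorn_carrier R 8" "d \<in> zorn_carrier R n"
    "s = pure_tensor R octonions (split_composition R n) c \<one>\<^bsub>split_composition R n\<^esub>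
      \<oplus>\<^bsub>tensor_product R octonions (split_composition R n)\<^esub>
      pure_tensor R octonions (split_composition R n) \<one>\<^bsub>octonions\<^esub> d"
proof -
  let ?O = "octonions" and ?D = "split_composition R n"
  interpret tensor_algebras R ?O ?D
    by (intro tensor_algebras.intro zorn_unital_algebra)
  have sT: "s \<in> carrier T" by (rule TA.alternative_nucleusD(1)[OF s])
  have alt: "left_alternator ?O x y z = \<zero>\<^bsub>?O\<^esub>" if "x \<in> carrier ?O" "y \<in> carrier ?O" "z \<in> carrier ?O" for x y z
    using that by (intro zorn_alternators) simp_all
  have central: "\<exists>\<beta>\<in>carrier R. h s = \<beta> \<odot>\<^bsub>?D\<^esub> \<one>\<^bsub>?D\<^esub>"
    if h: "h \<in> carrier T \<rightarrow> carrier ?D"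
      "\<And>x y. x \<in> carrier T \<Longrightarrow> y \<in> carrier T \<Longrightarrow> h (x \<oplus>\<^bsub>T\<^esub> y) = h x \<oplus>\<^bsub>?D\<^esub> h y"
      "\<And>c d. c \<in> carrier ?O \<Longrightarrow> d \<in> carrier ?D \<Longrightarrow> h (t c d) = zorn_coord i (associator ?O c a b) \<odot>\<^bsub>?D\<^esub> d"
      and "i < 8" "a \<in> zorn_carrier R 8" "b \<in> zorn_carrier R 8" for h i a b
  proof -
    have "commutator ?D (h s) d = \<zero>\<^bsub>?D\<^esub>" if "d \<in> zorn_carrier R n" for d
      using nucleus_slice_central[OF alt zorn_coord_functional[OF \<open>i < 8\<close>] _ _ h s, of d] that
        \<open>a \<in> zorn_carrier R 8\<close> \<open>b \<in> zorn_carrier R 8\<close> by simp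
    moreover have "h s \<in> zorn_carrier R n" using h(1) sT by auto
    ultimately obtain c where "c \<in> carrier R" "h s = zorn_scale R c \<one>\<^bsub>?D\<^esub>" using zorn_center[OF n] by metis
    then show ?thesis by auto
  qed
  have slice: "\<exists>h. h \<in> carrier T \<rightarrow> carrier ?D \<and>
      (\<forall>x\<in>carrier T. \<forall>y\<in>carrier T. h (x \<oplus>\<^bsub>T\<^esub> y) = h x \<oplus>\<^bsub>?D\<^esub> h y) \<and>
      (\<forall>c\<in>carrier ?O. \<forall>d\<in>carrier ?D. h (t c d) = l c \<odot>\<^bsub>?D\<^esub> d)"
    if "l \<in> linear_functionals R ?O" for l
    by (rule functional_slice[OF that]) blast
  have assoc_functional: "(\<lambda>c. zorn_coord i (associator ?O c a b)) \<in> linear_functionals R ?O"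
    if "i < 8" "a \<in> zorn_carrier R 8" "b \<in> zorn_carrier R 8" for i a b
  proof -
    note Z = zorn_coord_functional[OF \<open>i < 8\<close>, where m = 8, unfolded linear_functionals_def]
    have q: "x \<in> carrier ?O \<Longrightarrow> zorn_coord i x \<in> carrier R"
      "x \<in> carrier ?O \<Longrightarrow> y \<in> carrier ?O \<Longrightarrow> zorn_coord i (x \<oplus>\<^bsub>?O\<^esub> y) = zorn_coord i x \<oplus> zorn_coord i y"
      "r \<in> carrier R \<Longrightarrow> x \<in> carrier ?O \<Longrightarrow> zorn_coord i (r \<odot>\<^bsub>?O\<^esub> x) = r \<otimes> zorn_coord i x" for x y r
      using Z by (auto simp del: split_composition_simps)
    have cl: "associator ?O c a b \<in> carrier ?O" if "c \<in> carrier ?O" for c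
      using that \<open>a \<in> zorn_carrier R 8\<close> \<open>b \<in> zorn_carrier R 8\<close> by (intro fst.associator_closed) simp_all
    have ab: "a \<in> carrier ?O" "b \<in> carrier ?O" using that by simp_all
    show ?thesis unfolding linear_functionals_def
      using q cl fst.associator_add(1)[OF _ _ ab] fst.associator_smult(1)[OF _ _ ab]
      by (intro CollectI conjI ballI Pi_I) (simp_all del: split_composition_simps)
  qed
  have central_slice: "\<exists>h. h \<in> carrier T \<rightarrow> carrier ?D \<and>
      (\<forall>x\<in>carrier T. \<forall>y\<in>carrier T. h (x \<oplus>\<^bsub>T\<^esub> y) = h x \<oplus>\<^bsub>?D\<^esub> h y) \<and>
      (\<forall>c\<in>carrier ?O. \<forall>d\<in>carrier ?D. h (t c d) = zorn_coord i (associator ?O c a b) \<odot>\<^bsub>?D\<^esub> d) \<and>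
      (\<exists>\<beta>\<in>carrier R. h s = \<beta> \<odot>\<^bsub>?D\<^esub> \<one>\<^bsub>?D\<^esub>)"
    if "i < 8" "a \<in> zorn_carrier R 8" "b \<in> zorn_carrier R 8" for i a b
  proof -
    note abi = that
    obtain h where "h \<in> carrier T \<rightarrow> carrier ?D"
      "\<forall>x\<in>carrier T. \<forall>y\<in>carrier T. h (x \<oplus>\<^bsub>T\<^esub> y) = h x \<oplus>\<^bsub>?D\<^esub> h y"
      "\<forall>c\<in>carrier ?O. \<forall>d\<in>carrier ?D. h (t c d) = zorn_coord i (associator ?O c a b) \<odot>\<^bsub>?D\<^esub> d"
      using slice[OF assoc_functional[OF abi]] by blast
    then show ?thesis using central[of h i a b] abi by blast
  qed
  \<comment> \<open>Coordinates are taken with respect to \<open>1\<close>, the first idempotent, and the six off-diagonal units.\<close>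
  obtain h0 where h0: "h0 \<in> carrier T \<rightarrow> carrier ?D"
    "\<forall>x\<in>carrier T. \<forall>y\<in>carrier T. h0 (x \<oplus>\<^bsub>T\<^esub> y) = h0 x \<oplus>\<^bsub>?D\<^esub> h0 y"
    "\<forall>c\<in>carrier ?O. \<forall>d\<in>carrier ?D. h0 (t c d) = zorn_coord 7 c \<odot>\<^bsub>?D\<^esub> d"
    using slice[OF zorn_coord_functional[of 7]] by auto
  obtain h1 b1 where h1: "h1 \<in> carrier T \<rightarrow> carrier ?D"
    "\<forall>x\<in>carrier T. \<forall>y\<in>carrier T. h1 (x \<oplus>\<^bsub>T\<^esub> y) = h1 x \<oplus>\<^bsub>?D\<^esub> h1 y"
    "\<forall>c\<in>carrier ?O. \<forall>d\<in>carrier ?D. h1 (t c d) = zorn_coord 5 (associator ?O c zu1 zu3) \<odot>\<^bsub>?D\<^esub> d"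
    "b1 \<in> carrier R" "h1 s = b1 \<odot>\<^bsub>?D\<^esub> \<one>\<^bsub>?D\<^esub>"
    using central_slice[of 5 zu1 zu3] by auto
  obtain h2 b2 where h2: "h2 \<in> carrier T \<rightarrow> carrier ?D"
    "\<forall>x\<in>carrier T. \<forall>y\<in>carrier T. h2 (x \<oplus>\<^bsub>T\<^esub> y) = h2 x \<oplus>\<^bsub>?D\<^esub> h2 y"
    "\<forall>c\<in>carrier ?O. \<forall>d\<in>carrier ?D. h2 (t c d) = zorn_coord 6 (associator ?O c ze1 zu2) \<odot>\<^bsub>?D\<^esub> d"
    "b2 \<in> carrier R" "h2 s = b2 \<odot>\<^bsub>?D\<^esub> \<one>\<^bsub>?D\<^esub>"
    using central_slice[of 6 ze1 zu2] by auto
  obtain h3 b3 where h3: "h3 \<in> carrier T \<rightarrow> carrier ?D"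
    "\<forall>x\<in>carrier T. \<forall>y\<in>carrier T. h3 (x \<oplus>\<^bsub>T\<^esub> y) = h3 x \<oplus>\<^bsub>?D\<^esub> h3 y"
    "\<forall>c\<in>carrier ?O. \<forall>d\<in>carrier ?D. h3 (t c d) = zorn_coord 4 (associator ?O c ze1 zu3) \<odot>\<^bsub>?D\<^esub> d"
    "b3 \<in> carrier R" "h3 s = b3 \<odot>\<^bsub>?D\<^esub> \<one>\<^bsub>?D\<^esub>"
    using central_slice[of 4 ze1 zu3] by auto
  obtain h4 b4 where h4: "h4 \<in> carrier T \<rightarrow> carrier ?D"
    "\<forall>x\<in>carrier T. \<forall>y\<in>carrier T. h4 (x \<oplus>\<^bsub>T\<^esub> y) = h4 x \<oplus>\<^bsub>?D\<^esub> h4 y"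
    "\<forall>c\<in>carrier ?O. \<forall>d\<in>carrier ?D. h4 (t c d) = zorn_coord 5 (associator ?O c ze1 zu1) \<odot>\<^bsub>?D\<^esub> d"
    "b4 \<in> carrier R" "h4 s = b4 \<odot>\<^bsub>?D\<^esub> \<one>\<^bsub>?D\<^esub>"
    using central_slice[of 5 ze1 zu1] by auto
  obtain h5 b5 where h5: "h5 \<in> carrier T \<rightarrow> carrier ?D"
    "\<forall>x\<in>carrier T. \<forall>y\<in>carrier T. h5 (x \<oplus>\<^bsub>T\<^esub> y) = h5 x \<oplus>\<^bsub>?D\<^esub> h5 y"
    "\<forall>c\<in>carrier ?O. \<forall>d\<in>carrier ?D. h5 (t c d) = zorn_coord 3 (associator ?O c ze1 zv2) \<odot>\<^bsub>?D\<^esub> d"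
    "b5 \<in> carrier R" "h5 s = b5 \<odot>\<^bsub>?D\<^esub> \<one>\<^bsub>?D\<^esub>"
    using central_slice[of 3 ze1 zv2] by auto
  obtain h6 b6 where h6: "h6 \<in> carrier T \<rightarrow> carrier ?D"
    "\<forall>x\<in>carrier T. \<forall>y\<in>carrier T. h6 (x \<oplus>\<^bsub>T\<^esub> y) = h6 x \<oplus>\<^bsub>?D\<^esub> h6 y"
    "\<forall>c\<in>carrier ?O. \<forall>d\<in>carrier ?D. h6 (t c d) = zorn_coord 1 (associator ?O c ze1 zv3) \<odot>\<^bsub>?D\<^esub> d"
    "b6 \<in> carrier R" "h6 s = b6 \<odot>\<^bsub>?D\<^esub> \<one>\<^bsub>?D\<^esub>"
    using central_slice[of 1 ze1 zv3] by auto
  obtain h7 b7 where h7: "h7 \<in> carrier T \<rightarrow> carrier ?D"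
    "\<forall>x\<in>carrier T. \<forall>y\<in>carrier T. h7 (x \<oplus>\<^bsub>T\<^esub> y) = h7 x \<oplus>\<^bsub>?D\<^esub> h7 y"
    "\<forall>c\<in>carrier ?O. \<forall>d\<in>carrier ?D. h7 (t c d) = zorn_coord 2 (associator ?O c ze1 zv1) \<odot>\<^bsub>?D\<^esub> d"
    "b7 \<in> carrier R" "h7 s = b7 \<odot>\<^bsub>?D\<^esub> \<one>\<^bsub>?D\<^esub>"
    using central_slice[of 2 ze1 zv1] by auto
  define add where "add g \<longleftrightarrow> g \<in> carrier T \<rightarrow> carrier T \<and>
    (\<forall>x\<in>carrier T. \<forall>y\<in>carrier T. g (x \<oplus>\<^bsub>T\<^esub> y) = g x \<oplus>\<^bsub>T\<^esub> g y)" for g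
  have add_sum: "add (\<lambda>x. g x \<oplus>\<^bsub>T\<^esub> g' x)" if "add g" "add g'" for g g'
    using that add_swap unfolding add_def by (auto simp: Pi_iff)
  have add_pure: "add (\<lambda>x. t e (h x))"
    if "h \<in> carrier T \<rightarrow> carrier ?D" "\<forall>x\<in>carrier T. \<forall>y\<in>carrier T. h (x \<oplus>\<^bsub>T\<^esub> y) = h x \<oplus>\<^bsub>?D\<^esub> h y"
      "e \<in> carrier ?O" for e h
  proof -
    have "h x \<in> carrier ?D" if "x \<in> carrier T" for x using that \<open>h \<in> carrier T \<rightarrow> carrier ?D\<close> by blast
    then show ?thesis unfolding add_def using that pure_add_right pure_closed by (auto simp del: split_composition_simps)
  qed
  have e: "ze1 \<in> carrier ?O" "zu1 \<in> carrier ?O" "zu2 \<in> carrier ?O" "zu3 \<in> carrier ?O"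
    "zv1 \<in> carrier ?O" "zv2 \<in> carrier ?O" "zv3 \<in> carrier ?O" by simp_all
  note one = fst.unit_closed snd.unit_closed
  define g where "g x = t ze1 (h1 x) \<oplus>\<^bsub>T\<^esub> (t zu1 (h2 x) \<oplus>\<^bsub>T\<^esub> (t zu2 (h3 x) \<oplus>\<^bsub>T\<^esub> (t zu3 (h4 x) \<oplus>\<^bsub>T\<^esub>
     (t zv1 (h5 x) \<oplus>\<^bsub>T\<^esub> (t zv2 (h6 x) \<oplus>\<^bsub>T\<^esub> (t zv3 (h7 x) \<oplus>\<^bsub>T\<^esub> t \<one>\<^bsub>?O\<^esub> (h0 x)))))))" for x
  have g_add: "add g"
    unfolding g_def by (intro add_sum add_pure) (use h0 h1 h2 h3 h4 h5 h6 h7 e one in blast)+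
  have g_pure: "g (t c d) = t c d" if c: "c \<in> carrier ?O" and d: "d \<in> carrier ?D" for c d
  proof -
    obtain a u1 u2 u3 v1 v2 v3 b where cc: "c = Zorn a (u1, u2, u3) (v1, v2, v3) b"
      "{a, u1, u2, u3, v1, v2, v3, b} \<subseteq> carrier R"
      using c unfolding split_composition_simps by (elim zorn_components) simp
    note co = zorn_associator_coords[OF cc(2), folded cc(1)]
    have in_R: "a \<in> carrier R" "u1 \<in> carrier R" "u2 \<in> carrier R" "u3 \<in> carrier R"
      "v1 \<in> carrier R" "v2 \<in> carrier R" "v3 \<in> carrier R" "b \<in> carrier R" "a \<ominus> b \<in> carrier R"
      using cc(2) by auto
    have h: "h1 (t c d) = (a \<ominus> b) \<odot>\<^bsub>?D\<^esub> d" "h2 (t c d) = u1 \<odot>\<^bsub>?D\<^esub> d" "h3 (t c d) = u2 \<odot>\<^bsub>?D\<^esub> d"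
      "h4 (t c d) = u3 \<odot>\<^bsub>?D\<^esub> d" "h5 (t c d) = v1 \<odot>\<^bsub>?D\<^esub> d" "h6 (t c d) = v2 \<odot>\<^bsub>?D\<^esub> d"
      "h7 (t c d) = v3 \<odot>\<^bsub>?D\<^esub> d" "h0 (t c d) = b \<odot>\<^bsub>?D\<^esub> d"
      using h0(3) h1(3) h2(3) h3(3) h4(3) h5(3) h6(3) h7(3) c d co cc(1) by (simp_all del: split_composition_simps)
    have "c = (a \<ominus> b) \<odot>\<^bsub>?O\<^esub> ze1 \<oplus>\<^bsub>?O\<^esub> (u1 \<odot>\<^bsub>?O\<^esub> zu1 \<oplus>\<^bsub>?O\<^esub> (u2 \<odot>\<^bsub>?O\<^esub> zu2 \<oplus>\<^bsub>?O\<^esub> (u3 \<odot>\<^bsub>?O\<^esub> zu3 \<oplus>\<^bsub>?O\<^esub>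
       (v1 \<odot>\<^bsub>?O\<^esub> zv1 \<oplus>\<^bsub>?O\<^esub> (v2 \<odot>\<^bsub>?O\<^esub> zv2 \<oplus>\<^bsub>?O\<^esub> (v3 \<odot>\<^bsub>?O\<^esub> zv3 \<oplus>\<^bsub>?O\<^esub> b \<odot>\<^bsub>?O\<^esub> \<one>\<^bsub>?O\<^esub>))))))"
      using in_R cc(1) by (simp add: zorn_basis_defs minus_eq a_assoc l_neg)
    then have "t c d = t ((a \<ominus> b) \<odot>\<^bsub>?O\<^esub> ze1 \<oplus>\<^bsub>?O\<^esub> (u1 \<odot>\<^bsub>?O\<^esub> zu1 \<oplus>\<^bsub>?O\<^esub> (u2 \<odot>\<^bsub>?O\<^esub> zu2 \<oplus>\<^bsub>?O\<^esub> (u3 \<odot>\<^bsub>?O\<^esub> zu3 \<oplus>\<^bsub>?O\<^esub>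
       (v1 \<odot>\<^bsub>?O\<^esub> zv1 \<oplus>\<^bsub>?O\<^esub> (v2 \<odot>\<^bsub>?O\<^esub> zv2 \<oplus>\<^bsub>?O\<^esub> (v3 \<odot>\<^bsub>?O\<^esub> zv3 \<oplus>\<^bsub>?O\<^esub> b \<odot>\<^bsub>?O\<^esub> \<one>\<^bsub>?O\<^esub>))))))) d"
      by (rule arg_cong)
    also have "\<dots> = g (t c d)"
      unfolding g_def h using in_R d e one
      by (simp add: pure_add_left pure_balanced[symmetric] del: split_composition_simps)
    finally show ?thesis by simp
  qed
  \<comment> \<open>The map \<open>g\<close> reassembles a tensor from its coordinates, so it fixes \<open>s\<close>.\<close>
  have "s = g s"
    by (rule additive_eqI[symmetric, OF _ g_pure sT]) (use g_add in \<open>simp add: add_def\<close>)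
  also have "g s = t ze1 (b1 \<odot>\<^bsub>?D\<^esub> \<one>\<^bsub>?D\<^esub>) \<oplus>\<^bsub>T\<^esub> (t zu1 (b2 \<odot>\<^bsub>?D\<^esub> \<one>\<^bsub>?D\<^esub>) \<oplus>\<^bsub>T\<^esub> (t zu2 (b3 \<odot>\<^bsub>?D\<^esub> \<one>\<^bsub>?D\<^esub>) \<oplus>\<^bsub>T\<^esub>
     (t zu3 (b4 \<odot>\<^bsub>?D\<^esub> \<one>\<^bsub>?D\<^esub>) \<oplus>\<^bsub>T\<^esub> (t zv1 (b5 \<odot>\<^bsub>?D\<^esub> \<one>\<^bsub>?D\<^esub>) \<oplus>\<^bsub>T\<^esub> (t zv2 (b6 \<odot>\<^bsub>?D\<^esub> \<one>\<^bsub>?D\<^esub>) \<oplus>\<^bsub>T\<^esub>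
     (t zv3 (b7 \<odot>\<^bsub>?D\<^esub> \<one>\<^bsub>?D\<^esub>) \<oplus>\<^bsub>T\<^esub> t \<one>\<^bsub>?O\<^esub> (h0 s)))))))"
    unfolding g_def h1(5) h2(5) h3(5) h4(5) h5(5) h6(5) h7(5) by (rule refl)
  also have "\<dots> = t (b1 \<odot>\<^bsub>?O\<^esub> ze1 \<oplus>\<^bsub>?O\<^esub> (b2 \<odot>\<^bsub>?O\<^esub> zu1 \<oplus>\<^bsub>?O\<^esub> (b3 \<odot>\<^bsub>?O\<^esub> zu2 \<oplus>\<^bsub>?O\<^esub> (b4 \<odot>\<^bsub>?O\<^esub> zu3 \<oplus>\<^bsub>?O\<^esub>
     (b5 \<odot>\<^bsub>?O\<^esub> zv1 \<oplus>\<^bsub>?O\<^esub> (b6 \<odot>\<^bsub>?O\<^esub> zv2 \<oplus>\<^bsub>?O\<^esub> b7 \<odot>\<^bsub>?O\<^esub> zv3)))))) \<one>\<^bsub>?D\<^esub> \<oplus>\<^bsub>T\<^esub> t \<one>\<^bsub>?O\<^esub> (h0 s)"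
    using h1(4) h2(4) h3(4) h4(4) h5(4) h6(4) h7(4) e one funcset_mem[OF h0(1) sT]
    by (simp add: pure_add_left pure_balanced T.a_assoc pure_closed del: split_composition_simps)
  finally show thesis
  proof (rule that[rotated 2])
    show "h0 s \<in> zorn_carrier R n" using funcset_mem[OF h0(1) sT] by simp
    show "b1 \<odot>\<^bsub>?O\<^esub> ze1 \<oplus>\<^bsub>?O\<^esub> (b2 \<odot>\<^bsub>?O\<^esub> zu1 \<oplus>\<^bsub>?O\<^esub> (b3 \<odot>\<^bsub>?O\<^esub> zu2 \<oplus>\<^bsub>?O\<^esub> (b4 \<odot>\<^bsub>?O\<^esub> zu3 \<oplus>\<^bsub>?O\<^esub>
     (b5 \<odot>\<^bsub>?O\<^esub> zv1 \<oplus>\<^bsub>?O\<^esub> (b6 \<odot>\<^bsub>?O\<^esub> zv2 \<oplus>\<^bsub>?O\<^esub> b7 \<odot>\<^bsub>?O\<^esub> zv3))))) \<in> zorn_carrier R 8"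
      using h1(4) h2(4) h3(4) h4(4) h5(4) h6(4) h7(4) by (simp add: zorn_add_closed zorn_scale_closed)
  qed
qed

end

section \<open>Products of split composition algebras\<close>

context cring begin

lemma zorn_conj_simps:
  "x \<in> zorn_carrier R m \<Longrightarrow> y \<in> zorn_carrier R m \<Longrightarrow> zorn_conj R (zorn_add R x y) = zorn_add R (zorn_conj R x) (zorn_conj R y)"
  "c \<in> carrier R \<Longrightarrow> x \<in> zorn_carrier R m \<Longrightarrow> zorn_conj R (zorn_scale R c x) = zorn_scale R c (zorn_conj R x)"
  "zorn_conj R \<one>\<^bsub>split_composition R m\<^esub> = \<one>\<^bsub>split_composition R m\<^esub>"
proof -
  show "zorn_conj R (zorn_add R x y) = zorn_add R (zorn_conj R x) (zorn_conj R y)"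
    if "x \<in> zorn_carrier R m" "y \<in> zorn_carrier R m"
    using that by (elim zorn_components) (simp add: minus_add)
  show "zorn_conj R (zorn_scale R c x) = zorn_scale R c (zorn_conj R x)"
    if "c \<in> carrier R" "x \<in> zorn_carrier R m"
    using that by (elim zorn_components) (simp add: r_minus)
qed simp

end

locale split_product = cring K for K (structure) + fixes m n :: nat

abbreviation (in split_product) C1 where "C1 \<equiv> split_composition K m"
abbreviation (in split_product) C2 where "C2 \<equiv> split_composition K n"

sublocale split_product \<subseteq> tensor_algebras K C1 C2
  by (intro tensor_algebras.intro zorn_unital_algebra)

context split_product begin

abbreviation conj where "conj \<equiv> tensor_map K C1 C2 (zorn_conj K) (zorn_conj K)"

lemma
  shows conj_closed: "x \<in> carrier T \<Longrightarrow> conj x \<in> carrier T"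
    and conj_add: "x \<in> carrier T \<Longrightarrow> y \<in> carrier T \<Longrightarrow> conj (x \<oplus>\<^bsub>T\<^esub> y) = conj x \<oplus>\<^bsub>T\<^esub> conj y"
    and conj_pure: "a \<in> zorn_carrier K m \<Longrightarrow> b \<in> zorn_carrier K n \<Longrightarrow>
      conj (t a b) = t (zorn_conj K a) (zorn_conj K b)"
proof -
  have bal: "t (zorn_conj K (c \<odot>\<^bsub>C1\<^esub> a)) (zorn_conj K b) = t (zorn_conj K a) (zorn_conj K (c \<odot>\<^bsub>C2\<^esub> b))"
    if "c \<in> carrier K" "a \<in> carrier C1" "b \<in> carrier C2" for c a b
    using that pure_balanced[of c "zorn_conj K a" "zorn_conj K b"] by (simp add: zorn_conj_simps zorn_conj_closed)
  have f: "zorn_conj K \<in> carrier C1 \<rightarrow> carrier C1" "zorn_conj K \<in> carrier C2 \<rightarrow> carrier C2"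
    using zorn_conj_closed by auto
  have a1: "zorn_conj K (x \<oplus>\<^bsub>C1\<^esub> y) = zorn_conj K x \<oplus>\<^bsub>C1\<^esub> zorn_conj K y" if "x \<in> carrier C1" "y \<in> carrier C1" for x y
    using that by (simp add: zorn_conj_simps)
  have a2: "zorn_conj K (x \<oplus>\<^bsub>C2\<^esub> y) = zorn_conj K x \<oplus>\<^bsub>C2\<^esub> zorn_conj K y" if "x \<in> carrier C2" "y \<in> carrier C2" for x y
    using that by (simp add: zorn_conj_simps)
  show "x \<in> carrier T \<Longrightarrow> conj x \<in> carrier T" by (rule tensor_map_closed[OF f(1) a1 f(2) a2 bal])
  show "x \<in> carrier T \<Longrightarrow> y \<in> carrier T \<Longrightarrow> conj (x \<oplus>\<^bsub>T\<^esub> y) = conj x \<oplus>\<^bsub>T\<^esub> conj y"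
    by (rule tensor_map_add[OF f(1) a1 f(2) a2 bal])
  show "a \<in> zorn_carrier K m \<Longrightarrow> b \<in> zorn_carrier K n \<Longrightarrow> conj (t a b) = t (zorn_conj K a) (zorn_conj K b)"
    using tensor_map_pure[OF f(1) a1 f(2) a2 bal, of a b] by simp
qed

lemma unit_second_factor:
  assumes n: "n = 1" and s: "s \<in> carrier T"
  obtains c where "c \<in> carrier C1" "s = t c \<one>\<^bsub>C2\<^esub>"
proof -
  have "\<exists>c\<in>carrier C1. s = t c \<one>\<^bsub>C2\<^esub>"
    using s
  proof (induction s rule: tensor_induct)
    case (pure a b)
    obtain \<beta> where \<beta>: "\<beta> \<in> carrier K" "b = \<beta> \<odot>\<^bsub>C2\<^esub> \<one>\<^bsub>C2\<^esub>"
      using pure(2) n unfolding split_composition_simps by (elim zorn_cases) auto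
    have "t a b = t (\<beta> \<odot>\<^bsub>C1\<^esub> a) \<one>\<^bsub>C2\<^esub>"
      unfolding \<beta>(2) using \<beta>(1) pure(1) snd.unit_closed by (simp add: pure_balanced del: split_composition_simps)
    then show ?case using \<beta>(1) pure(1) by blast
  next
    case (add x y)
    then obtain c d where "c \<in> carrier C1" "x = t c \<one>\<^bsub>C2\<^esub>" "d \<in> carrier C1" "y = t d \<one>\<^bsub>C2\<^esub>" by blast
    then show ?case using pure_add_left[of c d "\<one>\<^bsub>C2\<^esub>"] snd.unit_closed
      by (intro bexI[of _ "c \<oplus>\<^bsub>C1\<^esub> d"]) (simp_all del: split_composition_simps)
  qed
  then show thesis using that by blast
qed

lemma split_nucleus:
  assumes mn: "(m, n) \<in> {(4, 1), (8, 1), (8, 4), (8, 8)}" and s: "s \<in> alternative_nucleus T"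
  obtains c d where "c \<in> carrier C1" "d \<in> carrier C2" "s = t c \<one>\<^bsub>C2\<^esub> \<oplus>\<^bsub>T\<^esub> t \<one>\<^bsub>C1\<^esub> d"
proof (cases "n = 1")
  case True
  obtain c where "c \<in> carrier C1" "s = t c \<one>\<^bsub>C2\<^esub>"
    by (rule unit_second_factor[OF True TA.alternative_nucleusD(1)[OF s]])
  then show thesis
    using that[of c "\<zero>\<^bsub>C2\<^esub>"] pure_null_right[OF fst.unit_closed] pure_closed[of c "\<one>\<^bsub>C2\<^esub>"] snd.unit_closed
      snd.M.zero_closed T.r_zero by metis
next
  case False
  then have "m = 8" "2 < n" using mn by auto
  show thesis
    using octonion_nucleus[OF \<open>2 < n\<close> s[unfolded \<open>m = 8\<close>]] that unfolding \<open>m = 8\<close> split_composition_simps(1)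
    by blast
qed

text \<open>
  The nucleus is \<open>C1 \<otimes> 1 + 1 \<otimes> C2\<close>, and its two summands commute with each other. Its commutators
  are therefore sums of commutators of the factors, which conjugation negates, and with the unit
  they generate each factor.
\<close>

theorem split_skew_generated:
  assumes mn: "(m, n) \<in> {(4, 1), (8, 1), (8, 4), (8, 8)}" and two: "\<one> \<oplus> \<one> \<in> Units K"
  shows "skew_generated K T conj"
  unfolding skew_generated_def
proof (intro conjI ballI allI impI)
  fix x assume "x \<in> nucleus_commutators T"
  then obtain s s' where s: "x = commutator T s s'" "s \<in> alternative_nucleus T" "s' \<in> alternative_nucleus T"
    by (auto simp: nucleus_commutators_def)
  obtain c d where c: "c \<in> carrier C1" "d \<in> carrier C2" "s = t c \<one>\<^bsub>C2\<^esub> \<oplus>\<^bsub>T\<^esub> t \<one>\<^bsub>C1\<^esub> d"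
    by (rule split_nucleus[OF mn s(2)])
  obtain c' d' where c': "c' \<in> carrier C1" "d' \<in> carrier C2" "s' = t c' \<one>\<^bsub>C2\<^esub> \<oplus>\<^bsub>T\<^esub> t \<one>\<^bsub>C1\<^esub> d'"
    by (rule split_nucleus[OF mn s(3)])
  have x: "x = t (commutator C1 c c') \<one>\<^bsub>C2\<^esub> \<oplus>\<^bsub>T\<^esub> t \<one>\<^bsub>C1\<^esub> (commutator C2 d d')"
    unfolding s(1) c(3) c'(3) by (rule factors_commutator) (use c c' in auto)
  have cl: "commutator C1 c c' \<in> carrier C1" "commutator C2 d d' \<in> carrier C2"
    using c c' by (auto simp del: split_composition_simps)
  have sk: "zorn_conj K (commutator C1 c c') = \<ominus>\<^bsub>C1\<^esub> commutator C1 c c'"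
    "zorn_conj K (commutator C2 d d') = \<ominus>\<^bsub>C2\<^esub> commutator C2 d d'"
    using c c' by (auto intro!: zorn_commutator_skew)
  note ones = fst.unit_closed snd.unit_closed
  have p: "t (commutator C1 c c') \<one>\<^bsub>C2\<^esub> \<in> carrier T" "t \<one>\<^bsub>C1\<^esub> (commutator C2 d d') \<in> carrier T"
    using cl ones pure_closed by auto
  have "conj x = conj (t (commutator C1 c c') \<one>\<^bsub>C2\<^esub>) \<oplus>\<^bsub>T\<^esub> conj (t \<one>\<^bsub>C1\<^esub> (commutator C2 d d'))"
    unfolding x by (rule conj_add[OF p])
  also have "conj (t (commutator C1 c c') \<one>\<^bsub>C2\<^esub>) = t (\<ominus>\<^bsub>C1\<^esub> commutator C1 c c') \<one>\<^bsub>C2\<^esub>"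
    using conj_pure[of "commutator C1 c c'" "\<one>\<^bsub>C2\<^esub>"] cl ones unfolding sk zorn_conj_simps(3) by simp
  also have "conj (t \<one>\<^bsub>C1\<^esub> (commutator C2 d d')) = t \<one>\<^bsub>C1\<^esub> (\<ominus>\<^bsub>C2\<^esub> commutator C2 d d')"
    using conj_pure[of "\<one>\<^bsub>C1\<^esub>" "commutator C2 d d'"] cl ones unfolding sk zorn_conj_simps(3) by simp
  also have "t (\<ominus>\<^bsub>C1\<^esub> commutator C1 c c') \<one>\<^bsub>C2\<^esub> \<oplus>\<^bsub>T\<^esub> t \<one>\<^bsub>C1\<^esub> (\<ominus>\<^bsub>C2\<^esub> commutator C2 d d') = \<ominus>\<^bsub>T\<^esub> x"
    unfolding x using cl ones p by (simp add: pure_uminus_left pure_uminus_right T.minus_add del: split_composition_simps)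
  finally show "conj x = \<ominus>\<^bsub>T\<^esub> x" .
next
  fix U assume U: "subalgebra K T U" "nucleus_commutators T \<subseteq> U"
  have sub: "submodule U K T" "\<one>\<^bsub>T\<^esub> \<in> U" "\<And>x y. x \<in> U \<Longrightarrow> y \<in> U \<Longrightarrow> x \<otimes>\<^bsub>T\<^esub> y \<in> U"
    using U by (auto simp: subalgebra_def)
  note E = TA.submoduleE[OF sub(1)]
  note ones = fst.unit_closed snd.unit_closed
  have nuc1: "c \<in> alternative_nucleus C1" if "c \<in> carrier C1" for c
    using that zorn_alternators(1) by (auto simp: alternative_nucleus_def)
  have nuc2: "c \<in> alternative_nucleus C2" if "c \<in> carrier C2" for c
    using that zorn_alternators(1) by (auto simp: alternative_nucleus_def)
  have "{c \<in> carrier C1. t c \<one>\<^bsub>C2\<^esub> \<in> U} = zorn_carrier K m"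
  proof (rule zorn_commutator_generate[OF _ two])
    show "m \<in> {1, 4, 8}" using mn by auto
    show "submodule {c \<in> carrier C1. t c \<one>\<^bsub>C2\<^esub> \<in> U} K C1"
    proof (rule fst.subspaceI)
      show "\<zero>\<^bsub>C1\<^esub> \<in> {c \<in> carrier C1. t c \<one>\<^bsub>C2\<^esub> \<in> U}"
        using pure_null_left[OF ones(2)] TA.submodule_zero[OF sub(1)] fst.M.zero_closed by auto
      show "x \<oplus>\<^bsub>C1\<^esub> y \<in> {c \<in> carrier C1. t c \<one>\<^bsub>C2\<^esub> \<in> U}"
        if "x \<in> {c \<in> carrier C1. t c \<one>\<^bsub>C2\<^esub> \<in> U}" "y \<in> {c \<in> carrier C1. t c \<one>\<^bsub>C2\<^esub> \<in> U}" for x y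
        using that E(5) pure_add_left[of x y "\<one>\<^bsub>C2\<^esub>"] ones by (simp del: split_composition_simps)
      show "r \<odot>\<^bsub>C1\<^esub> x \<in> {c \<in> carrier C1. t c \<one>\<^bsub>C2\<^esub> \<in> U}"
        if "r \<in> carrier K" "x \<in> {c \<in> carrier C1. t c \<one>\<^bsub>C2\<^esub> \<in> U}" for r x
        using that E(4)[of r "t x \<one>\<^bsub>C2\<^esub>"] tensor_smult_pure[of r x "\<one>\<^bsub>C2\<^esub>"] ones by (simp del: split_composition_simps)
    qed auto
    show "\<one>\<^bsub>C1\<^esub> \<in> {c \<in> carrier C1. t c \<one>\<^bsub>C2\<^esub> \<in> U}"
      using ones sub(2) by (simp add: tensor_one del: split_composition_simps)
    show "commutator C1 x y \<in> {c \<in> carrier C1. t c \<one>\<^bsub>C2\<^esub> \<in> U}"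
      if "x \<in> zorn_carrier K m" "y \<in> zorn_carrier K m" for x y
    proof -
      have xy: "x \<in> carrier C1" "y \<in> carrier C1" using that by auto
      have "commutator T (t x \<one>\<^bsub>C2\<^esub>) (t y \<one>\<^bsub>C2\<^esub>) \<in> nucleus_commutators T"
        using pure_one_in_nucleus[OF nuc1[OF xy(1)]] pure_one_in_nucleus[OF nuc1[OF xy(2)]]
        unfolding nucleus_commutators_def by blast
      then show ?thesis using pure_commutator_fst[OF xy] U(2) fst.commutator_closed[OF xy] by auto
    qed
  qed
  then have U1: "t c \<one>\<^bsub>C2\<^esub> \<in> U" if "c \<in> carrier C1" for c using that by auto
  have "{d \<in> carrier C2. t \<one>\<^bsub>C1\<^esub> d \<in> U} = zorn_carrier K n"
  proof (rule zorn_commutator_generate[OF _ two])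
    show "n \<in> {1, 4, 8}" using mn by auto
    show "submodule {d \<in> carrier C2. t \<one>\<^bsub>C1\<^esub> d \<in> U} K C2"
    proof (rule snd.subspaceI)
      show "\<zero>\<^bsub>C2\<^esub> \<in> {d \<in> carrier C2. t \<one>\<^bsub>C1\<^esub> d \<in> U}"
        using pure_null_right[OF ones(1)] TA.submodule_zero[OF sub(1)] snd.M.zero_closed by auto
      show "x \<oplus>\<^bsub>C2\<^esub> y \<in> {d \<in> carrier C2. t \<one>\<^bsub>C1\<^esub> d \<in> U}"
        if "x \<in> {d \<in> carrier C2. t \<one>\<^bsub>C1\<^esub> d \<in> U}" "y \<in> {d \<in> carrier C2. t \<one>\<^bsub>C1\<^esub> d \<in> U}" for x y
        using that E(5) pure_add_right[of "\<one>\<^bsub>C1\<^esub>" x y] ones by (simp del: split_composition_simps)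
      show "r \<odot>\<^bsub>C2\<^esub> x \<in> {d \<in> carrier C2. t \<one>\<^bsub>C1\<^esub> d \<in> U}"
        if "r \<in> carrier K" "x \<in> {d \<in> carrier C2. t \<one>\<^bsub>C1\<^esub> d \<in> U}" for r x
        using that E(4)[of r "t \<one>\<^bsub>C1\<^esub> x"] tensor_smult_pure[of r "\<one>\<^bsub>C1\<^esub>" x] pure_balanced[of r "\<one>\<^bsub>C1\<^esub>" x] ones
        by (simp del: split_composition_simps)
    qed auto
    show "\<one>\<^bsub>C2\<^esub> \<in> {d \<in> carrier C2. t \<one>\<^bsub>C1\<^esub> d \<in> U}"
      using ones sub(2) by (simp add: tensor_one del: split_composition_simps)
    show "commutator C2 x y \<in> {d \<in> carrier C2. t \<one>\<^bsub>C1\<^esub> d \<in> U}"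
      if "x \<in> zorn_carrier K n" "y \<in> zorn_carrier K n" for x y
    proof -
      have xy: "x \<in> carrier C2" "y \<in> carrier C2" using that by auto
      have "commutator T (t \<one>\<^bsub>C1\<^esub> x) (t \<one>\<^bsub>C1\<^esub> y) \<in> nucleus_commutators T"
        using one_pure_in_nucleus[OF nuc2[OF xy(1)]] one_pure_in_nucleus[OF nuc2[OF xy(2)]]
        unfolding nucleus_commutators_def by blast
      then show ?thesis using pure_commutator_snd[OF xy] U(2) snd.commutator_closed[OF xy] by auto
    qed
  qed
  then have U2: "t \<one>\<^bsub>C1\<^esub> d \<in> U" if "d \<in> carrier C2" for d using that by auto
  have "z \<in> U" if "z \<in> carrier T" for z
    using that
  proof (induction z rule: tensor_induct)
    case (pure c d)
    then have "t c d = t c \<one>\<^bsub>C2\<^esub> \<otimes>\<^bsub>T\<^esub> t \<one>\<^bsub>C1\<^esub> d"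
      using pure_mult[of c "\<one>\<^bsub>C1\<^esub>" "\<one>\<^bsub>C2\<^esub>" d] ones fst.unit_right snd.unit_left by (simp del: split_composition_simps)
    then show ?case using sub(3) U1 U2 pure by simp
  qed (rule E(5))
  then show "U = carrier T" using E(1) by blast
qed

text \<open>
  The second factor is associative, so associators of pure tensors are associators of the first
  factor tensored with a product. They vanish if the first factor is associative as well. If
  instead the second factor is commutative, that product is the same for all orders of its terms,
  and alternators of the first factor, which are zero, split off.
\<close>

lemma split_alternative:
  assumes mn: "(m, n) \<in> {(4, 2), (8, 2), (4, 4)}"
    and xyz: "x \<in> carrier T" "y \<in> carrier T" "z \<in> carrier T"
  shows "left_alternator T x y z = \<zero>\<^bsub>T\<^esub>" "right_alternator T x y z = \<zero>\<^bsub>T\<^esub>"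
proof -
  have n4: "n \<le> 4" using mn by auto
  have as: "associator T (t a a') (t b b') (t c c') = t (associator C1 a b c) ((a' \<otimes>\<^bsub>C2\<^esub> b') \<otimes>\<^bsub>C2\<^esub> c')"
    if "a \<in> carrier C1" "b \<in> carrier C1" "c \<in> carrier C1" "a' \<in> carrier C2" "b' \<in> carrier C2" "c' \<in> carrier C2"
    for a b c a' b' c'
    using that zorn_assoc[OF n4, of a' b' c'] by (intro pure_associator_snd) auto
  have m4: "associator C1 a b c = \<zero>\<^bsub>C1\<^esub>" if "m = 4" "a \<in> carrier C1" "b \<in> carrier C1" "c \<in> carrier C1" for a b c
  proof -
    have "(a \<otimes>\<^bsub>C1\<^esub> b) \<otimes>\<^bsub>C1\<^esub> c = a \<otimes>\<^bsub>C1\<^esub> (b \<otimes>\<^bsub>C1\<^esub> c)"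
      using zorn_assoc[of m a b c] that by simp
    then show ?thesis unfolding associator_def fst.M.minus_eq
      using fst.M.r_neg[of "a \<otimes>\<^bsub>C1\<^esub> (b \<otimes>\<^bsub>C1\<^esub> c)"] that(2-) fst.mult_closed by (simp del: split_composition_simps)
  qed
  have comm: "a \<otimes>\<^bsub>C2\<^esub> b = b \<otimes>\<^bsub>C2\<^esub> a" if "n = 2" "a \<in> carrier C2" "b \<in> carrier C2" for a b
    using zorn_commute[of n a b] that by simp
  have cases: "m = 4 \<or> n = 2" using mn by auto
  have L: "left_alternator T (t a a') (t b b') (t c c') = \<zero>\<^bsub>T\<^esub> \<and> right_alternator T (t a a') (t b b') (t c c') = \<zero>\<^bsub>T\<^esub>"
    if abc: "a \<in> carrier C1" "b \<in> carrier C1" "c \<in> carrier C1" "a' \<in> carrier C2" "b' \<in> carrier C2" "c' \<in> carrier C2"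
    for a b c a' b' c'
    using cases
  proof
    assume m: "m = 4"
    show ?thesis using abc unfolding left_alternator_def right_alternator_def
      by (simp add: as m4[OF m] pure_null_left snd.mult_closed del: split_composition_simps)
  next
    assume n: "n = 2"
    have ac: "(b' \<otimes>\<^bsub>C2\<^esub> a') \<otimes>\<^bsub>C2\<^esub> c' = (a' \<otimes>\<^bsub>C2\<^esub> b') \<otimes>\<^bsub>C2\<^esub> c'"
      using comm[OF n, of a' b'] abc by simp
    have ac': "(a' \<otimes>\<^bsub>C2\<^esub> c') \<otimes>\<^bsub>C2\<^esub> b' = (a' \<otimes>\<^bsub>C2\<^esub> b') \<otimes>\<^bsub>C2\<^esub> c'"
      using comm[OF n, of b' c'] abc zorn_assoc[OF n4, of a' b' c'] zorn_assoc[OF n4, of a' c' b'] by simp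
    have z: "left_alternator C1 a b c = \<zero>\<^bsub>C1\<^esub>" "right_alternator C1 a b c = \<zero>\<^bsub>C1\<^esub>"
      using zorn_alternators abc by auto
    have "left_alternator T (t a a') (t b b') (t c c') = t (left_alternator C1 a b c) ((a' \<otimes>\<^bsub>C2\<^esub> b') \<otimes>\<^bsub>C2\<^esub> c')"
      "right_alternator T (t a a') (t b b') (t c c') = t (right_alternator C1 a b c) ((a' \<otimes>\<^bsub>C2\<^esub> b') \<otimes>\<^bsub>C2\<^esub> c')"
      using abc unfolding left_alternator_def right_alternator_def
      by (simp_all add: as ac ac' pure_add_left snd.mult_closed del: split_composition_simps)
    then show ?thesis using z abc pure_null_left snd.mult_closed by (simp del: split_composition_simps)
  qed
  have "left_alternator T x y z = \<zero>\<^bsub>T\<^esub> \<and> right_alternator T x y z = \<zero>\<^bsub>T\<^esub>"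
    using xyz(3)
  proof (induction z rule: tensor_induct)
    case (pure c c')
    have cc: "t c c' \<in> carrier T" using pure pure_closed by blast
    show ?case
    proof
      show "left_alternator T x y (t c c') = \<zero>\<^bsub>T\<^esub>"
        using _ _ _ xyz(1,2)
        by (rule tensor_bilinear_zero) (use cc L pure in \<open>auto simp: TA.left_alternator_add\<close>)
      show "right_alternator T x y (t c c') = \<zero>\<^bsub>T\<^esub>"
        using _ _ _ xyz(1,2)
        by (rule tensor_bilinear_zero) (use cc L pure in \<open>auto simp: TA.right_alternator_add\<close>)
    qed
  next
    case (add u v)
    then show ?case using xyz by (simp add: TA.left_alternator_add TA.right_alternator_add)
  qed
  then show "left_alternator T x y z = \<zero>\<^bsub>T\<^esub>" "right_alternator T x y z = \<zero>\<^bsub>T\<^esub>" by blast+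
qed

end

section \<open>Inner derivations of alternative algebras\<close>

definition inner_derivation :: "('k, 'a, 'y) module_scheme \<Rightarrow> 'a \<Rightarrow> 'a \<Rightarrow> 'a \<Rightarrow> 'a"
  where "inner_derivation A a b x = commutator A (commutator A a b) x \<ominus>\<^bsub>A\<^esub>
    (associator A a b x \<oplus>\<^bsub>A\<^esub> associator A a b x \<oplus>\<^bsub>A\<^esub> associator A a b x)"

text \<open>
  Kleinfeld's function measures how far the associator is from being a derivation in its first
  argument.
\<close>

definition kleinfeld :: "('k, 'a, 'y) module_scheme \<Rightarrow> 'a \<Rightarrow> 'a \<Rightarrow> 'a \<Rightarrow> 'a \<Rightarrow> 'a"
  where "kleinfeld A w x y z = associator A (w \<otimes>\<^bsub>A\<^esub> x) y z \<ominus>\<^bsub>A\<^esub> x \<otimes>\<^bsub>A\<^esub> associator A w y z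
    \<ominus>\<^bsub>A\<^esub> associator A x y z \<otimes>\<^bsub>A\<^esub> w"

context unital_algebra begin

lemma inner_derivation_closed [simp]:
  "a \<in> carrier A \<Longrightarrow> b \<in> carrier A \<Longrightarrow> x \<in> carrier A \<Longrightarrow> inner_derivation A a b x \<in> carrier A"
  by (simp add: inner_derivation_def)

lemma inner_derivation_add:
  assumes "x \<in> carrier A" "x' \<in> carrier A" "y \<in> carrier A" "z \<in> carrier A"
  shows "inner_derivation A (x \<oplus>\<^bsub>A\<^esub> x') y z = inner_derivation A x y z \<oplus>\<^bsub>A\<^esub> inner_derivation A x' y z"
    "inner_derivation A y (x \<oplus>\<^bsub>A\<^esub> x') z = inner_derivation A y x z \<oplus>\<^bsub>A\<^esub> inner_derivation A y x' z"
    "inner_derivation A y z (x \<oplus>\<^bsub>A\<^esub> x') = inner_derivation A y z x \<oplus>\<^bsub>A\<^esub> inner_derivation A y z x'"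
  using assms
  by (simp_all add: inner_derivation_def commutator_add_left commutator_add_right associator_add
      M.minus_eq M.minus_add M.a_ac)

lemma commutator_smult_right:
  "c \<in> carrier K \<Longrightarrow> x \<in> carrier A \<Longrightarrow> y \<in> carrier A \<Longrightarrow> commutator A x (c \<odot>\<^bsub>A\<^esub> y) = c \<odot>\<^bsub>A\<^esub> commutator A x y"
  by (simp add: commutator_def smult_left smult_right smult_minus mult_closed)

lemma inner_derivation_smult:
  "c \<in> carrier K \<Longrightarrow> a \<in> carrier A \<Longrightarrow> b \<in> carrier A \<Longrightarrow> x \<in> carrier A \<Longrightarrow>
    inner_derivation A a b (c \<odot>\<^bsub>A\<^esub> x) = c \<odot>\<^bsub>A\<^esub> inner_derivation A a b x"
  by (simp add: inner_derivation_def commutator_smult_right associator_smult smult_minus smult_r_distr)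

lemma teichmueller:
  assumes "w \<in> carrier A" "x \<in> carrier A" "y \<in> carrier A" "z \<in> carrier A"
  shows "associator A (w \<otimes>\<^bsub>A\<^esub> x) y z \<ominus>\<^bsub>A\<^esub> associator A w (x \<otimes>\<^bsub>A\<^esub> y) z \<oplus>\<^bsub>A\<^esub> associator A w x (y \<otimes>\<^bsub>A\<^esub> z) =
    w \<otimes>\<^bsub>A\<^esub> associator A x y z \<oplus>\<^bsub>A\<^esub> associator A w x y \<otimes>\<^bsub>A\<^esub> z"
  using assms unfolding associator_def by algebra

text \<open>
  In a nonassociative ring a commutator fails to be a derivation by a sum of associators.
\<close>

lemma commutator_product:
  assumes "c \<in> carrier A" "x \<in> carrier A" "y \<in> carrier A"
  shows "commutator A c (x \<otimes>\<^bsub>A\<^esub> y) = commutator A c x \<otimes>\<^bsub>A\<^esub> y \<oplus>\<^bsub>A\<^esub> x \<otimes>\<^bsub>A\<^esub> commutator A c y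
    \<ominus>\<^bsub>A\<^esub> (associator A c x y \<ominus>\<^bsub>A\<^esub> associator A x c y \<oplus>\<^bsub>A\<^esub> associator A x y c)"
  using assms unfolding associator_def commutator_def by algebra

lemma eq_uminus: "x \<in> carrier A \<Longrightarrow> y \<in> carrier A \<Longrightarrow> x \<oplus>\<^bsub>A\<^esub> y = \<zero>\<^bsub>A\<^esub> \<Longrightarrow> y = \<ominus>\<^bsub>A\<^esub> x"
  using M.minus_equality[of y x] by (simp add: M.a_comm)

end

locale alternative_algebra = unital_algebra +
  assumes left_alternative: "x \<in> carrier A \<Longrightarrow> y \<in> carrier A \<Longrightarrow> z \<in> carrier A \<Longrightarrow> left_alternator A x y z = \<zero>\<^bsub>A\<^esub>"
    and right_alternative: "x \<in> carrier A \<Longrightarrow> y \<in> carrier A \<Longrightarrow> z \<in> carrier A \<Longrightarrow> right_alternator A x y z = \<zero>\<^bsub>A\<^esub>"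
begin

lemma associator_swap_left: "x \<in> carrier A \<Longrightarrow> y \<in> carrier A \<Longrightarrow> z \<in> carrier A \<Longrightarrow>
    associator A y x z = \<ominus>\<^bsub>A\<^esub> associator A x y z"
  using left_alternative[of x y z] by (intro eq_uminus) (simp_all add: left_alternator_def)

lemma associator_swap_right: "x \<in> carrier A \<Longrightarrow> y \<in> carrier A \<Longrightarrow> z \<in> carrier A \<Longrightarrow>
    associator A x z y = \<ominus>\<^bsub>A\<^esub> associator A x y z"
  using right_alternative[of x y z] by (intro eq_uminus) (simp_all add: right_alternator_def)

lemma associator_cyclic: "x \<in> carrier A \<Longrightarrow> y \<in> carrier A \<Longrightarrow> z \<in> carrier A \<Longrightarrow>
    associator A y z x = associator A x y z"
  using associator_swap_right[of y x z] associator_swap_left[of x y z] by simp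

lemma kleinfeld_closed [simp]: "w \<in> carrier A \<Longrightarrow> x \<in> carrier A \<Longrightarrow> y \<in> carrier A \<Longrightarrow> z \<in> carrier A \<Longrightarrow>
    kleinfeld A w x y z \<in> carrier A"
  by (simp add: kleinfeld_def mult_closed)

lemma kleinfeld_swap:
  assumes "w \<in> carrier A" "x \<in> carrier A" "y \<in> carrier A" "z \<in> carrier A"
  shows "kleinfeld A w x z y = \<ominus>\<^bsub>A\<^esub> kleinfeld A w x y z"
  using assms mult_closed
  by (simp add: kleinfeld_def associator_swap_right[of _ y z] M.minus_eq M.minus_add uminus_left uminus_right)

text \<open>
  This is the Teichmueller identity, rewritten with the invariance of the associator under cyclic
  permutations.
\<close>

lemma kleinfeld_sum:
  assumes c: "w \<in> carrier A" "x \<in> carrier A" "y \<in> carrier A" "z \<in> carrier A"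
  shows "kleinfeld A w x y z \<ominus>\<^bsub>A\<^esub> kleinfeld A x y z w \<oplus>\<^bsub>A\<^esub> kleinfeld A y z w x =
    commutator A w (associator A x y z) \<ominus>\<^bsub>A\<^esub> commutator A x (associator A w y z)
    \<oplus>\<^bsub>A\<^esub> commutator A y (associator A w x z) \<ominus>\<^bsub>A\<^esub> commutator A z (associator A w x y)"
proof -
  define \<alpha> \<beta> \<gamma> \<delta> where as: "\<alpha> = associator A x y z" "\<beta> = associator A w y z" "\<gamma> = associator A w x z" "\<delta> = associator A w x y"
  define p q r where pqr: "p = associator A (w \<otimes>\<^bsub>A\<^esub> x) y z" "q = associator A (x \<otimes>\<^bsub>A\<^esub> y) z w" "r = associator A (y \<otimes>\<^bsub>A\<^esub> z) w x"
  have closed: "\<alpha> \<in> carrier A" "\<beta> \<in> carrier A" "\<gamma> \<in> carrier A" "\<delta> \<in> carrier A"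
    "p \<in> carrier A" "q \<in> carrier A" "r \<in> carrier A"
    using c by (simp_all add: as pqr mult_closed)
  have eqs: "associator A x z w = \<gamma>" "associator A y z w = \<beta>" "associator A y w x = \<delta>" "associator A z w x = \<gamma>"
    using c associator_cyclic[of w x z] associator_cyclic[of w y z] associator_cyclic[of w x y]
      associator_cyclic[of z w x] associator_cyclic[of y w x] by (simp_all add: as)
  have T: "p \<ominus>\<^bsub>A\<^esub> q \<oplus>\<^bsub>A\<^esub> r = w \<otimes>\<^bsub>A\<^esub> \<alpha> \<oplus>\<^bsub>A\<^esub> \<delta> \<otimes>\<^bsub>A\<^esub> z"
  proof -
    have "associator A w (x \<otimes>\<^bsub>A\<^esub> y) z = q" "associator A w x (y \<otimes>\<^bsub>A\<^esub> z) = r"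
      using c mult_closed associator_cyclic[of w "x \<otimes>\<^bsub>A\<^esub> y" z] associator_cyclic[of "y \<otimes>\<^bsub>A\<^esub> z" w x]
      by (simp_all add: pqr)
    then show ?thesis using teichmueller[OF c] by (simp add: as pqr)
  qed
  have "kleinfeld A w x y z \<ominus>\<^bsub>A\<^esub> kleinfeld A x y z w \<oplus>\<^bsub>A\<^esub> kleinfeld A y z w x =
    (p \<ominus>\<^bsub>A\<^esub> x \<otimes>\<^bsub>A\<^esub> \<beta> \<ominus>\<^bsub>A\<^esub> \<alpha> \<otimes>\<^bsub>A\<^esub> w) \<ominus>\<^bsub>A\<^esub> (q \<ominus>\<^bsub>A\<^esub> y \<otimes>\<^bsub>A\<^esub> \<gamma> \<ominus>\<^bsub>A\<^esub> \<beta> \<otimes>\<^bsub>A\<^esub> x) \<oplus>\<^bsub>A\<^esub> (r \<ominus>\<^bsub>A\<^esub> z \<otimes>\<^bsub>A\<^esub> \<delta> \<ominus>\<^bsub>A\<^esub> \<gamma> \<otimes>\<^bsub>A\<^esub> y)"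
    unfolding kleinfeld_def eqs as[symmetric] pqr[symmetric] ..
  also have "\<dots> = (p \<ominus>\<^bsub>A\<^esub> q \<oplus>\<^bsub>A\<^esub> r) \<ominus>\<^bsub>A\<^esub> x \<otimes>\<^bsub>A\<^esub> \<beta> \<ominus>\<^bsub>A\<^esub> \<alpha> \<otimes>\<^bsub>A\<^esub> w \<oplus>\<^bsub>A\<^esub> y \<otimes>\<^bsub>A\<^esub> \<gamma> \<oplus>\<^bsub>A\<^esub> \<beta> \<otimes>\<^bsub>A\<^esub> x \<ominus>\<^bsub>A\<^esub> z \<otimes>\<^bsub>A\<^esub> \<delta> \<ominus>\<^bsub>A\<^esub> \<gamma> \<otimes>\<^bsub>A\<^esub> y"
    using c closed by algebra
  also have "\<dots> = commutator A w \<alpha> \<ominus>\<^bsub>A\<^esub> commutator A x \<beta> \<oplus>\<^bsub>A\<^esub> commutator A y \<gamma> \<ominus>\<^bsub>A\<^esub> commutator A z \<delta>"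
    unfolding T commutator_def using c closed by algebra
  finally show ?thesis unfolding as .
qed

text \<open>
  The right hand side of \<open>kleinfeld_sum\<close> changes sign when the arguments are rotated. Adding the
  identity to its rotation leaves only two terms on the left.
\<close>

lemma kleinfeld_rotate:
  assumes c: "w \<in> carrier A" "x \<in> carrier A" "y \<in> carrier A" "z \<in> carrier A"
  shows "kleinfeld A z w x y = \<ominus>\<^bsub>A\<^esub> kleinfeld A w x y z"
proof (rule eq_uminus)
  have eqs: "associator A x z w = associator A w x z" "associator A y z w = associator A w y z"
    "associator A x y w = associator A w x y"
    using c associator_cyclic[of w x z] associator_cyclic[of w y z] associator_cyclic[of w x y] by simp_all
  define f1 f2 f3 f4 where f: "f1 = kleinfeld A w x y z" "f2 = kleinfeld A x y z w" "f3 = kleinfeld A y z w x" "f4 = kleinfeld A z w x y"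
  define g1 g2 g3 g4 where g: "g1 = commutator A w (associator A x y z)" "g2 = commutator A x (associator A w y z)"
    "g3 = commutator A y (associator A w x z)" "g4 = commutator A z (associator A w x y)"
  have cl: "f1 \<in> carrier A" "f2 \<in> carrier A" "f3 \<in> carrier A" "f4 \<in> carrier A"
    "g1 \<in> carrier A" "g2 \<in> carrier A" "g3 \<in> carrier A" "g4 \<in> carrier A"
    using c by (simp_all add: f g)
  have 1: "f1 \<ominus>\<^bsub>A\<^esub> f2 \<oplus>\<^bsub>A\<^esub> f3 = g1 \<ominus>\<^bsub>A\<^esub> g2 \<oplus>\<^bsub>A\<^esub> g3 \<ominus>\<^bsub>A\<^esub> g4"
    unfolding f g by (rule kleinfeld_sum[OF c])
  have 2: "f2 \<ominus>\<^bsub>A\<^esub> f3 \<oplus>\<^bsub>A\<^esub> f4 = g2 \<ominus>\<^bsub>A\<^esub> g3 \<oplus>\<^bsub>A\<^esub> g4 \<ominus>\<^bsub>A\<^esub> g1"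
    using kleinfeld_sum[OF c(2,3,4,1)] unfolding f g eqs .
  have "f1 \<oplus>\<^bsub>A\<^esub> f4 = (f1 \<ominus>\<^bsub>A\<^esub> f2 \<oplus>\<^bsub>A\<^esub> f3) \<oplus>\<^bsub>A\<^esub> (f2 \<ominus>\<^bsub>A\<^esub> f3 \<oplus>\<^bsub>A\<^esub> f4)" using cl by algebra
  also have "\<dots> = \<zero>\<^bsub>A\<^esub>" unfolding 1 2 using cl by algebra
  finally show "kleinfeld A w x y z \<oplus>\<^bsub>A\<^esub> kleinfeld A z w x y = \<zero>\<^bsub>A\<^esub>" unfolding f .
qed (use c in simp_all)

text \<open>
  By \<open>kleinfeld_rotate\<close> and \<open>kleinfeld_swap\<close> the values of Kleinfeld's function at the
  permutations of \<open>a, b, x, y\<close> agree up to sign. With \<open>f\<close> for the value at \<open>a, b, x, y\<close>, the left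
  hand side is \<open>f + f + f\<close> up to products with associators, and \<open>kleinfeld_sum\<close> evaluates
  \<open>f + f + f\<close> without a division by three.
\<close>

lemma associator_commutator:
  assumes c: "a \<in> carrier A" "b \<in> carrier A" "x \<in> carrier A" "y \<in> carrier A"
  shows "associator A (commutator A a b) x y \<oplus>\<^bsub>A\<^esub> associator A a b (x \<otimes>\<^bsub>A\<^esub> y) =
    associator A a b x \<otimes>\<^bsub>A\<^esub> y \<oplus>\<^bsub>A\<^esub> x \<otimes>\<^bsub>A\<^esub> associator A a b y"
proof -
  define f where f: "f = kleinfeld A a b x y"
  define \<alpha> \<beta> \<gamma> \<delta> where as: "\<alpha> = associator A b x y" "\<beta> = associator A a x y" "\<gamma> = associator A a b y" "\<delta> = associator A a b x"
  define p q r where pqr: "p = associator A (a \<otimes>\<^bsub>A\<^esub> b) x y" "q = associator A (b \<otimes>\<^bsub>A\<^esub> a) x y" "r = associator A (x \<otimes>\<^bsub>A\<^esub> y) a b"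
  have cl: "f \<in> carrier A" "\<alpha> \<in> carrier A" "\<beta> \<in> carrier A" "\<gamma> \<in> carrier A" "\<delta> \<in> carrier A"
    "p \<in> carrier A" "q \<in> carrier A" "r \<in> carrier A"
    using c by (simp_all add: f as pqr mult_closed)
  have f2: "kleinfeld A x y a b = f"
    using kleinfeld_rotate[OF c] kleinfeld_rotate[OF c(4,1,2,3)] c by (simp add: f)
  have f3: "kleinfeld A b a x y = \<ominus>\<^bsub>A\<^esub> f"
    using kleinfeld_rotate[OF c(2,1,3,4)] kleinfeld_rotate[OF c(4,2,1,3)] kleinfeld_swap[OF c(3,4,1,2)] f2 c by simp
  have f4: "kleinfeld A b x y a = \<ominus>\<^bsub>A\<^esub> f"
    using kleinfeld_rotate[OF c(2,3,4,1)] c by (simp add: f)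
  have cyc: "associator A x a b = \<delta>" "associator A y a b = \<gamma>"
    using c associator_cyclic[of x a b] associator_cyclic[of y a b] by (simp_all add: as)
  have p: "f = p \<ominus>\<^bsub>A\<^esub> b \<otimes>\<^bsub>A\<^esub> \<beta> \<ominus>\<^bsub>A\<^esub> \<alpha> \<otimes>\<^bsub>A\<^esub> a" by (simp add: f kleinfeld_def as pqr)
  have q: "\<ominus>\<^bsub>A\<^esub> f = q \<ominus>\<^bsub>A\<^esub> a \<otimes>\<^bsub>A\<^esub> \<alpha> \<ominus>\<^bsub>A\<^esub> \<beta> \<otimes>\<^bsub>A\<^esub> b" unfolding f3[symmetric] by (simp add: kleinfeld_def as pqr)
  have r: "f = r \<ominus>\<^bsub>A\<^esub> y \<otimes>\<^bsub>A\<^esub> \<delta> \<ominus>\<^bsub>A\<^esub> \<gamma> \<otimes>\<^bsub>A\<^esub> x" unfolding f2[symmetric] kleinfeld_def cyc pqr ..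
  have G: "f \<oplus>\<^bsub>A\<^esub> f \<oplus>\<^bsub>A\<^esub> f = commutator A a \<alpha> \<ominus>\<^bsub>A\<^esub> commutator A b \<beta> \<oplus>\<^bsub>A\<^esub> commutator A x \<gamma> \<ominus>\<^bsub>A\<^esub> commutator A y \<delta>"
    using kleinfeld_sum[OF c] cl unfolding f2 f4 as[symmetric] by (simp add: f[symmetric] M.minus_eq)
  have ab: "associator A (commutator A a b) x y = p \<ominus>\<^bsub>A\<^esub> q"
    using c mult_closed unfolding pqr commutator_def associator_def by algebra
  have xy: "associator A a b (x \<otimes>\<^bsub>A\<^esub> y) = r"
    using c mult_closed associator_cyclic[of "x \<otimes>\<^bsub>A\<^esub> y" a b] by (simp add: pqr)
  have "p \<ominus>\<^bsub>A\<^esub> q \<oplus>\<^bsub>A\<^esub> r = (p \<ominus>\<^bsub>A\<^esub> b \<otimes>\<^bsub>A\<^esub> \<beta> \<ominus>\<^bsub>A\<^esub> \<alpha> \<otimes>\<^bsub>A\<^esub> a) \<ominus>\<^bsub>A\<^esub> (q \<ominus>\<^bsub>A\<^esub> a \<otimes>\<^bsub>A\<^esub> \<alpha> \<ominus>\<^bsub>A\<^esub> \<beta> \<otimes>\<^bsub>A\<^esub> b)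
      \<oplus>\<^bsub>A\<^esub> (r \<ominus>\<^bsub>A\<^esub> y \<otimes>\<^bsub>A\<^esub> \<delta> \<ominus>\<^bsub>A\<^esub> \<gamma> \<otimes>\<^bsub>A\<^esub> x) \<oplus>\<^bsub>A\<^esub> (b \<otimes>\<^bsub>A\<^esub> \<beta> \<oplus>\<^bsub>A\<^esub> \<alpha> \<otimes>\<^bsub>A\<^esub> a \<ominus>\<^bsub>A\<^esub> a \<otimes>\<^bsub>A\<^esub> \<alpha> \<ominus>\<^bsub>A\<^esub> \<beta> \<otimes>\<^bsub>A\<^esub> b \<oplus>\<^bsub>A\<^esub> y \<otimes>\<^bsub>A\<^esub> \<delta> \<oplus>\<^bsub>A\<^esub> \<gamma> \<otimes>\<^bsub>A\<^esub> x)"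
    using c cl by algebra
  also have "\<dots> = (f \<oplus>\<^bsub>A\<^esub> f \<oplus>\<^bsub>A\<^esub> f) \<oplus>\<^bsub>A\<^esub> (b \<otimes>\<^bsub>A\<^esub> \<beta> \<oplus>\<^bsub>A\<^esub> \<alpha> \<otimes>\<^bsub>A\<^esub> a \<ominus>\<^bsub>A\<^esub> a \<otimes>\<^bsub>A\<^esub> \<alpha> \<ominus>\<^bsub>A\<^esub> \<beta> \<otimes>\<^bsub>A\<^esub> b \<oplus>\<^bsub>A\<^esub> y \<otimes>\<^bsub>A\<^esub> \<delta> \<oplus>\<^bsub>A\<^esub> \<gamma> \<otimes>\<^bsub>A\<^esub> x)"
    unfolding p[symmetric] q[symmetric] r[symmetric] using cl by (simp add: M.minus_eq)
  also have "\<dots> = \<delta> \<otimes>\<^bsub>A\<^esub> y \<oplus>\<^bsub>A\<^esub> x \<otimes>\<^bsub>A\<^esub> \<gamma>"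
    unfolding G commutator_def using c cl by algebra
  finally show ?thesis unfolding ab xy as .
qed

text \<open>
  The failure of the commutator with \<open>[a, b]\<close> to be a derivation is three times the associator of
  \<open>[a, b]\<close> with the two factors. By \<open>associator_commutator\<close> the term \<open>- 3 (a, b, x)\<close>
  compensates exactly this.
\<close>

theorem inner_derivation_product:
  assumes c: "a \<in> carrier A" "b \<in> carrier A" "x \<in> carrier A" "y \<in> carrier A"
  shows "inner_derivation A a b (x \<otimes>\<^bsub>A\<^esub> y) =
    inner_derivation A a b x \<otimes>\<^bsub>A\<^esub> y \<oplus>\<^bsub>A\<^esub> x \<otimes>\<^bsub>A\<^esub> inner_derivation A a b y"
proof -
  define d where "d = commutator A a b"
  define s r \<gamma> \<delta> where s: "s = associator A d x y" "r = associator A a b (x \<otimes>\<^bsub>A\<^esub> y)" "\<gamma> = associator A a b y" "\<delta> = associator A a b x"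
  define u v where uv: "u = commutator A d x" "v = commutator A d y"
  have d: "d \<in> carrier A" using c by (simp add: d_def)
  have cl: "s \<in> carrier A" "r \<in> carrier A" "\<gamma> \<in> carrier A" "\<delta> \<in> carrier A" "u \<in> carrier A" "v \<in> carrier A"
    using c d by (simp_all add: s uv mult_closed)
  have sum: "s \<oplus>\<^bsub>A\<^esub> r = \<delta> \<otimes>\<^bsub>A\<^esub> y \<oplus>\<^bsub>A\<^esub> x \<otimes>\<^bsub>A\<^esub> \<gamma>" using associator_commutator[OF c] by (simp add: s d_def)
  have "commutator A d (x \<otimes>\<^bsub>A\<^esub> y) = u \<otimes>\<^bsub>A\<^esub> y \<oplus>\<^bsub>A\<^esub> x \<otimes>\<^bsub>A\<^esub> v \<ominus>\<^bsub>A\<^esub> (s \<ominus>\<^bsub>A\<^esub> (\<ominus>\<^bsub>A\<^esub> s) \<oplus>\<^bsub>A\<^esub> s)"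
    using commutator_product[OF d c(3,4)] associator_swap_left[OF d c(3,4)] associator_cyclic[OF d c(3,4)]
    by (simp add: s uv)
  then have "inner_derivation A a b (x \<otimes>\<^bsub>A\<^esub> y) =
      u \<otimes>\<^bsub>A\<^esub> y \<oplus>\<^bsub>A\<^esub> x \<otimes>\<^bsub>A\<^esub> v \<ominus>\<^bsub>A\<^esub> (s \<ominus>\<^bsub>A\<^esub> (\<ominus>\<^bsub>A\<^esub> s) \<oplus>\<^bsub>A\<^esub> s) \<ominus>\<^bsub>A\<^esub> (r \<oplus>\<^bsub>A\<^esub> r \<oplus>\<^bsub>A\<^esub> r)"
    by (simp add: inner_derivation_def d_def s)
  also have "\<dots> = u \<otimes>\<^bsub>A\<^esub> y \<oplus>\<^bsub>A\<^esub> x \<otimes>\<^bsub>A\<^esub> v \<ominus>\<^bsub>A\<^esub> (s \<oplus>\<^bsub>A\<^esub> r) \<ominus>\<^bsub>A\<^esub> (s \<oplus>\<^bsub>A\<^esub> r) \<ominus>\<^bsub>A\<^esub> (s \<oplus>\<^bsub>A\<^esub> r)"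
    using c cl by algebra
  also have "\<dots> = (u \<ominus>\<^bsub>A\<^esub> (\<delta> \<oplus>\<^bsub>A\<^esub> \<delta> \<oplus>\<^bsub>A\<^esub> \<delta>)) \<otimes>\<^bsub>A\<^esub> y \<oplus>\<^bsub>A\<^esub> x \<otimes>\<^bsub>A\<^esub> (v \<ominus>\<^bsub>A\<^esub> (\<gamma> \<oplus>\<^bsub>A\<^esub> \<gamma> \<oplus>\<^bsub>A\<^esub> \<gamma>))"
    unfolding sum using c cl by algebra
  finally show ?thesis by (simp add: inner_derivation_def d_def s uv)
qed

end

section \<open>Infinitesimal automorphisms\<close>

context scalar_extension begin

lemma base_inner_derivation:
  assumes "a \<in> carrier A" "b \<in> carrier A" "c \<in> carrier A" "r \<in> carrier S" "s \<in> carrier S" "q \<in> carrier S"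
  shows "inner_derivation B (t a r) (t b s) (t c q) = t (inner_derivation A a b c) (r \<otimes>\<^bsub>S\<^esub> s \<otimes>\<^bsub>S\<^esub> q)"
  using assms
  by (simp add: inner_derivation_def base_commutator base_associator base_pure_add_left pure_diff_left)

lemma base_alternative:
  assumes "alternative_algebra K A"
  shows "alternative_algebra S B"
proof -
  interpret alt: alternative_algebra K A by fact
  show ?thesis
  proof (unfold_locales)
    fix x y z assume xyz: "x \<in> carrier B" "y \<in> carrier B" "z \<in> carrier B"
    show "left_alternator B x y z = \<zero>\<^bsub>B\<^esub>"
      using _ _ _ _ xyz by (rule base_trilinear_zero)
        (simp_all add: B.left_alternator_add base_left_alternator alt.left_alternative pure_zero_left)
    show "right_alternator B x y z = \<zero>\<^bsub>B\<^esub>"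
      using _ _ _ _ xyz by (rule base_trilinear_zero)
        (simp_all add: B.right_alternator_add base_right_alternator alt.right_alternative pure_zero_left)
  qed
qed

end

context scalar_extension_over_field begin

lemma alternative_descent:
  assumes one: "\<one>\<^bsub>S\<^esub> \<noteq> \<zero>\<^bsub>S\<^esub>" and "alternative_algebra S B"
  shows "alternative_algebra K A"
proof -
  interpret alt: alternative_algebra S B by fact
  show ?thesis
  proof (unfold_locales)
    fix x y z assume xyz: "x \<in> carrier A" "y \<in> carrier A" "z \<in> carrier A"
    show "left_alternator A x y z = \<zero>\<^bsub>A\<^esub>"
      using xyz base_left_alternator[of x y z "\<one>\<^bsub>S\<^esub>" "\<one>\<^bsub>S\<^esub>" "\<one>\<^bsub>S\<^esub>"]
        alt.left_alternative[of "t x \<one>\<^bsub>S\<^esub>" "t y \<one>\<^bsub>S\<^esub>" "t z \<one>\<^bsub>S\<^esub>"]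
      by (intro pure_inj[OF one]) simp_all
    show "right_alternator A x y z = \<zero>\<^bsub>A\<^esub>"
      using xyz base_right_alternator[of x y z "\<one>\<^bsub>S\<^esub>" "\<one>\<^bsub>S\<^esub>" "\<one>\<^bsub>S\<^esub>"]
        alt.right_alternative[of "t x \<one>\<^bsub>S\<^esub>" "t y \<one>\<^bsub>S\<^esub>" "t z \<one>\<^bsub>S\<^esub>"]
      by (intro pure_inj[OF one]) simp_all
  qed
qed

end

lemma (in algebra_hom) hom_inner_derivation:
  "a \<in> carrier A \<Longrightarrow> b \<in> carrier A \<Longrightarrow> x \<in> carrier A \<Longrightarrow>
    f (inner_derivation A a b x) = inner_derivation B (f a) (f b) (f x)"
  by (simp add: inner_derivation_def hom_diff hom_add hom_commutator hom_associator)

text \<open>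
  The condition \<open>D = j D j\<close> for all inner derivations, which is trilinear and therefore stable
  under base change.
\<close>

definition derivations_commute :: "('k, 'a, 'y) module_scheme \<Rightarrow> ('a \<Rightarrow> 'a) \<Rightarrow> bool"
  where "derivations_commute A j \<longleftrightarrow> (\<forall>a\<in>carrier A. \<forall>b\<in>carrier A. \<forall>x\<in>carrier A.
    inner_derivation A a b x = j (inner_derivation A a b (j x)))"

context algebra_iso begin

lemma alternative_pullback:
  assumes "alternative_algebra K B"
  shows "alternative_algebra K A"
proof -
  interpret alt: alternative_algebra K B by fact
  show ?thesis
    by unfold_locales (auto intro!: inj simp: hom_left_alternator hom_right_alternator hom_zero
        alt.left_alternative alt.right_alternative)
qed

lemma derivations_commute_image:
  assumes i: "\<And>x. x \<in> carrier A \<Longrightarrow> i x \<in> carrier A" "\<And>x. x \<in> carrier A \<Longrightarrow> f (i x) = j (f x)"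
    and A: "derivations_commute A i"
  shows "derivations_commute B j"
  unfolding derivations_commute_def
proof (intro ballI)
  fix a' b' x' assume "a' \<in> carrier B" "b' \<in> carrier B" "x' \<in> carrier B"
  then obtain a b x where abx: "a \<in> carrier A" "b \<in> carrier A" "x \<in> carrier A" "f a = a'" "f b = b'" "f x = x'"
    by (metis surj)
  have "f (inner_derivation A a b x) = f (i (inner_derivation A a b (i x)))"
    using A abx unfolding derivations_commute_def by metis
  also have "\<dots> = j (f (inner_derivation A a b (i x)))" using abx i by simp
  finally show "inner_derivation B a' b' x' = j (inner_derivation B a' b' (j x'))"
    using abx i by (simp add: hom_inner_derivation)
qed

end

context involution_extension begin

lemma derivations_commute_base:
  assumes A: "derivations_commute A j"
  shows "derivations_commute B J"
  unfolding derivations_commute_def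
proof (intro ballI)
  fix a b x assume abx: "a \<in> carrier B" "b \<in> carrier B" "x \<in> carrier B"
  have "inner_derivation B a b x \<ominus>\<^bsub>B\<^esub> J (inner_derivation B a b (J x)) = \<zero>\<^bsub>B\<^esub>"
    using _ _ _ _ abx
  proof (rule base_trilinear_zero)
    fix x x' y z assume "x \<in> carrier B" "x' \<in> carrier B" "y \<in> carrier B" "z \<in> carrier B"
    note c = this J_closed[OF this(1)] J_closed[OF this(2)] J_closed[OF this(4)]
    show "inner_derivation B (x \<oplus>\<^bsub>B\<^esub> x') y z \<ominus>\<^bsub>B\<^esub> J (inner_derivation B (x \<oplus>\<^bsub>B\<^esub> x') y (J z)) =
      (inner_derivation B x y z \<ominus>\<^bsub>B\<^esub> J (inner_derivation B x y (J z))) \<oplus>\<^bsub>B\<^esub>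
      (inner_derivation B x' y z \<ominus>\<^bsub>B\<^esub> J (inner_derivation B x' y (J z)))"
      using c by (simp add: B.inner_derivation_add J_add B.M.minus_eq B.M.minus_add B.M.a_ac)
    show "inner_derivation B y (x \<oplus>\<^bsub>B\<^esub> x') z \<ominus>\<^bsub>B\<^esub> J (inner_derivation B y (x \<oplus>\<^bsub>B\<^esub> x') (J z)) =
      (inner_derivation B y x z \<ominus>\<^bsub>B\<^esub> J (inner_derivation B y x (J z))) \<oplus>\<^bsub>B\<^esub>
      (inner_derivation B y x' z \<ominus>\<^bsub>B\<^esub> J (inner_derivation B y x' (J z)))"
      using c by (simp add: B.inner_derivation_add J_add B.M.minus_eq B.M.minus_add B.M.a_ac)
    show "inner_derivation B y z (x \<oplus>\<^bsub>B\<^esub> x') \<ominus>\<^bsub>B\<^esub> J (inner_derivation B y z (J (x \<oplus>\<^bsub>B\<^esub> x'))) =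
      (inner_derivation B y z x \<ominus>\<^bsub>B\<^esub> J (inner_derivation B y z (J x))) \<oplus>\<^bsub>B\<^esub>
      (inner_derivation B y z x' \<ominus>\<^bsub>B\<^esub> J (inner_derivation B y z (J x')))"
      using c by (simp add: B.inner_derivation_add J_add B.M.minus_eq B.M.minus_add B.M.a_ac)
  next
    fix a b c r s q assume abc: "a \<in> carrier A" "b \<in> carrier A" "c \<in> carrier A"
      "r \<in> carrier S" "s \<in> carrier S" "q \<in> carrier S"
    have "j (inner_derivation A a b (j c)) = inner_derivation A a b c"
      using A abc unfolding derivations_commute_def by metis
    then have "J (inner_derivation B (t a r) (t b s) (J (t c q))) = inner_derivation B (t a r) (t b s) (t c q)"
      using abc by (simp add: J_pure base_inner_derivation)
    then show "inner_derivation B (t a r) (t b s) (t c q) \<ominus>\<^bsub>B\<^esub>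
        J (inner_derivation B (t a r) (t b s) (J (t c q))) = \<zero>\<^bsub>B\<^esub>"
      using abc by (simp add: B.M.minus_eq B.M.r_neg)
  qed
  then have "(inner_derivation B a b x \<ominus>\<^bsub>B\<^esub> J (inner_derivation B a b (J x))) \<oplus>\<^bsub>B\<^esub> J (inner_derivation B a b (J x))
     = J (inner_derivation B a b (J x))" using abx by simp
  then show "inner_derivation B a b x = J (inner_derivation B a b (J x))"
    using abx by (simp add: B.M.minus_eq B.M.a_assoc B.M.l_neg)
qed

text \<open>
  For a derivation \<open>D\<close> the map \<open>1 + \<epsilon> D\<close> is an automorphism with inverse \<open>1 - \<epsilon> D\<close>, because
  \<open>\<epsilon>\<^sup>2 = 0\<close>. It commutes with the involution only if the \<open>\<epsilon>\<close>-coefficient \<open>D\<close> does.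
\<close>

theorem noncommuting_automorphism:
  assumes alt: "alternative_algebra K A"
    and \<epsilon>: "\<epsilon> \<in> carrier S" "\<epsilon> \<noteq> \<zero>\<^bsub>S\<^esub>" "\<epsilon> \<otimes>\<^bsub>S\<^esub> \<epsilon> = \<zero>\<^bsub>S\<^esub>"
    and nc: "\<not> derivations_commute A j"
  obtains \<phi> z where "\<phi> \<in> algebra_autos S B" "z \<in> carrier B" "\<phi> (J z) \<noteq> J (\<phi> z)"
proof -
  interpret alt: alternative_algebra S B by (rule base_alternative[OF alt])
  obtain a b x where abx: "a \<in> carrier A" "b \<in> carrier A" "x \<in> carrier A"
    and ne: "inner_derivation A a b x \<noteq> j (inner_derivation A a b (j x))"
    using nc unfolding derivations_commute_def by blast
  define D where "D z = inner_derivation B (t a \<one>\<^bsub>S\<^esub>) (t b \<one>\<^bsub>S\<^esub>) z" for z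
  have ab: "t a \<one>\<^bsub>S\<^esub> \<in> carrier B" "t b \<one>\<^bsub>S\<^esub> \<in> carrier B" using abx by simp_all
  have Dc [simp]: "D z \<in> carrier B" if "z \<in> carrier B" for z using that ab by (simp add: D_def)
  have Dadd: "D (z \<oplus>\<^bsub>B\<^esub> w) = D z \<oplus>\<^bsub>B\<^esub> D w" if "z \<in> carrier B" "w \<in> carrier B" for z w
    using that ab by (simp add: D_def B.inner_derivation_add)
  have Dsmult: "D (r \<odot>\<^bsub>B\<^esub> z) = r \<odot>\<^bsub>B\<^esub> D z" if "r \<in> carrier S" "z \<in> carrier B" for r z
    using that ab by (simp add: D_def B.inner_derivation_smult)
  have Dmult: "D (z \<otimes>\<^bsub>B\<^esub> w) = D z \<otimes>\<^bsub>B\<^esub> w \<oplus>\<^bsub>B\<^esub> z \<otimes>\<^bsub>B\<^esub> D w" if "z \<in> carrier B" "w \<in> carrier B" for z w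
    using that ab by (simp add: D_def alt.inner_derivation_product)
  have \<epsilon>\<epsilon>: "\<epsilon> \<odot>\<^bsub>B\<^esub> (\<epsilon> \<odot>\<^bsub>B\<^esub> z) = \<zero>\<^bsub>B\<^esub>" if "z \<in> carrier B" for z
    using that \<epsilon> B.smult_assoc1[of \<epsilon> \<epsilon> z] by simp
  define g where "g s z = z \<oplus>\<^bsub>B\<^esub> s \<odot>\<^bsub>B\<^esub> D z" for s z
  have gc: "g s z \<in> carrier B" if "s \<in> carrier S" "z \<in> carrier B" for s z using that by (simp add: g_def)
  have ginv: "g (\<ominus>\<^bsub>S\<^esub> \<epsilon>) (g \<epsilon> z) = z" "g \<epsilon> (g (\<ominus>\<^bsub>S\<^esub> \<epsilon>) z) = z" if "z \<in> carrier B" for z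
  proof -
    have "D (\<epsilon> \<odot>\<^bsub>B\<^esub> D z) = \<epsilon> \<odot>\<^bsub>B\<^esub> D (D z)" "D (\<ominus>\<^bsub>B\<^esub> (\<epsilon> \<odot>\<^bsub>B\<^esub> D z)) = (\<ominus>\<^bsub>S\<^esub> \<epsilon>) \<odot>\<^bsub>B\<^esub> D (D z)"
      using that \<epsilon>(1) Dsmult[of \<epsilon> "D z"] Dsmult[of "\<ominus>\<^bsub>S\<^esub> \<epsilon>" "D z"] by (simp_all add: B.smult_l_minus)
    moreover have z0: "\<ominus>\<^bsub>B\<^esub> \<zero>\<^bsub>B\<^esub> = \<zero>\<^bsub>B\<^esub>" by (rule B.M.minus_equality) auto
    ultimately show "g (\<ominus>\<^bsub>S\<^esub> \<epsilon>) (g \<epsilon> z) = z" "g \<epsilon> (g (\<ominus>\<^bsub>S\<^esub> \<epsilon>) z) = z"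
      using that \<epsilon>(1) \<epsilon>\<epsilon>[of "D (D z)"]
      by (simp_all add: z0 g_def Dadd B.smult_l_minus B.smult_r_minus B.smult_r_distr B.M.a_assoc B.M.r_neg B.M.l_neg)
  qed
  define \<phi> where "\<phi> = restrict (g \<epsilon>) (carrier B)"
  have "bij_betw (g \<epsilon>) (carrier B) (carrier B)"
    by (rule bij_betw_byWitness[where f' = "g (\<ominus>\<^bsub>S\<^esub> \<epsilon>)"]) (use ginv gc \<epsilon>(1) in auto)
  then have "\<phi> \<in> Bij (carrier B)" unfolding \<phi>_def Bij_def by simp
  moreover have "\<phi> \<in> algebra_homs S B B"
    unfolding algebra_homs_def linear_maps_def
  proof (intro CollectI conjI ballI Pi_I)
    fix z assume z: "z \<in> carrier B"
    show "\<phi> z \<in> carrier B" using z gc \<epsilon> by (simp add: \<phi>_def)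
    show "\<phi> (r \<odot>\<^bsub>B\<^esub> z) = r \<odot>\<^bsub>B\<^esub> \<phi> z" if "r \<in> carrier S" for r
      using z that \<epsilon>(1) by (simp add: \<phi>_def g_def Dsmult B.smult_r_distr B.smult_assoc1[symmetric] ext.m_comm)
    fix w assume w: "w \<in> carrier B"
    show "\<phi> (z \<oplus>\<^bsub>B\<^esub> w) = \<phi> z \<oplus>\<^bsub>B\<^esub> \<phi> w"
      using z w \<epsilon>(1) by (simp add: \<phi>_def g_def Dadd B.smult_r_distr B.M.a_ac)
    have "(\<epsilon> \<odot>\<^bsub>B\<^esub> D z) \<otimes>\<^bsub>B\<^esub> (\<epsilon> \<odot>\<^bsub>B\<^esub> D w) = \<zero>\<^bsub>B\<^esub>"
      using z w \<epsilon>(1) \<epsilon>\<epsilon>[of "D z \<otimes>\<^bsub>B\<^esub> D w"] by (simp add: B.smult_left B.smult_right B.mult_closed)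
    then show "\<phi> (z \<otimes>\<^bsub>B\<^esub> w) = \<phi> z \<otimes>\<^bsub>B\<^esub> \<phi> w"
      using z w \<epsilon>(1) by (simp add: \<phi>_def g_def Dmult B.distrib_left B.distrib_right B.mult_closed
          B.smult_left B.smult_right B.smult_r_distr B.M.a_ac)
  next
    have "D \<one>\<^bsub>B\<^esub> = D \<one>\<^bsub>B\<^esub> \<oplus>\<^bsub>B\<^esub> D \<one>\<^bsub>B\<^esub>"
      using Dmult[OF B.unit_closed B.unit_closed] by (simp add: B.unit_closed B.unit_left B.unit_right)
    then have "D \<one>\<^bsub>B\<^esub> = \<zero>\<^bsub>B\<^esub>" using B.unit_closed by simp
    then show "\<phi> \<one>\<^bsub>B\<^esub> = \<one>\<^bsub>B\<^esub>" using B.unit_closed \<epsilon>(1) by (simp add: \<phi>_def g_def)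
  qed
  ultimately have "\<phi> \<in> algebra_autos S B" by (simp add: algebra_autos_def)
  moreover have "\<phi> (J (t (j x) \<one>\<^bsub>S\<^esub>)) \<noteq> J (\<phi> (t (j x) \<one>\<^bsub>S\<^esub>))"
  proof
    assume eq: "\<phi> (J (t (j x) \<one>\<^bsub>S\<^esub>)) = J (\<phi> (t (j x) \<one>\<^bsub>S\<^esub>))"
    let ?u = "inner_derivation A a b x" and ?v = "j (inner_derivation A a b (j x))"
    have "\<phi> (t y \<one>\<^bsub>S\<^esub>) = t y \<one>\<^bsub>S\<^esub> \<oplus>\<^bsub>B\<^esub> t (inner_derivation A a b y) \<epsilon>" if "y \<in> carrier A" for y
      using that abx \<epsilon>(1) by (simp add: \<phi>_def g_def D_def base_inner_derivation base_smult_pure)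
    then have "t x \<one>\<^bsub>S\<^esub> \<oplus>\<^bsub>B\<^esub> t ?u \<epsilon> = t x \<one>\<^bsub>S\<^esub> \<oplus>\<^bsub>B\<^esub> t ?v \<epsilon>"
      using eq abx \<epsilon>(1) by (simp add: J_pure J_add inv.involution_involutive)
    then have uv: "t ?u \<epsilon> = t ?v \<epsilon>" using abx \<epsilon>(1) by simp
    \<comment> \<open>A functional that is one at \<open>\<epsilon>\<close> reads off the coefficient.\<close>
    obtain l where l: "l \<in> linear_functionals K S" "l \<epsilon> = \<one>"
      by (rule ext.functional_separating[OF field lin_span_submodule[of "[]"], of \<epsilon>]) (use \<epsilon> in auto)
    obtain h where h: "h \<in> carrier B \<rightarrow> carrier A"
      "\<And>x y. x \<in> carrier B \<Longrightarrow> y \<in> carrier B \<Longrightarrow> h (x \<oplus>\<^bsub>B\<^esub> y) = h x \<oplus>\<^bsub>A\<^esub> h y"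
      "\<And>a s. a \<in> carrier A \<Longrightarrow> s \<in> carrier S \<Longrightarrow> h (t a s) = l s \<odot>\<^bsub>A\<^esub> a"
      by (rule slice_right[OF l(1)], rule that, assumption+)
    have cl: "?u \<in> carrier A" "?v \<in> carrier A" using abx by simp_all
    have hu: "h (t y \<epsilon>) = y" if "y \<in> carrier A" for y
      unfolding h(3)[OF that \<epsilon>(1)] l(2) using that by simp
    have "?u = h (t ?u \<epsilon>)" by (rule hu[OF cl(1), symmetric])
    also have "\<dots> = ?v" unfolding uv by (rule hu[OF cl(2)])
    finally have "?u = ?v" .
    then show False using ne by simp
  qed
  ultimately show thesis using abx by (intro that[of \<phi> "t (j x) \<one>\<^bsub>S\<^esub>"]) simp_all
qed

end

context split_product begin

text \<open>
  Take \<open>a = zu1 \<otimes> ze1\<close> and \<open>b = zv1 \<otimes> ze1\<close>. Then \<open>[a, b] = (ze1 - ze2) \<otimes> ze1\<close>, and the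
  associators that occur vanish. The derivation doubles \<open>a\<close>, but it kills the conjugate of \<open>a\<close>,
  whose second component \<open>ze2\<close> is annihilated by \<open>ze1\<close>.
\<close>

lemma split_derivation_noncommuting:
  assumes mn: "2 < m" "1 < n" and two: "\<one> \<oplus> \<one> \<noteq> \<zero>"
  shows "\<not> derivations_commute T conj"
proof
  assume dc: "derivations_commute T conj"
  have mem: "zu1 \<in> carrier C1" "zv1 \<in> carrier C1" "ze1 \<in> carrier C1" "ze2 \<in> carrier C1" "ze1 \<in> carrier C2" "ze2 \<in> carrier C2"
    using mn by (simp_all add: zorn_basis_defs zorn_mem_iff)
  have e: "zu1 \<otimes>\<^bsub>C1\<^esub> zv1 = ze1" "zv1 \<otimes>\<^bsub>C1\<^esub> zu1 = ze2" "ze1 \<otimes>\<^bsub>C1\<^esub> zu1 = zu1" "zu1 \<otimes>\<^bsub>C1\<^esub> ze2 = zu1"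
    "zu1 \<otimes>\<^bsub>C1\<^esub> ze1 = \<zero>\<^bsub>C1\<^esub>" "ze2 \<otimes>\<^bsub>C1\<^esub> zu1 = \<zero>\<^bsub>C1\<^esub>"
    "ze1 \<otimes>\<^bsub>C2\<^esub> ze1 = ze1" "ze1 \<otimes>\<^bsub>C2\<^esub> ze2 = \<zero>\<^bsub>C2\<^esub>" "ze2 \<otimes>\<^bsub>C2\<^esub> ze1 = \<zero>\<^bsub>C2\<^esub>"
    by (simp_all add: zorn_basis_defs minus_eq)
  let ?a = "t zu1 ze1" and ?b = "t zv1 ze1"
  have z0: "\<ominus>\<^bsub>T\<^esub> \<zero>\<^bsub>T\<^esub> = \<zero>\<^bsub>T\<^esub>" by (rule T.minus_equality) auto
  have com: "commutator T ?a ?b = t ze1 ze1 \<ominus>\<^bsub>T\<^esub> t ze2 ze1"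
    using mem unfolding commutator_def by (simp add: pure_mult e del: split_composition_simps)
  have Da: "inner_derivation T ?a ?b ?a = t zu1 ze1 \<oplus>\<^bsub>T\<^esub> t zu1 ze1"
    using mem unfolding inner_derivation_def com unfolding commutator_def associator_def
    by (simp add: pure_mult e pure_null_left pure_closed T.minus_eq T.r_neg z0 T.minus_add
        TA.distrib_left TA.distrib_right TA.uminus_left TA.uminus_right del: split_composition_simps)
  have Dc: "inner_derivation T ?a ?b (conj ?a) = \<zero>\<^bsub>T\<^esub>"
  proof -
    define w where "w = zorn_conj K zu1"
    have w: "w \<in> carrier C1" using mem zorn_conj_closed[of zu1 m] by (simp add: w_def)
    have "zorn_conj K ze1 = ze2" by (simp add: zorn_basis_defs)
    then have c: "conj ?a = t w ze2" using conj_pure[of zu1 ze1] mem by (simp add: w_def)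
    show ?thesis
      unfolding c inner_derivation_def com unfolding commutator_def associator_def using mem w
      by (simp add: pure_mult e pure_null_right pure_closed T.minus_eq z0 fst.mult_closed TA.null_right
          TA.distrib_left TA.distrib_right TA.uminus_left TA.uminus_right del: split_composition_simps)
  qed
  have conj0: "conj \<zero>\<^bsub>T\<^esub> = \<zero>\<^bsub>T\<^esub>"
    using conj_add[of "\<zero>\<^bsub>T\<^esub>" "\<zero>\<^bsub>T\<^esub>"] conj_closed[of "\<zero>\<^bsub>T\<^esub>"] by simp
  have "?a \<in> carrier T" "?b \<in> carrier T" using mem pure_closed by auto
  with dc have "inner_derivation T ?a ?b ?a = conj (inner_derivation T ?a ?b (conj ?a))"
    unfolding derivations_commute_def by blast
  then have eq: "t zu1 ze1 \<oplus>\<^bsub>T\<^esub> t zu1 ze1 = \<zero>\<^bsub>T\<^esub>" unfolding Da Dc conj0 .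
  obtain h where h: "h \<in> carrier T \<rightarrow> carrier C2"
    "\<And>x y. x \<in> carrier T \<Longrightarrow> y \<in> carrier T \<Longrightarrow> h (x \<oplus>\<^bsub>T\<^esub> y) = h x \<oplus>\<^bsub>C2\<^esub> h y"
    "\<And>a b. a \<in> carrier C1 \<Longrightarrow> b \<in> carrier C2 \<Longrightarrow> h (t a b) = zorn_coord 1 a \<odot>\<^bsub>C2\<^esub> b"
    by (rule functional_slice[OF zorn_coord_functional[of 1 m]]) auto
  have "h (t zu1 ze1 \<oplus>\<^bsub>T\<^esub> t zu1 ze1) = h (t \<zero>\<^bsub>C1\<^esub> \<zero>\<^bsub>C2\<^esub>)"
    unfolding eq using pure_null_left[OF snd.M.zero_closed] by simp
  then have "zorn_coord 1 zu1 \<odot>\<^bsub>C2\<^esub> ze1 \<oplus>\<^bsub>C2\<^esub> zorn_coord 1 zu1 \<odot>\<^bsub>C2\<^esub> ze1 = zorn_coord 1 \<zero>\<^bsub>C1\<^esub> \<odot>\<^bsub>C2\<^esub> \<zero>\<^bsub>C2\<^esub>"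
    using mem h(2,3) pure_closed fst.M.zero_closed snd.M.zero_closed by (simp del: split_composition_simps)
  then show False using two by (simp add: zorn_basis_defs)
qed

end

section \<open>Trivial and quadratic involutions\<close>

text \<open>
  The algebra is \<open>K 1 + K s\<close> with \<open>s\<^sup>2\<close> a unit, and the involution is the standard one.
\<close>

definition quadratic_involution :: "('k, 'x) ring_scheme \<Rightarrow> ('k, 'a, 'y) module_scheme \<Rightarrow> ('a \<Rightarrow> 'a) \<Rightarrow> bool"
  where "quadratic_involution K A j \<longleftrightarrow> (\<exists>s\<in>carrier A. \<exists>d\<in>Units K.
     j s = \<ominus>\<^bsub>A\<^esub> s \<and> s \<otimes>\<^bsub>A\<^esub> s = d \<odot>\<^bsub>A\<^esub> \<one>\<^bsub>A\<^esub> \<and>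
     (\<forall>x\<in>carrier A. \<exists>\<alpha>\<in>carrier K. \<exists>\<beta>\<in>carrier K. x = \<alpha> \<odot>\<^bsub>A\<^esub> \<one>\<^bsub>A\<^esub> \<oplus>\<^bsub>A\<^esub> \<beta> \<odot>\<^bsub>A\<^esub> s))"

lemma (in unital_algebra) double_zero:
  assumes "\<one> \<oplus> \<one> \<in> Units K" "x \<in> carrier A" "x \<oplus>\<^bsub>A\<^esub> x = \<zero>\<^bsub>A\<^esub>"
  shows "x = \<zero>\<^bsub>A\<^esub>"
proof -
  have "(\<one> \<oplus> \<one>) \<odot>\<^bsub>A\<^esub> x = \<zero>\<^bsub>A\<^esub>" using assms by (simp add: smult_l_distr)
  then have "(inv (\<one> \<oplus> \<one>) \<otimes> (\<one> \<oplus> \<one>)) \<odot>\<^bsub>A\<^esub> x = \<zero>\<^bsub>A\<^esub>"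
    using assms(1,2) by (simp add: smult_assoc1 del: R.Units_l_inv)
  then show ?thesis using assms by simp
qed

context scalar_extension begin

lemma ext_two_unit:
  assumes "\<one> \<oplus> \<one> \<in> Units K"
  shows "\<one>\<^bsub>S\<^esub> \<oplus>\<^bsub>S\<^esub> \<one>\<^bsub>S\<^esub> \<in> Units S"
proof -
  let ?h = "inv (\<one> \<oplus> \<one>)"
  have h: "?h \<in> carrier K" "?h \<otimes> (\<one> \<oplus> \<one>) = \<one>" using assms by simp_all
  have "(?h \<odot>\<^bsub>S\<^esub> \<one>\<^bsub>S\<^esub>) \<otimes>\<^bsub>S\<^esub> (\<one>\<^bsub>S\<^esub> \<oplus>\<^bsub>S\<^esub> \<one>\<^bsub>S\<^esub>) = ?h \<odot>\<^bsub>S\<^esub> ((\<one> \<oplus> \<one>) \<odot>\<^bsub>S\<^esub> \<one>\<^bsub>S\<^esub>)"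
    using h(1) by (simp add: ext.smult_assoc2 ext.smult_l_distr)
  also have "\<dots> = \<one>\<^bsub>S\<^esub>" using h ext.smult_assoc1[of ?h "\<one> \<oplus> \<one>" "\<one>\<^bsub>S\<^esub>"] by simp
  finally show ?thesis using h(1) ext.m_comm unfolding Units_def
    by (intro CollectI conjI bexI[of _ "?h \<odot>\<^bsub>S\<^esub> \<one>\<^bsub>S\<^esub>"]) auto
qed

end

context involution_extension begin

lemma trivial_involution_base:
  assumes "\<And>x. x \<in> carrier A \<Longrightarrow> j x = x" "z \<in> carrier B"
  shows "J z = z"
  using assms(2) by (induction z rule: base_induct) (simp_all add: J_pure J_add assms(1))

lemma trivial_involution_descent:
  assumes one: "\<one>\<^bsub>S\<^esub> \<noteq> \<zero>\<^bsub>S\<^esub>" and J: "\<And>z. z \<in> carrier B \<Longrightarrow> J z = z" and x: "x \<in> carrier A"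
  shows "j x = x"
  using J[of "t x \<one>\<^bsub>S\<^esub>"] x by (intro pure_inj'[OF one]) (simp_all add: J_pure)

text \<open>
  Let \<open>y = r + q s\<close> be the image of \<open>s\<close>. As \<open>y\<^sup>2 = s\<^sup>2\<close> is a scalar, \<open>2 r q s = 0\<close>. Then the
  image \<open>r y\<close> of \<open>r s\<close> is the scalar \<open>r\<^sup>2\<close>, so \<open>r s\<close> equals this scalar; it is both skew and
  symmetric, and therefore zero. Since \<open>s\<^sup>2\<close> is a unit, \<open>r = 0\<close>, and \<open>y\<close> is skew like \<open>s\<close>.
\<close>

theorem quadratic_automorphism_commutes:
  assumes two: "\<one> \<oplus> \<one> \<in> Units K" and A: "quadratic_involution K A j"
    and \<phi>: "\<phi> \<in> algebra_autos S B" and x: "x \<in> carrier B"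
  shows "\<phi> (J x) = J (\<phi> x)"
proof -
  interpret \<phi>: algebra_iso S B B \<phi>
    using \<phi> by unfold_locales (auto simp: algebra_autos_def Bij_def)
  obtain s d where s: "s \<in> carrier A" "d \<in> Units K" "j s = \<ominus>\<^bsub>A\<^esub> s" "s \<otimes>\<^bsub>A\<^esub> s = d \<odot>\<^bsub>A\<^esub> \<one>\<^bsub>A\<^esub>"
    and span: "\<And>x. x \<in> carrier A \<Longrightarrow> \<exists>\<alpha>\<in>carrier K. \<exists>\<beta>\<in>carrier K. x = \<alpha> \<odot>\<^bsub>A\<^esub> \<one>\<^bsub>A\<^esub> \<oplus>\<^bsub>A\<^esub> \<beta> \<odot>\<^bsub>A\<^esub> s"
    using A unfolding quadratic_involution_def by blast
  have dK: "d \<in> carrier K" using s(2) by (rule alg.R.Units_closed)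
  note u = alg.unit_closed
  have dbl: "z = \<zero>\<^bsub>B\<^esub>" if "z \<in> carrier B" "z \<oplus>\<^bsub>B\<^esub> z = \<zero>\<^bsub>B\<^esub>" for z
    by (rule B.double_zero[OF ext_two_unit[OF two] that])
  have form: "\<exists>r\<in>carrier S. \<exists>q\<in>carrier S. x = t \<one>\<^bsub>A\<^esub> r \<oplus>\<^bsub>B\<^esub> t s q" if "x \<in> carrier B" for x
    using that
  proof (induction x rule: base_induct)
    case (pure a p)
    obtain \<alpha> \<beta> where ab: "\<alpha> \<in> carrier K" "\<beta> \<in> carrier K" "a = \<alpha> \<odot>\<^bsub>A\<^esub> \<one>\<^bsub>A\<^esub> \<oplus>\<^bsub>A\<^esub> \<beta> \<odot>\<^bsub>A\<^esub> s"
      using span[OF pure(1)] by blast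
    have "t a p = t \<one>\<^bsub>A\<^esub> (\<alpha> \<odot>\<^bsub>S\<^esub> p) \<oplus>\<^bsub>B\<^esub> t s (\<beta> \<odot>\<^bsub>S\<^esub> p)"
      unfolding ab(3) using ab(1,2) pure(2) s(1) u by (simp add: base_pure_add_left pure_balanced)
    then show ?case using ab(1,2) pure(2) by blast
  next
    case (add x y)
    then obtain r q r' q' where *: "x = t \<one>\<^bsub>A\<^esub> r \<oplus>\<^bsub>B\<^esub> t s q" "y = t \<one>\<^bsub>A\<^esub> r' \<oplus>\<^bsub>B\<^esub> t s q'"
      "r \<in> carrier S" "q \<in> carrier S" "r' \<in> carrier S" "q' \<in> carrier S" by blast
    have "x \<oplus>\<^bsub>B\<^esub> y = t \<one>\<^bsub>A\<^esub> (r \<oplus>\<^bsub>S\<^esub> r') \<oplus>\<^bsub>B\<^esub> t s (q \<oplus>\<^bsub>S\<^esub> q')"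
      unfolding *(1,2) using *(3-) s(1) u by (simp add: base_pure_add_right B.M.a_ac)
    then show ?case using *(3-) by blast
  qed
  have J1: "J (t \<one>\<^bsub>A\<^esub> r) = t \<one>\<^bsub>A\<^esub> r" if "r \<in> carrier S" for r
    using that u by (simp add: J_pure inv.involution_one)
  have Js: "J (t s r) = \<ominus>\<^bsub>B\<^esub> t s r" if "r \<in> carrier S" for r
    using that s by (simp add: J_pure pure_minus_left)
  have one_smult: "t \<one>\<^bsub>A\<^esub> r = r \<odot>\<^bsub>B\<^esub> \<one>\<^bsub>B\<^esub>" if "r \<in> carrier S" for r
    using that u by (simp add: base_one base_smult_pure)
  have \<phi>1: "\<phi> (t \<one>\<^bsub>A\<^esub> r) = t \<one>\<^bsub>A\<^esub> r" if "r \<in> carrier S" for r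
    using that by (simp add: one_smult \<phi>.hom_smult B.unit_closed \<phi>.hom_one)
  define y where "y = \<phi> (t s \<one>\<^bsub>S\<^esub>)"
  have y: "y \<in> carrier B" using s(1) by (simp add: y_def)
  obtain r q where rq: "r \<in> carrier S" "q \<in> carrier S" "y = t \<one>\<^bsub>A\<^esub> r \<oplus>\<^bsub>B\<^esub> t s q" using form[OF y] by blast
  have ss: "t (s \<otimes>\<^bsub>A\<^esub> s) p = t \<one>\<^bsub>A\<^esub> (d \<odot>\<^bsub>S\<^esub> p)" if "p \<in> carrier S" for p
    unfolding s(4) using that u dK by (simp add: pure_balanced)
  define w where "w = t s (r \<otimes>\<^bsub>S\<^esub> q)"
  define e where "e = t \<one>\<^bsub>A\<^esub> (r \<otimes>\<^bsub>S\<^esub> r) \<oplus>\<^bsub>B\<^esub> t \<one>\<^bsub>A\<^esub> (d \<odot>\<^bsub>S\<^esub> (q \<otimes>\<^bsub>S\<^esub> q))"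
  have we: "w \<in> carrier B" "e \<in> carrier B" using rq s(1) u dK by (simp_all add: w_def e_def)
  \<comment> \<open>The square of \<open>y\<close> is a scalar, hence fixed by the involution; its skew part is \<open>w \<oplus> w\<close>.\<close>
  have yy: "y \<otimes>\<^bsub>B\<^esub> y = (w \<oplus>\<^bsub>B\<^esub> w) \<oplus>\<^bsub>B\<^esub> e"
    unfolding rq(3) using rq(1,2) s(1) u dK
    by (simp add: B.distrib_left B.distrib_right base_pure_mult alg.unit_left alg.unit_right w_def e_def
        ss ext.m_comm[of q r] B.M.a_ac)
  have "y \<otimes>\<^bsub>B\<^esub> y = t \<one>\<^bsub>A\<^esub> (d \<odot>\<^bsub>S\<^esub> \<one>\<^bsub>S\<^esub>)"
    unfolding y_def using s(1) dK by (simp add: \<phi>.hom_mult[symmetric] base_pure_mult ss \<phi>1)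
  then have "J (y \<otimes>\<^bsub>B\<^esub> y) = y \<otimes>\<^bsub>B\<^esub> y" using J1 dK by simp
  moreover have "J w = \<ominus>\<^bsub>B\<^esub> w" using Js rq(1,2) by (simp add: w_def)
  moreover have "J e = e" using J1 rq(1,2) dK u by (simp add: e_def J_add)
  ultimately have "(\<ominus>\<^bsub>B\<^esub> w \<oplus>\<^bsub>B\<^esub> \<ominus>\<^bsub>B\<^esub> w) \<oplus>\<^bsub>B\<^esub> e = (w \<oplus>\<^bsub>B\<^esub> w) \<oplus>\<^bsub>B\<^esub> e"
    unfolding yy using we by (simp add: J_add)
  then have "\<ominus>\<^bsub>B\<^esub> w \<oplus>\<^bsub>B\<^esub> \<ominus>\<^bsub>B\<^esub> w = w \<oplus>\<^bsub>B\<^esub> w" using we by simp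
  then have neg: "\<ominus>\<^bsub>B\<^esub> (w \<oplus>\<^bsub>B\<^esub> w) = w \<oplus>\<^bsub>B\<^esub> w" using we by (simp add: B.M.minus_add)
  have ww: "w \<oplus>\<^bsub>B\<^esub> w \<in> carrier B" using we by simp
  have "(w \<oplus>\<^bsub>B\<^esub> w) \<oplus>\<^bsub>B\<^esub> (w \<oplus>\<^bsub>B\<^esub> w) = \<zero>\<^bsub>B\<^esub>" using B.M.r_neg[OF ww] unfolding neg .
  then have "w \<oplus>\<^bsub>B\<^esub> w = \<zero>\<^bsub>B\<^esub>" by (rule dbl[OF ww])
  then have w0: "t s (r \<otimes>\<^bsub>S\<^esub> q) = \<zero>\<^bsub>B\<^esub>" unfolding w_def[symmetric] by (rule dbl[OF we(1)])
  have "\<phi> (t s r) = r \<odot>\<^bsub>B\<^esub> y"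
    unfolding y_def using s(1) rq(1) by (simp add: \<phi>.hom_smult[symmetric] base_smult_pure)
  also have "\<dots> = t \<one>\<^bsub>A\<^esub> (r \<otimes>\<^bsub>S\<^esub> r)"
    unfolding rq(3) using rq(1,2) s(1) u w0 by (simp add: B.smult_r_distr base_smult_pure)
  also have "\<dots> = \<phi> (t \<one>\<^bsub>A\<^esub> (r \<otimes>\<^bsub>S\<^esub> r))" using \<phi>1 rq(1) by simp
  finally have sr: "t s r = t \<one>\<^bsub>A\<^esub> (r \<otimes>\<^bsub>S\<^esub> r)" by (rule \<phi>.inj[rotated 2]) (use s(1) u rq(1) in simp_all)
  have "\<ominus>\<^bsub>B\<^esub> t s r = J (t s r)" by (rule Js[OF rq(1), symmetric])
  also have "\<dots> = t \<one>\<^bsub>A\<^esub> (r \<otimes>\<^bsub>S\<^esub> r)" unfolding sr by (rule J1) (use rq(1) in simp)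
  also have "\<dots> = t s r" by (rule sr[symmetric])
  finally have neg: "\<ominus>\<^bsub>B\<^esub> t s r = t s r" .
  have tsr: "t s r \<in> carrier B" using s(1) rq(1) by simp
  have "t s r \<oplus>\<^bsub>B\<^esub> t s r = \<zero>\<^bsub>B\<^esub>" using B.M.r_neg[OF tsr] unfolding neg .
  then have "t s r = \<zero>\<^bsub>B\<^esub>" by (rule dbl[OF tsr])
  then have "t s r \<otimes>\<^bsub>B\<^esub> t s \<one>\<^bsub>S\<^esub> = \<zero>\<^bsub>B\<^esub>" using s(1) by (simp add: B.null_left)
  then have dr: "t \<one>\<^bsub>A\<^esub> (d \<odot>\<^bsub>S\<^esub> r) = \<zero>\<^bsub>B\<^esub>" using s(1) rq(1) by (simp add: base_pure_mult ss)
  have r0: "t \<one>\<^bsub>A\<^esub> r = \<zero>\<^bsub>B\<^esub>"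
  proof -
    let ?i = "inv d"
    have i: "?i \<in> carrier K" "?i \<otimes> d = \<one>" using s(2) by simp_all
    have "t \<one>\<^bsub>A\<^esub> r = t \<one>\<^bsub>A\<^esub> (?i \<odot>\<^bsub>S\<^esub> (d \<odot>\<^bsub>S\<^esub> r))"
      using i dK rq(1) by (simp add: ext.smult_assoc1[symmetric])
    also have "?i \<odot>\<^bsub>S\<^esub> (d \<odot>\<^bsub>S\<^esub> r) = (?i \<odot>\<^bsub>S\<^esub> \<one>\<^bsub>S\<^esub>) \<otimes>\<^bsub>S\<^esub> (d \<odot>\<^bsub>S\<^esub> r)"
      using i dK rq(1) by (simp add: ext.smult_assoc2)
    also have "t \<one>\<^bsub>A\<^esub> \<dots> = (?i \<odot>\<^bsub>S\<^esub> \<one>\<^bsub>S\<^esub>) \<odot>\<^bsub>B\<^esub> t \<one>\<^bsub>A\<^esub> (d \<odot>\<^bsub>S\<^esub> r)"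
      using i dK rq(1) u by (simp add: base_smult_pure)
    also have "\<dots> = \<zero>\<^bsub>B\<^esub>" unfolding dr using i by simp
    finally show ?thesis .
  qed
  then have y': "y = t s q" using rq s(1) by simp
  then have Jy: "J y = \<ominus>\<^bsub>B\<^esub> y" using Js rq(2) by simp
  obtain p v where pv: "p \<in> carrier S" "v \<in> carrier S" "x = t \<one>\<^bsub>A\<^esub> p \<oplus>\<^bsub>B\<^esub> t s v" using form[OF x] by blast
  have \<phi>s: "\<phi> (t s v) = v \<odot>\<^bsub>B\<^esub> y"
    unfolding y_def using s(1) pv(2) by (simp add: \<phi>.hom_smult[symmetric] base_smult_pure)
  show ?thesis
    unfolding pv(3) using pv(1,2) s(1) u y
    by (simp add: J_add J1 Js \<phi>.hom_add \<phi>.hom_minus \<phi>1 \<phi>s J_smult Jy B.smult_r_minus)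
qed

end

context split_product begin

lemma conj_trivial:
  assumes "m = 1" "n = 1" "z \<in> carrier T"
  shows "conj z = z"
proof -
  have c1: "zorn_conj K x = x" if "x \<in> zorn_carrier K m" for x
    using that assms(1) unfolding zorn_carrier_def by auto
  have c2: "zorn_conj K x = x" if "x \<in> zorn_carrier K n" for x
    using that assms(2) unfolding zorn_carrier_def by auto
  show ?thesis using assms(3)
    by (induction z rule: tensor_induct) (simp_all add: conj_pure conj_add c1 c2)
qed

lemma conj_quadratic:
  assumes mn: "m = 2" "n = 1" and two: "\<one> \<oplus> \<one> \<in> Units K"
  obtains \<sigma> where "\<sigma> \<in> carrier T" "conj \<sigma> = \<ominus>\<^bsub>T\<^esub> \<sigma>" "\<sigma> \<otimes>\<^bsub>T\<^esub> \<sigma> = \<one>\<^bsub>T\<^esub>"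
    "\<And>x. x \<in> carrier T \<Longrightarrow> \<exists>\<alpha>\<in>carrier K. \<exists>\<beta>\<in>carrier K. x = \<alpha> \<odot>\<^bsub>T\<^esub> \<one>\<^bsub>T\<^esub> \<oplus>\<^bsub>T\<^esub> \<beta> \<odot>\<^bsub>T\<^esub> \<sigma>"
    "\<And>\<alpha>. \<alpha> \<in> carrier K \<Longrightarrow> conj (\<alpha> \<odot>\<^bsub>T\<^esub> \<one>\<^bsub>T\<^esub>) = \<alpha> \<odot>\<^bsub>T\<^esub> \<one>\<^bsub>T\<^esub>"
    "\<And>\<beta>. \<beta> \<in> carrier K \<Longrightarrow> conj (\<beta> \<odot>\<^bsub>T\<^esub> \<sigma>) = \<ominus>\<^bsub>T\<^esub> (\<beta> \<odot>\<^bsub>T\<^esub> \<sigma>)"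
proof
  define s where "s = Zorn \<one> (\<zero>, \<zero>, \<zero>) (\<zero>, \<zero>, \<zero>) (\<ominus> \<one>)"
  have s: "s \<in> carrier C1" "s \<in> zorn_carrier K m" using mn by (simp_all add: s_def zorn_mem_iff)
  note ones = fst.unit_closed snd.unit_closed
  have cs: "zorn_conj K s = \<ominus>\<^bsub>C1\<^esub> s" using zorn_uminus[OF s(2)] by (simp add: s_def l_minus)
  have cone: "conj (t c \<one>\<^bsub>C2\<^esub>) = t (zorn_conj K c) \<one>\<^bsub>C2\<^esub>" if "c \<in> carrier C1" for c
    using conj_pure[of c "\<one>\<^bsub>C2\<^esub>"] that ones unfolding zorn_conj_simps(3) by simp
  let ?s = "t s \<one>\<^bsub>C2\<^esub>"
  show sT: "?s \<in> carrier T" using s(1) ones pure_closed by blast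
  show cS: "conj ?s = \<ominus>\<^bsub>T\<^esub> ?s" using cone[OF s(1)] cs pure_uminus_left[OF s(1) ones(2)] by simp
  have ss: "s \<otimes>\<^bsub>C1\<^esub> s = \<one>\<^bsub>C1\<^esub>" by (simp add: s_def minus_eq l_minus)
  show "?s \<otimes>\<^bsub>T\<^esub> ?s = \<one>\<^bsub>T\<^esub>"
    unfolding pure_mult[OF s(1) s(1) ones(2) ones(2)] snd.unit_left[OF ones(2)] tensor_one ss ..
  define h where "h = inv (\<one> \<oplus> \<one>)"
  have h: "h \<in> carrier K" "h \<oplus> h = \<one>"
  proof -
    show hc: "h \<in> carrier K" using two by (simp add: h_def)
    show "h \<oplus> h = \<one>"
      using r_distr[OF one_closed one_closed hc] Units_l_inv[OF two] hc by (simp add: h_def del: Units_l_inv)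
  qed
  show "\<exists>\<alpha>\<in>carrier K. \<exists>\<beta>\<in>carrier K. x = \<alpha> \<odot>\<^bsub>T\<^esub> \<one>\<^bsub>T\<^esub> \<oplus>\<^bsub>T\<^esub> \<beta> \<odot>\<^bsub>T\<^esub> ?s" if x: "x \<in> carrier T" for x
  proof -
    obtain c where c: "c \<in> carrier C1" "x = t c \<one>\<^bsub>C2\<^esub>" by (rule unit_second_factor[OF mn(2) x])
    obtain a b where ab: "c = Zorn a (\<zero>, \<zero>, \<zero>) (\<zero>, \<zero>, \<zero>) b" "a \<in> carrier K" "b \<in> carrier K"
      using c(1) mn(1) unfolding split_composition_simps zorn_carrier_def by auto
    have e1: "h \<otimes> (a \<oplus> b) \<oplus> h \<otimes> (a \<oplus> \<ominus> b) = a" "h \<otimes> (a \<oplus> b) \<oplus> h \<otimes> (\<ominus> (a \<oplus> \<ominus> b)) = b"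
    proof -
      have pq: "(p \<oplus> q) \<oplus> (p \<oplus> \<ominus> q) = p \<oplus> p" "(p \<oplus> q) \<oplus> (\<ominus> p \<oplus> q) = q \<oplus> q"
        if "p \<in> carrier K" "q \<in> carrier K" for p q
      proof -
        have "(p \<oplus> q) \<oplus> (p \<oplus> \<ominus> q) = (p \<oplus> p) \<oplus> (q \<oplus> \<ominus> q)"
          "(p \<oplus> q) \<oplus> (\<ominus> p \<oplus> q) = (q \<oplus> q) \<oplus> (p \<oplus> \<ominus> p)"
          using that by (simp_all add: a_ac)
        then show "(p \<oplus> q) \<oplus> (p \<oplus> \<ominus> q) = p \<oplus> p" "(p \<oplus> q) \<oplus> (\<ominus> p \<oplus> q) = q \<oplus> q"
          using that by (simp_all add: r_neg)
      qed
      have hh: "h \<otimes> c \<oplus> h \<otimes> c = c" if "c \<in> carrier K" for c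
        using l_distr[OF h(1) h(1) that] h(2) that by simp
      show "h \<otimes> (a \<oplus> b) \<oplus> h \<otimes> (a \<oplus> \<ominus> b) = a" "h \<otimes> (a \<oplus> b) \<oplus> h \<otimes> (\<ominus> (a \<oplus> \<ominus> b)) = b"
        using pq[of "h \<otimes> a" "h \<otimes> b"] hh h(1) ab by (simp_all add: r_distr r_minus minus_add)
    qed
    have "c = (h \<otimes> (a \<oplus> b)) \<odot>\<^bsub>C1\<^esub> \<one>\<^bsub>C1\<^esub> \<oplus>\<^bsub>C1\<^esub> (h \<otimes> (a \<oplus> \<ominus> b)) \<odot>\<^bsub>C1\<^esub> s"
      using e1 h(1) ab by (simp add: s_def r_minus)
    then have "x = t ((h \<otimes> (a \<oplus> b)) \<odot>\<^bsub>C1\<^esub> \<one>\<^bsub>C1\<^esub> \<oplus>\<^bsub>C1\<^esub> (h \<otimes> (a \<oplus> \<ominus> b)) \<odot>\<^bsub>C1\<^esub> s) \<one>\<^bsub>C2\<^esub>"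
      using c(2) by (simp only:)
    also have "\<dots> = (h \<otimes> (a \<oplus> b)) \<odot>\<^bsub>T\<^esub> \<one>\<^bsub>T\<^esub> \<oplus>\<^bsub>T\<^esub> (h \<otimes> (a \<oplus> \<ominus> b)) \<odot>\<^bsub>T\<^esub> ?s"
      using h(1) ab(2,3) ones s(1) by (simp add: pure_add_left tensor_smult_pure tensor_one del: split_composition_simps)
    finally show ?thesis using h(1) ab(2,3) by blast
  qed
  show "conj (\<alpha> \<odot>\<^bsub>T\<^esub> \<one>\<^bsub>T\<^esub>) = \<alpha> \<odot>\<^bsub>T\<^esub> \<one>\<^bsub>T\<^esub>" if "\<alpha> \<in> carrier K" for \<alpha>
  proof -
    have "zorn_conj K (\<alpha> \<odot>\<^bsub>C1\<^esub> \<one>\<^bsub>C1\<^esub>) = \<alpha> \<odot>\<^bsub>C1\<^esub> \<one>\<^bsub>C1\<^esub>" using that by simp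
    then show ?thesis
      using cone[of "\<alpha> \<odot>\<^bsub>C1\<^esub> \<one>\<^bsub>C1\<^esub>"] tensor_smult_pure[OF that ones] fst.smult_closed[OF that ones(1)] tensor_one by simp
  qed
  show "conj (\<beta> \<odot>\<^bsub>T\<^esub> ?s) = \<ominus>\<^bsub>T\<^esub> (\<beta> \<odot>\<^bsub>T\<^esub> ?s)" if "\<beta> \<in> carrier K" for \<beta>
  proof -
    have "zorn_conj K (\<beta> \<odot>\<^bsub>C1\<^esub> s) = \<beta> \<odot>\<^bsub>C1\<^esub> zorn_conj K s"
      using zorn_conj_simps(2)[OF that s(2)] by simp
    also have "\<dots> = \<ominus>\<^bsub>C1\<^esub> (\<beta> \<odot>\<^bsub>C1\<^esub> s)"
      unfolding cs by (rule fst.smult_r_minus[OF that s(1)])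
    finally have "zorn_conj K (\<beta> \<odot>\<^bsub>C1\<^esub> s) = \<ominus>\<^bsub>C1\<^esub> (\<beta> \<odot>\<^bsub>C1\<^esub> s)" .
    then show ?thesis
      using cone[of "\<beta> \<odot>\<^bsub>C1\<^esub> s"] tensor_smult_pure[OF that s(1) ones(2)] fst.smult_closed[OF that s(1)]
        pure_uminus_left[of "\<beta> \<odot>\<^bsub>C1\<^esub> s" "\<one>\<^bsub>C2\<^esub>"] ones by simp
  qed
qed

end

section \<open>Descent of quadratic involutions\<close>

lemma (in split_product) tensor_one_nonzero:
  assumes "\<one> \<noteq> \<zero>"
  shows "\<one>\<^bsub>T\<^esub> \<noteq> \<zero>\<^bsub>T\<^esub>"
proof
  assume eq: "\<one>\<^bsub>T\<^esub> = \<zero>\<^bsub>T\<^esub>"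
  obtain h where h: "h \<in> carrier T \<rightarrow> carrier C2"
    "\<And>x y. x \<in> carrier T \<Longrightarrow> y \<in> carrier T \<Longrightarrow> h (x \<oplus>\<^bsub>T\<^esub> y) = h x \<oplus>\<^bsub>C2\<^esub> h y"
    "\<And>a b. a \<in> carrier C1 \<Longrightarrow> b \<in> carrier C2 \<Longrightarrow> h (t a b) = zorn_coord 0 a \<odot>\<^bsub>C2\<^esub> b"
    by (rule functional_slice[OF zorn_coord_functional[of 0 m]]) auto
  have "h (t \<one>\<^bsub>C1\<^esub> \<one>\<^bsub>C2\<^esub>) = h (t \<zero>\<^bsub>C1\<^esub> \<one>\<^bsub>C2\<^esub>)"
    using eq unfolding tensor_one pure_null_left[OF snd.unit_closed] by simp
  then have "zorn_coord 0 \<one>\<^bsub>C1\<^esub> \<odot>\<^bsub>C2\<^esub> \<one>\<^bsub>C2\<^esub> = zorn_coord 0 \<zero>\<^bsub>C1\<^esub> \<odot>\<^bsub>C2\<^esub> \<one>\<^bsub>C2\<^esub>"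
    unfolding h(3)[OF fst.unit_closed snd.unit_closed] h(3)[OF fst.M.zero_closed snd.unit_closed] .
  then show False using assms by simp
qed

text \<open>
  The involution of \<open>A\<close> is not trivial because that of the base change is not, so \<open>s = a - j a\<close>
  is nonzero for some \<open>a\<close>. Being skew, \<open>s\<close> becomes a nonzero multiple of \<open>\<sigma>\<close> over \<open>S\<close>. Hence its
  square is a nonzero scalar, and with the unit it spans the base change; membership in the
  subspaces \<open>K 1\<close> and \<open>K 1 + K s\<close> of \<open>A\<close> may be tested over \<open>S\<close>.
\<close>

theorem (in involution_extension) quadratic_involution_descent:
  fixes m n :: nat
  assumes mn: "m = 2" "n = 1"
    and one: "\<one>\<^bsub>S\<^esub> \<noteq> \<zero>\<^bsub>S\<^esub>" and S: "field S" and two: "\<one>\<^bsub>S\<^esub> \<oplus>\<^bsub>S\<^esub> \<one>\<^bsub>S\<^esub> \<in> Units S"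
    and f: "f \<in> algebra_homs S B (tensor_product S (split_composition S m) (split_composition S n))"
      "bij_betw f (carrier B) (carrier (tensor_product S (split_composition S m) (split_composition S n)))"
      "\<And>x. x \<in> carrier B \<Longrightarrow> f (J x) =
        tensor_map S (split_composition S m) (split_composition S n) (zorn_conj S) (zorn_conj S) (f x)"
  shows "quadratic_involution K A j"
proof -
  interpret P: split_product S m n by (unfold_locales)
  interpret f: algebra_iso S B P.T f
    using f(1,2) by unfold_locales
  obtain \<sigma> where \<sigma>: "\<sigma> \<in> carrier P.T" "P.conj \<sigma> = \<ominus>\<^bsub>P.T\<^esub> \<sigma>" "\<sigma> \<otimes>\<^bsub>P.T\<^esub> \<sigma> = \<one>\<^bsub>P.T\<^esub>"
    and span: "\<And>x. x \<in> carrier P.T \<Longrightarrow> \<exists>\<alpha>\<in>carrier S. \<exists>\<beta>\<in>carrier S. x = \<alpha> \<odot>\<^bsub>P.T\<^esub> \<one>\<^bsub>P.T\<^esub> \<oplus>\<^bsub>P.T\<^esub> \<beta> \<odot>\<^bsub>P.T\<^esub> \<sigma>"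
    and conj1: "\<And>\<alpha>. \<alpha> \<in> carrier S \<Longrightarrow> P.conj (\<alpha> \<odot>\<^bsub>P.T\<^esub> \<one>\<^bsub>P.T\<^esub>) = \<alpha> \<odot>\<^bsub>P.T\<^esub> \<one>\<^bsub>P.T\<^esub>"
    and conj\<sigma>: "\<And>\<beta>. \<beta> \<in> carrier S \<Longrightarrow> P.conj (\<beta> \<odot>\<^bsub>P.T\<^esub> \<sigma>) = \<ominus>\<^bsub>P.T\<^esub> (\<beta> \<odot>\<^bsub>P.T\<^esub> \<sigma>)"
    by (rule P.conj_quadratic[OF mn two]) (rule that, assumption+)
  have u: "\<one>\<^bsub>P.T\<^esub> \<in> carrier P.T" by (rule P.TA.unit_closed)
  have unit: "inv\<^bsub>S\<^esub> c \<in> carrier S \<and> inv\<^bsub>S\<^esub> c \<otimes>\<^bsub>S\<^esub> c = \<one>\<^bsub>S\<^esub>" if "c \<in> carrier S" "c \<noteq> \<zero>\<^bsub>S\<^esub>" for c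
    using that field.field_Units[OF S] ext.Units_inv_closed[of c] ext.Units_l_inv[of c] by blast
  have P1: "\<one>\<^bsub>P.T\<^esub> \<noteq> \<zero>\<^bsub>P.T\<^esub>" by (rule P.tensor_one_nonzero[OF one])
  have neg_zero: "x = \<zero>\<^bsub>P.T\<^esub>" if x: "x \<in> carrier P.T" "\<ominus>\<^bsub>P.T\<^esub> x = x" for x
  proof (rule P.TA.double_zero[OF two x(1)])
    show "x \<oplus>\<^bsub>P.T\<^esub> x = \<zero>\<^bsub>P.T\<^esub>" using P.T.r_neg[OF x(1)] unfolding x(2) .
  qed
  obtain a where a: "a \<in> carrier A" "j a \<noteq> a"
  proof (rule ccontr)
    assume "\<not> thesis"
    then have "\<And>a. a \<in> carrier A \<Longrightarrow> j a = a" using that by blast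
    then have J: "J z = z" if "z \<in> carrier B" for z using trivial_involution_base that by blast
    obtain z where z: "z \<in> carrier B" "f z = \<sigma>" using f.surj[OF \<sigma>(1)] by blast
    have "P.conj \<sigma> = \<sigma>" using f(3)[OF z(1)] J[OF z(1)] z(2) by simp
    then have "\<sigma> = \<zero>\<^bsub>P.T\<^esub>" using \<sigma>(2) neg_zero[OF \<sigma>(1)] by simp
    then have "\<sigma> \<otimes>\<^bsub>P.T\<^esub> \<sigma> = \<zero>\<^bsub>P.T\<^esub>" using P.TA.null_left[OF P.T.zero_closed] by simp
    then show False using \<sigma>(3) P1 by simp
  qed
  define s where "s = a \<ominus>\<^bsub>A\<^esub> j a"
  have s: "s \<in> carrier A" using a by (simp add: s_def)
  have js: "j s = \<ominus>\<^bsub>A\<^esub> s"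
    using a(1) by (simp add: s_def alg.M.minus_eq inv.involution_add inv.involution_minus
        inv.involution_involutive alg.M.minus_add alg.M.a_comm)
  have s0: "s \<noteq> \<zero>\<^bsub>A\<^esub>"
  proof
    assume "s = \<zero>\<^bsub>A\<^esub>"
    then have "(a \<ominus>\<^bsub>A\<^esub> j a) \<oplus>\<^bsub>A\<^esub> j a = j a" using a(1) by (simp add: s_def)
    then show False using a by (simp add: alg.M.minus_eq alg.M.a_assoc alg.M.l_neg)
  qed
  have ts: "t s \<one>\<^bsub>S\<^esub> \<in> carrier B" using s by simp
  obtain \<alpha> \<beta> where ab: "\<alpha> \<in> carrier S" "\<beta> \<in> carrier S"
    "f (t s \<one>\<^bsub>S\<^esub>) = \<alpha> \<odot>\<^bsub>P.T\<^esub> \<one>\<^bsub>P.T\<^esub> \<oplus>\<^bsub>P.T\<^esub> \<beta> \<odot>\<^bsub>P.T\<^esub> \<sigma>"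
    using span[OF f.hom_closed[OF ts]] by blast
  have c: "\<alpha> \<odot>\<^bsub>P.T\<^esub> \<one>\<^bsub>P.T\<^esub> \<in> carrier P.T" "\<beta> \<odot>\<^bsub>P.T\<^esub> \<sigma> \<in> carrier P.T"
    using ab(1,2) u \<sigma>(1) by simp_all
  have "f (J (t s \<one>\<^bsub>S\<^esub>)) = \<ominus>\<^bsub>P.T\<^esub> f (t s \<one>\<^bsub>S\<^esub>)"
    using s ts by (simp add: J_pure js pure_minus_left f.hom_minus)
  then have "\<alpha> \<odot>\<^bsub>P.T\<^esub> \<one>\<^bsub>P.T\<^esub> \<oplus>\<^bsub>P.T\<^esub> \<ominus>\<^bsub>P.T\<^esub> (\<beta> \<odot>\<^bsub>P.T\<^esub> \<sigma>) =
      \<ominus>\<^bsub>P.T\<^esub> (\<alpha> \<odot>\<^bsub>P.T\<^esub> \<one>\<^bsub>P.T\<^esub>) \<oplus>\<^bsub>P.T\<^esub> \<ominus>\<^bsub>P.T\<^esub> (\<beta> \<odot>\<^bsub>P.T\<^esub> \<sigma>)"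
    unfolding f(3)[OF ts] ab(3) P.conj_add[OF c] conj1[OF ab(1)] conj\<sigma>[OF ab(2)]
    using c by (simp add: P.T.minus_add)
  then have "\<ominus>\<^bsub>P.T\<^esub> (\<alpha> \<odot>\<^bsub>P.T\<^esub> \<one>\<^bsub>P.T\<^esub>) = \<alpha> \<odot>\<^bsub>P.T\<^esub> \<one>\<^bsub>P.T\<^esub>" using c by simp
  then have \<alpha>0: "\<alpha> \<odot>\<^bsub>P.T\<^esub> \<one>\<^bsub>P.T\<^esub> = \<zero>\<^bsub>P.T\<^esub>" by (rule neg_zero[OF c(1)])
  have fs: "f (t s \<one>\<^bsub>S\<^esub>) = \<beta> \<odot>\<^bsub>P.T\<^esub> \<sigma>" unfolding ab(3) \<alpha>0 using c by simp
  have \<beta>0: "\<beta> \<noteq> \<zero>\<^bsub>S\<^esub>"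
  proof
    assume "\<beta> = \<zero>\<^bsub>S\<^esub>"
    then have "f (t s \<one>\<^bsub>S\<^esub>) = f \<zero>\<^bsub>B\<^esub>" unfolding fs f.hom_zero using \<sigma>(1) by simp
    then have "t s \<one>\<^bsub>S\<^esub> = \<zero>\<^bsub>B\<^esub>" by (rule f.inj[OF ts B.M.zero_closed])
    then show False using pure_inj[OF one s] s0 by simp
  qed
  note i\<beta> = unit[OF ab(2) \<beta>0]
  have inY: "z \<in> add_span B Y" if "z \<in> Y" "z \<in> carrier B" for z Y
    using add_span_add[OF that(1) add_span_zero[of B]] that(2) by simp
  have one_sub: "submodule {c \<odot>\<^bsub>A\<^esub> \<one>\<^bsub>A\<^esub> | c. c \<in> carrier K} K A"
  proof (rule alg.subspaceI)
    show "{c \<odot>\<^bsub>A\<^esub> \<one>\<^bsub>A\<^esub> | c. c \<in> carrier K} \<subseteq> carrier A" using alg.unit_closed by auto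
    have "\<zero> \<odot>\<^bsub>A\<^esub> \<one>\<^bsub>A\<^esub> = \<zero>\<^bsub>A\<^esub>" using alg.unit_closed by simp
    then show "\<zero>\<^bsub>A\<^esub> \<in> {c \<odot>\<^bsub>A\<^esub> \<one>\<^bsub>A\<^esub> | c. c \<in> carrier K}" by (metis (mono_tags, lifting) alg.R.zero_closed mem_Collect_eq)
    show "x \<oplus>\<^bsub>A\<^esub> y \<in> {c \<odot>\<^bsub>A\<^esub> \<one>\<^bsub>A\<^esub> | c. c \<in> carrier K}"
      if xy: "x \<in> {c \<odot>\<^bsub>A\<^esub> \<one>\<^bsub>A\<^esub> | c. c \<in> carrier K}" "y \<in> {c \<odot>\<^bsub>A\<^esub> \<one>\<^bsub>A\<^esub> | c. c \<in> carrier K}" for x y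
    proof -
      obtain c d where "c \<in> carrier K" "d \<in> carrier K" "x = c \<odot>\<^bsub>A\<^esub> \<one>\<^bsub>A\<^esub>" "y = d \<odot>\<^bsub>A\<^esub> \<one>\<^bsub>A\<^esub>" using xy by blast
      then have "x \<oplus>\<^bsub>A\<^esub> y = (c \<oplus> d) \<odot>\<^bsub>A\<^esub> \<one>\<^bsub>A\<^esub>" "c \<oplus> d \<in> carrier K"
        using alg.unit_closed by (simp_all add: alg.smult_l_distr)
      then show ?thesis by blast
    qed
    show "e \<odot>\<^bsub>A\<^esub> x \<in> {c \<odot>\<^bsub>A\<^esub> \<one>\<^bsub>A\<^esub> | c. c \<in> carrier K}"
      if ex: "e \<in> carrier K" "x \<in> {c \<odot>\<^bsub>A\<^esub> \<one>\<^bsub>A\<^esub> | c. c \<in> carrier K}" for e x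
    proof -
      obtain c where "c \<in> carrier K" "x = c \<odot>\<^bsub>A\<^esub> \<one>\<^bsub>A\<^esub>" using ex by blast
      then have "e \<odot>\<^bsub>A\<^esub> x = (e \<otimes> c) \<odot>\<^bsub>A\<^esub> \<one>\<^bsub>A\<^esub>" "e \<otimes> c \<in> carrier K"
        using ex(1) alg.unit_closed by (simp_all add: alg.smult_assoc1)
      then show ?thesis by blast
    qed
  qed
  have one_mem: "\<one>\<^bsub>A\<^esub> \<in> {c \<odot>\<^bsub>A\<^esub> \<one>\<^bsub>A\<^esub> | c. c \<in> carrier K}"
  proof -
    have "\<one>\<^bsub>A\<^esub> = \<one> \<odot>\<^bsub>A\<^esub> \<one>\<^bsub>A\<^esub>" using alg.unit_closed by simp
    then show ?thesis by blast
  qed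
  have \<beta>\<beta>: "\<beta> \<otimes>\<^bsub>S\<^esub> \<beta> \<in> carrier S" using ab(2) by simp
  have ss: "s \<otimes>\<^bsub>A\<^esub> s \<in> carrier A" using s alg.mult_closed by simp
  have tss: "t (s \<otimes>\<^bsub>A\<^esub> s) \<one>\<^bsub>S\<^esub> = t \<one>\<^bsub>A\<^esub> (\<beta> \<otimes>\<^bsub>S\<^esub> \<beta>)"
  proof (rule f.inj)
    have "f (t (s \<otimes>\<^bsub>A\<^esub> s) \<one>\<^bsub>S\<^esub>) = f (t s \<one>\<^bsub>S\<^esub>) \<otimes>\<^bsub>P.T\<^esub> f (t s \<one>\<^bsub>S\<^esub>)"
      using s by (simp add: f.hom_mult[symmetric] base_pure_mult)
    also have "\<dots> = (\<beta> \<otimes>\<^bsub>S\<^esub> \<beta>) \<odot>\<^bsub>P.T\<^esub> \<one>\<^bsub>P.T\<^esub>"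
      unfolding fs using ab(2) \<sigma>(1,3) u c(2) by (simp add: P.TA.smult_left P.TA.smult_right P.TA.smult_assoc1)
    also have "\<dots> = f ((\<beta> \<otimes>\<^bsub>S\<^esub> \<beta>) \<odot>\<^bsub>B\<^esub> \<one>\<^bsub>B\<^esub>)"
      using f.hom_smult[OF \<beta>\<beta> B.unit_closed] f.hom_one by simp
    also have "(\<beta> \<otimes>\<^bsub>S\<^esub> \<beta>) \<odot>\<^bsub>B\<^esub> \<one>\<^bsub>B\<^esub> = t \<one>\<^bsub>A\<^esub> (\<beta> \<otimes>\<^bsub>S\<^esub> \<beta>)"
      using ab(2) alg.unit_closed by (simp add: base_one base_smult_pure)
    finally show "f (t (s \<otimes>\<^bsub>A\<^esub> s) \<one>\<^bsub>S\<^esub>) = f (t \<one>\<^bsub>A\<^esub> (\<beta> \<otimes>\<^bsub>S\<^esub> \<beta>))" .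
  qed (use ss ab(2) alg.unit_closed in simp_all)
  have "s \<otimes>\<^bsub>A\<^esub> s \<in> {c \<odot>\<^bsub>A\<^esub> \<one>\<^bsub>A\<^esub> | c. c \<in> carrier K}"
  proof (rule base_subspace_descent[OF one one_sub ss])
    show "t (s \<otimes>\<^bsub>A\<^esub> s) \<one>\<^bsub>S\<^esub> \<in> add_span B {t u r |u r. u \<in> {c \<odot>\<^bsub>A\<^esub> \<one>\<^bsub>A\<^esub> | c. c \<in> carrier K} \<and> r \<in> carrier S}"
      unfolding tss by (rule inY) (use one_mem \<beta>\<beta> alg.unit_closed in \<open>blast, simp\<close>)
  qed
  then obtain d where d: "d \<in> carrier K" "s \<otimes>\<^bsub>A\<^esub> s = d \<odot>\<^bsub>A\<^esub> \<one>\<^bsub>A\<^esub>" by blast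
  have "d \<noteq> \<zero>"
  proof
    assume "d = \<zero>"
    then have "s \<otimes>\<^bsub>A\<^esub> s = \<zero>\<^bsub>A\<^esub>" using d alg.unit_closed by simp
    then have z: "t \<one>\<^bsub>A\<^esub> (\<beta> \<otimes>\<^bsub>S\<^esub> \<beta>) = \<zero>\<^bsub>B\<^esub>" using tss pure_zero_left by simp
    let ?i = "inv\<^bsub>S\<^esub> \<beta>"
    have "(?i \<otimes>\<^bsub>S\<^esub> ?i) \<odot>\<^bsub>B\<^esub> t \<one>\<^bsub>A\<^esub> (\<beta> \<otimes>\<^bsub>S\<^esub> \<beta>) = t \<one>\<^bsub>A\<^esub> ((?i \<otimes>\<^bsub>S\<^esub> \<beta>) \<otimes>\<^bsub>S\<^esub> (?i \<otimes>\<^bsub>S\<^esub> \<beta>))"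
      using i\<beta> ab(2) alg.unit_closed by (simp add: base_smult_pure ext.m_ac del: ext.Units_l_inv)
    also have "\<dots> = \<one>\<^bsub>B\<^esub>" using i\<beta> by (simp add: base_one)
    finally have "\<one>\<^bsub>B\<^esub> = \<zero>\<^bsub>B\<^esub>" unfolding z using i\<beta> by simp
    then have "f \<one>\<^bsub>B\<^esub> = f \<zero>\<^bsub>B\<^esub>" by simp
    then show False using P1 by (simp add: f.hom_one f.hom_zero)
  qed
  then have dU: "d \<in> Units K" using field.field_Units[OF field] d(1) by simp
  have "\<exists>\<gamma>\<in>carrier K. \<exists>\<delta>\<in>carrier K. x = \<gamma> \<odot>\<^bsub>A\<^esub> \<one>\<^bsub>A\<^esub> \<oplus>\<^bsub>A\<^esub> \<delta> \<odot>\<^bsub>A\<^esub> s" if x: "x \<in> carrier A" for x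
  proof -
    define U where "U = {\<gamma> \<odot>\<^bsub>A\<^esub> \<one>\<^bsub>A\<^esub> \<oplus>\<^bsub>A\<^esub> \<delta> \<odot>\<^bsub>A\<^esub> s | \<gamma> \<delta>. \<gamma> \<in> carrier K \<and> \<delta> \<in> carrier K}"
    have UI: "\<gamma> \<odot>\<^bsub>A\<^esub> \<one>\<^bsub>A\<^esub> \<oplus>\<^bsub>A\<^esub> \<delta> \<odot>\<^bsub>A\<^esub> s \<in> U" if "\<gamma> \<in> carrier K" "\<delta> \<in> carrier K" for \<gamma> \<delta>
      unfolding U_def using that by blast
    note u = alg.unit_closed
    have sub: "submodule U K A"
    proof (rule alg.subspaceI)
      show "U \<subseteq> carrier A" unfolding U_def using s u by auto
      show "\<zero>\<^bsub>A\<^esub> \<in> U" using UI[of \<zero> \<zero>] s u by simp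
      show "x \<oplus>\<^bsub>A\<^esub> y \<in> U" if xy: "x \<in> U" "y \<in> U" for x y
      proof -
        obtain \<gamma> \<delta> \<gamma>' \<delta>' where *: "x = \<gamma> \<odot>\<^bsub>A\<^esub> \<one>\<^bsub>A\<^esub> \<oplus>\<^bsub>A\<^esub> \<delta> \<odot>\<^bsub>A\<^esub> s" "y = \<gamma>' \<odot>\<^bsub>A\<^esub> \<one>\<^bsub>A\<^esub> \<oplus>\<^bsub>A\<^esub> \<delta>' \<odot>\<^bsub>A\<^esub> s"
          "\<gamma> \<in> carrier K" "\<delta> \<in> carrier K" "\<gamma>' \<in> carrier K" "\<delta>' \<in> carrier K" using xy unfolding U_def by blast
        have "x \<oplus>\<^bsub>A\<^esub> y = (\<gamma> \<oplus> \<gamma>') \<odot>\<^bsub>A\<^esub> \<one>\<^bsub>A\<^esub> \<oplus>\<^bsub>A\<^esub> (\<delta> \<oplus> \<delta>') \<odot>\<^bsub>A\<^esub> s"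
          unfolding *(1,2) using *(3-) s u by (simp add: alg.smult_l_distr alg.M.a_ac)
        then show ?thesis using UI *(3-) by simp
      qed
      show "e \<odot>\<^bsub>A\<^esub> x \<in> U" if ex: "e \<in> carrier K" "x \<in> U" for e x
      proof -
        obtain \<gamma> \<delta> where *: "x = \<gamma> \<odot>\<^bsub>A\<^esub> \<one>\<^bsub>A\<^esub> \<oplus>\<^bsub>A\<^esub> \<delta> \<odot>\<^bsub>A\<^esub> s" "\<gamma> \<in> carrier K" "\<delta> \<in> carrier K"
          using ex(2) unfolding U_def by blast
        have "e \<odot>\<^bsub>A\<^esub> x = (e \<otimes> \<gamma>) \<odot>\<^bsub>A\<^esub> \<one>\<^bsub>A\<^esub> \<oplus>\<^bsub>A\<^esub> (e \<otimes> \<delta>) \<odot>\<^bsub>A\<^esub> s"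
          unfolding *(1) using *(2-) ex(1) s u by (simp add: alg.smult_r_distr alg.smult_assoc1)
        then show ?thesis using UI *(2-) ex(1) by simp
      qed
    qed
    have U1: "\<one>\<^bsub>A\<^esub> \<in> U" using UI[of \<one> \<zero>] s u by simp
    have Us: "s \<in> U" using UI[of \<zero> \<one>] s u by simp
    have "x \<in> U"
    proof (rule base_subspace_descent[OF one sub x])
      obtain \<gamma> \<delta> where cd: "\<gamma> \<in> carrier S" "\<delta> \<in> carrier S"
        "f (t x \<one>\<^bsub>S\<^esub>) = \<gamma> \<odot>\<^bsub>P.T\<^esub> \<one>\<^bsub>P.T\<^esub> \<oplus>\<^bsub>P.T\<^esub> \<delta> \<odot>\<^bsub>P.T\<^esub> \<sigma>"
        using span[OF f.hom_closed[of "t x \<one>\<^bsub>S\<^esub>"]] x by auto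
      let ?e = "\<delta> \<otimes>\<^bsub>S\<^esub> inv\<^bsub>S\<^esub> \<beta>"
      have e: "?e \<in> carrier S" "?e \<otimes>\<^bsub>S\<^esub> \<beta> = \<delta>" using cd(2) i\<beta> ab(2) by (simp_all add: ext.m_assoc)
      have "f (t x \<one>\<^bsub>S\<^esub>) = f (\<gamma> \<odot>\<^bsub>B\<^esub> \<one>\<^bsub>B\<^esub> \<oplus>\<^bsub>B\<^esub> ?e \<odot>\<^bsub>B\<^esub> t s \<one>\<^bsub>S\<^esub>)"
      proof -
        have "f (\<gamma> \<odot>\<^bsub>B\<^esub> \<one>\<^bsub>B\<^esub> \<oplus>\<^bsub>B\<^esub> ?e \<odot>\<^bsub>B\<^esub> t s \<one>\<^bsub>S\<^esub>) = \<gamma> \<odot>\<^bsub>P.T\<^esub> \<one>\<^bsub>P.T\<^esub> \<oplus>\<^bsub>P.T\<^esub> ?e \<odot>\<^bsub>P.T\<^esub> (\<beta> \<odot>\<^bsub>P.T\<^esub> \<sigma>)"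
          using cd(1) e(1) ts B.unit_closed by (simp add: f.hom_add f.hom_smult f.hom_one fs)
        also have "?e \<odot>\<^bsub>P.T\<^esub> (\<beta> \<odot>\<^bsub>P.T\<^esub> \<sigma>) = \<delta> \<odot>\<^bsub>P.T\<^esub> \<sigma>"
          using P.TA.smult_assoc1[OF e(1) ab(2) \<sigma>(1)] unfolding e(2) by simp
        finally show ?thesis using cd(3) by simp
      qed
      then have "t x \<one>\<^bsub>S\<^esub> = \<gamma> \<odot>\<^bsub>B\<^esub> \<one>\<^bsub>B\<^esub> \<oplus>\<^bsub>B\<^esub> ?e \<odot>\<^bsub>B\<^esub> t s \<one>\<^bsub>S\<^esub>"
        by (rule f.inj[rotated 2]) (use x cd(1) e(1) ts B.unit_closed in simp_all)
      also have "\<dots> = t \<one>\<^bsub>A\<^esub> \<gamma> \<oplus>\<^bsub>B\<^esub> t s ?e"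
        using cd(1) e(1) s u by (simp add: base_one base_smult_pure)
      also have "\<dots> \<in> add_span B {t u r |u r. u \<in> U \<and> r \<in> carrier S}"
        by (rule add_span_add[OF _ inY]) (use U1 Us cd(1) e(1) s in \<open>blast, blast, simp\<close>)
      finally show "t x \<one>\<^bsub>S\<^esub> \<in> add_span B {t u r |u r. u \<in> U \<and> r \<in> carrier S}" .
    qed
    then show ?thesis unfolding U_def by blast
  qed
  then show ?thesis unfolding quadratic_involution_def using s dU js d(2) by blast
qed

section \<open>Dual numbers\<close>

text \<open>
  The elements \<open>a + \<epsilon> b\<close> are stored as values of an injection \<open>e\<close> of pairs, so that the dual
  numbers can live on any type that is large enough.
\<close>

definition dual_numbers :: "('k, 'x) ring_scheme \<Rightarrow> ('k \<times> 'k \<Rightarrow> 'r) \<Rightarrow> ('k, 'r) module"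
  where "dual_numbers K e = (let d = inv_into (carrier K \<times> carrier K) e in
   \<lparr>carrier = e ` (carrier K \<times> carrier K),
    monoid.mult = (\<lambda>x y. e (fst (d x) \<otimes>\<^bsub>K\<^esub> fst (d y), fst (d x) \<otimes>\<^bsub>K\<^esub> snd (d y) \<oplus>\<^bsub>K\<^esub> snd (d x) \<otimes>\<^bsub>K\<^esub> fst (d y))),
    one = e (\<one>\<^bsub>K\<^esub>, \<zero>\<^bsub>K\<^esub>),
    ring.zero = e (\<zero>\<^bsub>K\<^esub>, \<zero>\<^bsub>K\<^esub>),
    ring.add = (\<lambda>x y. e (fst (d x) \<oplus>\<^bsub>K\<^esub> fst (d y), snd (d x) \<oplus>\<^bsub>K\<^esub> snd (d y))),
    smult = (\<lambda>c x. e (c \<otimes>\<^bsub>K\<^esub> fst (d x), c \<otimes>\<^bsub>K\<^esub> snd (d x)))\<rparr>)"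

locale dual_number_coding = cring K for K (structure) +
  fixes e assumes inj: "inj_on e (carrier K \<times> carrier K)"
begin

abbreviation D where "D \<equiv> dual_numbers K e"

lemma decode [simp]: "a \<in> carrier K \<Longrightarrow> b \<in> carrier K \<Longrightarrow> inv_into (carrier K \<times> carrier K) e (e (a, b)) = (a, b)"
  using inj by (simp add: inv_into_f_f)

lemma dual_simps:
  "x \<in> carrier D \<longleftrightarrow> (\<exists>a\<in>carrier K. \<exists>b\<in>carrier K. x = e (a, b))"
  "\<one>\<^bsub>D\<^esub> = e (\<one>, \<zero>)" "\<zero>\<^bsub>D\<^esub> = e (\<zero>, \<zero>)"
  "\<lbrakk>a \<in> carrier K; b \<in> carrier K; a' \<in> carrier K; b' \<in> carrier K\<rbrakk> \<Longrightarrow>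
     e (a, b) \<otimes>\<^bsub>D\<^esub> e (a', b') = e (a \<otimes> a', a \<otimes> b' \<oplus> b \<otimes> a')"
  "\<lbrakk>a \<in> carrier K; b \<in> carrier K; a' \<in> carrier K; b' \<in> carrier K\<rbrakk> \<Longrightarrow>
     e (a, b) \<oplus>\<^bsub>D\<^esub> e (a', b') = e (a \<oplus> a', b \<oplus> b')"
  "\<lbrakk>a \<in> carrier K; b \<in> carrier K; c \<in> carrier K\<rbrakk> \<Longrightarrow> c \<odot>\<^bsub>D\<^esub> e (a, b) = e (c \<otimes> a, c \<otimes> b)"
  by (auto simp: dual_numbers_def Let_def)

lemma dual_closed: "a \<in> carrier K \<Longrightarrow> b \<in> carrier K \<Longrightarrow> e (a, b) \<in> carrier D"
  unfolding dual_simps(1) by blast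

lemma dual_cases:
  assumes "x \<in> carrier D"
  obtains a b where "a \<in> carrier K" "b \<in> carrier K" "x = e (a, b)"
  using assms unfolding dual_simps(1) by blast

lemma dual_numbers_algebra: "algebra K D"
proof (rule algebraI[OF is_cring])
  show "cring D"
  proof (rule cringI)
    show "abelian_group D"
    proof (rule abelian_groupI)
      fix x assume "x \<in> carrier D"
      then obtain a b where x: "x = e (a, b)" "a \<in> carrier K" "b \<in> carrier K" unfolding dual_simps(1) by blast
      then show "\<exists>y\<in>carrier D. y \<oplus>\<^bsub>D\<^esub> x = \<zero>\<^bsub>D\<^esub>"
        by (intro bexI[of _ "e (\<ominus> a, \<ominus> b)"]) (auto simp: dual_simps(2-) dual_closed l_neg)
    qed (auto simp: dual_simps(2-) dual_closed a_ac elim!: dual_cases)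
    show "comm_monoid D"
      by (rule comm_monoidI) (auto simp: dual_simps(2-) dual_closed l_distr r_distr a_ac m_ac elim!: dual_cases)
  qed (auto simp: dual_simps(2-) dual_closed l_distr r_distr a_ac m_ac elim!: dual_cases)
qed (auto simp: dual_simps(2-) dual_closed l_distr r_distr a_ac m_ac elim!: dual_cases)

lemma dual_number_unit:
  assumes "\<one> \<noteq> \<zero>"
  obtains \<epsilon> where "\<epsilon> \<in> carrier D" "\<epsilon> \<noteq> \<zero>\<^bsub>D\<^esub>" "\<epsilon> \<otimes>\<^bsub>D\<^esub> \<epsilon> = \<zero>\<^bsub>D\<^esub>"
proof
  show "e (\<zero>, \<one>) \<in> carrier D" unfolding dual_simps(1) by blast
  show "e (\<zero>, \<one>) \<noteq> \<zero>\<^bsub>D\<^esub>" unfolding dual_simps(3) using inj_onD[OF inj, of "(\<zero>, \<one>)" "(\<zero>, \<zero>)"] assms by auto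
  show "e (\<zero>, \<one>) \<otimes>\<^bsub>D\<^esub> e (\<zero>, \<one>) = \<zero>\<^bsub>D\<^esub>" by (simp add: dual_simps)
qed

end

section \<open>Comparison of the automorphism group schemes\<close>

text \<open>
  Both groups carry the multiplication of the same group of bijections, so only the carriers have
  to be compared.
\<close>

lemma Aut_schemes_equal_iff:
  "Aut_involution_scheme K A j R = Aut_scheme K A R \<longleftrightarrow>
    (\<forall>\<phi>\<in>algebra_autos R (base_change K A R). \<forall>x\<in>carrier (base_change K A R).
       \<phi> (base_change_map K A R j x) = base_change_map K A R j (\<phi> x))"
proof -
  have carriers: "carrier (Aut_scheme K A R) = algebra_autos R (base_change K A R)"
    "carrier (Aut_involution_scheme K A j R) = {f \<in> algebra_autos R (base_change K A R).
        \<forall>x\<in>carrier (base_change K A R). f (base_change_map K A R j x) = base_change_map K A R j (f x)}"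
    by (simp_all add: Aut_scheme_def Aut_involution_scheme_def)
  show ?thesis
  proof
    assume "Aut_involution_scheme K A j R = Aut_scheme K A R"
    then have "carrier (Aut_involution_scheme K A j R) = carrier (Aut_scheme K A R)" by simp
    then show "\<forall>\<phi>\<in>algebra_autos R (base_change K A R). \<forall>x\<in>carrier (base_change K A R).
       \<phi> (base_change_map K A R j x) = base_change_map K A R j (\<phi> x)" unfolding carriers by blast
  next
    assume c: "\<forall>\<phi>\<in>algebra_autos R (base_change K A R). \<forall>x\<in>carrier (base_change K A R).
       \<phi> (base_change_map K A R j x) = base_change_map K A R j (\<phi> x)"
    have "{f \<in> algebra_autos R (base_change K A R).
        \<forall>x\<in>carrier (base_change K A R). f (base_change_map K A R j x) = base_change_map K A R j (f x)}
      = algebra_autos R (base_change K A R)" using c by blast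
    then show "Aut_involution_scheme K A j R = Aut_scheme K A R"
      unfolding Aut_scheme_def Aut_involution_scheme_def by simp
  qed
qed

theorem theorem3p13:
  fixes k :: "'k ring"
    and ks :: "('k, 'e) module"
    and m1 m2 :: nat
    and A :: "('k, 'a) module"
    and j :: "'a \<Rightarrow> 'a"
    and code :: "'k list \<Rightarrow> 'r"
  assumes "field k"
    and "[(2::nat)] \<cdot>\<^bsub>k\<^esub> \<one>\<^bsub>k\<^esub> \<noteq> \<zero>\<^bsub>k\<^esub>"
    and "[(3::nat)] \<cdot>\<^bsub>k\<^esub> \<one>\<^bsub>k\<^esub> \<noteq> \<zero>\<^bsub>k\<^esub>"
    and "separable_closure k ks"
    and "m1 \<in> {1, 2, 4, 8}" and "m2 \<in> {1, 2, 4, 8}" and "(m1, m2) \<noteq> (2, 2)"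
    and "product_algebra k ks m1 m2 A j"
    and "m1 \<ge> m2"
    \<comment> \<open>The commutative \<open>k\<close>-algebras \<open>R\<close> below range over an arbitrary type \<open>'r\<close> that is
      large enough to contain a copy of every finitely generated one.\<close>
    and "inj_on code (lists (carrier k))"
  shows "(\<forall>R :: ('k, 'r) module. algebra k R \<longrightarrow> Aut_involution_scheme k A j R = Aut_scheme k A R) \<longleftrightarrow>
    (m1, m2) \<in> {(1, 1), (2, 1), (4, 1), (8, 1), (8, 4), (8, 8)}"
proof -
  interpret k: field k by (rule assms(1))
  have ks: "field ks" "algebra k ks" using assms(4) unfolding separable_closure_def by blast+
  interpret ks: field ks by (rule ks(1))
  interpret A: algebra_with_involution k A j using assms(8) unfolding product_algebra_def by blast
  have ext: "involution_extension k A R j" if "algebra k R" for R :: "('k, 's) module"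
    by (intro involution_extension.intro scalar_extension_over_field.intro scalar_extension.intro
        scalar_extension_over_field_axioms.intro A.unital_algebra_axioms that assms(1)
        A.algebra_with_involution_axioms)
  interpret E: involution_extension k A ks j by (rule ext[OF ks(2)])
  interpret P: split_product ks m1 m2 by unfold_locales
  obtain f where f: "f \<in> algebra_homs ks E.B P.T" "bij_betw f (carrier E.B) (carrier P.T)"
    "\<And>x. x \<in> carrier E.B \<Longrightarrow> f (E.J x) = P.conj (f x)"
    using assms(8) unfolding product_algebra_def isomorphic_with_involution_def by blast
  interpret f: algebra_iso ks E.B P.T f using f(1,2) by unfold_locales
  note one = ks.one_not_zero
  have "\<one>\<^bsub>k\<^esub> \<oplus>\<^bsub>k\<^esub> \<one>\<^bsub>k\<^esub> \<noteq> \<zero>\<^bsub>k\<^esub>"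
    using assms(2) by (simp add: numeral_2_eq_2)
  then have two: "\<one>\<^bsub>k\<^esub> \<oplus>\<^bsub>k\<^esub> \<one>\<^bsub>k\<^esub> \<in> Units k" unfolding k.field_Units by simp
  have two': "\<one>\<^bsub>ks\<^esub> \<oplus>\<^bsub>ks\<^esub> \<one>\<^bsub>ks\<^esub> \<in> Units ks" by (rule E.ext_two_unit[OF two])
  have two'0: "\<one>\<^bsub>ks\<^esub> \<oplus>\<^bsub>ks\<^esub> \<one>\<^bsub>ks\<^esub> \<noteq> \<zero>\<^bsub>ks\<^esub>" using two' unfolding ks.field_Units by simp
  have equality: "\<forall>R :: ('k, 'r) module. algebra k R \<longrightarrow> Aut_involution_scheme k A j R = Aut_scheme k A R"
    if mn: "(m1, m2) \<in> {(1, 1), (2, 1), (4, 1), (8, 1), (8, 4), (8, 8)}"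
    unfolding Aut_schemes_equal_iff
  proof (intro allI impI ballI)
    fix R :: "('k, 'r) module" and \<phi> x
    assume R: "algebra k R" and \<phi>: "\<phi> \<in> algebra_autos R (base_change k A R)" and x: "x \<in> carrier (base_change k A R)"
    interpret R: involution_extension k A R j by (rule ext[OF R])
    consider "m1 = 1" "m2 = 1" | "m1 = 2" "m2 = 1" | "(m1, m2) \<in> {(4, 1), (8, 1), (8, 4), (8, 8)}"
      using mn by blast
    then show "\<phi> (R.J x) = R.J (\<phi> x)"
    proof cases
      case 1
      have "E.J z = z" if z: "z \<in> carrier E.B" for z
        using f(3)[OF z] P.conj_trivial[OF 1 f.hom_closed[OF z]] E.J_closed[OF z] z by (intro f.inj) simp_all
      then have "j y = y" if "y \<in> carrier A" for y by (rule E.trivial_involution_descent[OF one _ that])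
      then have J: "R.J z = z" if "z \<in> carrier R.B" for z by (rule R.trivial_involution_base[OF _ that])
      have "\<phi> x \<in> carrier R.B" using \<phi> x unfolding algebra_autos_def Bij_def bij_betw_def by auto
      then show ?thesis using J x by simp
    next
      case 2
      have "quadratic_involution k A j" by (rule E.quadratic_involution_descent[OF 2 one ks(1) two' f])
      then show ?thesis by (rule R.quadratic_automorphism_commutes[OF two _ \<phi> x])
    next
      case 3
      have "skew_generated ks E.B E.J"
        by (rule f.skew_generated_pullback[where i = E.J and j = P.conj, OF E.J_closed f(3) P.split_skew_generated[OF 3 two']])
      then have "skew_generated k A j" by (rule E.skew_generated_descent[OF one])
      then show ?thesis by (rule R.automorphism_commutes[OF _ \<phi> x])
    qed
  qed
  have inequality: "\<exists>R :: ('k, 'r) module. algebra k R \<and> Aut_involution_scheme k A j R \<noteq> Aut_scheme k A R"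
    if mn: "(m1, m2) \<in> {(4, 2), (8, 2), (4, 4)}"
  proof -
    have "alternative_algebra ks P.T"
      by (intro alternative_algebra.intro alternative_algebra_axioms.intro P.TA.unital_algebra_axioms
          P.split_alternative[OF mn])
    then have "alternative_algebra ks E.B" by (rule f.alternative_pullback)
    then have alt: "alternative_algebra k A" by (rule E.alternative_descent[OF one])
    have ncT: "\<not> derivations_commute P.T P.conj"
      by (rule P.split_derivation_noncommuting) (use mn two'0 in auto)
    have nc: "\<not> derivations_commute A j"
    proof
      assume "derivations_commute A j"
      then have "derivations_commute E.B E.J" by (rule E.derivations_commute_base)
      then have "derivations_commute P.T P.conj" by (intro f.derivations_commute_image[where i = E.J and j = P.conj] E.J_closed f(3))
      then show False using ncT by contradiction
    qed
    interpret D: dual_number_coding k "\<lambda>(a, b). code [a, b]"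
    proof
      show "inj_on (\<lambda>(a, b). code [a, b]) (carrier k \<times> carrier k)"
        by (auto intro!: inj_onI dest: inj_onD[OF assms(10)])
    qed
    interpret R: involution_extension k A D.D j by (rule ext[OF D.dual_numbers_algebra])
    obtain \<epsilon> where \<epsilon>: "\<epsilon> \<in> carrier D.D" "\<epsilon> \<noteq> \<zero>\<^bsub>D.D\<^esub>" "\<epsilon> \<otimes>\<^bsub>D.D\<^esub> \<epsilon> = \<zero>\<^bsub>D.D\<^esub>"
      by (rule D.dual_number_unit[OF k.one_not_zero])
    obtain \<phi> z where "\<phi> \<in> algebra_autos D.D R.B" "z \<in> carrier R.B" "\<phi> (R.J z) \<noteq> R.J (\<phi> z)"
      by (rule R.noncommuting_automorphism[OF alt \<epsilon> nc])
    then have "Aut_involution_scheme k A j D.D \<noteq> Aut_scheme k A D.D" unfolding Aut_schemes_equal_iff by blast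
    then show ?thesis using D.dual_numbers_algebra by blast
  qed
  have "(m1, m2) \<in> {(1, 1), (2, 1), (4, 1), (8, 1), (8, 4), (8, 8)} \<or> (m1, m2) \<in> {(4, 2), (8, 2), (4, 4)}"
    using assms(5-7,9) by auto
  then show ?thesis
  proof
    assume "(m1, m2) \<in> {(1, 1), (2, 1), (4, 1), (8, 1), (8, 4), (8, 8)}"
    with equality show ?thesis by blast
  next
    assume "(m1, m2) \<in> {(4, 2), (8, 2), (4, 4)}"
    moreover from this have "(m1, m2) \<notin> {(1, 1), (2, 1), (4, 1), (8, 1), (8, 4), (8, 8)}" by auto
    ultimately show ?thesis using inequality by blast
  qed
qed

end
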